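(* Let $A$ be a Noetherian ring, $n$ a positive integer, $F$ an $A$-algebra generated by elements $t_1,\dots,t_r$, and let $V\subseteq F$ be the $A$-submodule spanned by the monomials of degree $\le n$ in $t_1,\dots,t_r$. Let $X=\operatorname{Spec}(F)\to S=\operatorname{Spec}(A)$. Then the morphism $$\varphi\colon \mathrm{G}^n_{X/S}=\operatorname{Proj}\Big(\bigoplus_{m\ge0}I_F^m\Big)\longrightarrow \mathrm{Bl}_{I_V}(\Gamma^n_AF)=\operatorname{Proj}\Big(\bigoplus_{m\ge0}I_V^m\Big)$$ induced by the inclusion $\bigoplus_{m\ge0}I_V^m\to\bigoplus_{m\ge0}I_F^m$ is an isomorphism.
   Context: All rings are commutative with unit. Divided powers. For a ring $A$ and an $A$-module $M$, $\Gamma_AM=\bigoplus_{m\ge 0}\Gamma^m_AM$ is the divided power algebra: the $A$-algebra generated by symbols $\gamma^m(x)$ ($m\ge 0$, $x\in M$, degree $m$) subject to $\gamma^0(x)=1$, $\gamma^m(\lambda x)=\lambda^m\gamma^m(x)$ for $\lambda\in A$, $\gamma^m(x+y)=\sum_{j=0}^m\gamma^j(x)\gamma^{m-j}(y)$, $\gamma^m(x)\gamma^l(x)=\binom{m+l}{m}\gamma^{m+l}(x)$. Its product is written $*$. One has $\Gamma^n_A(M)\otimes_AB=\Gamma^n_B(M\otimes_AB)$ for every $A$-algebra $B$. If $F$ is an $A$-algebra, each $\Gamma^n_AF$ has a second product making it an $A$-algebra, characterised by $\gamma^n(x)\gamma^n(y)=\gamma^n(xy)$ after every base change $A\to B$.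 Ideals of norms. For $x=(x_1,\dots,x_n)$, $y=(y_1,\dots,y_n)$ in $F$ put $\delta(x,y)=\sum_{\sigma\in\mathfrak S_n}(-1)^{|\sigma|}\gamma^1(x_1y_{\sigma(1)})*\cdots*\gamma^1(x_ny_{\sigma(n)})\in\Gamma^n_AF$. For an $A$-submodule $V\subseteq F$, $I_V\subseteq\Gamma^n_AF$ is the ideal generated by all $\delta(x,y)$ with all $x_i,y_i\in V$; $I_F$ is the case $V=F$. Good component. $\mathrm{Hilb}^n_{X/S}$ is the Hilbert scheme of closed subschemes of $X$ that are flat and finite of rank $n$ over the base; $\mathrm{G}^n_{X/S}$ is the schematic closure in it of the open subscheme over which the universal family is étale. It is identified with the blow-up $\operatorname{Proj}(\bigoplus_{m\ge0}I_F^m)$ of $\operatorname{Spec}(\Gamma^n_AF)$ along $I_F$. For $V\subseteq F$ the $A$-submodule spanned by the monomials of degree $\le n$ in the generators $t_1,\dots,t_r$ of $F$ (which is $n$-sufficiently big: for every $A$-algebra $B$ and every quotient $B$-algebra $F\otimes_AB\to E$ with $E$ locally free of rank $n$ over $B$, the map $V\otimes_AB\to E$ is surjective), the morphism $\varphi$ is defined on all of $\operatorname{Proj}(\bigoplus_m I_F^m)$. *)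

theory Defs
  imports "HOL-Analysis.Abstract_Topology" "HOL-Combinatorics.Permutations" "HOL-Algebra.Algebra"
begin

section \<open>Commutative algebras by generators and relations\<close>

text \<open>HOL-Algebra has no polynomial rings in arbitrary sets of variables together with their
  quotients as algebras, so the algebra over \<open>A\<close> with generators \<open>E\<close> and relations \<open>Q\<close> is built
  as the set of formal expressions modulo the least congruence which contains \<open>Q\<close> and makes the
  quotient a commutative \<open>A\<close>-algebra.\<close>

datatype ('a, 'x) aterm =
    Con 'a
  | Gen 'x
  | Add "('a, 'x) aterm" "('a, 'x) aterm"
  | Mul "('a, 'x) aterm" "('a, 'x) aterm"

inductive_set aterms :: "('a, 'm) ring_scheme \<Rightarrow> 'x set \<Rightarrow> ('a, 'x) aterm set"
  for A and E where
    "a \<in> carrier A \<Longrightarrow> Con a \<in> aterms A E"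
  | "x \<in> E \<Longrightarrow> Gen x \<in> aterms A E"
  | "\<lbrakk> s \<in> aterms A E; t \<in> aterms A E \<rbrakk> \<Longrightarrow> Add s t \<in> aterms A E"
  | "\<lbrakk> s \<in> aterms A E; t \<in> aterms A E \<rbrakk> \<Longrightarrow> Mul s t \<in> aterms A E"

inductive aterm_cong ::
    "('a, 'm) ring_scheme \<Rightarrow> 'x set \<Rightarrow> (('a, 'x) aterm \<times> ('a, 'x) aterm) set
      \<Rightarrow> ('a, 'x) aterm \<Rightarrow> ('a, 'x) aterm \<Rightarrow> bool"
  for A and E and Q where
    rel: "\<lbrakk> (s, t) \<in> Q; s \<in> aterms A E; t \<in> aterms A E \<rbrakk> \<Longrightarrow> aterm_cong A E Q s t"
  | refl: "s \<in> aterms A E \<Longrightarrow> aterm_cong A E Q s s"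
  | sym: "aterm_cong A E Q s t \<Longrightarrow> aterm_cong A E Q t s"
  | trans: "\<lbrakk> aterm_cong A E Q s t; aterm_cong A E Q t u \<rbrakk> \<Longrightarrow> aterm_cong A E Q s u"
  | add: "\<lbrakk> aterm_cong A E Q s s'; aterm_cong A E Q t t' \<rbrakk>
      \<Longrightarrow> aterm_cong A E Q (Add s t) (Add s' t')"
  | mul: "\<lbrakk> aterm_cong A E Q s s'; aterm_cong A E Q t t' \<rbrakk>
      \<Longrightarrow> aterm_cong A E Q (Mul s t) (Mul s' t')"
  | con_add: "\<lbrakk> a \<in> carrier A; b \<in> carrier A \<rbrakk>
      \<Longrightarrow> aterm_cong A E Q (Con (a \<oplus>\<^bsub>A\<^esub> b)) (Add (Con a) (Con b))"
  | con_mul: "\<lbrakk> a \<in> carrier A; b \<in> carrier A \<rbrakk>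
      \<Longrightarrow> aterm_cong A E Q (Con (a \<otimes>\<^bsub>A\<^esub> b)) (Mul (Con a) (Con b))"
  | add_assoc: "\<lbrakk> s \<in> aterms A E; t \<in> aterms A E; u \<in> aterms A E \<rbrakk>
      \<Longrightarrow> aterm_cong A E Q (Add (Add s t) u) (Add s (Add t u))"
  | add_comm: "\<lbrakk> s \<in> aterms A E; t \<in> aterms A E \<rbrakk> \<Longrightarrow> aterm_cong A E Q (Add s t) (Add t s)"
  | add_zero: "s \<in> aterms A E \<Longrightarrow> aterm_cong A E Q (Add s (Con \<zero>\<^bsub>A\<^esub>)) s"
  | add_neg: "s \<in> aterms A E
      \<Longrightarrow> aterm_cong A E Q (Add s (Mul (Con (\<ominus>\<^bsub>A\<^esub> \<one>\<^bsub>A\<^esub>)) s)) (Con \<zero>\<^bsub>A\<^esub>)"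
  | mul_assoc: "\<lbrakk> s \<in> aterms A E; t \<in> aterms A E; u \<in> aterms A E \<rbrakk>
      \<Longrightarrow> aterm_cong A E Q (Mul (Mul s t) u) (Mul s (Mul t u))"
  | mul_comm: "\<lbrakk> s \<in> aterms A E; t \<in> aterms A E \<rbrakk> \<Longrightarrow> aterm_cong A E Q (Mul s t) (Mul t s)"
  | mul_one: "s \<in> aterms A E \<Longrightarrow> aterm_cong A E Q (Mul (Con \<one>\<^bsub>A\<^esub>) s) s"
  | distr: "\<lbrakk> s \<in> aterms A E; t \<in> aterms A E; u \<in> aterms A E \<rbrakk>
      \<Longrightarrow> aterm_cong A E Q (Mul s (Add t u)) (Add (Mul s t) (Mul s u))"

definition aterm_class ::
    "('a, 'm) ring_scheme \<Rightarrow> 'x set \<Rightarrow> (('a, 'x) aterm \<times> ('a, 'x) aterm) set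
      \<Rightarrow> ('a, 'x) aterm \<Rightarrow> ('a, 'x) aterm set"
  where "aterm_class A E Q s = {t. aterm_cong A E Q s t}"

definition presented_algebra ::
    "('a, 'm) ring_scheme \<Rightarrow> 'x set \<Rightarrow> (('a, 'x) aterm \<times> ('a, 'x) aterm) set
      \<Rightarrow> ('a, ('a, 'x) aterm set) module"
  where "presented_algebra A E Q =
    \<lparr>carrier = aterm_class A E Q ` aterms A E,
     monoid.mult = (\<lambda>u v. \<Union>s\<in>u. \<Union>t\<in>v. aterm_class A E Q (Mul s t)),
     one = aterm_class A E Q (Con \<one>\<^bsub>A\<^esub>),
     ring.zero = aterm_class A E Q (Con \<zero>\<^bsub>A\<^esub>),
     ring.add = (\<lambda>u v. \<Union>s\<in>u. \<Union>t\<in>v. aterm_class A E Q (Add s t)),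
     module.smult = (\<lambda>a u. \<Union>s\<in>u. aterm_class A E Q (Mul (Con a) s))\<rparr>"

fun aterm_sum :: "('a, 'm) ring_scheme \<Rightarrow> ('a, 'x) aterm list \<Rightarrow> ('a, 'x) aterm" where
  "aterm_sum A [] = Con \<zero>\<^bsub>A\<^esub>"
| "aterm_sum A (s # ss) = Add s (aterm_sum A ss)"


section \<open>Submodules, generation and base change\<close>

definition lin_span :: "('a, 'm) ring_scheme \<Rightarrow> ('a, 'b, 'k) module_scheme \<Rightarrow> 'b set \<Rightarrow> 'b set"
  where "lin_span A M T = \<Inter>{H. submodule H A M \<and> T \<subseteq> H}"

definition generated_subalgebra ::
    "('a, 'm) ring_scheme \<Rightarrow> ('a, 'b, 'k) module_scheme \<Rightarrow> 'b set \<Rightarrow> 'b set"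
  where "generated_subalgebra A F T = \<Inter>{H. subring H F \<and> submodule H A F \<and> T \<subseteq> H}"

definition monomial_span ::
    "('a, 'm) ring_scheme \<Rightarrow> ('a, 'f, 'k) module_scheme \<Rightarrow> nat \<Rightarrow> (nat \<Rightarrow> 'f) \<Rightarrow> nat \<Rightarrow> 'f set"
  where "monomial_span A F r t d =
    lin_span A F {finprod F (\<lambda>i. t i [^]\<^bsub>F\<^esub> e i) {..<r} |e::nat \<Rightarrow> nat. sum e {..<r} \<le> d}"

text \<open>The tensor product of the \<open>A\<close>-algebras \<open>F\<close> and \<open>B\<close>, as the \<open>B\<close>-algebra generated by
  the symbols \<open>x \<otimes> 1\<close> for \<open>x\<close> in \<open>F\<close>, subject to the relations saying that
  \<open>x \<mapsto> x \<otimes> 1\<close> is a homomorphism of \<open>A\<close>-algebras.\<close>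

inductive_set base_change_rels ::
    "('a, 'm) ring_scheme \<Rightarrow> ('a, 'b, 'k) module_scheme \<Rightarrow> ('a, 'f, 'l) module_scheme
      \<Rightarrow> (('b, 'f) aterm \<times> ('b, 'f) aterm) set"
  for A and B and F where
    "\<lbrakk> x \<in> carrier F; y \<in> carrier F \<rbrakk>
      \<Longrightarrow> (Gen (x \<oplus>\<^bsub>F\<^esub> y), Add (Gen x) (Gen y)) \<in> base_change_rels A B F"
  | "\<lbrakk> x \<in> carrier F; y \<in> carrier F \<rbrakk>
      \<Longrightarrow> (Gen (x \<otimes>\<^bsub>F\<^esub> y), Mul (Gen x) (Gen y)) \<in> base_change_rels A B F"
  | "(Gen \<one>\<^bsub>F\<^esub>, Con \<one>\<^bsub>B\<^esub>) \<in> base_change_rels A B F"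
  | "\<lbrakk> a \<in> carrier A; x \<in> carrier F \<rbrakk>
      \<Longrightarrow> (Gen (a \<odot>\<^bsub>F\<^esub> x), Mul (Con (a \<odot>\<^bsub>B\<^esub> \<one>\<^bsub>B\<^esub>)) (Gen x)) \<in> base_change_rels A B F"

definition base_change ::
    "('a, 'm) ring_scheme \<Rightarrow> ('a, 'b, 'k) module_scheme \<Rightarrow> ('a, 'f, 'l) module_scheme
      \<Rightarrow> ('b, ('b, 'f) aterm set) module"
  where "base_change A B F = presented_algebra B (carrier F) (base_change_rels A B F)"

definition base_change_elt ::
    "('a, 'm) ring_scheme \<Rightarrow> ('a, 'b, 'k) module_scheme \<Rightarrow> ('a, 'f, 'l) module_scheme
      \<Rightarrow> 'f \<Rightarrow> ('b, 'f) aterm set"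
  where "base_change_elt A B F x =
    aterm_class B (carrier F) (base_change_rels A B F) (Gen x)"


section \<open>Divided powers\<close>

text \<open>The generator \<open>Gen (m, x)\<close> stands for \<open>\<gamma>\<^sup>m(x)\<close>.\<close>

inductive_set Gamma_rels ::
    "('a, 'm) ring_scheme \<Rightarrow> ('a, 'b, 'k) module_scheme
      \<Rightarrow> (('a, nat \<times> 'b) aterm \<times> ('a, nat \<times> 'b) aterm) set"
  for A and M where
    "x \<in> carrier M \<Longrightarrow> (Gen (0, x), Con \<one>\<^bsub>A\<^esub>) \<in> Gamma_rels A M"
  | "\<lbrakk> a \<in> carrier A; x \<in> carrier M \<rbrakk>
      \<Longrightarrow> (Gen (m, a \<odot>\<^bsub>M\<^esub> x), Mul (Con (a [^]\<^bsub>A\<^esub> m)) (Gen (m, x))) \<in> Gamma_rels A M"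
  | "\<lbrakk> x \<in> carrier M; y \<in> carrier M \<rbrakk>
      \<Longrightarrow> (Gen (m, x \<oplus>\<^bsub>M\<^esub> y),
          aterm_sum A (map (\<lambda>j. Mul (Gen (j, x)) (Gen (m - j, y))) [0..<Suc m]))
        \<in> Gamma_rels A M"
  | "x \<in> carrier M
      \<Longrightarrow> (Mul (Gen (m, x)) (Gen (l, x)),
          Mul (Con (add_pow A ((m + l) choose m) \<one>\<^bsub>A\<^esub>)) (Gen (m + l, x)))
        \<in> Gamma_rels A M"

definition Gamma ::
    "('a, 'm) ring_scheme \<Rightarrow> ('a, 'b, 'k) module_scheme
      \<Rightarrow> ('a, ('a, nat \<times> 'b) aterm set) module"
  where "Gamma A M = presented_algebra A (UNIV \<times> carrier M) (Gamma_rels A M)"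

definition dpow ::
    "('a, 'm) ring_scheme \<Rightarrow> ('a, 'b, 'k) module_scheme \<Rightarrow> nat \<Rightarrow> 'b \<Rightarrow> ('a, nat \<times> 'b) aterm set"
  where "dpow A M m x = aterm_class A (UNIV \<times> carrier M) (Gamma_rels A M) (Gen (m, x))"

text \<open>The component of degree \<open>n\<close>: the span of the products
  \<open>\<gamma>\<^sup>p(x) * \<dots> * \<gamma>\<^sup>q(y)\<close> with \<open>p + \<dots> + q = n\<close>.\<close>

definition Gamma_deg ::
    "('a, 'm) ring_scheme \<Rightarrow> ('a, 'b, 'k) module_scheme \<Rightarrow> nat \<Rightarrow> ('a, nat \<times> 'b) aterm set set"
  where "Gamma_deg A M n =
    lin_span A (Gamma A M)
      {foldr (\<lambda>(m, x) u. dpow A M m x \<otimes>\<^bsub>Gamma A M\<^esub> u) l \<one>\<^bsub>Gamma A M\<^esub> |l.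
        snd ` set l \<subseteq> carrier M \<and> sum_list (map fst l) = n}"


subsection \<open>The second product\<close>

definition bilinear_op ::
    "('a, 'm) ring_scheme \<Rightarrow> ('a, 'b, 'k) module_scheme \<Rightarrow> 'b set \<Rightarrow> ('b \<Rightarrow> 'b \<Rightarrow> 'b) \<Rightarrow> bool"
  where "bilinear_op A M H f \<longleftrightarrow>
    (\<forall>u\<in>H. \<forall>v\<in>H. f u v \<in> H) \<and>
    (\<forall>u\<in>H. \<forall>v\<in>H. \<forall>w\<in>H. f (u \<oplus>\<^bsub>M\<^esub> v) w = f u w \<oplus>\<^bsub>M\<^esub> f v w \<and>
                        f w (u \<oplus>\<^bsub>M\<^esub> v) = f w u \<oplus>\<^bsub>M\<^esub> f w v) \<and>
    (\<forall>a\<in>carrier A. \<forall>u\<in>H. \<forall>v\<in>H. f (a \<odot>\<^bsub>M\<^esub> u) v = a \<odot>\<^bsub>M\<^esub> f u v \<and>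
                               f u (a \<odot>\<^bsub>M\<^esub> v) = a \<odot>\<^bsub>M\<^esub> f u v)"

definition Gamma_deg_with_mult ::
    "('a, 'm) ring_scheme \<Rightarrow> ('a, 'f, 'k) module_scheme \<Rightarrow> nat
      \<Rightarrow> (('a, nat \<times> 'f) aterm set \<Rightarrow> ('a, nat \<times> 'f) aterm set \<Rightarrow> ('a, nat \<times> 'f) aterm set)
      \<Rightarrow> ('a, ('a, nat \<times> 'f) aterm set) module"
  where "Gamma_deg_with_mult A F n f =
    \<lparr>carrier = Gamma_deg A F n, monoid.mult = f, one = dpow A F n \<one>\<^bsub>F\<^esub>,
     ring.zero = \<zero>\<^bsub>Gamma A F\<^esub>, ring.add = ring.add (Gamma A F), module.smult = module.smult (Gamma A F)\<rparr>"

text \<open>The map \<open>c\<close> is the canonical one from the divided power algebra of \<open>F\<close> over \<open>A\<close> to that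
  of the base change \<open>F\<^sub>B\<close> over \<open>B\<close>; it identifies the latter with the base change of the
  former. Since the image of \<open>c\<close> spans the target over \<open>B\<close>, the map \<open>g\<close> is the \<open>B\<close>-bilinear
  extension of \<open>f\<close>.\<close>

definition norm_law_after ::
    "('a, 'm) ring_scheme \<Rightarrow> ('a, 'b, 'l) module_scheme \<Rightarrow> ('a, 'f, 'k) module_scheme \<Rightarrow> nat
      \<Rightarrow> (('a, nat \<times> 'f) aterm set \<Rightarrow> ('a, nat \<times> 'f) aterm set \<Rightarrow> ('a, nat \<times> 'f) aterm set)
      \<Rightarrow> bool"
  where "norm_law_after A B F n f \<longleftrightarrow>
    (let F\<^sub>B = base_change A B F in
      \<exists>c \<in> ring_hom (Gamma A F) (Gamma B F\<^sub>B). \<exists>g.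
        (\<forall>m. \<forall>x\<in>carrier F. c (dpow A F m x) = dpow B F\<^sub>B m (base_change_elt A B F x)) \<and>
        (\<forall>a\<in>carrier A. \<forall>u\<in>carrier (Gamma A F).
          c (a \<odot>\<^bsub>Gamma A F\<^esub> u) = (a \<odot>\<^bsub>B\<^esub> \<one>\<^bsub>B\<^esub>) \<odot>\<^bsub>Gamma B F\<^sub>B\<^esub> c u) \<and>
        bilinear_op B (Gamma B F\<^sub>B) (Gamma_deg B F\<^sub>B n) g \<and>
        (\<forall>u\<in>Gamma_deg A F n. \<forall>v\<in>Gamma_deg A F n. g (c u) (c v) = c (f u v)) \<and>
        (\<forall>x\<in>carrier F\<^sub>B. \<forall>y\<in>carrier F\<^sub>B.
          g (dpow B F\<^sub>B n x) (dpow B F\<^sub>B n y) = dpow B F\<^sub>B n (x \<otimes>\<^bsub>F\<^sub>B\<^esub> y)))"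

text \<open>A definition cannot quantify over all types of base rings. The carrier type chosen for \<open>B\<close>
  contains a copy of every countably generated \<open>A\<close>-algebra, such as the polynomial ring in
  countably many variables, which already determines the product. The identity for an arbitrary
  \<open>B\<close> follows, because two elements of the base change of \<open>F\<close> to \<open>B\<close> come from a finitely
  generated subalgebra of \<open>B\<close>.\<close>

definition is_norm_mult ::
    "('a, 'm) ring_scheme \<Rightarrow> ('a, 'f, 'k) module_scheme \<Rightarrow> nat
      \<Rightarrow> (('a, nat \<times> 'f) aterm set \<Rightarrow> ('a, nat \<times> 'f) aterm set \<Rightarrow> ('a, nat \<times> 'f) aterm set)
      \<Rightarrow> bool"
  where "is_norm_mult A F n f \<longleftrightarrow>
    algebra A (Gamma_deg_with_mult A F n f) \<and>
    (\<forall>B :: ('a, ('a, nat) aterm set) module. algebra A B \<longrightarrow> norm_law_after A B F n f)"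

definition Gamma_ring ::
    "('a, 'm) ring_scheme \<Rightarrow> ('a, 'f, 'k) module_scheme \<Rightarrow> nat
      \<Rightarrow> ('a, ('a, nat \<times> 'f) aterm set) module"
  where "Gamma_ring A F n = Gamma_deg_with_mult A F n (SOME f. is_norm_mult A F n f)"


section \<open>Ideals of norms\<close>

definition norm_delta ::
    "('a, 'm) ring_scheme \<Rightarrow> ('a, 'f, 'k) module_scheme \<Rightarrow> nat \<Rightarrow> (nat \<Rightarrow> 'f) \<Rightarrow> (nat \<Rightarrow> 'f)
      \<Rightarrow> ('a, nat \<times> 'f) aterm set"
  where "norm_delta A F n x y =
    finsum (Gamma A F)
      (\<lambda>\<sigma>. let u = finprod (Gamma A F) (\<lambda>i. dpow A F 1 (x i \<otimes>\<^bsub>F\<^esub> y (\<sigma> i))) {..<n}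
            in if evenperm \<sigma> then u else \<ominus>\<^bsub>Gamma A F\<^esub> u)
      {\<sigma>. \<sigma> permutes {..<n}}"

definition norm_ideal ::
    "('a, 'm) ring_scheme \<Rightarrow> ('a, 'f, 'k) module_scheme \<Rightarrow> nat \<Rightarrow> 'f set
      \<Rightarrow> ('a, nat \<times> 'f) aterm set set"
  where "norm_ideal A F n V =
    genideal (Gamma_ring A F n)
      {norm_delta A F n x y |x y. (\<forall>i<n. x i \<in> V) \<and> (\<forall>i<n. y i \<in> V)}"


section \<open>Ringed spaces\<close>

text \<open>Sheaves of rings whose sections over \<open>U\<close> are functions on \<open>U\<close>, so that restriction of
  sections is restriction of functions.\<close>

record ('p, 'v) ringed_space =
  sp :: "'p topology"
  sections :: "'p set \<Rightarrow> ('p \<Rightarrow> 'v) ring"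

text \<open>A pair of a map \<open>f\<close> on points and maps \<open>fs W\<close> from the sections over \<open>W\<close> to the sections
  over its preimage is an isomorphism of ringed spaces. An isomorphism of ringed spaces between
  schemes is automatically local, hence an isomorphism of schemes.\<close>

definition ringed_space_iso ::
    "('p, 'v) ringed_space \<Rightarrow> ('q, 'w) ringed_space
      \<Rightarrow> ('p \<Rightarrow> 'q) \<Rightarrow> ('q set \<Rightarrow> ('q \<Rightarrow> 'w) \<Rightarrow> ('p \<Rightarrow> 'v)) \<Rightarrow> bool"
  where "ringed_space_iso M N f fs \<longleftrightarrow>
    homeomorphic_map (sp M) (sp N) f \<and>
    (\<forall>W. openin (sp N) W \<longrightarrow>
      fs W \<in> ring_iso (sections N W) (sections M {p \<in> topspace (sp M). f p \<in> W})) \<and>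
    (\<forall>W W'. openin (sp N) W \<and> openin (sp N) W' \<and> W' \<subseteq> W \<longrightarrow>
      (\<forall>s\<in>carrier (sections N W).
        fs W' (restrict s W') = restrict (fs W s) {p \<in> topspace (sp M). f p \<in> W'}))"


section \<open>Proj of a graded ring\<close>

text \<open>A graded ring is given by a ring \<open>S\<close> and its homogeneous components \<open>G 0, G 1, \<dots>\<close>.\<close>

definition Proj_points :: "('s, 'm) ring_scheme \<Rightarrow> (nat \<Rightarrow> 's set) \<Rightarrow> 's set set"
  where "Proj_points S G =
    {P. primeideal P S \<and> P = genideal S (P \<inter> (\<Union>m. G m)) \<and> (\<exists>m>0. \<not> G m \<subseteq> P)}"

definition Proj_top :: "('s, 'm) ring_scheme \<Rightarrow> (nat \<Rightarrow> 's set) \<Rightarrow> 's set topology"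
  where "Proj_top S G =
    topology_generated_by {{P \<in> Proj_points S G. f \<notin> P} |f m. 0 < m \<and> f \<in> G m}"

text \<open>The fraction \<open>a / f\<close> of degree zero in the homogeneous localization at \<open>P\<close>, where \<open>a\<close> and
  \<open>f\<close> are homogeneous of the same degree and \<open>f\<close> is not in \<open>P\<close>.\<close>

definition hfrac ::
    "('s, 'm) ring_scheme \<Rightarrow> (nat \<Rightarrow> 's set) \<Rightarrow> 's set \<Rightarrow> 's \<Rightarrow> 's \<Rightarrow> ('s \<times> 's) set"
  where "hfrac S G P a f =
    {(b, g). (\<exists>m. b \<in> G m \<and> g \<in> G m) \<and> g \<notin> P \<and>
      (\<exists>h\<in>(\<Union>m. G m). h \<notin> P \<and> h \<otimes>\<^bsub>S\<^esub> (a \<otimes>\<^bsub>S\<^esub> g) = h \<otimes>\<^bsub>S\<^esub> (b \<otimes>\<^bsub>S\<^esub> f))}"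

definition hloc ::
    "('s, 'm) ring_scheme \<Rightarrow> (nat \<Rightarrow> 's set) \<Rightarrow> 's set \<Rightarrow> ('s \<times> 's) set ring"
  where "hloc S G P =
    \<lparr>carrier = {hfrac S G P a f |a f. (\<exists>m. a \<in> G m \<and> f \<in> G m) \<and> f \<notin> P},
     monoid.mult = (\<lambda>u v. \<Union>(a, f)\<in>u. \<Union>(b, g)\<in>v. hfrac S G P (a \<otimes>\<^bsub>S\<^esub> b) (f \<otimes>\<^bsub>S\<^esub> g)),
     one = hfrac S G P \<one>\<^bsub>S\<^esub> \<one>\<^bsub>S\<^esub>,
     ring.zero = hfrac S G P \<zero>\<^bsub>S\<^esub> \<one>\<^bsub>S\<^esub>,
     ring.add = (\<lambda>u v. \<Union>(a, f)\<in>u. \<Union>(b, g)\<in>v.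
              hfrac S G P ((a \<otimes>\<^bsub>S\<^esub> g) \<oplus>\<^bsub>S\<^esub> (b \<otimes>\<^bsub>S\<^esub> f)) (f \<otimes>\<^bsub>S\<^esub> g))\<rparr>"

definition Proj_sections ::
    "('s, 'm) ring_scheme \<Rightarrow> (nat \<Rightarrow> 's set) \<Rightarrow> 's set set \<Rightarrow> ('s set \<Rightarrow> ('s \<times> 's) set) ring"
  where "Proj_sections S G U =
    \<lparr>carrier = {s \<in> (\<Pi>\<^sub>E P\<in>U. carrier (hloc S G P)).
       \<forall>P\<in>U. \<exists>W. openin (Proj_top S G) W \<and> P \<in> W \<and> W \<subseteq> U \<and>
         (\<exists>m. \<exists>a\<in>G m. \<exists>f\<in>G m. \<forall>Q\<in>W. f \<notin> Q \<and> s Q = hfrac S G Q a f)},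
     monoid.mult = (\<lambda>s t. \<lambda>P\<in>U. s P \<otimes>\<^bsub>hloc S G P\<^esub> t P),
     one = (\<lambda>P\<in>U. \<one>\<^bsub>hloc S G P\<^esub>),
     ring.zero = (\<lambda>P\<in>U. \<zero>\<^bsub>hloc S G P\<^esub>),
     ring.add = (\<lambda>s t. \<lambda>P\<in>U. s P \<oplus>\<^bsub>hloc S G P\<^esub> t P)\<rparr>"

definition Proj ::
    "('s, 'm) ring_scheme \<Rightarrow> (nat \<Rightarrow> 's set) \<Rightarrow> ('s set, ('s \<times> 's) set) ringed_space"
  where "Proj S G = \<lparr>sp = Proj_top S G, sections = Proj_sections S G\<rparr>"

text \<open>The morphism to \<open>Proj S'\<close> induced by a homomorphism of graded rings \<open>h\<close> from \<open>S'\<close> to \<open>S\<close>.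
  It is defined on the open set of those points of \<open>Proj S\<close> that do not contain the image of the
  irrelevant ideal of \<open>S'\<close>.\<close>

definition Proj_map_domain ::
    "(nat \<Rightarrow> 't set) \<Rightarrow> ('s, 'm) ring_scheme \<Rightarrow> (nat \<Rightarrow> 's set) \<Rightarrow> ('t \<Rightarrow> 's) \<Rightarrow> 's set set"
  where "Proj_map_domain G' S G h = {P \<in> Proj_points S G. \<exists>m>0. \<not> h ` G' m \<subseteq> P}"

definition Proj_map_point :: "('t, 'k) ring_scheme \<Rightarrow> ('t \<Rightarrow> 's) \<Rightarrow> 's set \<Rightarrow> 't set"
  where "Proj_map_point S' h P = {a \<in> carrier S'. h a \<in> P}"

definition Proj_map_sections ::
    "('t, 'k) ring_scheme \<Rightarrow> (nat \<Rightarrow> 't set) \<Rightarrow> ('s, 'm) ring_scheme \<Rightarrow> (nat \<Rightarrow> 's set) \<Rightarrow> ('t \<Rightarrow> 's)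
      \<Rightarrow> 't set set \<Rightarrow> ('t set \<Rightarrow> ('t \<times> 't) set) \<Rightarrow> ('s set \<Rightarrow> ('s \<times> 's) set)"
  where "Proj_map_sections S' G' S G h W s =
    (\<lambda>P\<in>{P \<in> Proj_map_domain G' S G h. Proj_map_point S' h P \<in> W}.
      \<Union>(a, f)\<in>s (Proj_map_point S' h P). hfrac S G P (h a) (h f))"


section \<open>Blow-ups of affine schemes\<close>

fun ideal_power :: "('a, 'm) ring_scheme \<Rightarrow> 'a set \<Rightarrow> nat \<Rightarrow> 'a set" where
  "ideal_power R I 0 = carrier R"
| "ideal_power R I (Suc m) = ideal_prod R I (ideal_power R I m)"

text \<open>The direct sum of the powers of \<open>I\<close>, realized inside the polynomial ring over \<open>R\<close>.\<close>

definition Rees :: "('a, 'm) ring_scheme \<Rightarrow> 'a set \<Rightarrow> ('a, nat \<Rightarrow> 'a) up_ring"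
  where "Rees R I =
    (UP R)\<lparr>carrier := {p \<in> carrier (UP R). \<forall>m. coeff (UP R) p m \<in> ideal_power R I m}\<rparr>"

definition Rees_deg :: "('a, 'm) ring_scheme \<Rightarrow> 'a set \<Rightarrow> nat \<Rightarrow> (nat \<Rightarrow> 'a) set"
  where "Rees_deg R I m =
    {p \<in> carrier (Rees R I). \<forall>i. i \<noteq> m \<longrightarrow> coeff (UP R) p i = \<zero>\<^bsub>R\<^esub>}"

definition Blowup ::
    "('a, 'm) ring_scheme \<Rightarrow> 'a set
      \<Rightarrow> ((nat \<Rightarrow> 'a) set, ((nat \<Rightarrow> 'a) \<times> (nat \<Rightarrow> 'a)) set) ringed_space"
  where "Blowup R I = Proj (Rees R I) (Rees_deg R I)"

end

theory Submission
  imports Defs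
begin

text \<open>The second product on the degree \<open>n\<close> part of the divided power algebra multiplies products of
  divided powers by summing over nonnegative integer matrices with prescribed margins. It follows
  that \<open>\<delta>\<close> behaves like a product of two Vandermonde determinants: it satisfies Cramer's rule
  \<open>\<delta>(w\<^sub>k \<rightarrow> qz, y) \<delta>(x, y') = \<Sum>\<^sub>i \<delta>(w\<^sub>k \<rightarrow> q x\<^sub>i, y) \<delta>(x\<^sub>i \<rightarrow> z, y')\<close>, where one entry is replaced, and the
  Cayley-Hamilton theorem holds in each entry.

  Let \<open>J\<close> be the ideal generated by the \<open>\<delta>\<close> of monomials of degree less than \<open>n\<close>, so that \<open>J\<close> is
  contained in \<open>I\<^sub>V\<close>. By Cayley-Hamilton \<open>I\<^sub>F\<close> is finitely generated, and by Cramer's rule each of its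
  generators is nilpotent modulo \<open>J\<close> in the Rees algebra of \<open>I\<^sub>F\<close>. Hence \<open>J\<close> is a reduction of \<open>I\<^sub>F\<close>,
  and the charts \<open>f \<noteq> 0\<close> with \<open>f\<close> among the generators of \<open>J\<close> cover both blow-ups. On such a chart
  Cramer's rule shows that each \<open>g\<close> in \<open>I\<^sub>F\<close> satisfies \<open>f\<^sup>N g \<in> I\<^sub>V\<^sup>N\<^sup>+\<^sup>1\<close> for some \<open>N\<close>, so the two
  homogeneous localizations at \<open>f\<close> agree.\<close>

section \<open>Presented algebras\<close>

text \<open>If Gamma^n embedded in the symmetric tensors, gamma^1(c_0) * ... * gamma^1(c_(n-1))
  would be a permanent and delta(x, y) would be det(x_i(p_j)) det(y_i(p_j)). As F need not be flat
  over A, no such embedding is available, and the identities are derived from permutation sums in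
  Gamma^n itself. Its ring structure is moreover only a choice subject to a law after base change,
  so existence and uniqueness come first. Both use polynomials Y in F[T]: the coefficients of
  gamma^n(Y) span Gamma^n, and multiplication by them is read off the algebra map gamma^m(x) ->
  gamma^m(xY). One variable is enough because exponents may be powers of n + 1. The covering of the
  blow-up along I_V is the delicate half: nilpotency modulo J is known in the Rees algebra of I_F,
  and it is transferred to a prime of the Rees algebra of I_V through the finitely generated module
  I_F^N. The bound n on degrees arises because the charts use monomials of degree less than n, and
  such a monomial times one more generator must stay in V.\<close>

primrec aterm_eval where
  "aterm_eval W b v (Con a) = b a"
| "aterm_eval W b v (Gen x) = v x"
| "aterm_eval W b v (Add s t) = aterm_eval W b v s \<oplus>\<^bsub>W\<^esub> aterm_eval W b v t"
| "aterm_eval W b v (Mul s t) = aterm_eval W b v s \<otimes>\<^bsub>W\<^esub> aterm_eval W b v t"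

text \<open>A class is a set of expressions, so its value is the one shared by all members. This is
  meaningful once evaluation has been shown to respect the congruence.\<close>

definition presented_lift where
  "presented_lift W b v u = (THE w. \<forall>s\<in>u. aterm_eval W b v s = w)"

locale presentation = cring A for A (structure) +
  fixes E :: "'x set" and Q :: "(('a, 'x) aterm \<times> ('a, 'x) aterm) set"
begin

abbreviation "PA \<equiv> presented_algebra A E Q"
abbreviation "cls \<equiv> aterm_class A E Q"
abbreviation cong (infix \<open>\<approx>\<close> 50) where "s \<approx> t \<equiv> aterm_cong A E Q s t"

lemma cong_aterms: "s \<approx> t \<Longrightarrow> s \<in> aterms A E \<and> t \<in> aterms A E"
  by (induction rule: aterm_cong.induct) (auto intro!: aterms.intros)

lemmas [trans] = aterm_cong.trans

text \<open>The congruence is reflexive only on well-formed expressions, and all other expressions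
  have the empty class; hence the assumption on \<open>s\<close>.\<close>

lemma cls_eq_iff: "s \<in> aterms A E \<Longrightarrow> cls s = cls t \<longleftrightarrow> s \<approx> t"
  unfolding aterm_class_def
  by (auto simp: set_eq_iff intro: aterm_cong.refl aterm_cong.sym aterm_cong.trans)

lemma cls_eqI: "s \<approx> t \<Longrightarrow> cls s = cls t"
  using cls_eq_iff cong_aterms by blast

lemma mem_cls: "t \<in> cls s \<longleftrightarrow> s \<approx> t"
  unfolding aterm_class_def by simp

lemma self_in_cls: "s \<in> aterms A E \<Longrightarrow> s \<in> cls s"
  by (simp add: mem_cls aterm_cong.refl)

lemma PA_carrier: "carrier PA = cls ` aterms A E"
  and PA_one: "\<one>\<^bsub>PA\<^esub> = cls (Con \<one>)"
  and PA_zero: "\<zero>\<^bsub>PA\<^esub> = cls (Con \<zero>)"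
  unfolding presented_algebra_def by simp_all

text \<open>The operations of the quotient are unions over all representatives. Independence of
  representatives makes such a union constant, which reduces it to the class of one chosen
  expression.\<close>

lemma UN_const_eq: "(\<And>x. x \<in> U \<Longrightarrow> F x = Z) \<Longrightarrow> p \<in> U \<Longrightarrow> (\<Union>x\<in>U. F x) = Z"
  by auto

lemma PA_add: "\<lbrakk> s \<in> aterms A E; t \<in> aterms A E \<rbrakk> \<Longrightarrow> cls s \<oplus>\<^bsub>PA\<^esub> cls t = cls (Add s t)"
  unfolding presented_algebra_def ring.simps
  by (intro UN_const_eq[OF _ self_in_cls] cls_eqI)
    (auto simp: mem_cls intro: aterm_cong.add aterm_cong.sym)

lemma PA_mult: "\<lbrakk> s \<in> aterms A E; t \<in> aterms A E \<rbrakk> \<Longrightarrow> cls s \<otimes>\<^bsub>PA\<^esub> cls t = cls (Mul s t)"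
  unfolding presented_algebra_def monoid.simps
  by (intro UN_const_eq[OF _ self_in_cls] cls_eqI)
    (auto simp: mem_cls intro: aterm_cong.mul aterm_cong.sym)

lemma PA_smult: "\<lbrakk> a \<in> carrier A; s \<in> aterms A E \<rbrakk> \<Longrightarrow> a \<odot>\<^bsub>PA\<^esub> cls s = cls (Mul (Con a) s)"
  unfolding presented_algebra_def module.simps
  by (intro UN_const_eq[OF _ self_in_cls] cls_eqI)
    (auto simp: mem_cls intro: aterm_cong.mul aterm_cong.sym aterm_cong.refl aterms.intros)

lemma distr_right:
  assumes "s \<in> aterms A E" "t \<in> aterms A E" "u \<in> aterms A E"
  shows "Mul (Add s t) u \<approx> Add (Mul s u) (Mul t u)"
proof -
  have "Mul (Add s t) u \<approx> Mul u (Add s t)" using assms by (intro aterm_cong.mul_comm aterms.intros)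
  also have "Mul u (Add s t) \<approx> Add (Mul u s) (Mul u t)"
    using assms by (intro aterm_cong.distr)
  also have "Add (Mul u s) (Mul u t) \<approx> Add (Mul s u) (Mul t u)"
    using assms by (intro aterm_cong.add aterm_cong.mul_comm)
  finally show ?thesis .
qed

lemma PA_cring: "cring PA"
proof -
  have "abelian_group PA"
  proof (rule abelian_groupI)
    fix x assume x: "x \<in> carrier PA"
    then obtain s where s: "x = cls s" "s \<in> aterms A E" unfolding PA_carrier by blast
    have "cls (Mul (Con (\<ominus> \<one>)) s) \<oplus>\<^bsub>PA\<^esub> x = \<zero>\<^bsub>PA\<^esub>"
      using s by (auto simp: PA_add PA_zero aterms.intros intro!: cls_eqI
          intro: aterm_cong.trans[OF aterm_cong.add_comm] aterm_cong.add_neg aterms.intros)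
    then show "\<exists>y\<in>carrier PA. y \<oplus>\<^bsub>PA\<^esub> x = \<zero>\<^bsub>PA\<^esub>"
      using s unfolding PA_carrier by (auto intro!: imageI aterms.intros)
  next
    have "Add (Con \<zero>) s \<approx> s" if "s \<in> aterms A E" for s
      using that by (intro aterm_cong.trans[OF aterm_cong.add_comm aterm_cong.add_zero] aterms.intros) auto
    then show "\<zero>\<^bsub>PA\<^esub> \<oplus>\<^bsub>PA\<^esub> x = x" if "x \<in> carrier PA" for x
      using that unfolding PA_carrier PA_zero by (elim imageE) (simp add: PA_add aterms.intros cls_eqI)
  next
    show "x \<oplus>\<^bsub>PA\<^esub> y = y \<oplus>\<^bsub>PA\<^esub> x" if "x \<in> carrier PA" "y \<in> carrier PA" for x y
      using that unfolding PA_carrier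
      by (elim imageE) (simp add: PA_add cls_eqI[OF aterm_cong.add_comm])
  qed (unfold PA_carrier PA_zero, safe elim!: imageE,
    simp_all add: PA_add aterms.intros cls_eqI[OF aterm_cong.add_assoc])
  moreover have "comm_monoid PA"
  proof (rule comm_monoidI)
    show "x \<otimes>\<^bsub>PA\<^esub> y = y \<otimes>\<^bsub>PA\<^esub> x" if "x \<in> carrier PA" "y \<in> carrier PA" for x y
      using that unfolding PA_carrier
      by (elim imageE) (simp add: PA_mult cls_eqI[OF aterm_cong.mul_comm])
  qed (unfold PA_carrier PA_one, safe elim!: imageE,
    simp_all add: PA_mult aterms.intros cls_eqI[OF aterm_cong.mul_assoc] cls_eqI[OF aterm_cong.mul_one])
  ultimately show ?thesis
    by (rule cringI, unfold PA_carrier, safe elim!: imageE)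
      (simp_all add: PA_mult PA_add aterms.intros cls_eqI[OF distr_right])
qed

lemma PA_algebra: "algebra A PA"
proof (rule algebraI[OF is_cring PA_cring])
  fix a b x y
  assume "a \<in> carrier A" "b \<in> carrier A" "x \<in> carrier PA"
  moreover from this obtain s where s: "x = cls s" "s \<in> aterms A E" unfolding PA_carrier by blast
  ultimately have [simp]: "a \<in> carrier A" "b \<in> carrier A" "s \<in> aterms A E" "x = cls s" by auto
  have "Mul (Con (a \<oplus> b)) s \<approx> Mul (Add (Con a) (Con b)) s"
    by (intro aterm_cong.mul aterm_cong.con_add aterm_cong.refl) auto
  also have "\<dots> \<approx> Add (Mul (Con a) s) (Mul (Con b) s)"
    by (intro distr_right aterms.intros) auto
  finally
  show "(a \<oplus> b) \<odot>\<^bsub>PA\<^esub> x = a \<odot>\<^bsub>PA\<^esub> x \<oplus>\<^bsub>PA\<^esub> b \<odot>\<^bsub>PA\<^esub> x"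
    by (simp add: PA_smult PA_add aterms.intros cls_eqI)
  have "Mul (Con (a \<otimes> b)) s \<approx> Mul (Mul (Con a) (Con b)) s"
    by (intro aterm_cong.mul aterm_cong.con_mul aterm_cong.refl) auto
  also have "\<dots> \<approx> Mul (Con a) (Mul (Con b) s)"
    by (intro aterm_cong.mul_assoc aterms.intros) auto
  finally
  show "(a \<otimes> b) \<odot>\<^bsub>PA\<^esub> x = a \<odot>\<^bsub>PA\<^esub> (b \<odot>\<^bsub>PA\<^esub> x)"
    by (simp add: PA_smult aterms.intros cls_eqI)
qed (unfold PA_carrier, safe elim!: imageE,
    simp_all add: PA_smult PA_add PA_mult aterms.intros
      cls_eqI[OF aterm_cong.distr] cls_eqI[OF aterm_cong.mul_one] cls_eqI[OF aterm_cong.mul_assoc])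

abbreviation con where "con a \<equiv> cls (Con a)"
abbreviation gen where "gen x \<equiv> cls (Gen x)"

lemma con_closed: "a \<in> carrier A \<Longrightarrow> con a \<in> carrier PA"
  and gen_closed: "x \<in> E \<Longrightarrow> gen x \<in> carrier PA"
  unfolding PA_carrier by (auto intro: aterms.intros)

lemma con_hom: "con \<in> ring_hom A PA"
  by (rule ring_hom_memI)
    (simp_all add: PA_one PA_mult PA_add aterms.intros con_closed cls_eqI aterm_cong.con_add aterm_cong.con_mul)

lemma smult_con: "\<lbrakk> a \<in> carrier A; u \<in> carrier PA \<rbrakk> \<Longrightarrow> a \<odot>\<^bsub>PA\<^esub> u = con a \<otimes>\<^bsub>PA\<^esub> u"
  unfolding PA_carrier by (auto simp: PA_smult PA_mult aterms.intros)

lemma rel_eq: "\<lbrakk> (s, t) \<in> Q; s \<in> aterms A E; t \<in> aterms A E \<rbrakk> \<Longrightarrow> cls s = cls t"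
  by (intro cls_eqI aterm_cong.rel)

lemma cls_eval: "s \<in> aterms A E \<Longrightarrow> cls s = aterm_eval PA con gen s"
  by (induction rule: aterms.induct) (simp_all add: PA_add PA_mult flip: PA_add PA_mult)

lemma PA_induct [consumes 1, case_names con gen add mult]:
  assumes "u \<in> carrier PA"
    and "\<And>a. a \<in> carrier A \<Longrightarrow> P (con a)" "\<And>x. x \<in> E \<Longrightarrow> P (gen x)"
    and "\<And>u v. \<lbrakk> u \<in> carrier PA; v \<in> carrier PA; P u; P v \<rbrakk> \<Longrightarrow> P (u \<oplus>\<^bsub>PA\<^esub> v)"
    and "\<And>u v. \<lbrakk> u \<in> carrier PA; v \<in> carrier PA; P u; P v \<rbrakk> \<Longrightarrow> P (u \<otimes>\<^bsub>PA\<^esub> v)"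
  shows "P u"
proof -
  obtain s where s: "u = cls s" "s \<in> aterms A E" using assms(1) unfolding PA_carrier by blast
  from s(2) have "P (cls s)"
  proof (induction rule: aterms.induct)
    case (3 s t)
    then show ?case using assms(4)[of "cls s" "cls t"] by (auto simp: PA_add PA_carrier)
  next
    case (4 s t)
    then show ?case using assms(5)[of "cls s" "cls t"] by (auto simp: PA_mult PA_carrier)
  qed (use assms in auto)
  then show ?thesis using s by simp
qed

lemma hom_ext:
  assumes "h \<in> ring_hom PA W" "h' \<in> ring_hom PA W"
    and "\<And>a. a \<in> carrier A \<Longrightarrow> h (con a) = h' (con a)" "\<And>x. x \<in> E \<Longrightarrow> h (gen x) = h' (gen x)"
    and "u \<in> carrier PA"
  shows "h u = h' u"
  using assms(5)
  by (induction rule: PA_induct)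
    (simp_all add: assms(3,4) ring_hom_add[OF assms(1)] ring_hom_add[OF assms(2)]
      ring_hom_mult[OF assms(1)] ring_hom_mult[OF assms(2)])

context
  fixes W (structure) and b v
  assumes W: "cring W" and b: "b \<in> ring_hom A W" and v: "v \<in> E \<rightarrow> carrier W"
    and Q: "\<And>s t. \<lbrakk> (s, t) \<in> Q; s \<in> aterms A E; t \<in> aterms A E \<rbrakk>
      \<Longrightarrow> aterm_eval W b v s = aterm_eval W b v t"
begin

lemma aterm_eval_closed: "s \<in> aterms A E \<Longrightarrow> aterm_eval W b v s \<in> carrier W"
proof (induction rule: aterms.induct)
  case (3 s t)
  interpret W: cring W by fact
  show ?case using 3 by simp
next
  case (4 s t)
  interpret W: cring W by fact
  show ?case using 4 by simp
qed (use b v in \<open>auto simp: ring_hom_closed\<close>)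

text \<open>The congruence is the least one forced by the ring axioms and \<open>Q\<close>, so rule
  induction reduces the claim to the axioms of \<open>W\<close> and the assumption on the
  relations.\<close>

lemma aterm_eval_cong: "s \<approx> t \<Longrightarrow> aterm_eval W b v s = aterm_eval W b v t"
proof (induction rule: aterm_cong.induct)
  interpret W: cring W by fact
  have hz: "b \<zero> = \<zero>\<^bsub>W\<^esub>" using ring_hom_zero[OF b ring_axioms W.ring_axioms] .
  have hc: "b a \<in> carrier W" if "a \<in> carrier A" for a using b that by (simp add: ring_hom_closed)
  note [simp] = aterm_eval_closed hz hc ring_hom_one[OF b] ring_hom_add[OF b] ring_hom_mult[OF b]
  {
    case (rel s t) then show ?case by (rule Q)
  next
    case (con_add a c) then show ?case by simp
  next
    case (con_mul a c) then show ?case by simp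
  next
    case (add_zero s) then show ?case by simp
  next
    case (mul_one s) then show ?case by simp
  next
    case (add_assoc s t u) then show ?case by (simp add: W.a_assoc)
  next
    case (add_comm s t) then show ?case by (simp add: W.a_comm)
  next
    case (add_neg s)
    \<comment> \<open>Negatives are expressed through the constant -1, so the image of -1 under
      \<open>b\<close> has to be recognised as -1 in \<open>W\<close> first.\<close>
    have "b (\<ominus> \<one>) \<oplus>\<^bsub>W\<^esub> \<one>\<^bsub>W\<^esub> = b (\<ominus> \<one> \<oplus> \<one>)" by simp
    then have "b (\<ominus> \<one>) \<oplus>\<^bsub>W\<^esub> \<one>\<^bsub>W\<^esub> = \<zero>\<^bsub>W\<^esub>" by (simp add: l_neg)
    then have "b (\<ominus> \<one>) = \<ominus>\<^bsub>W\<^esub> \<one>\<^bsub>W\<^esub>" using W.minus_equality[of "b (\<ominus> \<one>)" "\<one>\<^bsub>W\<^esub>"] by simp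
    then show ?case using add_neg by (simp add: W.l_minus W.r_neg)
  next
    case (mul_assoc s t u) then show ?case by (simp add: W.m_assoc)
  next
    case (mul_comm s t) then show ?case by (simp add: W.m_comm)
  next
    case (distr s t u) then show ?case by (simp add: W.r_distr)
  }
qed simp_all

lemma presented_lift_cls:
  assumes "s \<in> aterms A E"
  shows "presented_lift W b v (cls s) = aterm_eval W b v s"
  unfolding presented_lift_def
  using assms aterm_eval_cong self_in_cls by (intro the_equality) (auto simp: mem_cls)

lemma presented_lift_hom: "presented_lift W b v \<in> ring_hom PA W"
  using ring_hom_one[OF b]
  by (intro ring_hom_memI)
    (auto simp: PA_carrier PA_mult PA_add PA_one presented_lift_cls aterm_eval_closed aterms.intros)

lemma presented_lift_con: "a \<in> carrier A \<Longrightarrow> presented_lift W b v (con a) = b a"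
  and presented_lift_gen: "x \<in> E \<Longrightarrow> presented_lift W b v (gen x) = v x"
  by (simp_all add: presented_lift_cls aterms.intros)

end

end

section \<open>Finite products and sums\<close>

context comm_monoid
begin

text \<open>Stated for commutative monoids, so that the prefix \<open>add.\<close> gives the same
  fact for finite sums in a ring. Closure is asked of the right-hand side only.\<close>

lemma finprod_cong2: "(\<And>i. i \<in> I \<Longrightarrow> f i = g i) \<Longrightarrow> (\<And>i. i \<in> I \<Longrightarrow> g i \<in> carrier G)
    \<Longrightarrow> finprod G f I = finprod G g I"
  by (rule finprod_cong') auto

lemma finprod_in: "(\<And>i. i \<in> I \<Longrightarrow> f i \<in> carrier G) \<Longrightarrow> finprod G f I \<in> carrier G"
  by (rule finprod_closed) auto

lemma finprod_Sigma:
  assumes "finite I" "\<And>i. i \<in> I \<Longrightarrow> finite (J i)"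
    "\<And>i j. i \<in> I \<Longrightarrow> j \<in> J i \<Longrightarrow> f (i, j) \<in> carrier G"
  shows "finprod G f (Sigma I J) = finprod G (\<lambda>i. finprod G (\<lambda>j. f (i, j)) (J i)) I"
proof -
  have "Sigma I J = (\<Union>i\<in>I. Pair i ` J i)" by auto
  then have "finprod G f (Sigma I J) = finprod G (\<lambda>i. finprod G f (Pair i ` J i)) I"
    using assms by (simp, subst finprod_UN_disjoint) (auto simp: pairwise_def disjnt_def)
  also have "\<dots> = finprod G (\<lambda>i. finprod G (\<lambda>j. f (i, j)) (J i)) I"
    using assms by (intro finprod_cong2)
      (auto intro!: finprod_in, subst finprod_reindex, auto simp: inj_on_def)
  finally show ?thesis .
qed

lemma finprod_bij:
  assumes "bij_betw h I J" "\<And>j. j \<in> J \<Longrightarrow> f j \<in> carrier G"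
  shows "finprod G f J = finprod G (\<lambda>i. f (h i)) I"
  using assms finprod_reindex[of f h I] unfolding bij_betw_def by auto

lemma finprod_swap:
  assumes "finite I" "finite J" "\<And>i j. i \<in> I \<Longrightarrow> j \<in> J \<Longrightarrow> f i j \<in> carrier G"
  shows "finprod G (\<lambda>i. finprod G (f i) J) I = finprod G (\<lambda>j. finprod G (\<lambda>i. f i j) I) J"
proof -
  have "finprod G (\<lambda>i. finprod G (f i) J) I = finprod G (\<lambda>(i, j). f i j) (I \<times> J)"
    using assms by (subst finprod_Sigma) auto
  also have "\<dots> = finprod G (\<lambda>(j, i). f i j) (J \<times> I)"
    using assms by (subst finprod_bij[of prod.swap "J \<times> I" "I \<times> J"]) (auto simp: case_prod_beta bij_betw_def intro!: finprod_cong2)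
  also have "\<dots> = finprod G (\<lambda>j. finprod G (\<lambda>i. f i j) I) J"
    using assms by (subst finprod_Sigma) auto
  finally show ?thesis .
qed

lemma finprod_fibres:
  assumes "finite I" "finite J" "\<And>i. i \<in> I \<Longrightarrow> h i \<in> J" "\<And>i. i \<in> I \<Longrightarrow> f i \<in> carrier G"
  shows "finprod G f I = finprod G (\<lambda>j. finprod G f {i \<in> I. h i = j}) J"
proof -
  have "I = (\<Union>j\<in>J. {i \<in> I. h i = j})" using assms(3) by auto
  then have "finprod G f I = finprod G f (\<Union>j\<in>J. {i \<in> I. h i = j})" by simp
  also have "\<dots> = finprod G (\<lambda>j. finprod G f {i \<in> I. h i = j}) J"
    using assms by (intro finprod_UN_disjoint) (auto simp: pairwise_def disjnt_def)
  finally show ?thesis .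
qed

lemma finprod_foldr:
  "(\<And>x. x \<in> set l \<Longrightarrow> f x \<in> carrier G) \<Longrightarrow>
    foldr (\<lambda>x u. f x \<otimes> u) l \<one> = finprod G (\<lambda>i. f (l ! i)) {..<length l}"
proof (induction l)
  case (Cons x l)
  have "{..<length (x # l)} = insert 0 (Suc ` {..<length l})"
    by (simp add: lessThan_Suc_eq_insert_0)
  then have "finprod G (\<lambda>i. f ((x # l) ! i)) {..<length (x # l)}
      = f x \<otimes> finprod G (\<lambda>i. f ((x # l) ! i)) (Suc ` {..<length l})"
    using Cons.prems by (simp, subst finprod_insert) (auto simp: Pi_def)
  also have "finprod G (\<lambda>i. f ((x # l) ! i)) (Suc ` {..<length l}) = finprod G (\<lambda>i. f (l ! i)) {..<length l}"
    using Cons.prems by (subst finprod_reindex) auto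
  finally show ?case using Cons by simp
qed simp

end

text \<open>Functions in \<open>PiE\<close> are undefined off their index set, so the value at
  \<open>i\<close> and the part on \<open>I\<close> determine everything.\<close>

lemma PiE_insert_bij:
  assumes "i \<notin> I"
  shows "bij_betw (\<lambda>(y, g). g(i := y)) (C i \<times> PiE I C) (PiE (insert i I) C)"
  unfolding bij_betw_def
proof
  show "inj_on (\<lambda>(y, g). g(i := y)) (C i \<times> PiE I C)"
  proof (rule inj_onI, clarsimp)
    fix y g z h
    assume gh: "g \<in> PiE I C" "h \<in> PiE I C" and e: "g(i := y) = h(i := z)"
    have "g j = h j" for j
      using fun_cong[OF e, of j] gh assms PiE_arb[OF gh(1), of i] PiE_arb[OF gh(2), of i]
      by (cases "j = i") auto
    then show "y = z \<and> g = h" using fun_cong[OF e, of i] by auto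
  qed
qed (simp add: PiE_insert_eq)

lemma (in cring) finsum_ideal:
  assumes "ideal I R" "finite J" "\<And>i. i \<in> J \<Longrightarrow> f i \<in> I"
  shows "finsum R f J \<in> I"
proof -
  interpret I: ideal I R by fact
  show ?thesis using assms(2,3)
  proof (induction J rule: finite_induct)
    case (insert i J)
    then have "finsum R f (insert i J) = f i \<oplus> finsum R f J"
      using I.Icarr by (intro finsum_insert) simp_all
    then show ?case using insert by (simp add: I.a_closed)
  qed (simp add: I.zero_closed)
qed

text \<open>Distributivity: expanding the product picks one summand from each factor, and such a
  choice is a function in \<open>PiE I C\<close>.\<close>

lemma (in cring) finprod_finsum:
  assumes "finite I" "\<And>i. i \<in> I \<Longrightarrow> finite (C i)"
    "\<And>i c. i \<in> I \<Longrightarrow> c \<in> C i \<Longrightarrow> f i c \<in> carrier R"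
  shows "finprod R (\<lambda>i. finsum R (f i) (C i)) I
    = finsum R (\<lambda>d. finprod R (\<lambda>i. f i (d i)) I) (PiE I C)"
  using assms
proof (induction I rule: finite_induct)
  case empty
  then show ?case by simp
next
  case (insert i I)
  have fin: "finite (PiE I C)" using insert by (intro finite_PiE) auto
  have cl: "finprod R (\<lambda>j. f j (d j)) I \<in> carrier R" if "d \<in> PiE I C" for d
    using insert.prems(2) that by (intro finprod_in) auto
  have "finprod R (\<lambda>i. finsum R (f i) (C i)) (insert i I)
      = finsum R (f i) (C i) \<otimes> finprod R (\<lambda>i. finsum R (f i) (C i)) I"
    using insert by (intro finprod_insert) (auto intro!: add.finprod_in)
  also have "\<dots> = finsum R (f i) (C i) \<otimes> finsum R (\<lambda>d. finprod R (\<lambda>i. f i (d i)) I) (PiE I C)"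
    using insert by simp
  also have "\<dots> = finsum R (\<lambda>c. f i c \<otimes> finsum R (\<lambda>d. finprod R (\<lambda>i. f i (d i)) I) (PiE I C)) (C i)"
    using insert.prems cl by (intro finsum_ldistr) (auto intro!: add.finprod_in)
  also have "\<dots> = finsum R (\<lambda>c. finsum R (\<lambda>d. f i c \<otimes> finprod R (\<lambda>i. f i (d i)) I) (PiE I C)) (C i)"
    using insert.prems cl fin by (intro add.finprod_cong2 finsum_rdistr) (auto intro!: add.finprod_in)
  also have "\<dots> = finsum R (\<lambda>(c, d). f i c \<otimes> finprod R (\<lambda>i. f i (d i)) I) (C i \<times> PiE I C)"
    using insert.prems cl fin by (subst add.finprod_Sigma) auto
  also have "\<dots> = finsum R (\<lambda>p. finprod R (\<lambda>j. f j ((case p of (c, d) \<Rightarrow> d(i := c)) j)) (insert i I)) (C i \<times> PiE I C)"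
  proof (rule add.finprod_cong2; clarify)
    fix c d assume cd: "c \<in> C i" "d \<in> PiE I C"
    have "finprod R (\<lambda>j. f j ((d(i := c)) j)) (insert i I)
        = f i c \<otimes> finprod R (\<lambda>j. f j ((d(i := c)) j)) I"
      using insert cd by (subst finprod_insert) (auto simp: PiE_iff)
    also have "finprod R (\<lambda>j. f j ((d(i := c)) j)) I = finprod R (\<lambda>j. f j (d j)) I"
      using insert cd by (intro finprod_cong2) auto
    finally show "f i c \<otimes> finprod R (\<lambda>i. f i (d i)) I
        = finprod R (\<lambda>j. f j ((d(i := c)) j)) (insert i I)" by simp
    show "finprod R (\<lambda>j. f j ((d(i := c)) j)) (insert i I) \<in> carrier R"
      using insert.prems(2) cd by (intro finprod_in) (auto simp: PiE_iff)
  qed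
  also have "\<dots> = finsum R (\<lambda>d. finprod R (\<lambda>j. f j (d j)) (insert i I)) (PiE (insert i I) C)"
    using insert PiE_insert_bij[of i I C]
    by (subst add.finprod_bij[of "\<lambda>(y, g). g(i := y)" "C i \<times> PiE I C"]) (auto intro!: finprod_in)
  finally show ?case .
qed

section \<open>Sequences under convolution\<close>

text \<open>Formal power series in one variable under multiplication, stored as coefficient
  sequences. The addition rule for divided powers says that x maps to the series with coefficients
  gamma^m(x) in a way that turns sums into products.\<close>

definition seqs :: "('w, 'm) ring_scheme \<Rightarrow> (nat \<Rightarrow> 'w) monoid" where
  "seqs W = \<lparr>carrier = UNIV \<rightarrow> carrier W,
     monoid.mult = (\<lambda>f g m. finsum W (\<lambda>j. f j \<otimes>\<^bsub>W\<^esub> g (m - j)) {..m}),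
     one = (\<lambda>m. if m = 0 then \<one>\<^bsub>W\<^esub> else \<zero>\<^bsub>W\<^esub>)\<rparr>"

text \<open>The series that behave like exp(xT): constant term 1 and the binomial rule for products
  of coefficients. These are the possible images of all divided powers of one element.\<close>

definition dp_seqs where
  "dp_seqs W = {e \<in> carrier (seqs W). e 0 = \<one>\<^bsub>W\<^esub> \<and>
     (\<forall>m l. e m \<otimes>\<^bsub>W\<^esub> e l = add_pow W ((m + l) choose m) (e (m + l)))}"

context cring
begin

lemma seqs_carrier: "carrier (seqs R) = UNIV \<rightarrow> carrier R"
  and seqs_mult: "f \<otimes>\<^bsub>seqs R\<^esub> g = (\<lambda>m. \<Oplus>j\<in>{..m}. f j \<otimes> g (m - j))"
  and seqs_one: "\<one>\<^bsub>seqs R\<^esub> = (\<lambda>m. if m = 0 then \<one> else \<zero>)"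
  unfolding seqs_def by simp_all

lemma seqs_closed: "f \<in> carrier (seqs R) \<Longrightarrow> f m \<in> carrier R"
  by (auto simp: seqs_carrier)

lemma seqs_mult_closed:
  "\<lbrakk> f \<in> carrier (seqs R); g \<in> carrier (seqs R) \<rbrakk> \<Longrightarrow> f \<otimes>\<^bsub>seqs R\<^esub> g \<in> carrier (seqs R)"
  using seqs_closed by (auto simp: seqs_carrier seqs_mult intro!: add.finprod_in)

lemma seqs_comm_monoid: "comm_monoid (seqs R)"
proof -
  show ?thesis
  proof (rule comm_monoidI[OF seqs_mult_closed])
    fix f g h assume "f \<in> carrier (seqs R)" "g \<in> carrier (seqs R)" "h \<in> carrier (seqs R)"
    then have cl [simp]: "f j \<in> carrier R" "g j \<in> carrier R" "h j \<in> carrier R" for j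
      using seqs_closed by auto
    show "f \<otimes>\<^bsub>seqs R\<^esub> g = g \<otimes>\<^bsub>seqs R\<^esub> f"
    proof
      fix m :: nat
      have "bij_betw (\<lambda>j. m - j) {..m} {..m}" by (rule bij_betw_byWitness[of _ "\<lambda>j. m - j"]) auto
      from add.finprod_bij[OF this, of "\<lambda>j. f j \<otimes> g (m - j)"]
      have "(\<Oplus>j\<in>{..m}. f j \<otimes> g (m - j)) = (\<Oplus>j\<in>{..m}. f (m - j) \<otimes> g (m - (m - j)))" by simp
      also have "\<dots> = (\<Oplus>j\<in>{..m}. g j \<otimes> f (m - j))"
        by (intro add.finprod_cong2) (auto simp: m_comm)
      finally show "(f \<otimes>\<^bsub>seqs R\<^esub> g) m = (g \<otimes>\<^bsub>seqs R\<^esub> f) m" by (simp add: seqs_mult)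
    qed
    show "f \<otimes>\<^bsub>seqs R\<^esub> g \<otimes>\<^bsub>seqs R\<^esub> h = f \<otimes>\<^bsub>seqs R\<^esub> (g \<otimes>\<^bsub>seqs R\<^esub> h)"
    proof
      fix m :: nat
      \<comment> \<open>Both triple sums run over the ways to write m as a sum of three.
        \<open>?L\<close> records the first two parts together and then the first; \<open>?M\<close>
        records the first and the second.\<close>
      let ?L = "SIGMA j:{..m}. {..j}" and ?M = "SIGMA k:{..m}. {..m - k}"
      have "(f \<otimes>\<^bsub>seqs R\<^esub> g \<otimes>\<^bsub>seqs R\<^esub> h) m = (\<Oplus>j\<in>{..m}. \<Oplus>k\<in>{..j}. f k \<otimes> g (j - k) \<otimes> h (m - j))"
        unfolding seqs_mult by (intro add.finprod_cong2 finsum_ldistr) (auto intro!: add.finprod_in)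
      also have "\<dots> = (\<Oplus>p\<in>?L. f (snd p) \<otimes> g (fst p - snd p) \<otimes> h (m - fst p))"
        by (subst add.finprod_Sigma) auto
      also have "\<dots> = (\<Oplus>p\<in>?M. f (fst p) \<otimes> g (snd p) \<otimes> h (m - (fst p + snd p)))"
      proof -
        have b: "bij_betw (\<lambda>(k, i). (k + i, k)) ?M ?L"
          by (rule bij_betw_byWitness[of _ "\<lambda>(j, k). (k, j - k)"]) auto
        show ?thesis
          by (subst add.finprod_bij[OF b]) (auto intro!: add.finprod_cong2 simp: case_prod_beta)
      qed
      also have "\<dots> = (\<Oplus>k\<in>{..m}. \<Oplus>i\<in>{..m - k}. f k \<otimes> g i \<otimes> h (m - (k + i)))"
        by (subst add.finprod_Sigma) auto
      also have "\<dots> = (\<Oplus>k\<in>{..m}. f k \<otimes> (\<Oplus>i\<in>{..m - k}. g i \<otimes> h (m - k - i)))"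
      proof (intro add.finprod_cong2)
        fix k assume "k \<in> {..m}"
        have "f k \<otimes> (\<Oplus>i\<in>{..m - k}. g i \<otimes> h (m - k - i))
            = (\<Oplus>i\<in>{..m - k}. f k \<otimes> (g i \<otimes> h (m - k - i)))"
          by (intro finsum_rdistr) auto
        also have "\<dots> = (\<Oplus>i\<in>{..m - k}. f k \<otimes> g i \<otimes> h (m - (k + i)))"
          by (intro add.finprod_cong2) (auto simp: m_assoc)
        finally show "(\<Oplus>i\<in>{..m - k}. f k \<otimes> g i \<otimes> h (m - (k + i)))
            = f k \<otimes> (\<Oplus>i\<in>{..m - k}. g i \<otimes> h (m - k - i))" by simp
      qed (auto intro!: add.finprod_in)
      finally show "(f \<otimes>\<^bsub>seqs R\<^esub> g \<otimes>\<^bsub>seqs R\<^esub> h) m = (f \<otimes>\<^bsub>seqs R\<^esub> (g \<otimes>\<^bsub>seqs R\<^esub> h)) m"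
        by (simp add: seqs_mult)
    qed
  next
    show o: "\<one>\<^bsub>seqs R\<^esub> \<in> carrier (seqs R)" by (auto simp: seqs_one seqs_carrier)
    fix f assume f: "f \<in> carrier (seqs R)"
    show "\<one>\<^bsub>seqs R\<^esub> \<otimes>\<^bsub>seqs R\<^esub> f = f"
    proof
      fix m :: nat
      have "(\<one>\<^bsub>seqs R\<^esub> \<otimes>\<^bsub>seqs R\<^esub> f) m = (\<Oplus>j\<in>{..m}. if 0 = j then f (m - j) else \<zero>)"
        unfolding seqs_mult seqs_one using seqs_closed[OF f] by (intro add.finprod_cong2) auto
      also have "\<dots> = f m" using seqs_closed[OF f] by (subst finsum_singleton) auto
      finally show "(\<one>\<^bsub>seqs R\<^esub> \<otimes>\<^bsub>seqs R\<^esub> f) m = f m" .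
    qed
  qed
qed

end

text \<open>Weak compositions of m with parts indexed by \<open>I\<close>, taken extensional so that
  a finite index set yields a finite set.\<close>

definition comps :: "'i set \<Rightarrow> nat \<Rightarrow> ('i \<Rightarrow> nat) set" where
  "comps I m = {c \<in> I \<rightarrow>\<^sub>E UNIV. sum c I = m}"

lemma comps_subset: "finite I \<Longrightarrow> comps I m \<subseteq> I \<rightarrow>\<^sub>E {..m}"
  unfolding comps_def by (auto simp: PiE_iff extensional_def intro: member_le_sum)

lemma finite_comps [simp]: "finite I \<Longrightarrow> finite (comps I m)"
  using comps_subset finite_PiE finite_subset by (metis finite_atMost)

lemma comps_empty: "comps {} m = (if m = 0 then {\<lambda>_. undefined} else {})"
  by (auto simp: comps_def)

lemma comps_insert_bij:
  assumes "finite I" "i \<notin> I"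
  shows "bij_betw (\<lambda>(j, c). c(i := j)) (SIGMA j:{..m}. comps I (m - j)) (comps (insert i I) m)"
proof -
  have s: "sum (c(i := j)) I = sum c I" for c :: "_ \<Rightarrow> nat" and j
    using assms by (intro sum.cong) auto
  have "(\<lambda>(j, c). c(i := j)) ` (SIGMA j:{..m}. comps I (m - j)) = comps (insert i I) m"
  proof (intro equalityI subsetI)
    fix c assume "c \<in> comps (insert i I) m"
    then have c: "c \<in> insert i I \<rightarrow>\<^sub>E UNIV" "c i + sum c I = m"
      using assms by (auto simp: comps_def)
    have "c = (restrict c I)(i := c i)" using c(1) by (auto simp: fun_eq_iff PiE_iff extensional_def)
    moreover have "(c i, restrict c I) \<in> (SIGMA j:{..m}. comps I (m - j))"
      using c by (auto simp: comps_def)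
    ultimately show "c \<in> (\<lambda>(j, c). c(i := j)) ` (SIGMA j:{..m}. comps I (m - j))"
      by (auto intro!: image_eqI[of _ _ "(c i, restrict c I)"])
  qed (use assms s in \<open>auto simp: comps_def PiE_iff extensional_def\<close>)
  moreover have "inj_on (\<lambda>(j, c). c(i := j)) (SIGMA j:{..m}. comps I (m - j))"
    by (rule inj_on_subset[OF bij_betw_imp_inj_on[OF PiE_insert_bij[OF assms(2), of "\<lambda>_. UNIV"]]])
      (auto simp: comps_def)
  ultimately show ?thesis by (simp add: bij_betw_def)
qed

context cring
begin

lemma finprod_seqs:
  assumes "finite I" "\<And>i. i \<in> I \<Longrightarrow> e i \<in> carrier (seqs R)"
  shows "finprod (seqs R) e I m = (\<Oplus>c\<in>comps I m. \<Otimes>i\<in>I. e i (c i))"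
  using assms
proof (induction I arbitrary: m rule: finite_induct)
  case empty
  show ?case
    by (simp add: comps_empty comm_monoid.finprod_empty[OF seqs_comm_monoid] seqs_one)
next
  case (insert i I)
  interpret S: comm_monoid "seqs R" by (rule seqs_comm_monoid)
  have cl: "e k j \<in> carrier R" if "k \<in> insert i I" for k j using insert.prems that seqs_closed by blast
  have cl': "(\<Otimes>k\<in>I. e k (c k)) \<in> carrier R" for c using cl by (intro finprod_in) auto
  have "finprod (seqs R) e (insert i I) m = (e i \<otimes>\<^bsub>seqs R\<^esub> finprod (seqs R) e I) m"
    using insert by (subst S.finprod_insert) auto
  also have "\<dots> = (\<Oplus>j\<in>{..m}. e i j \<otimes> (\<Oplus>c\<in>comps I (m - j). \<Otimes>k\<in>I. e k (c k)))"
    using insert by (simp add: seqs_mult)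
  also have "\<dots> = (\<Oplus>j\<in>{..m}. \<Oplus>c\<in>comps I (m - j). e i j \<otimes> (\<Otimes>k\<in>I. e k (c k)))"
    using insert cl cl' by (intro add.finprod_cong2 finsum_rdistr) (auto intro!: add.finprod_in)
  also have "\<dots> = (\<Oplus>p\<in>(SIGMA j:{..m}. comps I (m - j)). e i (fst p) \<otimes> (\<Otimes>k\<in>I. e k (snd p k)))"
    using insert cl cl' by (subst add.finprod_Sigma) auto
  also have "\<dots> = (\<Oplus>p\<in>(SIGMA j:{..m}. comps I (m - j)). \<Otimes>k\<in>insert i I. e k ((case p of (j, c) \<Rightarrow> c(i := j)) k))"
  proof (rule add.finprod_cong2; clarify)
    fix j c
    have "(\<Otimes>k\<in>insert i I. e k ((c(i := j)) k)) = e i j \<otimes> (\<Otimes>k\<in>I. e k ((c(i := j)) k))"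
      using insert cl by (subst finprod_insert) auto
    also have "(\<Otimes>k\<in>I. e k ((c(i := j)) k)) = (\<Otimes>k\<in>I. e k (c k))"
      using insert cl by (intro finprod_cong2) auto
    finally show "e i (fst (j, c)) \<otimes> (\<Otimes>k\<in>I. e k (snd (j, c) k)) = (\<Otimes>k\<in>insert i I. e k ((c(i := j)) k))" by simp
    show "(\<Otimes>k\<in>insert i I. e k ((c(i := j)) k)) \<in> carrier R"
      using cl by (intro finprod_in) blast
  qed
  also have "\<dots> = (\<Oplus>c\<in>comps (insert i I) m. \<Otimes>k\<in>insert i I. e k (c k))"
    using cl by (subst add.finprod_bij[OF comps_insert_bij[OF insert(1,2)]]) (auto intro!: finprod_in)
  finally show ?case .
qed

lemma finsum_add_pow:
  assumes "finite I" "x \<in> carrier R"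
  shows "(\<Oplus>i\<in>I. add_pow R (c i) x) = add_pow R (sum c I :: nat) x"
  using assms(1) by (induction I rule: finite_induct) (use assms(2) in \<open>auto simp: add.nat_pow_mult\<close>)

lemma add_pow_finsum:
  assumes "\<And>i. i \<in> I \<Longrightarrow> f i \<in> carrier R"
  shows "add_pow R (k :: nat) (\<Oplus>i\<in>I. f i) = (\<Oplus>i\<in>I. add_pow R k (f i))"
  using assms
  by (induction I rule: infinite_finite_induct)
    (auto simp: add.nat_pow_distrib Pi_def intro!: add.finprod_in)

lemma dp_seqsD:
  assumes "e \<in> dp_seqs R"
  shows "e \<in> carrier (seqs R)" "e m \<in> carrier R" "e 0 = \<one>"
    "e m \<otimes> e l = add_pow R ((m + l) choose m) (e (m + l))"
  using assms seqs_closed unfolding dp_seqs_def by auto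

lemma dp_seqs_one: "\<one>\<^bsub>seqs R\<^esub> \<in> dp_seqs R"
  unfolding dp_seqs_def seqs_one by (auto simp: seqs_carrier)

text \<open>Vandermonde's identity; the conditions \<open>j \<le> s\<close> and
  \<open>s - j \<le> l\<close> only omit terms in which a binomial coefficient vanishes.\<close>

lemma sum_choose_antidiagonal:
  assumes "s \<le> m + l"
  shows "(\<Sum>p\<in>{p \<in> {..m} \<times> {..l}. fst p + snd p = s}.
    (s choose fst p) * ((m + l - s) choose (m - fst p))) = (m + l) choose m"
proof -
  have "(\<Sum>p\<in>{p \<in> {..m} \<times> {..l}. fst p + snd p = s}. (s choose fst p) * ((m + l - s) choose (m - fst p)))
    = (\<Sum>j\<in>{j. j \<le> m \<and> j \<le> s \<and> s - j \<le> l}. (s choose j) * ((m + l - s) choose (m - j)))"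
    by (rule sum.reindex_bij_witness[of _ "\<lambda>j. (j, s - j)" fst]) auto
  also have "\<dots> = (\<Sum>j\<le>m. (s choose j) * ((m + l - s) choose (m - j)))"
    using assms by (intro sum.mono_neutral_left) (auto simp: not_le)
  also have "\<dots> = (s + (m + l - s)) choose m" by (rule vandermonde)
  finally show ?thesis using assms by simp
qed

text \<open>The model is exp(xT) exp(yT) = exp((x + y)T). In the product of the coefficients m and
  l, all terms with the same s = j + k are multiples of one element \<open>x s\<close>, and their
  multiplicities add up to the right binomial coefficient by
  \<open>sum_choose_antidiagonal\<close>.\<close>

lemma dp_seqs_mult:
  assumes e: "e \<in> dp_seqs R" and f: "f \<in> dp_seqs R"
  shows "e \<otimes>\<^bsub>seqs R\<^esub> f \<in> dp_seqs R"
proof -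
  note cl [simp] = dp_seqsD(2)[OF e] dp_seqsD(2)[OF f]
  let ?g = "e \<otimes>\<^bsub>seqs R\<^esub> f"
  have g: "?g m = (\<Oplus>j\<in>{..m}. e j \<otimes> f (m - j))" for m by (simp add: seqs_mult)
  have "?g m \<otimes> ?g l = add_pow R ((m + l) choose m) (?g (m + l))" for m l
  proof -
    define x where "x s = e s \<otimes> f (m + l - s)" for s
    have [simp]: "x s \<in> carrier R" for s by (simp add: x_def)
    define c where "c p = (fst p + snd p choose fst p) * ((m + l - (fst p + snd p)) choose (m - fst p))"
      for p :: "nat \<times> nat"
    have step: "(e j \<otimes> f (m - j)) \<otimes> (e k \<otimes> f (l - k)) = add_pow R (c (j, k)) (x (j + k))"
      if "j \<le> m" "k \<le> l" for j k
    proof -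
      have "(e j \<otimes> f (m - j)) \<otimes> (e k \<otimes> f (l - k)) = (e j \<otimes> e k) \<otimes> (f (m - j) \<otimes> f (l - k))"
        by (simp add: m_ac)
      also have "\<dots> = add_pow R (j + k choose j) (e (j + k))
          \<otimes> add_pow R ((m - j + (l - k)) choose (m - j)) (f (m - j + (l - k)))"
        using dp_seqsD(4)[OF e] dp_seqsD(4)[OF f] by simp
      also have "m - j + (l - k) = m + l - (j + k)" using that by simp
      finally show ?thesis
        by (simp add: c_def x_def add_pow_ldistr add_pow_rdistr add.nat_pow_pow mult.commute)
    qed
    have "?g m \<otimes> ?g l = (\<Oplus>j\<in>{..m}. (e j \<otimes> f (m - j)) \<otimes> (\<Oplus>k\<in>{..l}. e k \<otimes> f (l - k)))"
      unfolding g by (intro finsum_ldistr) (auto intro!: add.finprod_in)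
    also have "\<dots> = (\<Oplus>j\<in>{..m}. \<Oplus>k\<in>{..l}. (e j \<otimes> f (m - j)) \<otimes> (e k \<otimes> f (l - k)))"
      by (intro add.finprod_cong2 finsum_rdistr) (auto intro!: add.finprod_in)
    also have "\<dots> = (\<Oplus>p\<in>{..m} \<times> {..l}. (e (fst p) \<otimes> f (m - fst p)) \<otimes> (e (snd p) \<otimes> f (l - snd p)))"
      by (subst add.finprod_Sigma) auto
    also have "\<dots> = (\<Oplus>p\<in>{..m} \<times> {..l}. add_pow R (c p) (x (fst p + snd p)))"
      by (intro add.finprod_cong2) (auto simp: step)
    also have "\<dots> = (\<Oplus>s\<in>{..m + l}. \<Oplus>p\<in>{p \<in> {..m} \<times> {..l}. fst p + snd p = s}. add_pow R (c p) (x (fst p + snd p)))"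
      by (rule add.finprod_fibres) auto
    also have "\<dots> = (\<Oplus>s\<in>{..m + l}. add_pow R ((m + l) choose m) (x s))"
    proof (intro add.finprod_cong2)
      fix s assume s: "s \<in> {..m + l}"
      let ?P = "{p \<in> {..m} \<times> {..l}. fst p + snd p = s}"
      have "(\<Oplus>p\<in>?P. add_pow R (c p) (x (fst p + snd p))) = (\<Oplus>p\<in>?P. add_pow R (c p) (x s))"
        by (intro add.finprod_cong2) auto
      also have "\<dots> = add_pow R (sum c ?P) (x s)" by (rule finsum_add_pow) auto
      also have "sum c ?P = (m + l) choose m"
        using sum_choose_antidiagonal[of s m l] s by (auto simp: c_def intro: sum.cong trans)
      finally show "(\<Oplus>p\<in>?P. add_pow R (c p) (x (fst p + snd p))) = add_pow R ((m + l) choose m) (x s)" .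
    qed simp
    also have "\<dots> = add_pow R ((m + l) choose m) (\<Oplus>s\<in>{..m + l}. x s)"
      by (simp add: add_pow_finsum)
    finally show ?thesis by (simp add: g x_def)
  qed
  moreover have "?g 0 = \<one>" using dp_seqsD(3)[OF e] dp_seqsD(3)[OF f] by (simp add: g)
  moreover have "?g \<in> carrier (seqs R)" using seqs_mult_closed dp_seqsD(1) e f by blast
  ultimately show ?thesis unfolding dp_seqs_def by blast
qed

lemma dp_seqs_finprod:
  assumes "finite I" "\<And>i. i \<in> I \<Longrightarrow> e i \<in> dp_seqs R"
  shows "finprod (seqs R) e I \<in> dp_seqs R"
proof -
  interpret S: comm_monoid "seqs R" by (rule seqs_comm_monoid)
  show ?thesis using assms
    by (induction I rule: finite_induct)
      (auto simp: dp_seqs_one dp_seqs_mult dp_seqsD(1) Pi_def)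
qed

text \<open>In terms of power series the map substitutes uT for T, which respects products.\<close>

lemma seqs_scale_mult:
  assumes "e \<in> carrier (seqs R)" "f \<in> carrier (seqs R)" and u: "u \<in> carrier R"
  shows "(\<lambda>m. u [^] m \<otimes> (e \<otimes>\<^bsub>seqs R\<^esub> f) m)
    = (\<lambda>m. u [^] m \<otimes> e m) \<otimes>\<^bsub>seqs R\<^esub> (\<lambda>m. u [^] m \<otimes> f m)"
proof
  fix m
  have [simp]: "e j \<in> carrier R" "f j \<in> carrier R" for j using assms seqs_closed by auto
  have "u [^] m \<otimes> (\<Oplus>j\<in>{..m}. e j \<otimes> f (m - j)) = (\<Oplus>j\<in>{..m}. u [^] m \<otimes> (e j \<otimes> f (m - j)))"
    using u by (intro finsum_rdistr) auto
  also have "\<dots> = (\<Oplus>j\<in>{..m}. (u [^] j \<otimes> e j) \<otimes> (u [^] (m - j) \<otimes> f (m - j)))"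
  proof (intro add.finprod_cong2)
    fix j assume "j \<in> {..m}"
    then have "u [^] m = u [^] j \<otimes> u [^] (m - j)" using u by (simp add: nat_pow_mult)
    then show "u [^] m \<otimes> (e j \<otimes> f (m - j)) = (u [^] j \<otimes> e j) \<otimes> (u [^] (m - j) \<otimes> f (m - j))"
      using u by (simp add: m_ac)
  qed (use u in auto)
  finally show "u [^] m \<otimes> (e \<otimes>\<^bsub>seqs R\<^esub> f) m
    = ((\<lambda>m. u [^] m \<otimes> e m) \<otimes>\<^bsub>seqs R\<^esub> (\<lambda>m. u [^] m \<otimes> f m)) m"
    by (simp add: seqs_mult)
qed

text \<open>The model is exp((u + v)x) = exp(ux) exp(vx): the coefficients of the binomial theorem
  are absorbed by the product rule of a divided power sequence.\<close>

lemma dp_seqs_binomial: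
  assumes e: "e \<in> dp_seqs R" and u: "u \<in> carrier R" and v: "v \<in> carrier R"
  shows "(\<lambda>m. (u \<oplus> v) [^] m \<otimes> e m)
    = (\<lambda>m. u [^] m \<otimes> e m) \<otimes>\<^bsub>seqs R\<^esub> (\<lambda>m. v [^] m \<otimes> e m)"
proof
  fix m
  note [simp] = dp_seqsD(2)[OF e] u v
  have "(u \<oplus> v) [^] m = (\<Oplus>j\<in>{..m}. add_pow R (m choose j) (u [^] j \<otimes> v [^] (m - j)))" for m
  proof -
    let ?b = "\<lambda>m j. add_pow R (m choose j) (u [^] j \<otimes> v [^] (m - j))"
    show ?thesis
    proof (induction m)
      case (Suc m)
      have "(u \<oplus> v) [^] Suc m = (\<Oplus>j\<in>{..m}. ?b m j) \<otimes> u \<oplus> (\<Oplus>j\<in>{..m}. ?b m j) \<otimes> v"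
        by (simp add: Suc.IH[symmetric] r_distr)
      also have "(\<Oplus>j\<in>{..m}. ?b m j) \<otimes> u = (\<Oplus>j\<in>{..m}. add_pow R (m choose j) (u [^] Suc j \<otimes> v [^] (m - j)))"
        by (subst finsum_ldistr) (auto intro!: add.finprod_cong2 simp: add_pow_ldistr m_ac add_pow_rdistr)
      also have "(\<Oplus>j\<in>{..m}. ?b m j) \<otimes> v = (\<Oplus>j\<in>{..m}. add_pow R (m choose j) (u [^] j \<otimes> v [^] (Suc m - j)))"
        by (subst finsum_ldistr) (auto intro!: add.finprod_cong2 simp: add_pow_ldistr m_ac add_pow_rdistr Suc_diff_le)
      also have "\<dots> = (\<Oplus>j\<in>{..Suc m}. add_pow R (m choose j) (u [^] j \<otimes> v [^] (Suc m - j)))"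
        by (subst finsum_Suc) (auto simp: binomial_eq_0)
      also have "\<dots> = (\<Oplus>j\<in>{..m}. add_pow R (m choose Suc j) (u [^] Suc j \<otimes> v [^] (m - j))) \<oplus> v [^] Suc m"
        by (subst finsum_Suc2) (auto simp del: nat_pow_Suc)
      finally have "(u \<oplus> v) [^] Suc m
          = (\<Oplus>j\<in>{..m}. add_pow R (m choose j) (u [^] Suc j \<otimes> v [^] (m - j)))
          \<oplus> ((\<Oplus>j\<in>{..m}. add_pow R (m choose Suc j) (u [^] Suc j \<otimes> v [^] (m - j))) \<oplus> v [^] Suc m)" .
      also have "\<dots> = (\<Oplus>j\<in>{..m}. add_pow R (Suc m choose Suc j) (u [^] Suc j \<otimes> v [^] (m - j))) \<oplus> v [^] Suc m"
        by (subst a_assoc[symmetric])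
          (auto simp del: nat_pow_Suc simp flip: finsum_addf simp add: add.nat_pow_mult)
      also have "\<dots> = (\<Oplus>j\<in>{..Suc m}. ?b (Suc m) j)"
        by (subst finsum_Suc2) (auto simp del: nat_pow_Suc)
      finally show ?case .
    qed simp
  qed
  then have "(u \<oplus> v) [^] m \<otimes> e m = (\<Oplus>j\<in>{..m}. add_pow R (m choose j) (u [^] j \<otimes> v [^] (m - j)) \<otimes> e m)"
    by (simp only:) (intro finsum_ldistr, auto)
  also have "\<dots> = (\<Oplus>j\<in>{..m}. (u [^] j \<otimes> e j) \<otimes> (v [^] (m - j) \<otimes> e (m - j)))"
  proof (intro add.finprod_cong2)
    fix j assume j: "j \<in> {..m}"
    have "(u [^] j \<otimes> e j) \<otimes> (v [^] (m - j) \<otimes> e (m - j)) = (u [^] j \<otimes> v [^] (m - j)) \<otimes> (e j \<otimes> e (m - j))"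
      by (simp add: m_ac)
    then show "add_pow R (m choose j) (u [^] j \<otimes> v [^] (m - j)) \<otimes> e m
        = (u [^] j \<otimes> e j) \<otimes> (v [^] (m - j) \<otimes> e (m - j))"
      using j by (simp add: dp_seqsD(4)[OF e] add_pow_ldistr add_pow_rdistr)
  qed auto
  finally show "(u \<oplus> v) [^] m \<otimes> e m
    = ((\<lambda>m. u [^] m \<otimes> e m) \<otimes>\<^bsub>seqs R\<^esub> (\<lambda>m. v [^] m \<otimes> e m)) m"
    by (simp add: seqs_mult)
qed

end

section \<open>The divided power algebra\<close>

lemma (in module) lin_span_submodule:
  assumes "T \<subseteq> carrier M"
  shows "submodule (lin_span R M T) R M"
proof (rule submoduleI)
  show "lin_span R M T \<subseteq> carrier M"
    unfolding lin_span_def using carrier_is_submodule assms by blast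
  show "\<zero>\<^bsub>M\<^esub> \<in> lin_span R M T"
    unfolding lin_span_def using submodule.axioms(1) subgroup.one_closed by fastforce
next
  fix a b assume ab: "a \<in> lin_span R M T" "b \<in> lin_span R M T"
  show "\<ominus>\<^bsub>M\<^esub> a \<in> lin_span R M T" "a \<oplus>\<^bsub>M\<^esub> b \<in> lin_span R M T"
    using ab submoduleE(3,5) unfolding lin_span_def by blast+
next
  fix a x assume "a \<in> carrier R" "x \<in> lin_span R M T"
  then show "a \<odot>\<^bsub>M\<^esub> x \<in> lin_span R M T"
    using submoduleE(4) unfolding lin_span_def by blast
qed

lemma lin_span_superset: "T \<subseteq> lin_span A M T"
  unfolding lin_span_def by blast

lemma lin_span_minimal: "\<lbrakk> submodule H A M; T \<subseteq> H \<rbrakk> \<Longrightarrow> lin_span A M T \<subseteq> H"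
  unfolding lin_span_def by blast

locale dp_algebra = AC: cring A + FC: cring F + alg: algebra A F
  for A :: "('a, 'm) ring_scheme" and F :: "('a, 'f, 'k) module_scheme"
begin

abbreviation "\<Gamma> \<equiv> Gamma A F"
abbreviation "\<gamma> \<equiv> dpow A F"

sublocale pres: presentation A "UNIV \<times> carrier F" "Gamma_rels A F"
  by (simp add: presentation.intro AC.is_cring)

lemma Gamma_eq: "\<Gamma> = pres.PA"
  by (simp add: Gamma_def)

lemma Gamma_algebra: "algebra A \<Gamma>"
  using pres.PA_algebra by (simp add: Gamma_eq)

lemma Gamma_cring: "cring \<Gamma>" by (rule algebra.M_cring[OF Gamma_algebra])

sublocale GC: cring \<Gamma> by (rule Gamma_cring)
sublocale G: algebra A \<Gamma> by (rule Gamma_algebra)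

lemma dpow_eq: "\<gamma> m x = pres.gen (m, x)"
  by (simp add: dpow_def)

lemma dpow_closed [simp]: "x \<in> carrier F \<Longrightarrow> \<gamma> m x \<in> carrier \<Gamma>"
  unfolding dpow_eq Gamma_eq by (rule pres.gen_closed) simp

lemma con_eq: "a \<in> carrier A \<Longrightarrow> pres.con a = a \<odot>\<^bsub>\<Gamma>\<^esub> \<one>\<^bsub>\<Gamma>\<^esub>"
  using pres.smult_con[of a "\<one>\<^bsub>\<Gamma>\<^esub>"] pres.con_closed GC.one_closed by (simp flip: Gamma_eq)

lemma smult_eq: "\<lbrakk> a \<in> carrier A; u \<in> carrier \<Gamma> \<rbrakk> \<Longrightarrow> a \<odot>\<^bsub>\<Gamma>\<^esub> u = pres.con a \<otimes>\<^bsub>\<Gamma>\<^esub> u"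
  using pres.smult_con by (simp add: Gamma_eq)

lemma dpow_zero_deg: "x \<in> carrier F \<Longrightarrow> \<gamma> 0 x = \<one>\<^bsub>\<Gamma>\<^esub>"
  unfolding dpow_eq Gamma_eq pres.PA_one
  by (intro pres.rel_eq Gamma_rels.intros) (auto intro: aterms.intros)

lemma dpow_smult:
  assumes "a \<in> carrier A" "x \<in> carrier F"
  shows "\<gamma> m (a \<odot>\<^bsub>F\<^esub> x) = (a [^]\<^bsub>A\<^esub> m) \<odot>\<^bsub>\<Gamma>\<^esub> \<gamma> m x"
proof -
  have t: "Gen (m, x) \<in> aterms A (UNIV \<times> carrier F)" "Con (a [^]\<^bsub>A\<^esub> m) \<in> aterms A (UNIV \<times> carrier F)"
    "Gen (m, a \<odot>\<^bsub>F\<^esub> x) \<in> aterms A (UNIV \<times> carrier F)"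
    using assms by (auto intro!: aterms.intros)
  have "pres.gen (m, a \<odot>\<^bsub>F\<^esub> x) = pres.cls (Mul (Con (a [^]\<^bsub>A\<^esub> m)) (Gen (m, x)))"
    using assms t by (intro pres.rel_eq Gamma_rels.intros aterms.intros(4)) auto
  then show ?thesis using t assms
    by (simp add: dpow_eq pres.PA_smult Gamma_eq)
qed

lemma aterm_sum_eval:
  fixes W (structure)
  assumes "cring W" "b \<zero>\<^bsub>A\<^esub> = \<zero>" "\<And>j. j < k \<Longrightarrow> aterm_eval W b v (f j) \<in> carrier W"
  shows "aterm_eval W b v (aterm_sum A (map f [0..<k])) = (\<Oplus>j\<in>{..<k}. aterm_eval W b v (f j))"
proof -
  interpret W: cring W by fact
  have "aterm_eval W b v (aterm_sum A ss) = foldr (\<lambda>s u. aterm_eval W b v s \<oplus> u) ss \<zero>" for ss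
    by (induction ss) (auto simp: assms(2))
  also have "foldr (\<lambda>s u. aterm_eval W b v s \<oplus> u) (map f [0..<k]) \<zero>
      = (\<Oplus>i\<in>{..<length (map f [0..<k])}. aterm_eval W b v (map f [0..<k] ! i))"
    using assms(3) by (intro W.add.finprod_foldr) auto
  also have "\<dots> = (\<Oplus>j\<in>{..<k}. aterm_eval W b v (f j))"
    using assms(3) by (intro W.add.finprod_cong') auto
  finally show ?thesis .
qed

lemma aterm_sum_closed: "(\<And>s. s \<in> set ss \<Longrightarrow> s \<in> aterms A E) \<Longrightarrow> aterm_sum A ss \<in> aterms A E"
  by (induction ss) (auto intro!: aterms.intros)

lemma dpow_add:
  assumes x: "x \<in> carrier F" and y: "y \<in> carrier F"
  shows "(\<lambda>m. \<gamma> m (x \<oplus>\<^bsub>F\<^esub> y)) = (\<lambda>m. \<gamma> m x) \<otimes>\<^bsub>seqs \<Gamma>\<^esub> (\<lambda>m. \<gamma> m y)"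
proof
  fix m :: nat
  let ?t = "\<lambda>j. Mul (Gen (j, x)) (Gen (m - j, y))"
  have t: "aterm_sum A (map ?t [0..<Suc m]) \<in> aterms A (UNIV \<times> carrier F)"
    using x y by (intro aterm_sum_closed) (auto intro!: aterms.intros)
  have "\<gamma> m (x \<oplus>\<^bsub>F\<^esub> y) = pres.cls (aterm_sum A (map ?t [0..<Suc m]))"
    unfolding dpow_eq using x y t by (intro pres.rel_eq Gamma_rels.intros) (auto intro!: aterms.intros)
  also have "\<dots> = aterm_eval \<Gamma> pres.con pres.gen (aterm_sum A (map ?t [0..<Suc m]))"
    using pres.cls_eval[OF t] by (simp add: Gamma_eq)
  also have "\<dots> = (\<Oplus>\<^bsub>\<Gamma>\<^esub>j\<in>{..<Suc m}. \<gamma> j x \<otimes>\<^bsub>\<Gamma>\<^esub> \<gamma> (m - j) y)"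
    using x y pres.PA_zero by (subst aterm_sum_eval[OF Gamma_cring]) (auto simp flip: dpow_eq simp: Gamma_eq[symmetric])
  finally show "\<gamma> m (x \<oplus>\<^bsub>F\<^esub> y) = ((\<lambda>m. \<gamma> m x) \<otimes>\<^bsub>seqs \<Gamma>\<^esub> (\<lambda>m. \<gamma> m y)) m"
    by (simp add: GC.seqs_mult lessThan_Suc_atMost)
qed

lemma con_nat: "pres.con (add_pow A (k::nat) \<one>\<^bsub>A\<^esub>) = add_pow \<Gamma> k \<one>\<^bsub>\<Gamma>\<^esub>"
proof (induction k)
  case 0
  then show ?case using pres.PA_zero by (simp flip: Gamma_eq)
next
  case (Suc k)
  have "pres.con (add_pow A (Suc k) \<one>\<^bsub>A\<^esub>) = pres.con (add_pow A k \<one>\<^bsub>A\<^esub>) \<oplus>\<^bsub>\<Gamma>\<^esub> pres.con \<one>\<^bsub>A\<^esub>"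
    using ring_hom_add[OF pres.con_hom] by (simp flip: Gamma_eq)
  then show ?case using Suc pres.PA_one by (simp flip: Gamma_eq)
qed

lemma dpow_seq: "x \<in> carrier F \<Longrightarrow> (\<lambda>m. \<gamma> m x) \<in> dp_seqs \<Gamma>"
proof -
  assume x: "x \<in> carrier F"
  have "\<gamma> m x \<otimes>\<^bsub>\<Gamma>\<^esub> \<gamma> l x = add_pow \<Gamma> ((m + l) choose m) (\<gamma> (m + l) x)" for m l
  proof -
    let ?k = "(m + l) choose m"
    have "pres.cls (Mul (Gen (m, x)) (Gen (l, x)))
        = pres.cls (Mul (Con (add_pow A ?k \<one>\<^bsub>A\<^esub>)) (Gen (m + l, x)))"
      using x by (intro pres.rel_eq Gamma_rels.intros) (auto intro!: aterms.intros)
    then have "\<gamma> m x \<otimes>\<^bsub>\<Gamma>\<^esub> \<gamma> l x = pres.con (add_pow A ?k \<one>\<^bsub>A\<^esub>) \<otimes>\<^bsub>\<Gamma>\<^esub> \<gamma> (m + l) x"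
      using x unfolding Gamma_eq dpow_eq by (subst (1 2) pres.PA_mult) (auto intro!: aterms.intros)
    then show ?thesis using x by (simp add: con_nat GC.add_pow_ldistr)
  qed
  then show ?thesis using x by (auto simp: dp_seqs_def GC.seqs_carrier dpow_zero_deg)
qed

lemma dpow_zero: "0 < m \<Longrightarrow> \<gamma> m \<zero>\<^bsub>F\<^esub> = \<zero>\<^bsub>\<Gamma>\<^esub>"
  using dpow_smult[of "\<zero>\<^bsub>A\<^esub>" "\<zero>\<^bsub>F\<^esub>" m] AC.nat_pow_zero[of m] by auto

lemma dpow_zero_seq: "(\<lambda>m. \<gamma> m \<zero>\<^bsub>F\<^esub>) = \<one>\<^bsub>seqs \<Gamma>\<^esub>"
  using dpow_zero dpow_zero_deg by (auto simp: GC.seqs_one fun_eq_iff)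

lemma Gamma_hom_smult:
  fixes W (structure)
  assumes "h \<in> ring_hom \<Gamma> W" "a \<in> carrier A" "u \<in> carrier \<Gamma>"
  shows "h (a \<odot>\<^bsub>\<Gamma>\<^esub> u) = h (pres.con a) \<otimes> h u"
  using assms ring_hom_mult[OF assms(1)] pres.con_closed by (simp add: smult_eq flip: Gamma_eq)

lemma Gamma_hom_ext:
  assumes "h \<in> ring_hom \<Gamma> W" "h' \<in> ring_hom \<Gamma> W"
    and "\<And>a. a \<in> carrier A \<Longrightarrow> h (pres.con a) = h' (pres.con a)"
    and "\<And>m x. x \<in> carrier F \<Longrightarrow> h (\<gamma> m x) = h' (\<gamma> m x)"
    and "u \<in> carrier \<Gamma>"
  shows "h u = h' u"
  using pres.hom_ext[of h W h' u] assms unfolding Gamma_eq dpow_eq by auto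

definition Gamma_lift where
  "Gamma_lift W b e = presented_lift W b (\<lambda>(m, x). e x m)"

text \<open>Universal property of the divided power algebra. The relations on constant term and
  products say that each \<open>e x\<close> is a divided power sequence, and the remaining two are
  homogeneity and the passage from sums to products of series.\<close>

lemma Gamma_lift:
  fixes W (structure)
  assumes W: "cring W" and b: "b \<in> ring_hom A W"
    and e: "\<And>x. x \<in> carrier F \<Longrightarrow> e x \<in> dp_seqs W"
    and e_smult: "\<And>a x m. \<lbrakk> a \<in> carrier A; x \<in> carrier F \<rbrakk> \<Longrightarrow> e (a \<odot>\<^bsub>F\<^esub> x) m = b a [^] m \<otimes> e x m"
    and e_add: "\<And>x y. \<lbrakk> x \<in> carrier F; y \<in> carrier F \<rbrakk> \<Longrightarrow> e (x \<oplus>\<^bsub>F\<^esub> y) = e x \<otimes>\<^bsub>seqs W\<^esub> e y"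
  shows "Gamma_lift W b e \<in> ring_hom \<Gamma> W"
    and "a \<in> carrier A \<Longrightarrow> Gamma_lift W b e (pres.con a) = b a"
    and "x \<in> carrier F \<Longrightarrow> Gamma_lift W b e (\<gamma> m x) = e x m"
proof -
  interpret W: cring W by fact
  let ?v = "\<lambda>(m, x). e x m"
  have cl: "e x m \<in> carrier W" if "x \<in> carrier F" for x m using W.dp_seqsD(2) e that by blast
  have v: "?v \<in> UNIV \<times> carrier F \<rightarrow> carrier W" using cl by auto
  have b0: "b \<zero>\<^bsub>A\<^esub> = \<zero>" using ring_hom_zero[OF b AC.ring_axioms W.ring_axioms] .
  have bn: "b (add_pow A (k::nat) \<one>\<^bsub>A\<^esub>) = add_pow W k \<one>" for k
    by (induction k) (auto simp: b0 ring_hom_add[OF b] ring_hom_one[OF b])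
  have bp: "b (a [^]\<^bsub>A\<^esub> (m::nat)) = b a [^] m" if "a \<in> carrier A" for a m
    using that by (induction m) (auto simp: ring_hom_mult[OF b] ring_hom_one[OF b])
  have Q: "aterm_eval W b ?v s = aterm_eval W b ?v t" if "(s, t) \<in> Gamma_rels A F" for s t
    using that
  proof (induction rule: Gamma_rels.induct[split_format (complete)])
    case (1 x)
    then show ?case using W.dp_seqsD(3)[OF e] by (simp add: ring_hom_one[OF b])
  next
    case (2 a x m)
    then show ?case by (simp add: e_smult bp)
  next
    case (3 x y m)
    then have "aterm_eval W b ?v (aterm_sum A (map (\<lambda>j. Mul (Gen (j, x)) (Gen (m - j, y))) [0..<Suc m]))
      = (\<Oplus>j\<in>{..<Suc m}. e x j \<otimes> e y (m - j))"
      using cl b0 by (subst aterm_sum_eval[OF W]) auto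
    then show ?case using 3 by (simp add: e_add W.seqs_mult lessThan_Suc_atMost)
  next
    case (4 x m l)
    then show ?case using W.dp_seqsD(4)[OF e] cl by (simp add: bn W.add_pow_ldistr)
  qed
  note L = pres.presented_lift_hom[OF W b v Q] pres.presented_lift_con[OF W b v Q]
    pres.presented_lift_gen[OF W b v Q]
  show "Gamma_lift W b e \<in> ring_hom \<Gamma> W"
    unfolding Gamma_lift_def Gamma_eq using L(1) by simp
  show "a \<in> carrier A \<Longrightarrow> Gamma_lift W b e (pres.con a) = b a"
    unfolding Gamma_lift_def using L(2) by simp
  show "x \<in> carrier F \<Longrightarrow> Gamma_lift W b e (\<gamma> m x) = e x m"
    unfolding Gamma_lift_def dpow_eq using L(3)[of "(m, x)"] by simp
qed

lemma Gamma_deg_closed: "u \<in> Gamma_deg A F n \<Longrightarrow> u \<in> carrier \<Gamma>"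
  and Gamma_deg_submodule: "submodule (Gamma_deg A F n) A \<Gamma>"
proof -
  let ?T = "{foldr (\<lambda>(m, x) u. \<gamma> m x \<otimes>\<^bsub>\<Gamma>\<^esub> u) l \<one>\<^bsub>\<Gamma>\<^esub> |l.
        snd ` set l \<subseteq> carrier F \<and> sum_list (map fst l) = n}"
  have "foldr (\<lambda>(m, x) u. \<gamma> m x \<otimes>\<^bsub>\<Gamma>\<^esub> u) l \<one>\<^bsub>\<Gamma>\<^esub> \<in> carrier \<Gamma>"
    if "snd ` set l \<subseteq> carrier F" for l
    using that by (induction l) auto
  then have "?T \<subseteq> carrier \<Gamma>" by blast
  from G.lin_span_submodule[OF this] show S: "submodule (Gamma_deg A F n) A \<Gamma>"
    unfolding Gamma_deg_def .
  show "u \<in> Gamma_deg A F n \<Longrightarrow> u \<in> carrier \<Gamma>"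
    using G.submoduleE(1)[OF S] by blast
qed

text \<open>\<open>Gamma_deg\<close> is spanned by products along lists, while the computations use
  products over finite sets; an enumeration of the set translates one into the other.
  \<open>Gamma_deg_induct\<close> is the way back.\<close>

lemma finprod_dpow_deg:
  assumes "finite I" "\<And>i. i \<in> I \<Longrightarrow> x i \<in> carrier F" "sum c I = n"
  shows "finprod \<Gamma> (\<lambda>i. \<gamma> (c i) (x i)) I \<in> Gamma_deg A F n"
proof -
  obtain l where l: "set l = I" "distinct l" using finite_distinct_list[OF assms(1)] by blast
  let ?l = "map (\<lambda>i. (c i, x i)) l"
  have bij: "bij_betw (\<lambda>k. l ! k) {..<length l} I"
    using bij_betw_nth[OF l(2)] l(1) by blast
  have "foldr (\<lambda>(m, x) u. \<gamma> m x \<otimes>\<^bsub>\<Gamma>\<^esub> u) ?l \<one>\<^bsub>\<Gamma>\<^esub>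
      = foldr (\<lambda>i u. \<gamma> (c i) (x i) \<otimes>\<^bsub>\<Gamma>\<^esub> u) l \<one>\<^bsub>\<Gamma>\<^esub>"
    by (simp add: foldr_map comp_def case_prod_beta)
  also have "\<dots> = finprod \<Gamma> (\<lambda>k. \<gamma> (c (l ! k)) (x (l ! k))) {..<length l}"
    using assms(2) l by (intro GC.finprod_foldr) auto
  also have "\<dots> = finprod \<Gamma> (\<lambda>i. \<gamma> (c i) (x i)) I"
    using assms(2) by (subst GC.finprod_bij[OF bij]) auto
  finally have "finprod \<Gamma> (\<lambda>i. \<gamma> (c i) (x i)) I = foldr (\<lambda>(m, x) u. \<gamma> m x \<otimes>\<^bsub>\<Gamma>\<^esub> u) ?l \<one>\<^bsub>\<Gamma>\<^esub>" ..
  moreover have "snd ` set ?l \<subseteq> carrier F" using assms(2) l(1) by auto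
  moreover have "sum_list (map fst ?l) = n"
    using assms(3) l by (simp add: comp_def sum_list_distinct_conv_sum_set)
  ultimately show ?thesis unfolding Gamma_deg_def
    by (intro subsetD[OF lin_span_superset] CollectI exI[of _ ?l] conjI)
qed

lemma Gamma_deg_induct:
  assumes H: "submodule H A \<Gamma>"
    and "\<And>(k::nat) c x. \<lbrakk> \<And>i. i < k \<Longrightarrow> x i \<in> carrier F; sum c {..<k} = n \<rbrakk>
      \<Longrightarrow> finprod \<Gamma> (\<lambda>i. \<gamma> (c i) (x i)) {..<k} \<in> H"
  shows "Gamma_deg A F n \<subseteq> H"
  unfolding Gamma_deg_def
proof (rule lin_span_minimal[OF H], clarify)
  fix l :: "(nat \<times> 'f) list" assume l: "snd ` set l \<subseteq> carrier F" "n = sum_list (map fst l)"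
  have "foldr (\<lambda>(m, x) u. \<gamma> m x \<otimes>\<^bsub>\<Gamma>\<^esub> u) l \<one>\<^bsub>\<Gamma>\<^esub>
      = foldr (\<lambda>p u. \<gamma> (fst p) (snd p) \<otimes>\<^bsub>\<Gamma>\<^esub> u) l \<one>\<^bsub>\<Gamma>\<^esub>" by (intro arg_cong[where f = "\<lambda>g. foldr g l \<one>\<^bsub>\<Gamma>\<^esub>"]) (auto simp: fun_eq_iff)
  also have "\<dots> = finprod \<Gamma> (\<lambda>i. \<gamma> (fst (l ! i)) (snd (l ! i))) {..<length l}"
    using l(1) by (intro GC.finprod_foldr) auto
  also have "\<dots> \<in> H"
  proof (rule assms(2)[of "length l" "\<lambda>i. snd (l ! i)" "\<lambda>i. fst (l ! i)"])
    show "snd (l ! i) \<in> carrier F" if "i < length l" for i using l(1) that by auto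
    show "(\<Sum>i<length l. fst (l ! i)) = n" unfolding l(2) by (simp add: sum_list_sum_nth atLeast0LessThan)
  qed
  finally show "foldr (\<lambda>(m, x) u. \<gamma> m x \<otimes>\<^bsub>\<Gamma>\<^esub> u) l \<one>\<^bsub>\<Gamma>\<^esub> \<in> H" .
qed

end

section \<open>Divided powers of polynomials with coefficients in F\<close>

lemma UP_carrier: "carrier (UP R) = up R"
  by (simp add: UP_def)

lemma UP_coeff: "p \<in> up R \<Longrightarrow> up_ring.coeff (UP R) p k = p k"
  by (simp add: UP_def)

context cring
begin

lemma coeff_finprod_monom:
  assumes "finite I" "\<And>i. i \<in> I \<Longrightarrow> f i \<in> carrier R"
  shows "finprod (UP R) (\<lambda>i. up_ring.monom (UP R) (f i) (w i)) I = up_ring.monom (UP R) (finprod R f I) (sum w I)"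
proof -
  interpret UP_cring R "UP R" by (rule UP_cring.intro[OF is_cring])
  show ?thesis using assms
    by (induction I rule: finite_induct) (auto simp: Pi_def P.finprod_insert intro!: finprod_in)
qed

lemma finsum_monom:
  assumes "\<And>i. i \<in> I \<Longrightarrow> f i \<in> carrier R"
  shows "finsum (UP R) (\<lambda>i. up_ring.monom (UP R) (f i) k) I = up_ring.monom (UP R) (finsum R f I) k"
proof -
  interpret UP_cring R "UP R" by (rule UP_cring.intro[OF is_cring])
  show ?thesis using assms
    by (induction I rule: infinite_finite_induct) (auto simp: Pi_def intro!: add.finprod_in)
qed

lemma coeff_finsum_UP:
  assumes "\<And>i. i \<in> I \<Longrightarrow> p i \<in> carrier (UP R)"
  shows "up_ring.coeff (UP R) (finsum (UP R) p I) k = (\<Oplus>i\<in>I. up_ring.coeff (UP R) (p i) k)"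
proof -
  interpret UP_cring R "UP R" by (rule UP_cring.intro[OF is_cring])
  show ?thesis using assms
    by (induction I rule: infinite_finite_induct) (auto simp: Pi_def intro!: P.add.finprod_in)
qed

lemma seqs_scale_finprod:
  assumes "finite I" "\<And>i. i \<in> I \<Longrightarrow> e i \<in> carrier (seqs R)" "u \<in> carrier R"
  shows "(\<lambda>m. u [^] m \<otimes> finprod (seqs R) e I m) = finprod (seqs R) (\<lambda>i m. u [^] m \<otimes> e i m) I"
proof -
  interpret S: comm_monoid "seqs R" by (rule seqs_comm_monoid)
  have cl: "(\<lambda>m. u [^] m \<otimes> f m) \<in> carrier (seqs R)" if "f \<in> carrier (seqs R)" for f
    using that assms(3) by (auto simp: seqs_carrier)
  show ?thesis using assms(1,2)
  proof (induction I rule: finite_induct)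
    case empty
    then show ?case using assms(3) by (auto simp: seqs_one fun_eq_iff)
  next
    case (insert i I)
    have "(\<lambda>m. u [^] m \<otimes> finprod (seqs R) e (insert i I) m)
        = (\<lambda>m. u [^] m \<otimes> e i m) \<otimes>\<^bsub>seqs R\<^esub> (\<lambda>m. u [^] m \<otimes> finprod (seqs R) e I m)"
      using insert assms(3) by (subst seqs_scale_mult[symmetric]) (auto intro!: S.finprod_in)
    then show ?case using insert cl by (auto simp: Pi_def)
  qed
qed

end

context dp_algebra
begin

abbreviation "UF \<equiv> UP F"
abbreviation "UG \<equiv> UP \<Gamma>"

sublocale UF: UP_cring F UF by (rule UP_cring.intro[OF FC.is_cring])
sublocale UG: UP_cring \<Gamma> UG by (rule UP_cring.intro[OF Gamma_cring])

lemma UG_cring: "cring UG" by (rule UG.UP_cring)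
lemma UF_cring: "cring UF" by (rule UF.UP_cring)

sublocale Seq: comm_monoid "seqs UG" by (rule cring.seqs_comm_monoid[OF UG_cring])

abbreviation cf where "cf p k \<equiv> up_ring.coeff UF p k"
abbreviation cg where "cg p k \<equiv> up_ring.coeff UG p k"
abbreviation mono where "mono \<equiv> up_ring.monom UG"

text \<open>The divided powers of the monomial xT^k: the m-th one is gamma^m(x) T^(km), a polynomial
  over the divided power algebra.\<close>

definition mseq where "mseq k x = (\<lambda>m. mono (\<gamma> m x) (k * m))"

definition supp where "supp p = {k. cf p k \<noteq> \<zero>\<^bsub>F\<^esub>}"

text \<open>The divided powers of a polynomial p in F[T], as polynomials over
  \<open>\<Gamma>\<close>: since p is the sum of its monomials, its series is the product of theirs.
  This stands in for the divided power algebra of F[T] over A[T].\<close>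

definition dexp where "dexp p = finprod (seqs UG) (\<lambda>k. mseq k (cf p k)) (supp p)"

lemma mono_add_pow: "u \<in> carrier \<Gamma> \<Longrightarrow> add_pow UG (k::nat) (mono u m) = mono (add_pow \<Gamma> k u) m"
  by (induction k) auto

lemma mseq_dp: "x \<in> carrier F \<Longrightarrow> mseq k x \<in> dp_seqs UG"
  using GC.dp_seqsD[OF dpow_seq[of x]]
  unfolding dp_seqs_def mseq_def
  by (auto simp: UG.P.seqs_carrier mono_add_pow algebra_simps simp flip: UG.monom_mult)

lemma mseq_closed [simp]: "x \<in> carrier F \<Longrightarrow> mseq k x \<in> carrier (seqs UG)"
  using mseq_dp UG.P.dp_seqsD(1) by blast

lemma mseq_zero: "mseq k \<zero>\<^bsub>F\<^esub> = \<one>\<^bsub>seqs UG\<^esub>"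
  using dpow_zero dpow_zero_deg[OF FC.zero_closed] by (auto simp: mseq_def UG.P.seqs_one fun_eq_iff)

lemma mseq_add:
  assumes "x \<in> carrier F" "y \<in> carrier F"
  shows "mseq k (x \<oplus>\<^bsub>F\<^esub> y) = mseq k x \<otimes>\<^bsub>seqs UG\<^esub> mseq k y"
proof
  fix m
  have "\<gamma> m (x \<oplus>\<^bsub>F\<^esub> y) = (\<Oplus>\<^bsub>\<Gamma>\<^esub>j\<in>{..m}. \<gamma> j x \<otimes>\<^bsub>\<Gamma>\<^esub> \<gamma> (m - j) y)"
    using fun_cong[OF dpow_add[OF assms], of m] by (simp add: GC.seqs_mult)
  then have "mseq k (x \<oplus>\<^bsub>F\<^esub> y) m = (\<Oplus>\<^bsub>UG\<^esub>j\<in>{..m}. mono (\<gamma> j x \<otimes>\<^bsub>\<Gamma>\<^esub> \<gamma> (m - j) y) (k * m))"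
    using assms by (simp add: mseq_def, subst GC.finsum_monom) auto
  also have "\<dots> = (\<Oplus>\<^bsub>UG\<^esub>j\<in>{..m}. mseq k x j \<otimes>\<^bsub>UG\<^esub> mseq k y (m - j))"
    using assms by (intro UG.P.add.finprod_cong2)
      (auto simp: mseq_def simp flip: UG.monom_mult distrib_left)
  finally show "mseq k (x \<oplus>\<^bsub>F\<^esub> y) m = (mseq k x \<otimes>\<^bsub>seqs UG\<^esub> mseq k y) m"
    by (simp add: UG.P.seqs_mult)
qed

lemma finite_supp: "p \<in> carrier UF \<Longrightarrow> finite (supp p)"
proof -
  assume "p \<in> carrier UF"
  then have p: "p \<in> up F" by (simp only: UP_carrier)
  then obtain n where n: "bound \<zero>\<^bsub>F\<^esub> n p" using FC.bound_upD by blast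
  have "cf p k = p k" for k using p by (rule UP_coeff)
  then have "supp p \<subseteq> {..n}" unfolding supp_def using bound.bound[OF n] by (auto simp: not_less[symmetric])
  then show ?thesis using finite_subset by blast
qed

text \<open>A zero coefficient contributes the unit series, so the product may run over any larger
  finite set. This allows several polynomials to be compared over a common set of exponents.\<close>

lemma dexp_superset:
  assumes "p \<in> carrier UF" "finite K" "supp p \<subseteq> K"
  shows "dexp p = finprod (seqs UG) (\<lambda>k. mseq k (cf p k)) K"
  unfolding dexp_def using assms
  by (intro Seq.finprod_mono_neutral_cong_left) (auto simp: supp_def mseq_zero)

lemma dexp_dp: "p \<in> carrier UF \<Longrightarrow> dexp p \<in> dp_seqs UG"
  unfolding dexp_def by (intro UG.P.dp_seqs_finprod finite_supp mseq_dp) auto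

lemma dexp_closed [simp]: "p \<in> carrier UF \<Longrightarrow> dexp p \<in> carrier (seqs UG)"
  "p \<in> carrier UF \<Longrightarrow> dexp p m \<in> carrier UG"
  using dexp_dp UG.P.dp_seqsD by blast+

lemma dexp_add:
  assumes p: "p \<in> carrier UF" and q: "q \<in> carrier UF"
  shows "dexp (p \<oplus>\<^bsub>UF\<^esub> q) = dexp p \<otimes>\<^bsub>seqs UG\<^esub> dexp q"
proof -
  let ?K = "supp p \<union> supp q \<union> supp (p \<oplus>\<^bsub>UF\<^esub> q)"
  have fin: "finite ?K" using assms finite_supp by simp
  have "dexp (p \<oplus>\<^bsub>UF\<^esub> q) = finprod (seqs UG) (\<lambda>k. mseq k (cf p k) \<otimes>\<^bsub>seqs UG\<^esub> mseq k (cf q k)) ?K"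
    using assms fin by (subst dexp_superset[of _ ?K]) (auto simp: mseq_add intro!: Seq.finprod_cong2)
  also have "\<dots> = dexp p \<otimes>\<^bsub>seqs UG\<^esub> dexp q"
  proof -
    have "supp p \<subseteq> ?K" "supp q \<subseteq> ?K" by auto
    then have "dexp p = finprod (seqs UG) (\<lambda>k. mseq k (cf p k)) ?K"
      "dexp q = finprod (seqs UG) (\<lambda>k. mseq k (cf q k)) ?K"
      using dexp_superset[OF p fin] dexp_superset[OF q fin] by blast+
    then show ?thesis using assms by (subst Seq.finprod_multf) auto
  qed
  finally show ?thesis .
qed

lemma dexp_monom:
  assumes "x \<in> carrier F"
  shows "dexp (up_ring.monom UF x k) = mseq k x"
proof -
  have "dexp (up_ring.monom UF x k) = finprod (seqs UG) (\<lambda>j. mseq j (cf (up_ring.monom UF x k) j)) {k}"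
    using assms by (intro dexp_superset) (auto simp: supp_def)
  then show ?thesis using assms by simp
qed

lemma dexp_const: "x \<in> carrier F \<Longrightarrow> dexp (up_ring.monom UF x 0) m = mono (\<gamma> m x) 0"
  by (simp add: dexp_monom mseq_def)

lemma mono_pow: "u \<in> carrier \<Gamma> \<Longrightarrow> mono u k [^]\<^bsub>UG\<^esub> (m::nat) = mono (u [^]\<^bsub>\<Gamma>\<^esub> m) (k * m)"
  by (induction m) (auto simp: algebra_simps simp flip: UG.monom_mult)

lemma con_pow: "a \<in> carrier A \<Longrightarrow> pres.con a [^]\<^bsub>\<Gamma>\<^esub> (m::nat) = pres.con (a [^]\<^bsub>A\<^esub> m)"
  by (induction m) (use ring_hom_mult[OF pres.con_hom] pres.PA_one in \<open>auto simp flip: Gamma_eq\<close>)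

lemma con_closed' [simp]: "a \<in> carrier A \<Longrightarrow> pres.con a \<in> carrier \<Gamma>"
  using pres.con_closed by (simp add: Gamma_eq)

lemma coeff_monom_mult':
  assumes "x \<in> carrier F" "p \<in> carrier UF"
  shows "cf (up_ring.monom UF x 0 \<otimes>\<^bsub>UF\<^esub> p) k = x \<otimes>\<^bsub>F\<^esub> cf p k"
  using UF.monom_mult_is_smult[OF assms] assms by simp

text \<open>Constants from A and the variable T generate A[T]. Together with
  \<open>dexp_shift\<close> for T and \<open>dp_seqs_binomial\<close> for sums of scalars, this
  makes \<open>dexp\<close> homogeneous over A[T].\<close>

lemma dexp_scale:
  assumes a: "a \<in> carrier A" and p: "p \<in> carrier UF"
  shows "dexp (up_ring.monom UF (a \<odot>\<^bsub>F\<^esub> \<one>\<^bsub>F\<^esub>) 0 \<otimes>\<^bsub>UF\<^esub> p) = (\<lambda>m. mono (pres.con a) 0 [^]\<^bsub>UG\<^esub> m \<otimes>\<^bsub>UG\<^esub> dexp p m)"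
proof -
  let ?q = "up_ring.monom UF (a \<odot>\<^bsub>F\<^esub> \<one>\<^bsub>F\<^esub>) 0 \<otimes>\<^bsub>UF\<^esub> p"
  have q: "?q \<in> carrier UF" using a p by simp
  have cq: "cf ?q k = a \<odot>\<^bsub>F\<^esub> cf p k" for k
    using a p by (simp add: coeff_monom_mult' alg.smult_assoc2 del: UF.coeff_mult)
  have "supp ?q \<subseteq> supp p" using a by (auto simp: supp_def cq)
  then have "dexp ?q = finprod (seqs UG) (\<lambda>k. mseq k (a \<odot>\<^bsub>F\<^esub> cf p k)) (supp p)"
    using dexp_superset[OF q finite_supp[OF p]] by (simp add: cq)
  also have "\<dots> = finprod (seqs UG) (\<lambda>k m. mono (pres.con a) 0 [^]\<^bsub>UG\<^esub> m \<otimes>\<^bsub>UG\<^esub> mseq k (cf p k) m) (supp p)"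
  proof (rule Seq.finprod_cong2)
    fix k
    show *: "mseq k (a \<odot>\<^bsub>F\<^esub> cf p k) = (\<lambda>m. mono (pres.con a) 0 [^]\<^bsub>UG\<^esub> m \<otimes>\<^bsub>UG\<^esub> mseq k (cf p k) m)"
      using a p by (auto simp: fun_eq_iff mseq_def dpow_smult mono_pow con_pow smult_eq simp flip: UG.monom_mult)
    show "(\<lambda>m. mono (pres.con a) 0 [^]\<^bsub>UG\<^esub> m \<otimes>\<^bsub>UG\<^esub> mseq k (cf p k) m) \<in> carrier (seqs UG)"
      unfolding *[symmetric] using a p by (intro mseq_closed) simp
  qed
  also have "\<dots> = (\<lambda>m. mono (pres.con a) 0 [^]\<^bsub>UG\<^esub> m \<otimes>\<^bsub>UG\<^esub> dexp p m)"
    unfolding dexp_def using a p finite_supp by (subst UG.P.seqs_scale_finprod) auto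
  finally show ?thesis .
qed

lemma dexp_shift:
  assumes p: "p \<in> carrier UF"
  shows "dexp (up_ring.monom UF \<one>\<^bsub>F\<^esub> 1 \<otimes>\<^bsub>UF\<^esub> p) = (\<lambda>m. mono \<one>\<^bsub>\<Gamma>\<^esub> 1 [^]\<^bsub>UG\<^esub> m \<otimes>\<^bsub>UG\<^esub> dexp p m)"
proof -
  let ?q = "up_ring.monom UF \<one>\<^bsub>F\<^esub> 1 \<otimes>\<^bsub>UF\<^esub> p"
  have q: "?q \<in> carrier UF" using p by simp
  have cq: "cf ?q (Suc k) = cf p k" for k
    using UF.coeff_monom_mult[OF FC.one_closed p, of 1 k] p by simp
  have cq0: "cf ?q 0 = \<zero>\<^bsub>F\<^esub>"
    using p by (subst UF.coeff_mult) auto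
  have "supp ?q \<subseteq> Suc ` supp p"
  proof
    fix k assume k: "k \<in> supp ?q"
    then obtain j where "k = Suc j" using cq0 unfolding supp_def by (cases k) auto
    then show "k \<in> Suc ` supp p" using k cq[of j] unfolding supp_def by auto
  qed
  then have "dexp ?q = finprod (seqs UG) (\<lambda>k. mseq k (cf ?q k)) (Suc ` supp p)"
    using finite_supp[OF p] by (intro dexp_superset[OF q]) auto
  also have "\<dots> = finprod (seqs UG) (\<lambda>k. mseq (Suc k) (cf p k)) (supp p)"
  proof -
    have "finprod (seqs UG) (\<lambda>k. mseq k (cf ?q k)) (Suc ` supp p)
        = finprod (seqs UG) (\<lambda>k. mseq (Suc k) (cf ?q (Suc k))) (supp p)"
      using q by (intro Seq.finprod_reindex) (auto simp del: UF.coeff_mult)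
    then show ?thesis by (simp only: cq)
  qed
  also have "\<dots> = finprod (seqs UG) (\<lambda>k m. mono \<one>\<^bsub>\<Gamma>\<^esub> 1 [^]\<^bsub>UG\<^esub> m \<otimes>\<^bsub>UG\<^esub> mseq k (cf p k) m) (supp p)"
  proof (rule Seq.finprod_cong2)
    fix k
    show *: "mseq (Suc k) (cf p k) = (\<lambda>m. mono \<one>\<^bsub>\<Gamma>\<^esub> 1 [^]\<^bsub>UG\<^esub> m \<otimes>\<^bsub>UG\<^esub> mseq k (cf p k) m)"
      using p by (auto simp: fun_eq_iff mseq_def mono_pow simp flip: UG.monom_mult)
    show "(\<lambda>m. mono \<one>\<^bsub>\<Gamma>\<^esub> 1 [^]\<^bsub>UG\<^esub> m \<otimes>\<^bsub>UG\<^esub> mseq k (cf p k) m) \<in> carrier (seqs UG)"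
      unfolding *[symmetric] using p by (intro mseq_closed) simp
  qed
  also have "\<dots> = (\<lambda>m. mono \<one>\<^bsub>\<Gamma>\<^esub> 1 [^]\<^bsub>UG\<^esub> m \<otimes>\<^bsub>UG\<^esub> dexp p m)"
    unfolding dexp_def using p finite_supp by (subst UG.P.seqs_scale_finprod) auto
  finally show ?thesis .
qed

lemma dexp_formula:
  assumes p: "p \<in> carrier UF" and K: "finite K" "supp p \<subseteq> K"
  shows "dexp p m = (\<Oplus>\<^bsub>UG\<^esub>c\<in>comps K m. mono (finprod \<Gamma> (\<lambda>k. \<gamma> (c k) (cf p k)) K) (\<Sum>k\<in>K. k * c k))"
proof -
  have "dexp p m = (\<Oplus>\<^bsub>UG\<^esub>c\<in>comps K m. \<Otimes>\<^bsub>UG\<^esub>k\<in>K. mseq k (cf p k) (c k))"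
    using p by (subst dexp_superset[OF p K], subst UG.P.finprod_seqs[OF K(1)]) auto
  also have "\<dots> = (\<Oplus>\<^bsub>UG\<^esub>c\<in>comps K m. mono (finprod \<Gamma> (\<lambda>k. \<gamma> (c k) (cf p k)) K) (\<Sum>k\<in>K. k * c k))"
    using p K by (intro UG.P.add.finprod_cong2) (auto simp: mseq_def GC.coeff_finprod_monom intro!: GC.finprod_in)
  finally show ?thesis .
qed

text \<open>Sums of products of divided powers over integer vectors subject to a condition
  \<open>R\<close>. When the index set is a product, the vectors are matrices and \<open>R\<close>
  prescribes weights of rows and columns.\<close>

definition mat_sum where
  "mat_sum I m R x = finsum \<Gamma> (\<lambda>c. finprod \<Gamma> (\<lambda>i. \<gamma> (c i) (x i)) I) {c \<in> comps I m. R c}"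

text \<open>The coefficient of T^N in the m-th divided power of p. For m > 0 these elements span the
  component of degree m, and linear statements are checked on them.\<close>

definition tcoeff where "tcoeff m p N = cg (dexp p m) N"

lemma coeff_mono_sum:
  assumes "finite C" "\<And>c. c \<in> C \<Longrightarrow> f c \<in> carrier \<Gamma>"
  shows "cg (\<Oplus>\<^bsub>UG\<^esub>c\<in>C. mono (f c) (w c)) N = finsum \<Gamma> f {c \<in> C. w c = N}"
proof -
  have "cg (\<Oplus>\<^bsub>UG\<^esub>c\<in>C. mono (f c) (w c)) N = (\<Oplus>\<^bsub>\<Gamma>\<^esub>c\<in>C. if w c = N then f c else \<zero>\<^bsub>\<Gamma>\<^esub>)"
    using assms by (subst GC.coeff_finsum_UP) (auto intro!: GC.add.finprod_cong2)
  also have "\<dots> = finsum \<Gamma> f {c \<in> C. w c = N}"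
    using assms by (intro GC.add.finprod_mono_neutral_cong_right) auto
  finally show ?thesis .
qed

lemma tcoeff_formula:
  assumes "p \<in> carrier UF" "finite K" "supp p \<subseteq> K"
  shows "tcoeff m p N = mat_sum K m (\<lambda>c. (\<Sum>k\<in>K. k * c k) = N) (cf p)"
  unfolding tcoeff_def mat_sum_def dexp_formula[OF assms]
  using assms by (intro coeff_mono_sum) (auto intro!: GC.finprod_in)

lemma mat_sum_deg:
  assumes "finite I" "\<And>i. i \<in> I \<Longrightarrow> x i \<in> carrier F"
  shows "mat_sum I m R x \<in> Gamma_deg A F m"
proof -
  interpret S: submodule "Gamma_deg A F m" A \<Gamma> by (rule Gamma_deg_submodule)
  have *: "finsum \<Gamma> f C \<in> Gamma_deg A F m" if "finite C" "\<And>c. c \<in> C \<Longrightarrow> f c \<in> Gamma_deg A F m" for f C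
    using that
  proof (induction C rule: finite_induct)
    case empty
    then show ?case using S.one_closed by simp
  next
    case (insert c C)
    then have "finsum \<Gamma> f (insert c C) = f c \<oplus>\<^bsub>\<Gamma>\<^esub> finsum \<Gamma> f C"
      using Gamma_deg_closed by (intro GC.finsum_insert) auto
    then show ?case using S.m_closed[of "f c" "finsum \<Gamma> f C"] insert by simp
  qed
  show ?thesis unfolding mat_sum_def
  proof (rule *)
    show "finite {c \<in> comps I m. R c}" using assms(1) by simp
  qed (use assms in \<open>auto simp: comps_def intro!: finprod_dpow_deg\<close>)
qed

end

section \<open>Multiplication by a polynomial, expanded over integer matrices\<close>

lemma ring_hom_finprod:
  assumes "cring R" "cring S" "h \<in> ring_hom R S" "\<And>i. i \<in> I \<Longrightarrow> f i \<in> carrier R"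
  shows "h (finprod R f I) = finprod S (\<lambda>i. h (f i)) I"
proof -
  interpret R: cring R by fact
  interpret S: cring S by fact
  show ?thesis using assms(4)
    by (induction I rule: infinite_finite_induct)
      (auto simp: ring_hom_one[OF assms(3)] ring_hom_mult[OF assms(3)] Pi_def ring_hom_closed[OF assms(3)]
        intro!: R.finprod_in)
qed

lemma ring_hom_finsum:
  assumes "cring R" "cring S" "h \<in> ring_hom R S" "\<And>i. i \<in> I \<Longrightarrow> f i \<in> carrier R"
  shows "h (finsum R f I) = finsum S (\<lambda>i. h (f i)) I"
proof -
  interpret R: cring R by fact
  interpret S: cring S by fact
  show ?thesis using assms(4)
    by (induction I rule: infinite_finite_induct)
      (auto simp: ring_hom_zero[OF assms(3) R.ring_axioms S.ring_axioms] ring_hom_add[OF assms(3)] Pi_def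
        ring_hom_closed[OF assms(3)] intro!: R.add.finprod_in)
qed

text \<open>Uniqueness of digits in base n + 1: the lower digits contribute less than (n + 1)^k, so
  the top digit is the quotient by this power.\<close>

lemma digits_unique:
  fixes c d :: "nat \<Rightarrow> nat"
  assumes "\<And>i. i < k \<Longrightarrow> c i \<le> n" "\<And>i. i < k \<Longrightarrow> d i \<le> n"
    and "(\<Sum>i<k. (n + 1) ^ i * c i) = (\<Sum>i<k. (n + 1) ^ i * d i)" "i < k"
  shows "c i = d i"
  using assms
proof (induction k)
  case (Suc k)
  have bound: "(\<Sum>i<j. (n + 1) ^ i * e i) < (n + 1) ^ j" if "\<And>i. i < j \<Longrightarrow> e i \<le> n" for e :: "nat \<Rightarrow> nat" and j
    using that
  proof (induction j)
    case (Suc j)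
    have "(n + 1) ^ j * e j \<le> (n + 1) ^ j * n" using Suc.prems[of j] by simp
    moreover have "(\<Sum>i<j. (n + 1) ^ i * e i) < (n + 1) ^ j" using Suc by simp
    ultimately have "(\<Sum>i<j. (n + 1) ^ i * e i) + (n + 1) ^ j * e j < (n + 1) ^ j + (n + 1) ^ j * n"
      by linarith
    also have "\<dots> = (n + 1) ^ Suc j" by (simp add: algebra_simps)
    finally show ?case by simp
  qed simp
  let ?A = "\<Sum>i<k. (n + 1) ^ i * c i" and ?B = "\<Sum>i<k. (n + 1) ^ i * d i"
  have eq: "?A + (n + 1) ^ k * c k = ?B + (n + 1) ^ k * d k" using Suc.prems(3) by simp
  have lt: "?A < (n + 1) ^ k" "?B < (n + 1) ^ k" using bound Suc.prems(1,2) by simp_all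
  have "(?A + (n + 1) ^ k * c k) div (n + 1) ^ k = c k" "(?B + (n + 1) ^ k * d k) div (n + 1) ^ k = d k"
    using lt by simp_all
  then have "c k = d k" unfolding eq by metis
  then show ?case using Suc eq by (cases "i = k") auto
qed simp

lemma sum_pairs: "(\<Sum>p\<in>A \<times> B. f p) = (\<Sum>a\<in>A. \<Sum>b\<in>B. f (a, b))" for f :: "_ \<Rightarrow> nat"
  by (simp add: sum.cartesian_product)

context dp_algebra
begin

definition xmul where "xmul x Y = up_ring.monom UF x 0 \<otimes>\<^bsub>UF\<^esub> Y"

text \<open>The algebra map sending gamma^m(x) to the m-th divided power of xY. As the second
  product has to satisfy gamma^n(x) gamma^n(Y) = gamma^n(xY), in degree n this is multiplication by
  gamma^n(Y).\<close>

definition Phi where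
  "Phi Y = Gamma_lift UG (\<lambda>a. mono (pres.con a) 0) (\<lambda>x. dexp (xmul x Y))"

text \<open>By comparison of coefficients, this is what multiplication by
  \<open>tcoeff n Y N\<close> has to be in degree n.\<close>

definition D where "D Y N u = cg (Phi Y u) N"

lemma xmul_closed [simp]: "\<lbrakk> x \<in> carrier F; Y \<in> carrier UF \<rbrakk> \<Longrightarrow> xmul x Y \<in> carrier UF"
  by (simp add: xmul_def)

lemma cf_xmul: "\<lbrakk> x \<in> carrier F; Y \<in> carrier UF \<rbrakk> \<Longrightarrow> cf (xmul x Y) k = x \<otimes>\<^bsub>F\<^esub> cf Y k"
  unfolding xmul_def by (rule coeff_monom_mult')

lemma con_UG_hom: "(\<lambda>a. mono (pres.con a) 0) \<in> ring_hom A UG"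
  using ring_hom_mult[OF pres.con_hom] ring_hom_add[OF pres.con_hom] ring_hom_one[OF pres.con_hom]
  by (intro ring_hom_memI) (auto simp flip: Gamma_eq UG.monom_mult)

lemma Phi_lift:
  assumes Y: "Y \<in> carrier UF"
  shows "Phi Y \<in> ring_hom \<Gamma> UG"
    and "a \<in> carrier A \<Longrightarrow> Phi Y (pres.con a) = mono (pres.con a) 0"
    and "x \<in> carrier F \<Longrightarrow> Phi Y (\<gamma> m x) = dexp (xmul x Y) m"
proof -
  have 1: "dexp (xmul x Y) \<in> dp_seqs UG" if "x \<in> carrier F" for x
    using that Y by (intro dexp_dp) auto
  have 2: "dexp (xmul (a \<odot>\<^bsub>F\<^esub> x) Y) m = mono (pres.con a) 0 [^]\<^bsub>UG\<^esub> m \<otimes>\<^bsub>UG\<^esub> dexp (xmul x Y) m"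
    if "a \<in> carrier A" "x \<in> carrier F" for a x m
  proof -
    have "a \<odot>\<^bsub>F\<^esub> x = (a \<odot>\<^bsub>F\<^esub> \<one>\<^bsub>F\<^esub>) \<otimes>\<^bsub>F\<^esub> x" using that by (simp add: alg.smult_assoc2)
    then have "xmul (a \<odot>\<^bsub>F\<^esub> x) Y = up_ring.monom UF (a \<odot>\<^bsub>F\<^esub> \<one>\<^bsub>F\<^esub>) 0 \<otimes>\<^bsub>UF\<^esub> xmul x Y"
      using that Y UF.monom_mult[of "a \<odot>\<^bsub>F\<^esub> \<one>\<^bsub>F\<^esub>" x 0 0] unfolding xmul_def
      by (simp add: UF.P.m_assoc del: UF.monom_mult)
    then show ?thesis using fun_cong[OF dexp_scale[of a "xmul x Y"]] that Y by simp
  qed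
  have 3: "dexp (xmul (x \<oplus>\<^bsub>F\<^esub> y) Y) = dexp (xmul x Y) \<otimes>\<^bsub>seqs UG\<^esub> dexp (xmul y Y)"
    if "x \<in> carrier F" "y \<in> carrier F" for x y
  proof -
    have "xmul (x \<oplus>\<^bsub>F\<^esub> y) Y = xmul x Y \<oplus>\<^bsub>UF\<^esub> xmul y Y"
      using that Y by (simp add: xmul_def UF.P.l_distr)
    then show ?thesis using dexp_add[of "xmul x Y" "xmul y Y"] that Y by simp
  qed
  note L = Gamma_lift[of UG "\<lambda>a. mono (pres.con a) 0" "\<lambda>x. dexp (xmul x Y)", OF UG_cring con_UG_hom 1 2 3]
  show "Phi Y \<in> ring_hom \<Gamma> UG" "a \<in> carrier A \<Longrightarrow> Phi Y (pres.con a) = mono (pres.con a) 0"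
    "x \<in> carrier F \<Longrightarrow> Phi Y (\<gamma> m x) = dexp (xmul x Y) m"
    unfolding Phi_def by (rule L; assumption)+
qed

lemma Phi_closed: "\<lbrakk> Y \<in> carrier UF; u \<in> carrier \<Gamma> \<rbrakk> \<Longrightarrow> Phi Y u \<in> carrier UG"
  using ring_hom_closed[OF Phi_lift(1)] by blast

lemma D_closed: "\<lbrakk> Y \<in> carrier UF; u \<in> carrier \<Gamma> \<rbrakk> \<Longrightarrow> D Y N u \<in> carrier \<Gamma>"
  by (simp add: D_def Phi_closed)

lemma D_add: "\<lbrakk> Y \<in> carrier UF; u \<in> carrier \<Gamma>; v \<in> carrier \<Gamma> \<rbrakk>
    \<Longrightarrow> D Y N (u \<oplus>\<^bsub>\<Gamma>\<^esub> v) = D Y N u \<oplus>\<^bsub>\<Gamma>\<^esub> D Y N v"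
  using ring_hom_add[OF Phi_lift(1)] by (simp add: D_def Phi_closed)

lemma D_smult:
  assumes "Y \<in> carrier UF" "a \<in> carrier A" "u \<in> carrier \<Gamma>"
  shows "D Y N (a \<odot>\<^bsub>\<Gamma>\<^esub> u) = a \<odot>\<^bsub>\<Gamma>\<^esub> D Y N u"
proof -
  have "Phi Y (a \<odot>\<^bsub>\<Gamma>\<^esub> u) = mono (pres.con a) 0 \<otimes>\<^bsub>UG\<^esub> Phi Y u"
    using assms Gamma_hom_smult[OF Phi_lift(1)] by (simp add: Phi_lift(2))
  also have "\<dots> = pres.con a \<odot>\<^bsub>UG\<^esub> Phi Y u"
    using assms Phi_closed by (intro UG.monom_mult_is_smult) auto
  finally show ?thesis using assms Phi_closed D_closed by (simp add: D_def smult_eq)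
qed

lemma dexp_xmul_formula:
  assumes "x \<in> carrier F" "Y \<in> carrier UF" "finite K" "supp Y \<subseteq> K"
  shows "dexp (xmul x Y) m
    = (\<Oplus>\<^bsub>UG\<^esub>c\<in>comps K m. mono (finprod \<Gamma> (\<lambda>k. \<gamma> (c k) (x \<otimes>\<^bsub>F\<^esub> cf Y k)) K) (\<Sum>k\<in>K. k * c k))"
proof -
  have "supp (xmul x Y) \<subseteq> K" using assms by (auto simp: supp_def cf_xmul)
  then show ?thesis using dexp_formula[OF xmul_closed assms(3), of x Y m] assms by (simp add: cf_xmul)
qed

text \<open>Row i of a matrix d distributes \<open>a i\<close> over the monomials of the polynomial
  x_i Y. Row sums are therefore fixed, while the columns are seen only through the total weight
  N.\<close>

lemma D_finprod:
  assumes I: "finite I" "\<And>i. i \<in> I \<Longrightarrow> x i \<in> carrier F"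
    and Y: "Y \<in> carrier UF" "finite K" "supp Y \<subseteq> K"
  shows "D Y N (finprod \<Gamma> (\<lambda>i. \<gamma> (a i) (x i)) I)
    = finsum \<Gamma> (\<lambda>d. finprod \<Gamma> (\<lambda>i. finprod \<Gamma> (\<lambda>k. \<gamma> (d i k) (x i \<otimes>\<^bsub>F\<^esub> cf Y k)) K) I)
      {d \<in> PiE I (\<lambda>i. comps K (a i)). (\<Sum>i\<in>I. \<Sum>k\<in>K. k * d i k) = N}"
proof -
  let ?f = "\<lambda>i d. finprod \<Gamma> (\<lambda>k. \<gamma> (d k) (x i \<otimes>\<^bsub>F\<^esub> cf Y k)) K"
  let ?w = "\<lambda>d. \<Sum>k\<in>K. k * d k"
  have cl: "?f i d \<in> carrier \<Gamma>" if "i \<in> I" for i d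
    using that I Y by (intro GC.finprod_in) auto
  have "Phi Y (finprod \<Gamma> (\<lambda>i. \<gamma> (a i) (x i)) I) = (\<Otimes>\<^bsub>UG\<^esub>i\<in>I. dexp (xmul (x i) Y) (a i))"
    using I Y by (subst ring_hom_finprod[OF Gamma_cring UG_cring Phi_lift(1)])
      (auto simp: Phi_lift(3) intro!: UG.P.finprod_cong2)
  also have "\<dots> = (\<Otimes>\<^bsub>UG\<^esub>i\<in>I. \<Oplus>\<^bsub>UG\<^esub>d\<in>comps K (a i). mono (?f i d) (?w d))"
    using I Y cl by (intro UG.P.finprod_cong2) (auto simp: dexp_xmul_formula intro!: UG.P.add.finprod_in)
  also have "\<dots> = (\<Oplus>\<^bsub>UG\<^esub>d\<in>PiE I (\<lambda>i. comps K (a i)). \<Otimes>\<^bsub>UG\<^esub>i\<in>I. mono (?f i (d i)) (?w (d i)))"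
    using I Y cl by (intro UG.P.finprod_finsum) auto
  also have "\<dots> = (\<Oplus>\<^bsub>UG\<^esub>d\<in>PiE I (\<lambda>i. comps K (a i)).
      mono (finprod \<Gamma> (\<lambda>i. ?f i (d i)) I) (\<Sum>i\<in>I. ?w (d i)))"
    using I cl by (intro UG.P.add.finprod_cong2) (auto simp: GC.coeff_finprod_monom intro!: GC.finprod_in)
  finally have "D Y N (finprod \<Gamma> (\<lambda>i. \<gamma> (a i) (x i)) I)
    = cg (\<Oplus>\<^bsub>UG\<^esub>d\<in>PiE I (\<lambda>i. comps K (a i)). mono (finprod \<Gamma> (\<lambda>i. ?f i (d i)) I) (\<Sum>i\<in>I. ?w (d i))) N"
    by (simp add: D_def)
  also have "\<dots> = finsum \<Gamma> (\<lambda>d. finprod \<Gamma> (\<lambda>i. ?f i (d i)) I)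
      {d \<in> PiE I (\<lambda>i. comps K (a i)). (\<Sum>i\<in>I. ?w (d i)) = N}"
    using I Y cl by (intro coeff_mono_sum) (auto intro!: GC.finprod_in finite_PiE)
  finally show ?thesis .
qed

lemma D_finsum:
  assumes "Y \<in> carrier UF" "finite C" "\<And>c. c \<in> C \<Longrightarrow> f c \<in> carrier \<Gamma>"
  shows "D Y N (finsum \<Gamma> f C) = finsum \<Gamma> (\<lambda>c. D Y N (f c)) C"
  using assms Phi_closed unfolding D_def
  by (subst ring_hom_finsum[OF Gamma_cring UG_cring Phi_lift(1)]) (auto intro!: GC.coeff_finsum_UP)

text \<open>A matrix determines its row sums, so a sum over vectors c followed by a sum over the
  matrices with row sums c is one sum over matrices, with \<open>R\<close> imposed on the row
  sums.\<close>

lemma D_mat_sum: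
  assumes I: "finite I" "\<And>i. i \<in> I \<Longrightarrow> x i \<in> carrier F"
    and Y: "Y \<in> carrier UF" "finite K" "supp Y \<subseteq> K"
  shows "D Y N (mat_sum I m R x)
    = mat_sum (I \<times> K) m
        (\<lambda>d. R (\<lambda>i\<in>I. \<Sum>k\<in>K. d (i, k)) \<and> (\<Sum>i\<in>I. \<Sum>k\<in>K. k * d (i, k)) = N)
        (\<lambda>p. x (fst p) \<otimes>\<^bsub>F\<^esub> cf Y (snd p))"
proof -
  let ?C = "{c \<in> comps I m. R c}"
  let ?E = "\<lambda>c. {d \<in> PiE I (\<lambda>i. comps K (c i)). (\<Sum>i\<in>I. \<Sum>k\<in>K. k * d i k) = N}"
  let ?g = "\<lambda>d. finprod \<Gamma> (\<lambda>i. finprod \<Gamma> (\<lambda>k. \<gamma> (d i k) (x i \<otimes>\<^bsub>F\<^esub> cf Y k)) K) I"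
  let ?T = "{d \<in> comps (I \<times> K) m. R (\<lambda>i\<in>I. \<Sum>k\<in>K. d (i, k)) \<and> (\<Sum>i\<in>I. \<Sum>k\<in>K. k * d (i, k)) = N}"
  have finE: "finite (?E c)" for c
    using I Y by (intro finite_subset[OF _ finite_PiE[of I "\<lambda>i. comps K (c i)"]]) auto
  have cl: "?g d \<in> carrier \<Gamma>" for d using I Y by (intro GC.finprod_in) auto
  have "D Y N (mat_sum I m R x) = finsum \<Gamma> (\<lambda>c. D Y N (finprod \<Gamma> (\<lambda>i. \<gamma> (c i) (x i)) I)) ?C"
    unfolding mat_sum_def using I Y by (intro D_finsum) (auto intro!: GC.finprod_in)
  also have "\<dots> = finsum \<Gamma> (\<lambda>c. finsum \<Gamma> ?g (?E c)) ?C"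
    using D_finprod[OF I Y] cl by (intro GC.add.finprod_cong2) (auto intro!: GC.add.finprod_in)
  also have "\<dots> = finsum \<Gamma> (\<lambda>p. ?g (snd p)) (Sigma ?C ?E)"
    using I finE cl by (subst GC.add.finprod_Sigma) auto
  also have "\<dots> = finsum \<Gamma> (\<lambda>d. ?g (\<lambda>i k. d (i, k))) ?T"
  proof -
    define h where "h = (\<lambda>d :: _ \<times> nat \<Rightarrow> nat. (\<lambda>i\<in>I. \<Sum>k\<in>K. d (i, k), \<lambda>i\<in>I. \<lambda>k\<in>K. d (i, k)))"
    have "bij_betw h ?T (Sigma ?C ?E)"
    proof (rule bij_betw_byWitness[where f' = "\<lambda>(c, d). \<lambda>(i, k)\<in>I \<times> K. d i k"])
      show "\<forall>d\<in>?T. (case h d of (c, d) \<Rightarrow> \<lambda>(i, k)\<in>I \<times> K. d i k) = d"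
        by (auto simp: h_def fun_eq_iff comps_def restrict_def PiE_iff extensional_def)
      show "\<forall>p\<in>Sigma ?C ?E. h (case p of (c, d) \<Rightarrow> \<lambda>(i, k)\<in>I \<times> K. d i k) = p"
      proof clarify
        fix c d assume c: "c \<in> comps I m" and d: "d \<in> PiE I (\<lambda>i. comps K (c i))"
        have di: "d i \<in> extensional K" "sum (d i) K = c i" if "i \<in> I" for i
          using PiE_mem[OF d that] by (auto simp: comps_def PiE_iff)
        have "(\<lambda>i\<in>I. \<Sum>k\<in>K. (\<lambda>(i, k)\<in>I \<times> K. d i k) (i, k)) = c"
        proof
          fix i show "(\<lambda>i\<in>I. \<Sum>k\<in>K. (\<lambda>(i, k)\<in>I \<times> K. d i k) (i, k)) i = c i"
            using di[of i] c by (cases "i \<in> I") (auto simp: comps_def PiE_iff extensional_def)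
        qed
        moreover have "(\<lambda>i\<in>I. \<lambda>k\<in>K. (\<lambda>(i, k)\<in>I \<times> K. d i k) (i, k)) = d"
        proof
          fix i show "(\<lambda>i\<in>I. \<lambda>k\<in>K. (\<lambda>(i, k)\<in>I \<times> K. d i k) (i, k)) i = d i"
            using di[of i] d by (cases "i \<in> I") (auto simp: PiE_iff extensional_def fun_eq_iff)
        qed
        ultimately show "h (\<lambda>(i, k)\<in>I \<times> K. d i k) = (c, d)" unfolding h_def by simp
      qed
      show "h ` ?T \<subseteq> Sigma ?C ?E"
      proof (rule image_subsetI)
        fix d assume d: "d \<in> ?T"
        have "(\<lambda>i\<in>I. \<Sum>k\<in>K. d (i, k)) \<in> comps I m"
          using d by (auto simp: comps_def sum_pairs)
        moreover have "(\<lambda>i\<in>I. \<lambda>k\<in>K. d (i, k)) \<in> ?E (\<lambda>i\<in>I. \<Sum>k\<in>K. d (i, k))"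
          using d by (auto simp: comps_def)
        ultimately show "h d \<in> Sigma ?C ?E" using d unfolding h_def by blast
      qed
      show "(\<lambda>(c, d). \<lambda>(i, k)\<in>I \<times> K. d i k) ` Sigma ?C ?E \<subseteq> ?T"
      proof clarify
        fix c d assume c: "c \<in> comps I m" "R c" and d: "d \<in> PiE I (\<lambda>i. comps K (c i))"
        have di: "sum (d i) K = c i" if "i \<in> I" for i
          using PiE_mem[OF d that] by (auto simp: comps_def PiE_iff)
        have "(\<lambda>i\<in>I. \<Sum>k\<in>K. (\<lambda>(i, k)\<in>I \<times> K. d i k) (i, k)) = c"
        proof
          fix i show "(\<lambda>i\<in>I. \<Sum>k\<in>K. (\<lambda>(i, k)\<in>I \<times> K. d i k) (i, k)) i = c i"
            using di[of i] c by (cases "i \<in> I") (auto simp: comps_def PiE_iff extensional_def)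
        qed
        then show "(\<lambda>(i, k)\<in>I \<times> K. d i k) \<in> comps (I \<times> K) m \<and>
           R (\<lambda>i\<in>I. \<Sum>k\<in>K. (\<lambda>(i, k)\<in>I \<times> K. d i k) (i, k)) \<and>
           (\<Sum>i\<in>I. \<Sum>k\<in>K. k * (\<lambda>(i, k)\<in>I \<times> K. d i k) (i, k)) = (\<Sum>i\<in>I. \<Sum>k\<in>K. k * d i k)"
          using c di by (simp add: comps_def sum_pairs)
      qed
    qed
    from GC.add.finprod_bij[OF this, of "\<lambda>p. ?g (snd p)"] cl
    have "finsum \<Gamma> (\<lambda>p. ?g (snd p)) (Sigma ?C ?E) = finsum \<Gamma> (\<lambda>d. ?g (snd (h d))) ?T" by simp
    also have "\<dots> = finsum \<Gamma> (\<lambda>d. ?g (\<lambda>i k. d (i, k))) ?T"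
      using I Y by (intro GC.add.finprod_cong2) (auto simp: h_def intro!: GC.finprod_cong2 GC.finprod_in)
    finally show ?thesis .
  qed
  also have "\<dots> = mat_sum (I \<times> K) m
        (\<lambda>d. R (\<lambda>i\<in>I. \<Sum>k\<in>K. d (i, k)) \<and> (\<Sum>i\<in>I. \<Sum>k\<in>K. k * d (i, k)) = N)
        (\<lambda>p. x (fst p) \<otimes>\<^bsub>F\<^esub> cf Y (snd p))"
    unfolding mat_sum_def using I Y
    by (intro GC.add.finprod_cong2) (auto simp: GC.finprod_Sigma intro!: GC.finprod_in)
  finally show ?thesis .
qed

lemma mat_sum_reindex:
  assumes I: "finite I" "\<And>i. i \<in> I \<Longrightarrow> x i \<in> carrier F" and h: "bij_betw h J I"
    and R: "\<And>c. c \<in> comps I m \<Longrightarrow> R c \<longleftrightarrow> R' (\<lambda>j\<in>J. c (h j))"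
    and x: "\<And>j. j \<in> J \<Longrightarrow> x' j = x (h j)"
  shows "mat_sum I m R x = mat_sum J m R' x'"
proof -
  have J: "finite J" using bij_betw_finite[OF h] I by simp
  have hJ: "h j \<in> I" if "j \<in> J" for j using bij_betwE[OF h] that by blast
  have inv: "inv_into J h i \<in> J" "h (inv_into J h i) = i" if "i \<in> I" for i
    using that h by (auto simp: bij_betw_def inv_into_into f_inv_into_f)
  have inv': "inv_into J h (h j) = j" if "j \<in> J" for j
    using that h by (simp add: bij_betw_def inv_into_f_f)
  have bij: "bij_betw (\<lambda>c. \<lambda>j\<in>J. c (h j)) {c \<in> comps I m. R c} {c \<in> comps J m. R' c}"
  proof (rule bij_betw_byWitness[where f' = "\<lambda>c. \<lambda>i\<in>I. c (inv_into J h i)"])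
    show "\<forall>c\<in>{c \<in> comps I m. R c}. (\<lambda>i\<in>I. (\<lambda>j\<in>J. c (h j)) (inv_into J h i)) = c"
      using inv by (auto simp: fun_eq_iff comps_def PiE_iff extensional_def)
    show ret: "\<forall>c\<in>{c \<in> comps J m. R' c}. (\<lambda>j\<in>J. (\<lambda>i\<in>I. c (inv_into J h i)) (h j)) = c"
      using inv' hJ by (auto simp: fun_eq_iff comps_def PiE_iff extensional_def)
    show "(\<lambda>c. \<lambda>j\<in>J. c (h j)) ` {c \<in> comps I m. R c} \<subseteq> {c \<in> comps J m. R' c}"
      using R sum.reindex_bij_betw[OF h] by (auto simp: comps_def)
    show "(\<lambda>c. \<lambda>i\<in>I. c (inv_into J h i)) ` {c \<in> comps J m. R' c} \<subseteq> {c \<in> comps I m. R c}"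
    proof clarify
      fix c assume c: "c \<in> comps J m" "R' c"
      have "sum (\<lambda>i. c (inv_into J h i)) I = sum c J"
        using sum.reindex_bij_betw[OF bij_betw_inv_into[OF h], of c] by simp
      then have 1: "(\<lambda>i\<in>I. c (inv_into J h i)) \<in> comps I m" using c by (auto simp: comps_def)
      then show "(\<lambda>i\<in>I. c (inv_into J h i)) \<in> comps I m \<and> R (\<lambda>i\<in>I. c (inv_into J h i))"
        using R[OF 1] ret c by auto
    qed
  qed
  have "mat_sum J m R' x' = finsum \<Gamma> (\<lambda>c. finprod \<Gamma> (\<lambda>j. \<gamma> ((\<lambda>j\<in>J. c (h j)) j) (x' j)) J) {c \<in> comps I m. R c}"
    unfolding mat_sum_def using I J x hJ
    by (subst GC.add.finprod_bij[OF bij]) (auto intro!: GC.finprod_in)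
  also have "\<dots> = mat_sum I m R x"
    unfolding mat_sum_def
  proof (rule GC.add.finprod_cong2)
    fix c
    have "finprod \<Gamma> (\<lambda>i. \<gamma> (c i) (x i)) I = finprod \<Gamma> (\<lambda>j. \<gamma> (c (h j)) (x (h j))) J"
      using I by (intro GC.finprod_bij[OF h]) auto
    also have "\<dots> = finprod \<Gamma> (\<lambda>j. \<gamma> ((\<lambda>j\<in>J. c (h j)) j) (x' j)) J"
      using I x hJ by (intro GC.finprod_cong2) auto
    finally show "finprod \<Gamma> (\<lambda>j. \<gamma> ((\<lambda>j\<in>J. c (h j)) j) (x' j)) J = finprod \<Gamma> (\<lambda>i. \<gamma> (c i) (x i)) I" ..
    show "finprod \<Gamma> (\<lambda>i. \<gamma> (c i) (x i)) I \<in> carrier \<Gamma>" using I by (intro GC.finprod_in) auto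
  qed
  finally show ?thesis ..
qed

lemma D_tcoeff:
  assumes Z: "Z \<in> carrier UF" and Y: "Y \<in> carrier UF"
  shows "D Y N (tcoeff m Z M) = mat_sum (supp Z \<times> supp Y) m
    (\<lambda>d. (\<Sum>k\<in>supp Z. k * (\<Sum>l\<in>supp Y. d (k, l))) = M \<and> (\<Sum>k\<in>supp Z. \<Sum>l\<in>supp Y. l * d (k, l)) = N)
    (\<lambda>p. cf Z (fst p) \<otimes>\<^bsub>F\<^esub> cf Y (snd p))"
  using D_mat_sum[OF finite_supp[OF Z] _ Y finite_supp[OF Y] subset_refl, of "cf Z"]
    tcoeff_formula[OF Z finite_supp[OF Z] subset_refl] Z
  by simp

text \<open>Transposing the matrices exchanges Z with Y and M with N. This symmetry makes the second
  product well defined and also commutative.\<close>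

lemma D_sym:
  assumes Z: "Z \<in> carrier UF" and Y: "Y \<in> carrier UF"
  shows "D Y N (tcoeff m Z M) = D Z M (tcoeff m Y N)"
  unfolding D_tcoeff[OF Z Y] D_tcoeff[OF Y Z]
proof (rule mat_sum_reindex[where h = prod.swap])
  show "bij_betw prod.swap (supp Y \<times> supp Z) (supp Z \<times> supp Y)"
    by (auto simp: bij_betw_def)
  fix d :: "nat \<times> nat \<Rightarrow> nat"
  have "(\<Sum>k\<in>supp Z. k * (\<Sum>l\<in>supp Y. d (k, l))) = (\<Sum>l\<in>supp Y. \<Sum>k\<in>supp Z. k * d (k, l))"
    by (simp add: sum_distrib_left, rule sum.swap)
  moreover have "(\<Sum>k\<in>supp Z. \<Sum>l\<in>supp Y. l * d (k, l)) = (\<Sum>l\<in>supp Y. l * (\<Sum>k\<in>supp Z. d (k, l)))"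
    by (simp add: sum_distrib_left, rule sum.swap)
  ultimately show "((\<Sum>k\<in>supp Z. k * (\<Sum>l\<in>supp Y. d (k, l))) = M \<and> (\<Sum>k\<in>supp Z. \<Sum>l\<in>supp Y. l * d (k, l)) = N)
    \<longleftrightarrow> ((\<Sum>k\<in>supp Y. k * (\<Sum>l\<in>supp Z. (\<lambda>j\<in>supp Y \<times> supp Z. d (prod.swap j)) (k, l))) = N \<and>
      (\<Sum>k\<in>supp Y. \<Sum>l\<in>supp Z. l * (\<lambda>j\<in>supp Y \<times> supp Z. d (prod.swap j)) (k, l)) = M)"
    by auto
qed (use assms finite_supp in \<open>auto simp: FC.m_comm\<close>)

text \<open>Both sides are sums over three-dimensional arrays indexed by the exponents of Z, Y and
  W, with one weight prescribed in each direction. Associativity of the second product comes from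
  here.\<close>

lemma D_commute:
  assumes Z: "Z \<in> carrier UF" and Y: "Y \<in> carrier UF" and W: "W \<in> carrier UF"
  shows "D W L (D Y N (tcoeff m Z M)) = D Y N (D W L (tcoeff m Z M))"
proof -
  let ?x = "\<lambda>Y W p. cf Z (fst (fst p)) \<otimes>\<^bsub>F\<^esub> cf Y (snd (fst p)) \<otimes>\<^bsub>F\<^esub> cf W (snd p)"
  let ?R = "\<lambda>Y W N L d. ((\<Sum>k\<in>supp Z. k * (\<Sum>l\<in>supp Y. \<Sum>j\<in>supp W. d ((k, l), j))) = M \<and>
      (\<Sum>k\<in>supp Z. \<Sum>l\<in>supp Y. l * (\<Sum>j\<in>supp W. d ((k, l), j))) = N) \<and>
      (\<Sum>k\<in>supp Z. \<Sum>l\<in>supp Y. \<Sum>j\<in>supp W. j * d ((k, l), j)) = L"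
  have formula: "D W L (D Y N (tcoeff m Z M)) = mat_sum ((supp Z \<times> supp Y) \<times> supp W) m (?R Y W N L) (?x Y W)"
    if Y: "Y \<in> carrier UF" and W: "W \<in> carrier UF" for Y W L N
    unfolding D_tcoeff[OF Z Y] using Z Y W
    by (subst D_mat_sum[OF _ _ W finite_supp[OF W] subset_refl]) (auto simp: finite_supp sum_pairs cong: conj_cong)
  show ?thesis unfolding formula[OF Y W] formula[OF W Y]
  proof (rule mat_sum_reindex[where h = "\<lambda>((k, j), l). ((k, l), j)"])
    show "bij_betw (\<lambda>((k, j), l). ((k, l), j)) ((supp Z \<times> supp W) \<times> supp Y) ((supp Z \<times> supp Y) \<times> supp W)"
      by (rule bij_betw_byWitness[where f' = "\<lambda>((k, j), l). ((k, l), j)"]) auto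
    fix d :: "(nat \<times> nat) \<times> nat \<Rightarrow> nat"
    have 1: "(\<Sum>l\<in>supp Y. \<Sum>j\<in>supp W. d ((k, l), j)) = (\<Sum>j\<in>supp W. \<Sum>l\<in>supp Y. d ((k, l), j))" for k
      by (rule sum.swap)
    have 2: "(\<Sum>l\<in>supp Y. l * (\<Sum>j\<in>supp W. d ((k, l), j))) = (\<Sum>j\<in>supp W. \<Sum>l\<in>supp Y. l * d ((k, l), j))" for k
      by (simp add: sum_distrib_left, rule sum.swap)
    have 3: "(\<Sum>l\<in>supp Y. \<Sum>j\<in>supp W. j * d ((k, l), j)) = (\<Sum>j\<in>supp W. j * (\<Sum>l\<in>supp Y. d ((k, l), j)))" for k
      by (simp add: sum_distrib_left, rule sum.swap)
    show "?R Y W N L d \<longleftrightarrow> ?R W Y L N (\<lambda>p\<in>(supp Z \<times> supp W) \<times> supp Y. d ((\<lambda>((k, j), l). ((k, l), j)) p))"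
      unfolding 1 2 3 by auto
  qed (use Z Y W finite_supp in \<open>auto simp: FC.m_ac\<close>)
qed

end

section \<open>Spanning elements and the construction of the second product\<close>

context dp_algebra
begin

lemma coeff_finsum_monom:
  assumes "finite I" "inj_on e I" "\<And>i. i \<in> I \<Longrightarrow> x i \<in> carrier F" "i \<in> I"
  shows "cf (finsum UF (\<lambda>i. up_ring.monom UF (x i) (e i)) I) (e i) = x i"
proof -
  have "cf (finsum UF (\<lambda>i. up_ring.monom UF (x i) (e i)) I) (e i) = (\<Oplus>\<^bsub>F\<^esub>j\<in>I. if i = j then x j else \<zero>\<^bsub>F\<^esub>)"
    using assms by (subst FC.coeff_finsum_UP) (auto intro!: FC.add.finprod_cong2 simp: inj_on_eq_iff)
  also have "\<dots> = x i" using assms by (subst FC.finsum_singleton) auto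
  finally show ?thesis .
qed

lemma supp_finsum_monom:
  assumes "\<And>i. i \<in> I \<Longrightarrow> x i \<in> carrier F"
  shows "supp (finsum UF (\<lambda>i. up_ring.monom UF (x i) (e i)) I) \<subseteq> e ` I"
proof
  fix k assume k: "k \<in> supp (finsum UF (\<lambda>i. up_ring.monom UF (x i) (e i)) I)"
  show "k \<in> e ` I"
  proof (rule ccontr)
    assume "k \<notin> e ` I"
    then have "(\<Oplus>\<^bsub>F\<^esub>i\<in>I. cf (up_ring.monom UF (x i) (e i)) k) = \<zero>\<^bsub>F\<^esub>"
      using assms by (intro FC.add.finprod_one_eqI) auto
    then show False using k assms unfolding supp_def by (subst (asm) FC.coeff_finsum_UP) auto
  qed
qed

text \<open>The exponents are powers of a base exceeding the total degree, so that one coefficient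
  isolates one product of divided powers.\<close>

lemma finprod_dpow_kronecker:
  fixes k n :: nat
  defines "e \<equiv> \<lambda>i :: nat. (n + 1) ^ i"
  assumes x: "\<And>i. i < k \<Longrightarrow> x i \<in> carrier F" and c: "sum c {..<k} = n" and n: "0 < n"
  obtains Y where "Y \<in> carrier UF" "supp Y \<subseteq> e ` {..<k}" "\<And>i. i < k \<Longrightarrow> cf Y (e i) = x i"
    "finprod \<Gamma> (\<lambda>i. \<gamma> (c i) (x i)) {..<k} = tcoeff n Y (\<Sum>i<k. e i * c i)"
proof -
  have inj: "inj_on e {..<k}" using n by (auto simp: e_def inj_on_def)
  define Y where "Y = finsum UF (\<lambda>i. up_ring.monom UF (x i) (e i)) {..<k}"
  define N where "N = (\<Sum>i<k. e i * c i)"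
  have Y: "Y \<in> carrier UF" unfolding Y_def using x by (intro UF.P.add.finprod_in) auto
  have cfY: "cf Y (e i) = x i" if "i < k" for i
    unfolding Y_def using that x inj by (intro coeff_finsum_monom) auto
  have suppY: "supp Y \<subseteq> e ` {..<k}" unfolding Y_def using x by (intro supp_finsum_monom) auto
  have bij: "bij_betw e {..<k} (e ` {..<k})" using inj by (simp add: bij_betw_def)
  have S: "{d \<in> comps {..<k} n. (\<Sum>i<k. e i * d i) = N} = {restrict c {..<k}}"
  proof (intro equalityI subsetI)
    fix d assume d: "d \<in> {d \<in> comps {..<k} n. (\<Sum>i<k. e i * d i) = N}"
    have le: "d i \<le> n" "c i \<le> n" if "i < k" for i
      using d c that member_le_sum[of i "{..<k}" d] member_le_sum[of i "{..<k}" c] by (auto simp: comps_def)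
    have "d i = c i" if "i < k" for i
      using digits_unique[of k d n c i] d le that by (auto simp: N_def e_def)
    then show "d \<in> {restrict c {..<k}}"
      using d by (auto simp: comps_def PiE_iff extensional_def fun_eq_iff)
  qed (use c in \<open>auto simp: comps_def N_def\<close>)
  have "tcoeff n Y N = mat_sum (e ` {..<k}) n (\<lambda>c. (\<Sum>j\<in>e ` {..<k}. j * c j) = N) (cf Y)"
    by (rule tcoeff_formula[OF Y _ suppY]) simp
  also have "\<dots> = mat_sum {..<k} n (\<lambda>d. (\<Sum>i<k. e i * d i) = N) x"
    using Y cfY inj by (intro mat_sum_reindex[OF _ _ bij]) (auto simp: sum.reindex)
  also have "\<dots> = finprod \<Gamma> (\<lambda>i. \<gamma> (restrict c {..<k} i) (x i)) {..<k}"
    unfolding mat_sum_def S using x by (simp add: GC.finprod_in)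
  also have "\<dots> = finprod \<Gamma> (\<lambda>i. \<gamma> (c i) (x i)) {..<k}"
    using x by (intro GC.finprod_cong2) auto
  finally show thesis using that[OF Y suppY cfY] by (simp add: N_def)
qed

lemma finprod_dpow_tcoeff:
  fixes k :: nat
  assumes x: "\<And>i. i < k \<Longrightarrow> x i \<in> carrier F" and c: "sum c {..<k} = n" and n: "0 < n"
  obtains Y N where "Y \<in> carrier UF" "finprod \<Gamma> (\<lambda>i. \<gamma> (c i) (x i)) {..<k} = tcoeff n Y N"
proof (rule finprod_dpow_kronecker[of k x c n, OF _ c n])
  show "x i \<in> carrier F" if "i < k" for i using that by (rule x)
  show thesis if "Y \<in> carrier UF" "finprod \<Gamma> (\<lambda>i. \<gamma> (c i) (x i)) {..<k} = tcoeff n Y (\<Sum>i<k. (n + 1) ^ i * c i)" for Y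
    using that by (rule \<open>\<And>Y N. \<lbrakk> Y \<in> carrier UF; finprod \<Gamma> (\<lambda>i. \<gamma> (c i) (x i)) {..<k} = tcoeff n Y N \<rbrakk> \<Longrightarrow> thesis\<close>)
qed

lemma tcoeff_deg: "Y \<in> carrier UF \<Longrightarrow> tcoeff n Y N \<in> Gamma_deg A F n"
  using tcoeff_formula[OF _ finite_supp subset_refl] finite_supp
  by (auto intro!: mat_sum_deg)

lemma tcoeff_induct:
  assumes "0 < n" "submodule H A \<Gamma>" "\<And>Y N. Y \<in> carrier UF \<Longrightarrow> tcoeff n Y N \<in> H"
  shows "Gamma_deg A F n \<subseteq> H"
proof (rule Gamma_deg_induct[OF assms(2)])
  fix k :: nat and c x assume "\<And>i. i < k \<Longrightarrow> x i \<in> carrier F" "sum c {..<k} = n"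
  then show "finprod \<Gamma> (\<lambda>i. \<gamma> (c i) (x i)) {..<k} \<in> H"
    using finprod_dpow_tcoeff[of k x c n] assms(1,3) by metis
qed

text \<open>Linearity is asked on the component of degree n, but values may lie anywhere in
  \<open>\<Gamma>\<close>. In this way \<open>D Y N\<close> qualifies before it is known to preserve
  the degree.\<close>

definition lin_on where
  "lin_on n f \<longleftrightarrow> (\<forall>u\<in>Gamma_deg A F n. f u \<in> carrier \<Gamma>) \<and>
    (\<forall>u\<in>Gamma_deg A F n. \<forall>v\<in>Gamma_deg A F n. f (u \<oplus>\<^bsub>\<Gamma>\<^esub> v) = f u \<oplus>\<^bsub>\<Gamma>\<^esub> f v) \<and>
    (\<forall>a\<in>carrier A. \<forall>u\<in>Gamma_deg A F n. f (a \<odot>\<^bsub>\<Gamma>\<^esub> u) = a \<odot>\<^bsub>\<Gamma>\<^esub> f u)"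

lemma Gamma_deg_closures:
  "\<zero>\<^bsub>\<Gamma>\<^esub> \<in> Gamma_deg A F n"
  "u \<in> Gamma_deg A F n \<Longrightarrow> v \<in> Gamma_deg A F n \<Longrightarrow> u \<oplus>\<^bsub>\<Gamma>\<^esub> v \<in> Gamma_deg A F n"
  "u \<in> Gamma_deg A F n \<Longrightarrow> \<ominus>\<^bsub>\<Gamma>\<^esub> u \<in> Gamma_deg A F n"
  "a \<in> carrier A \<Longrightarrow> u \<in> Gamma_deg A F n \<Longrightarrow> a \<odot>\<^bsub>\<Gamma>\<^esub> u \<in> Gamma_deg A F n"
  using G.submoduleE[OF Gamma_deg_submodule] subgroup.one_closed[OF submodule.axioms(1)[OF Gamma_deg_submodule]]
  by auto

lemma minus_smult: "u \<in> carrier \<Gamma> \<Longrightarrow> \<ominus>\<^bsub>\<Gamma>\<^esub> u = (\<ominus>\<^bsub>A\<^esub> \<one>\<^bsub>A\<^esub>) \<odot>\<^bsub>\<Gamma>\<^esub> u"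
  by (simp add: G.smult_l_minus)

lemma submoduleI':
  assumes "H \<subseteq> carrier \<Gamma>" "\<zero>\<^bsub>\<Gamma>\<^esub> \<in> H" "\<And>a b. a \<in> H \<Longrightarrow> b \<in> H \<Longrightarrow> a \<oplus>\<^bsub>\<Gamma>\<^esub> b \<in> H"
    "\<And>a x. a \<in> carrier A \<Longrightarrow> x \<in> H \<Longrightarrow> a \<odot>\<^bsub>\<Gamma>\<^esub> x \<in> H"
  shows "submodule H A \<Gamma>"
  using assms minus_smult by (intro G.submoduleI) auto

lemma lin_on_zero: "lin_on n f \<Longrightarrow> f \<zero>\<^bsub>\<Gamma>\<^esub> = \<zero>\<^bsub>\<Gamma>\<^esub>"
proof -
  assume f: "lin_on n f"
  have "f (\<zero>\<^bsub>A\<^esub> \<odot>\<^bsub>\<Gamma>\<^esub> \<zero>\<^bsub>\<Gamma>\<^esub>) = \<zero>\<^bsub>A\<^esub> \<odot>\<^bsub>\<Gamma>\<^esub> f \<zero>\<^bsub>\<Gamma>\<^esub>"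
    using f Gamma_deg_closures(1) AC.zero_closed unfolding lin_on_def by blast
  moreover have "f \<zero>\<^bsub>\<Gamma>\<^esub> \<in> carrier \<Gamma>" using f Gamma_deg_closures(1) unfolding lin_on_def by blast
  ultimately show ?thesis by simp
qed

lemma lin_on_ext:
  assumes n: "0 < n" and f: "lin_on n f" and g: "lin_on n g"
    and eq: "\<And>Y N. Y \<in> carrier UF \<Longrightarrow> f (tcoeff n Y N) = g (tcoeff n Y N)"
    and u: "u \<in> Gamma_deg A F n"
  shows "f u = g u"
proof -
  have "submodule {u \<in> Gamma_deg A F n. f u = g u} A \<Gamma>"
    using f g lin_on_zero[OF f] lin_on_zero[OF g] Gamma_deg_closures Gamma_deg_closed
    by (intro submoduleI') (auto simp: lin_on_def)
  from tcoeff_induct[OF n this] show ?thesis using eq tcoeff_deg u by blast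
qed

lemma lin_on_deg:
  assumes n: "0 < n" and f: "lin_on n f"
    and "\<And>Y N. Y \<in> carrier UF \<Longrightarrow> f (tcoeff n Y N) \<in> Gamma_deg A F n" and u: "u \<in> Gamma_deg A F n"
  shows "f u \<in> Gamma_deg A F n"
proof -
  have "submodule {u \<in> Gamma_deg A F n. f u \<in> Gamma_deg A F n} A \<Gamma>"
    using f lin_on_zero[OF f] Gamma_deg_closures Gamma_deg_closed
    by (intro submoduleI') (auto simp: lin_on_def)
  from tcoeff_induct[OF n this] show ?thesis using assms(3) tcoeff_deg u by blast
qed

lemma lin_on_D: "Y \<in> carrier UF \<Longrightarrow> lin_on n (D Y N)"
  unfolding lin_on_def using Gamma_deg_closed D_closed D_add D_smult by auto

lemma D_deg:
  assumes "0 < n" "Y \<in> carrier UF" "u \<in> Gamma_deg A F n"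
  shows "D Y N u \<in> Gamma_deg A F n"
proof (rule lin_on_deg[OF assms(1) lin_on_D[OF assms(2)] _ assms(3)])
  fix Z M assume Z: "Z \<in> carrier UF"
  show "D Y N (tcoeff n Z M) \<in> Gamma_deg A F n"
    unfolding D_tcoeff[OF Z assms(2)]
    using Z assms(2) by (intro mat_sum_deg) (auto intro: finite_supp)
qed

text \<open>For fixed v, the product is a linear map in u with prescribed values on the elements
  \<open>tcoeff n Y N\<close>. These span for n > 0, so the choice is unique on degree n once
  \<open>norm_mult_ex\<close> has shown that such a map exists.\<close>

definition norm_mult where
  "norm_mult n u v = (SOME f. lin_on n f \<and> (\<forall>Y\<in>carrier UF. \<forall>N. f (tcoeff n Y N) = D Y N v)) u"

text \<open>The v that admit such a map form a submodule, so it suffices to treat v =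
  \<open>tcoeff n Z M\<close>. There \<open>D Z M\<close> is the required map by
  \<open>D_sym\<close>, and the relations among the spanning elements never have to be
  examined.\<close>

lemma norm_mult_ex:
  assumes n: "0 < n" and v: "v \<in> Gamma_deg A F n"
  shows "\<exists>f. lin_on n f \<and> (\<forall>Y\<in>carrier UF. \<forall>N. f (tcoeff n Y N) = D Y N v)"
proof -
  let ?P = "\<lambda>v f. lin_on n f \<and> (\<forall>Y\<in>carrier UF. \<forall>N. f (tcoeff n Y N) = D Y N v)"
  have "submodule {v \<in> carrier \<Gamma>. \<exists>f. ?P v f} A \<Gamma>"
  proof (rule submoduleI')
    have "?P \<zero>\<^bsub>\<Gamma>\<^esub> (\<lambda>_. \<zero>\<^bsub>\<Gamma>\<^esub>)"
      using lin_on_zero[OF lin_on_D] by (auto simp: lin_on_def)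
    then show "\<zero>\<^bsub>\<Gamma>\<^esub> \<in> {v \<in> carrier \<Gamma>. \<exists>f. ?P v f}" by auto
  next
    fix v w assume "v \<in> {v \<in> carrier \<Gamma>. \<exists>f. ?P v f}" "w \<in> {v \<in> carrier \<Gamma>. \<exists>f. ?P v f}"
    then obtain f g where fg: "v \<in> carrier \<Gamma>" "w \<in> carrier \<Gamma>" "?P v f" "?P w g" by blast
    have "?P (v \<oplus>\<^bsub>\<Gamma>\<^esub> w) (\<lambda>u. f u \<oplus>\<^bsub>\<Gamma>\<^esub> g u)"
      using fg D_add tcoeff_deg by (auto simp: lin_on_def GC.a_ac G.smult_r_distr)
    then show "v \<oplus>\<^bsub>\<Gamma>\<^esub> w \<in> {v \<in> carrier \<Gamma>. \<exists>f. ?P v f}" using fg by blast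
  next
    fix a v assume a: "a \<in> carrier A" and "v \<in> {v \<in> carrier \<Gamma>. \<exists>f. ?P v f}"
    then obtain f where f: "v \<in> carrier \<Gamma>" "?P v f" by blast
    have "b \<odot>\<^bsub>\<Gamma>\<^esub> (a \<odot>\<^bsub>\<Gamma>\<^esub> x) = a \<odot>\<^bsub>\<Gamma>\<^esub> (b \<odot>\<^bsub>\<Gamma>\<^esub> x)" if "b \<in> carrier A" "x \<in> carrier \<Gamma>" for b x
      using that a by (simp flip: G.smult_assoc1 add: AC.m_comm)
    then have "?P (a \<odot>\<^bsub>\<Gamma>\<^esub> v) (\<lambda>u. a \<odot>\<^bsub>\<Gamma>\<^esub> f u)"
      using f a D_smult by (auto simp: lin_on_def G.smult_r_distr)
    then show "a \<odot>\<^bsub>\<Gamma>\<^esub> v \<in> {v \<in> carrier \<Gamma>. \<exists>f. ?P v f}" using a f by blast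
  qed auto
  moreover have "tcoeff n Z M \<in> {v \<in> carrier \<Gamma>. \<exists>f. ?P v f}" if "Z \<in> carrier UF" for Z M
    using that lin_on_D[OF that] D_sym[OF that] D_sym[OF _ that] Gamma_deg_closed[OF tcoeff_deg[OF that]]
    by (auto intro!: exI[of _ "D Z M"])
  ultimately show ?thesis using tcoeff_induct[OF n] v by blast
qed

context
  fixes n :: nat assumes n: "0 < n"
begin

lemma norm_mult_spec:
  assumes "v \<in> Gamma_deg A F n"
  shows "lin_on n (\<lambda>u. norm_mult n u v)" "Y \<in> carrier UF \<Longrightarrow> norm_mult n (tcoeff n Y N) v = D Y N v"
  using someI_ex[OF norm_mult_ex[OF n assms]] unfolding norm_mult_def by auto

lemma norm_mult_right:
  assumes "Y \<in> carrier UF" "u \<in> Gamma_deg A F n"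
  shows "norm_mult n u (tcoeff n Y N) = D Y N u"
proof (rule lin_on_ext[OF n _ lin_on_D[OF assms(1)] _ assms(2)])
  show "lin_on n (\<lambda>u. norm_mult n u (tcoeff n Y N))" using norm_mult_spec tcoeff_deg assms by blast
  show "norm_mult n (tcoeff n Z M) (tcoeff n Y N) = D Y N (tcoeff n Z M)" if "Z \<in> carrier UF" for Z M
    using that assms norm_mult_spec(2)[OF tcoeff_deg] D_sym by simp
qed

lemma norm_mult_deg:
  assumes u: "u \<in> Gamma_deg A F n" and v: "v \<in> Gamma_deg A F n"
  shows "norm_mult n u v \<in> Gamma_deg A F n"
  using lin_on_deg[OF n norm_mult_spec(1)[OF v] _ u] norm_mult_spec(2)[OF v] D_deg[OF n _ v] by simp

lemma norm_mult_lin_right: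
  assumes u: "u \<in> Gamma_deg A F n"
  shows "lin_on n (norm_mult n u)"
proof -
  have "norm_mult n u (v \<oplus>\<^bsub>\<Gamma>\<^esub> w) = norm_mult n u v \<oplus>\<^bsub>\<Gamma>\<^esub> norm_mult n u w"
    if vw: "v \<in> Gamma_deg A F n" "w \<in> Gamma_deg A F n" for v w
  proof (rule lin_on_ext[OF n _ _ _ u])
    show "lin_on n (\<lambda>u. norm_mult n u (v \<oplus>\<^bsub>\<Gamma>\<^esub> w))" by (intro norm_mult_spec Gamma_deg_closures vw)
    show "lin_on n (\<lambda>u. norm_mult n u v \<oplus>\<^bsub>\<Gamma>\<^esub> norm_mult n u w)"
      using norm_mult_spec(1)[OF vw(1)] norm_mult_spec(1)[OF vw(2)]
      by (auto simp: lin_on_def GC.a_ac G.smult_r_distr)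
    show "norm_mult n (tcoeff n Y N) (v \<oplus>\<^bsub>\<Gamma>\<^esub> w)
        = norm_mult n (tcoeff n Y N) v \<oplus>\<^bsub>\<Gamma>\<^esub> norm_mult n (tcoeff n Y N) w" if "Y \<in> carrier UF" for Y N
      using that vw D_add Gamma_deg_closures Gamma_deg_closed by (simp add: norm_mult_spec)
  qed
  moreover have "norm_mult n u (a \<odot>\<^bsub>\<Gamma>\<^esub> v) = a \<odot>\<^bsub>\<Gamma>\<^esub> norm_mult n u v"
    if a: "a \<in> carrier A" and v: "v \<in> Gamma_deg A F n" for a v
  proof (rule lin_on_ext[OF n _ _ _ u])
    show "lin_on n (\<lambda>u. norm_mult n u (a \<odot>\<^bsub>\<Gamma>\<^esub> v))" by (intro norm_mult_spec Gamma_deg_closures a v)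
    have "b \<odot>\<^bsub>\<Gamma>\<^esub> (a \<odot>\<^bsub>\<Gamma>\<^esub> x) = a \<odot>\<^bsub>\<Gamma>\<^esub> (b \<odot>\<^bsub>\<Gamma>\<^esub> x)" if "b \<in> carrier A" "x \<in> carrier \<Gamma>" for b x
      using that a by (simp flip: G.smult_assoc1 add: AC.m_comm)
    then show "lin_on n (\<lambda>u. a \<odot>\<^bsub>\<Gamma>\<^esub> norm_mult n u v)"
      using norm_mult_spec(1)[OF v] a by (auto simp: lin_on_def G.smult_r_distr)
    show "norm_mult n (tcoeff n Y N) (a \<odot>\<^bsub>\<Gamma>\<^esub> v) = a \<odot>\<^bsub>\<Gamma>\<^esub> norm_mult n (tcoeff n Y N) v"
      if "Y \<in> carrier UF" for Y N
      using that a v D_smult Gamma_deg_closures Gamma_deg_closed by (simp add: norm_mult_spec)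
  qed
  ultimately show ?thesis
    using norm_mult_deg[OF u] Gamma_deg_closed unfolding lin_on_def by blast
qed

lemma norm_mult_comm:
  assumes u: "u \<in> Gamma_deg A F n" and v: "v \<in> Gamma_deg A F n"
  shows "norm_mult n u v = norm_mult n v u"
  using norm_mult_right norm_mult_spec(2) v
  by (intro lin_on_ext[OF n norm_mult_spec(1)[OF v] norm_mult_lin_right[OF v] _ u]) simp

lemma lin_on_compose:
  "\<lbrakk> lin_on n f; lin_on n g; \<And>u. u \<in> Gamma_deg A F n \<Longrightarrow> f u \<in> Gamma_deg A F n \<rbrakk> \<Longrightarrow> lin_on n (\<lambda>u. g (f u))"
  unfolding lin_on_def by auto

text \<open>Linearity in each of the three variables reduces the claim to spanning elements, where
  it is \<open>D_commute\<close> combined with \<open>D_sym\<close>.\<close>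

lemma norm_mult_assoc:
  assumes u: "u \<in> Gamma_deg A F n" and v: "v \<in> Gamma_deg A F n" and w: "w \<in> Gamma_deg A F n"
  shows "norm_mult n (norm_mult n u v) w = norm_mult n u (norm_mult n v w)"
proof (rule lin_on_ext[OF n _ _ _ w])
  show "lin_on n (norm_mult n (norm_mult n u v))"
    using norm_mult_lin_right norm_mult_deg u v by blast
  show "lin_on n (\<lambda>w. norm_mult n u (norm_mult n v w))"
    by (rule lin_on_compose[of "norm_mult n v" "norm_mult n u"])
      (intro norm_mult_lin_right norm_mult_deg u v; assumption)+
  fix W L assume W: "W \<in> carrier UF"
  have "D W L (norm_mult n u v) = norm_mult n u (D W L v)"
  proof (rule lin_on_ext[OF n _ _ _ v])
    show "lin_on n (\<lambda>v. D W L (norm_mult n u v))"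
      by (rule lin_on_compose[of "norm_mult n u" "D W L"])
        (intro norm_mult_lin_right norm_mult_deg u lin_on_D W; assumption)+
    show "lin_on n (\<lambda>v. norm_mult n u (D W L v))"
      by (rule lin_on_compose[of "D W L" "norm_mult n u"])
        (intro norm_mult_lin_right D_deg n u lin_on_D W; assumption)+
    fix Y N assume Y: "Y \<in> carrier UF"
    have "D W L (D Y N u) = norm_mult n u (D W L (tcoeff n Y N))"
    proof (rule lin_on_ext[OF n _ _ _ u])
      show "lin_on n (\<lambda>u. D W L (D Y N u))"
        by (rule lin_on_compose[of "D Y N" "D W L"]) (intro D_deg n Y lin_on_D W; assumption)+
      show "lin_on n (\<lambda>u. norm_mult n u (D W L (tcoeff n Y N)))"
        by (intro norm_mult_spec D_deg n W tcoeff_deg Y)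
      fix Z M assume Z: "Z \<in> carrier UF"
      have "norm_mult n (tcoeff n Z M) (D W L (tcoeff n Y N)) = D Z M (D W L (tcoeff n Y N))"
        by (intro norm_mult_spec D_deg n W tcoeff_deg Y Z)
      also have "\<dots> = D W L (D Z M (tcoeff n Y N))" by (rule D_commute[OF Y W Z])
      also have "\<dots> = D W L (D Y N (tcoeff n Z M))" by (simp add: D_sym[OF Y Z])
      finally show "D W L (D Y N (tcoeff n Z M)) = norm_mult n (tcoeff n Z M) (D W L (tcoeff n Y N))" ..
    qed
    then show "D W L (norm_mult n u (tcoeff n Y N)) = norm_mult n u (D W L (tcoeff n Y N))"
      using norm_mult_right[OF Y u] by simp
  qed
  then show "norm_mult n (norm_mult n u v) (tcoeff n W L) = norm_mult n u (norm_mult n v (tcoeff n W L))"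
    using norm_mult_right[OF W] norm_mult_deg u v by simp
qed

lemma dpow_tcoeff: "x \<in> carrier F \<Longrightarrow> \<gamma> n x = tcoeff n (up_ring.monom UF x 0) 0"
  by (simp add: tcoeff_def dexp_const)

lemma dpow_deg: "x \<in> carrier F \<Longrightarrow> \<gamma> n x \<in> Gamma_deg A F n"
  by (simp add: dpow_tcoeff tcoeff_deg)

lemma norm_mult_dpow:
  assumes x: "x \<in> carrier F" and y: "y \<in> carrier F"
  shows "norm_mult n (\<gamma> n x) (\<gamma> n y) = \<gamma> n (x \<otimes>\<^bsub>F\<^esub> y)"
proof -
  have "norm_mult n (\<gamma> n x) (\<gamma> n y) = D (up_ring.monom UF x 0) 0 (\<gamma> n y)"
    using x y by (simp add: dpow_tcoeff[OF x] norm_mult_spec dpow_deg)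
  also have "\<dots> = cg (dexp (up_ring.monom UF (y \<otimes>\<^bsub>F\<^esub> x) 0) n) 0"
    using x y by (simp add: D_def Phi_lift xmul_def flip: UF.monom_mult)
  finally show ?thesis using x y by (simp add: dexp_const FC.m_comm)
qed

text \<open>The unit is gamma^n of the constant polynomial 1, and multiplying by this polynomial
  changes nothing, so \<open>Phi\<close> is the inclusion of constants.\<close>

lemma norm_mult_one:
  assumes u: "u \<in> Gamma_deg A F n"
  shows "norm_mult n (\<gamma> n \<one>\<^bsub>F\<^esub>) u = u"
proof -
  let ?I = "up_ring.monom UF \<one>\<^bsub>F\<^esub> 0"
  have "Phi ?I u = mono u 0"
  proof (rule Gamma_hom_ext)
    show "(\<lambda>u. mono u 0) \<in> ring_hom \<Gamma> UG"
      by (intro ring_hom_memI) (auto simp flip: UG.monom_mult)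
    show "Phi ?I (\<gamma> m x) = mono (\<gamma> m x) 0" if "x \<in> carrier F" for m x
      using that by (simp add: Phi_lift xmul_def dexp_const flip: UF.monom_mult)
  qed (use u Gamma_deg_closed in \<open>auto simp: Phi_lift\<close>)
  then have "D ?I 0 u = u" using u Gamma_deg_closed by (simp add: D_def)
  then show ?thesis using u by (simp add: dpow_tcoeff norm_mult_spec)
qed

lemma Gamma_deg_algebraI:
  assumes cl: "\<And>u v. \<lbrakk> u \<in> Gamma_deg A F n; v \<in> Gamma_deg A F n \<rbrakk> \<Longrightarrow> f u v \<in> Gamma_deg A F n"
    and comm: "\<And>u v. \<lbrakk> u \<in> Gamma_deg A F n; v \<in> Gamma_deg A F n \<rbrakk> \<Longrightarrow> f u v = f v u"
    and assoc: "\<And>u v w. \<lbrakk> u \<in> Gamma_deg A F n; v \<in> Gamma_deg A F n; w \<in> Gamma_deg A F n \<rbrakk>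
      \<Longrightarrow> f (f u v) w = f u (f v w)"
    and one: "\<And>u. u \<in> Gamma_deg A F n \<Longrightarrow> f (\<gamma> n \<one>\<^bsub>F\<^esub>) u = u"
    and lin: "\<And>v. v \<in> Gamma_deg A F n \<Longrightarrow> lin_on n (\<lambda>u. f u v)"
  shows "algebra A (Gamma_deg_with_mult A F n f)"
proof -
  let ?R = "Gamma_deg_with_mult A F n f"
  have [simp]: "carrier ?R = Gamma_deg A F n" "monoid.mult ?R = f" "\<one>\<^bsub>?R\<^esub> = \<gamma> n \<one>\<^bsub>F\<^esub>"
    "\<zero>\<^bsub>?R\<^esub> = \<zero>\<^bsub>\<Gamma>\<^esub>" "ring.add ?R = ring.add \<Gamma>" "module.smult ?R = module.smult \<Gamma>"
    by (simp_all add: Gamma_deg_with_mult_def)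
  note [simp] = Gamma_deg_closed Gamma_deg_closures cl assoc one dpow_deg
  have "abelian_group ?R"
  proof (rule abelian_groupI)
    show "\<exists>y\<in>carrier ?R. y \<oplus>\<^bsub>?R\<^esub> x = \<zero>\<^bsub>?R\<^esub>" if "x \<in> carrier ?R" for x
      using that by (intro bexI[of _ "\<ominus>\<^bsub>\<Gamma>\<^esub> x"]) (auto simp: GC.l_neg)
    show "x \<oplus>\<^bsub>?R\<^esub> y = y \<oplus>\<^bsub>?R\<^esub> x" if "x \<in> carrier ?R" "y \<in> carrier ?R" for x y
      using that by (simp add: GC.a_comm)
  qed (simp_all add: GC.a_assoc)
  moreover have "comm_monoid ?R"
  proof (rule comm_monoidI)
    show "x \<otimes>\<^bsub>?R\<^esub> y = y \<otimes>\<^bsub>?R\<^esub> x" if "x \<in> carrier ?R" "y \<in> carrier ?R" for x y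
      using comm[of x y] that by simp
  qed simp_all
  ultimately have "cring ?R"
    by (rule cringI) (use lin in \<open>auto simp: lin_on_def\<close>)
  then show ?thesis
    by (intro algebraI[OF AC.is_cring])
      (use lin in \<open>auto simp: lin_on_def G.smult_l_distr G.smult_r_distr G.smult_assoc1\<close>)
qed

lemma norm_mult_algebra: "algebra A (Gamma_deg_with_mult A F n (norm_mult n))"
  using norm_mult_deg norm_mult_comm norm_mult_assoc norm_mult_one norm_mult_spec(1)
  by (intro Gamma_deg_algebraI)

end

end

section \<open>Base change and the norm law\<close>

context dp_algebra
begin

lemma dpow_finsum:
  assumes "finite K" "\<And>k. k \<in> K \<Longrightarrow> z k \<in> carrier F"
  shows "(\<lambda>m. \<gamma> m (finsum F z K)) = finprod (seqs \<Gamma>) (\<lambda>k m. \<gamma> m (z k)) K"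
proof -
  interpret S: comm_monoid "seqs \<Gamma>" by (rule GC.seqs_comm_monoid)
  have cl: "(\<lambda>m. \<gamma> m x) \<in> carrier (seqs \<Gamma>)" if "x \<in> carrier F" for x
    using dpow_seq[OF that] GC.dp_seqsD(1) by blast
  show ?thesis using assms
  proof (induction K rule: finite_induct)
    case (insert k K)
    have "finsum F z (insert k K) = z k \<oplus>\<^bsub>F\<^esub> finsum F z K" using insert by (intro FC.finsum_insert) auto
    moreover have "(\<lambda>m. \<gamma> m (z k \<oplus>\<^bsub>F\<^esub> finsum F z K))
        = (\<lambda>m. \<gamma> m (z k)) \<otimes>\<^bsub>seqs \<Gamma>\<^esub> (\<lambda>m. \<gamma> m (finsum F z K))"
      using insert by (intro dpow_add FC.add.finprod_in) auto
    moreover have "finprod (seqs \<Gamma>) (\<lambda>k m. \<gamma> m (z k)) (insert k K)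
        = (\<lambda>m. \<gamma> m (z k)) \<otimes>\<^bsub>seqs \<Gamma>\<^esub> finprod (seqs \<Gamma>) (\<lambda>k m. \<gamma> m (z k)) K"
      using insert cl by (intro S.finprod_insert) auto
    ultimately show ?case using insert by simp
  qed (simp add: dpow_zero_seq)
qed

lemma smult_mult_smult:
  assumes "a \<in> carrier A" "b \<in> carrier A" "u \<in> carrier \<Gamma>" "v \<in> carrier \<Gamma>"
  shows "(a \<odot>\<^bsub>\<Gamma>\<^esub> u) \<otimes>\<^bsub>\<Gamma>\<^esub> (b \<odot>\<^bsub>\<Gamma>\<^esub> v) = (a \<otimes>\<^bsub>A\<^esub> b) \<odot>\<^bsub>\<Gamma>\<^esub> (u \<otimes>\<^bsub>\<Gamma>\<^esub> v)"
  using assms ring_hom_mult[OF pres.con_hom, of a b]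
  by (simp add: smult_eq GC.m_ac flip: Gamma_eq)

lemma finprod_smult:
  assumes "finite K" "\<And>k. k \<in> K \<Longrightarrow> s k \<in> carrier A" "\<And>k. k \<in> K \<Longrightarrow> u k \<in> carrier \<Gamma>"
  shows "finprod \<Gamma> (\<lambda>k. s k \<odot>\<^bsub>\<Gamma>\<^esub> u k) K = finprod A s K \<odot>\<^bsub>\<Gamma>\<^esub> finprod \<Gamma> u K"
  using assms
  by (induction K rule: finite_induct) (auto simp: Pi_def smult_mult_smult intro!: AC.finprod_in GC.finprod_in)

text \<open>The sum on the left is a polynomial evaluated at s^b. Stretching the exponents by b
  later leaves room for those of a second polynomial in the same variable.\<close>

lemma dpow_lincomb:
  assumes K: "finite K" and s: "s \<in> carrier A" and x: "\<And>k. k \<in> K \<Longrightarrow> x k \<in> carrier F"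
  shows "\<gamma> n (\<Oplus>\<^bsub>F\<^esub>k\<in>K. (s [^]\<^bsub>A\<^esub> (b * k :: nat)) \<odot>\<^bsub>F\<^esub> x k)
    = (\<Oplus>\<^bsub>\<Gamma>\<^esub>c\<in>comps K n. (s [^]\<^bsub>A\<^esub> (b * (\<Sum>k\<in>K. k * c k))) \<odot>\<^bsub>\<Gamma>\<^esub> finprod \<Gamma> (\<lambda>k. \<gamma> (c k) (x k)) K)"
proof -
  have *: "finprod A (\<lambda>k. s [^]\<^bsub>A\<^esub> (e k :: nat)) K = s [^]\<^bsub>A\<^esub> sum e K" for e
    using K s by (induction K rule: finite_induct) (auto simp: AC.nat_pow_mult)
  have "\<gamma> n (\<Oplus>\<^bsub>F\<^esub>k\<in>K. (s [^]\<^bsub>A\<^esub> (b * k)) \<odot>\<^bsub>F\<^esub> x k)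
      = (\<Oplus>\<^bsub>\<Gamma>\<^esub>c\<in>comps K n. finprod \<Gamma> (\<lambda>k. \<gamma> (c k) ((s [^]\<^bsub>A\<^esub> (b * k)) \<odot>\<^bsub>F\<^esub> x k)) K)"
    using s x K GC.dp_seqsD(1)[OF dpow_seq]
    by (subst fun_cong[OF dpow_finsum[OF K]]) (auto simp: GC.finprod_seqs)
  also have "\<dots> = (\<Oplus>\<^bsub>\<Gamma>\<^esub>c\<in>comps K n. (s [^]\<^bsub>A\<^esub> (b * (\<Sum>k\<in>K. k * c k))) \<odot>\<^bsub>\<Gamma>\<^esub> finprod \<Gamma> (\<lambda>k. \<gamma> (c k) (x k)) K)"
  proof (rule GC.add.finprod_cong2)
    fix c
    have "finprod \<Gamma> (\<lambda>k. \<gamma> (c k) ((s [^]\<^bsub>A\<^esub> (b * k)) \<odot>\<^bsub>F\<^esub> x k)) K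
        = finprod \<Gamma> (\<lambda>k. (s [^]\<^bsub>A\<^esub> (b * k * c k)) \<odot>\<^bsub>\<Gamma>\<^esub> \<gamma> (c k) (x k)) K"
      using s x by (intro GC.finprod_cong2) (auto simp: dpow_smult AC.nat_pow_pow)
    also have "\<dots> = finprod A (\<lambda>k. s [^]\<^bsub>A\<^esub> (b * k * c k)) K \<odot>\<^bsub>\<Gamma>\<^esub> finprod \<Gamma> (\<lambda>k. \<gamma> (c k) (x k)) K"
      using s x K by (intro finprod_smult) auto
    finally show "finprod \<Gamma> (\<lambda>k. \<gamma> (c k) ((s [^]\<^bsub>A\<^esub> (b * k)) \<odot>\<^bsub>F\<^esub> x k)) K
        = (s [^]\<^bsub>A\<^esub> (b * (\<Sum>k\<in>K. k * c k))) \<odot>\<^bsub>\<Gamma>\<^esub> finprod \<Gamma> (\<lambda>k. \<gamma> (c k) (x k)) K"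
      by (simp add: * sum_distrib_left mult.assoc)
  qed (use s x in \<open>auto intro!: GC.finprod_in\<close>)
  finally show ?thesis .
qed

end

locale dp_base_change = dp_algebra A F + BC: cring B + Balg: algebra A B
  for A :: "('a, 'm) ring_scheme" and F :: "('a, 'f, 'k) module_scheme" and B :: "('a, 'b, 'l) module_scheme"
begin

abbreviation "FB \<equiv> base_change A B F"
abbreviation "elt \<equiv> base_change_elt A B F"

sublocale bc: presentation B "carrier F" "base_change_rels A B F"
  by (simp add: presentation.intro BC.is_cring)

lemma FB_eq: "FB = bc.PA" by (simp add: base_change_def)

lemma elt_eq: "elt x = bc.gen x" by (simp add: base_change_elt_def)

lemma FB_algebra: "algebra B FB" using bc.PA_algebra by (simp add: FB_eq)

lemma FB_cring: "cring FB" using bc.PA_cring by (simp add: FB_eq)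

sublocale dB: dp_algebra B FB
  by (intro dp_algebra.intro BC.is_cring FB_cring FB_algebra)

abbreviation "\<Gamma>B \<equiv> Gamma B FB"

definition scal where "scal a = a \<odot>\<^bsub>B\<^esub> \<one>\<^bsub>B\<^esub>"

lemma scal_hom: "scal \<in> ring_hom A B"
  by (intro ring_hom_memI)
    (auto simp: scal_def Balg.smult_l_distr Balg.smult_assoc2 Balg.smult_assoc1)

lemma scal_closed [simp]: "a \<in> carrier A \<Longrightarrow> scal a \<in> carrier B"
  by (simp add: scal_def)

lemma elt_closed [simp]: "x \<in> carrier F \<Longrightarrow> elt x \<in> carrier FB"
  unfolding elt_eq FB_eq by (rule bc.gen_closed)

lemma elt_add: "\<lbrakk> x \<in> carrier F; y \<in> carrier F \<rbrakk> \<Longrightarrow> elt (x \<oplus>\<^bsub>F\<^esub> y) = elt x \<oplus>\<^bsub>FB\<^esub> elt y"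
  unfolding elt_eq FB_eq
  by (subst bc.PA_add, (auto intro!: aterms.intros)[2], rule bc.rel_eq)
    (auto intro!: aterms.intros base_change_rels.intros)

lemma elt_mult: "\<lbrakk> x \<in> carrier F; y \<in> carrier F \<rbrakk> \<Longrightarrow> elt (x \<otimes>\<^bsub>F\<^esub> y) = elt x \<otimes>\<^bsub>FB\<^esub> elt y"
  unfolding elt_eq FB_eq
  by (subst bc.PA_mult, (auto intro!: aterms.intros)[2], rule bc.rel_eq)
    (auto intro!: aterms.intros base_change_rels.intros)

lemma elt_smult: "\<lbrakk> a \<in> carrier A; x \<in> carrier F \<rbrakk> \<Longrightarrow> elt (a \<odot>\<^bsub>F\<^esub> x) = scal a \<odot>\<^bsub>FB\<^esub> elt x"
  unfolding elt_eq FB_eq scal_def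
  by (subst bc.PA_smult, (auto intro!: aterms.intros)[2], rule bc.rel_eq)
    (auto intro!: aterms.intros base_change_rels.intros)

lemma elt_one: "elt \<one>\<^bsub>F\<^esub> = \<one>\<^bsub>FB\<^esub>"
  unfolding elt_eq FB_eq bc.PA_one
  by (rule bc.rel_eq) (auto intro!: aterms.intros base_change_rels.intros)

lemma elt_hom: "elt \<in> ring_hom F FB"
  by (intro ring_hom_memI) (auto simp: elt_add elt_mult elt_one)

lemma elt_zero: "elt \<zero>\<^bsub>F\<^esub> = \<zero>\<^bsub>FB\<^esub>"
  by (rule ring_hom_zero[OF elt_hom FC.ring_axioms dB.FC.ring_axioms])

definition canon where
  "canon = Gamma_lift \<Gamma>B (\<lambda>a. dB.pres.con (scal a)) (\<lambda>x m. dpow B FB m (elt x))"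

lemma
  shows canon_hom: "canon \<in> ring_hom \<Gamma> \<Gamma>B"
    and canon_con: "a \<in> carrier A \<Longrightarrow> canon (pres.con a) = dB.pres.con (scal a)"
    and canon_dpow: "x \<in> carrier F \<Longrightarrow> canon (\<gamma> m x) = dpow B FB m (elt x)"
proof -
  have b: "(\<lambda>a. dB.pres.con (scal a)) \<in> ring_hom A \<Gamma>B"
    using ring_hom_trans[OF scal_hom dB.pres.con_hom] unfolding dB.Gamma_eq comp_def .
  have 1: "(\<lambda>m. dpow B FB m (elt x)) \<in> dp_seqs \<Gamma>B" if "x \<in> carrier F" for x
    using that by (intro dB.dpow_seq) auto
  have 2: "dpow B FB m (elt (a \<odot>\<^bsub>F\<^esub> x)) = dB.pres.con (scal a) [^]\<^bsub>\<Gamma>B\<^esub> m \<otimes>\<^bsub>\<Gamma>B\<^esub> dpow B FB m (elt x)"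
    if "a \<in> carrier A" "x \<in> carrier F" for a x m
    using that by (simp add: elt_smult dB.dpow_smult dB.smult_eq dB.con_pow)
  have 3: "(\<lambda>m. dpow B FB m (elt (x \<oplus>\<^bsub>F\<^esub> y)))
      = (\<lambda>m. dpow B FB m (elt x)) \<otimes>\<^bsub>seqs \<Gamma>B\<^esub> (\<lambda>m. dpow B FB m (elt y))"
    if "x \<in> carrier F" "y \<in> carrier F" for x y
    using that dB.dpow_add[of "elt x" "elt y"] by (simp add: elt_add)
  note L = Gamma_lift[of \<Gamma>B "\<lambda>a. dB.pres.con (scal a)" "\<lambda>x m. dpow B FB m (elt x)",
      OF dB.Gamma_cring b 1 2 3]
  show "canon \<in> ring_hom \<Gamma> \<Gamma>B" "a \<in> carrier A \<Longrightarrow> canon (pres.con a) = dB.pres.con (scal a)"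
    "x \<in> carrier F \<Longrightarrow> canon (\<gamma> m x) = dpow B FB m (elt x)"
    unfolding canon_def by (rule L; assumption)+
qed

lemma canon_closed [simp]: "u \<in> carrier \<Gamma> \<Longrightarrow> canon u \<in> carrier \<Gamma>B"
  by (rule ring_hom_closed[OF canon_hom])

lemma canon_smult: "\<lbrakk> a \<in> carrier A; u \<in> carrier \<Gamma> \<rbrakk> \<Longrightarrow> canon (a \<odot>\<^bsub>\<Gamma>\<^esub> u) = scal a \<odot>\<^bsub>\<Gamma>B\<^esub> canon u"
  by (simp add: Gamma_hom_smult[OF canon_hom] canon_con dB.smult_eq)

text \<open>The norm law asserts the existence of some map c; its values on divided powers and its
  behaviour under scalars force it to be \<open>canon\<close>.\<close>

lemma canon_unique:
  assumes "h \<in> ring_hom \<Gamma> \<Gamma>B" "\<And>m x. x \<in> carrier F \<Longrightarrow> h (\<gamma> m x) = dpow B FB m (elt x)"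
    and "\<And>a u. \<lbrakk> a \<in> carrier A; u \<in> carrier \<Gamma> \<rbrakk> \<Longrightarrow> h (a \<odot>\<^bsub>\<Gamma>\<^esub> u) = scal a \<odot>\<^bsub>\<Gamma>B\<^esub> h u"
    and "u \<in> carrier \<Gamma>"
  shows "h u = canon u"
  using assms(3)[of _ "\<one>\<^bsub>\<Gamma>\<^esub>"] canon_smult[of _ "\<one>\<^bsub>\<Gamma>\<^esub>"] ring_hom_one[OF assms(1)] ring_hom_one[OF canon_hom]
  by (intro Gamma_hom_ext[OF assms(1) canon_hom _ _ assms(4)])
    (simp_all add: assms(2) canon_dpow con_eq)

lemma canon_finprod:
  "(\<And>i. i \<in> I \<Longrightarrow> x i \<in> carrier F) \<Longrightarrow> canon (finprod \<Gamma> (\<lambda>i. \<gamma> (c i) (x i)) I)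
    = finprod \<Gamma>B (\<lambda>i. dpow B FB (c i) (elt (x i))) I"
  by (subst ring_hom_finprod[OF Gamma_cring dB.Gamma_cring canon_hom])
    (auto simp: canon_dpow intro!: dB.GC.finprod_cong2)

lemma canon_mat_sum:
  assumes "finite I" "\<And>i. i \<in> I \<Longrightarrow> x i \<in> carrier F"
  shows "canon (mat_sum I m R x) = dB.mat_sum I m R (\<lambda>i. elt (x i))"
  unfolding mat_sum_def dB.mat_sum_def using assms
  by (subst ring_hom_finsum[OF Gamma_cring dB.Gamma_cring canon_hom])
    (auto simp: canon_finprod intro!: dB.GC.add.finprod_cong2 GC.finprod_in dB.GC.finprod_in)

definition eltP where "eltP Y = (\<lambda>k. elt (cf Y k))"

text \<open>The support can shrink, since \<open>elt\<close> need not be injective. This is why the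
  formulas for \<open>dexp\<close> accept any finite set containing the support.\<close>

lemma eltP:
  assumes "Y \<in> carrier UF"
  shows "eltP Y \<in> carrier dB.UF" "dB.cf (eltP Y) k = elt (cf Y k)" "dB.supp (eltP Y) \<subseteq> supp Y"
proof -
  obtain n where n: "supp Y \<subseteq> {..n}" using finite_supp[OF assms] finite_nat_iff_bounded_le by blast
  have "bound \<zero>\<^bsub>FB\<^esub> n (eltP Y)"
  proof (rule bound.intro)
    fix m assume "n < m"
    then have "cf Y m = \<zero>\<^bsub>F\<^esub>" using n by (auto simp: supp_def)
    then show "eltP Y m = \<zero>\<^bsub>FB\<^esub>" by (simp only: eltP_def elt_zero)
  qed
  then have "eltP Y \<in> up FB" using assms by (intro mem_upI) (auto simp: eltP_def)
  then show 1: "eltP Y \<in> carrier dB.UF" and 2: "dB.cf (eltP Y) k = elt (cf Y k)" for k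
    by (simp_all only: UP_carrier UP_coeff eltP_def)
  show "dB.supp (eltP Y) \<subseteq> supp Y"
  proof
    fix j assume "j \<in> dB.supp (eltP Y)"
    then have "elt (cf Y j) \<noteq> \<zero>\<^bsub>FB\<^esub>" unfolding dB.supp_def 2 by simp
    then have "cf Y j \<noteq> \<zero>\<^bsub>F\<^esub>" using elt_zero by metis
    then show "j \<in> supp Y" unfolding supp_def by simp
  qed
qed

lemma canon_tcoeff:
  assumes "Y \<in> carrier UF"
  shows "canon (tcoeff n Y N) = dB.tcoeff n (eltP Y) N"
  using assms finite_supp[OF assms] eltP[OF assms]
  by (simp add: tcoeff_formula[OF assms finite_supp[OF assms] subset_refl] canon_mat_sum
      dB.tcoeff_formula[OF _ finite_supp[OF assms]])

context
  fixes n :: nat assumes n: "0 < n"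
begin

lemma canon_deg:
  assumes "u \<in> Gamma_deg A F n" shows "canon u \<in> Gamma_deg B FB n"
proof -
  have "submodule {u \<in> Gamma_deg A F n. canon u \<in> Gamma_deg B FB n} A \<Gamma>"
    using Gamma_deg_closures Gamma_deg_closed dB.Gamma_deg_closures
      ring_hom_zero[OF canon_hom GC.ring_axioms dB.GC.ring_axioms]
    by (intro submoduleI') (auto simp: ring_hom_add[OF canon_hom] canon_smult)
  moreover have "canon (tcoeff n Y N) \<in> Gamma_deg B FB n" if "Y \<in> carrier UF" for Y N
    using that eltP by (simp add: canon_tcoeff dB.tcoeff_deg)
  ultimately show ?thesis using tcoeff_induct[OF n] tcoeff_deg assms by blast
qed

text \<open>Both sides are expanded over the supports of the original polynomials, which contain
  those of their images, so the index sets of the two matrix sums agree.\<close>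

lemma canon_D:
  assumes Y: "Y \<in> carrier UF" and Z: "Z \<in> carrier UF"
  shows "canon (D Y N (tcoeff n Z M)) = dB.D (eltP Y) N (dB.tcoeff n (eltP Z) M)"
  unfolding tcoeff_formula[OF Z finite_supp[OF Z] subset_refl]
    dB.tcoeff_formula[OF eltP(1)[OF Z] finite_supp[OF Z] eltP(3)[OF Z]]
  using Y Z finite_supp eltP
  by (subst D_mat_sum[OF _ _ Y finite_supp[OF Y] subset_refl], simp, simp,
      subst dB.D_mat_sum[OF _ _ eltP(1)[OF Y] finite_supp[OF Y] eltP(3)[OF Y]], simp, simp,
      subst canon_mat_sum) (auto simp: elt_mult)

text \<open>Linear in each variable, so the comparison takes place on spanning elements, where it is
  \<open>canon_D\<close>.\<close>

lemma canon_norm_mult: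
  assumes u: "u \<in> Gamma_deg A F n" and v: "v \<in> Gamma_deg A F n"
  shows "canon (norm_mult n u v) = dB.norm_mult n (canon u) (canon v)"
proof -
  note lin = norm_mult_spec(1)[OF n] norm_mult_lin_right[OF n] dB.norm_mult_spec(1)[OF n] dB.norm_mult_lin_right[OF n]
  note z = ring_hom_zero[OF canon_hom GC.ring_axioms dB.GC.ring_axioms]
  note cl = Gamma_deg_closures Gamma_deg_closed dB.Gamma_deg_closures norm_mult_deg[OF n] canon_deg
  have 1: "canon (norm_mult n u (tcoeff n Y N)) = dB.norm_mult n (canon u) (canon (tcoeff n Y N))"
    if Y: "Y \<in> carrier UF" and u: "u \<in> Gamma_deg A F n" for Y N u
  proof -
    let ?t = "tcoeff n Y N"
    have t: "?t \<in> Gamma_deg A F n" using tcoeff_deg Y by blast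
    have "submodule {u \<in> Gamma_deg A F n. canon (norm_mult n u ?t) = dB.norm_mult n (canon u) (canon ?t)} A \<Gamma>"
      using cl t lin(1)[OF t] lin(3)[OF canon_deg[OF t]] lin_on_zero[OF lin(1)[OF t]]
        dB.lin_on_zero[OF lin(3)[OF canon_deg[OF t]]]
      by (intro submoduleI') (auto simp: ring_hom_add[OF canon_hom] canon_smult lin_on_def dB.lin_on_def z)
    moreover have "canon (norm_mult n (tcoeff n Z M) ?t) = dB.norm_mult n (canon (tcoeff n Z M)) (canon ?t)"
      if Z: "Z \<in> carrier UF" for Z M
      using canon_D[OF Z Y] Z Y t eltP(1)
      by (simp add: norm_mult_spec(2)[OF n] canon_tcoeff dB.norm_mult_spec(2)[OF n] dB.tcoeff_deg)
    ultimately show ?thesis using tcoeff_induct[OF n] tcoeff_deg u by blast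
  qed
  have "submodule {v \<in> Gamma_deg A F n. canon (norm_mult n u v) = dB.norm_mult n (canon u) (canon v)} A \<Gamma>"
    using cl u lin(2)[OF u] lin(4)[OF canon_deg[OF u]] lin_on_zero[OF lin(2)[OF u]]
      dB.lin_on_zero[OF lin(4)[OF canon_deg[OF u]]]
    by (intro submoduleI') (auto simp: ring_hom_add[OF canon_hom] canon_smult lin_on_def dB.lin_on_def z)
  then show ?thesis using tcoeff_induct[OF n] tcoeff_deg v 1[OF _ u] by blast
qed

text \<open>The construction is uniform in the base ring: the bilinear extension over B is the
  product obtained from B and \<open>FB\<close> by the same recipe.\<close>

lemma norm_mult_law: "norm_law_after A B F n (norm_mult n)"
  unfolding norm_law_after_def Let_def
proof (intro bexI[OF _ canon_hom] exI[of _ "dB.norm_mult n"] conjI ballI allI)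
  show "bilinear_op B \<Gamma>B (Gamma_deg B FB n) (dB.norm_mult n)"
    using dB.norm_mult_spec(1)[OF n] dB.norm_mult_lin_right[OF n] dB.norm_mult_deg[OF n]
    unfolding bilinear_op_def dB.lin_on_def by (intro conjI ballI) simp_all
next
  fix a u assume "a \<in> carrier A" "u \<in> carrier \<Gamma>"
  then show "canon (a \<odot>\<^bsub>\<Gamma>\<^esub> u) = (a \<odot>\<^bsub>B\<^esub> \<one>\<^bsub>B\<^esub>) \<odot>\<^bsub>\<Gamma>B\<^esub> canon u"
    by (simp only: canon_smult scal_def)
qed (simp_all only: canon_dpow canon_norm_mult dB.norm_mult_dpow[OF n])

end

end

lemma (in dp_algebra) norm_mult_is_norm_mult:
  assumes "0 < n" shows "is_norm_mult A F n (norm_mult n)"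
  unfolding is_norm_mult_def
proof (intro conjI allI impI norm_mult_algebra assms)
  fix B :: "('a, ('a, nat) aterm set) module" assume B: "algebra A B"
  show "norm_law_after A B F n (norm_mult n)"
    by (rule dp_base_change.norm_mult_law[OF dp_base_change.intro[OF dp_algebra_axioms algebra.M_cring[OF B] B] assms])
qed

section \<open>Uniqueness of the second product\<close>

context dp_algebra
begin

lemma lin_on_finsum:
  assumes f: "lin_on n f" and C: "finite C" "\<And>c. c \<in> C \<Longrightarrow> w c \<in> Gamma_deg A F n"
  shows "finsum \<Gamma> w C \<in> Gamma_deg A F n" "f (finsum \<Gamma> w C) = finsum \<Gamma> (\<lambda>c. f (w c)) C"
proof -
  have "finsum \<Gamma> w C \<in> Gamma_deg A F n \<and> f (finsum \<Gamma> w C) = finsum \<Gamma> (\<lambda>c. f (w c)) C"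
    using C
  proof (induction C rule: finite_induct)
    case empty
    then show ?case using lin_on_zero[OF f] Gamma_deg_closures(1) by simp
  next
    case (insert c C)
    have cl: "w c \<in> Gamma_deg A F n" "w \<in> C \<rightarrow> carrier \<Gamma>" "(\<lambda>c. f (w c)) \<in> C \<rightarrow> carrier \<Gamma>" "f (w c) \<in> carrier \<Gamma>"
      using insert.prems Gamma_deg_closed[OF insert.prems] f unfolding lin_on_def by (simp_all add: Pi_iff)
    have "finsum \<Gamma> w (insert c C) = w c \<oplus>\<^bsub>\<Gamma>\<^esub> finsum \<Gamma> w C"
      using insert.hyps cl Gamma_deg_closed by (intro GC.finsum_insert)
    moreover have "finsum \<Gamma> (\<lambda>c. f (w c)) (insert c C) = f (w c) \<oplus>\<^bsub>\<Gamma>\<^esub> finsum \<Gamma> (\<lambda>c. f (w c)) C"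
      using insert.hyps cl by (intro GC.finsum_insert)
    ultimately show ?case
      using insert cl(1) Gamma_deg_closures(2) f unfolding lin_on_def by simp
  qed
  then show "finsum \<Gamma> w C \<in> Gamma_deg A F n" "f (finsum \<Gamma> w C) = finsum \<Gamma> (\<lambda>c. f (w c)) C" by auto
qed

lemma bilinear_opD:
  assumes "bilinear_op A \<Gamma> (Gamma_deg A F n) g"
  shows "v \<in> Gamma_deg A F n \<Longrightarrow> lin_on n (\<lambda>u. g u v)" "u \<in> Gamma_deg A F n \<Longrightarrow> lin_on n (g u)"
    "\<lbrakk> u \<in> Gamma_deg A F n; v \<in> Gamma_deg A F n \<rbrakk> \<Longrightarrow> g u v \<in> Gamma_deg A F n"
proof -
  show cl: "g u v \<in> Gamma_deg A F n" if "u \<in> Gamma_deg A F n" "v \<in> Gamma_deg A F n" for u v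
    using assms that unfolding bilinear_op_def by simp
  then show "v \<in> Gamma_deg A F n \<Longrightarrow> lin_on n (\<lambda>u. g u v)" "u \<in> Gamma_deg A F n \<Longrightarrow> lin_on n (g u)"
    using assms Gamma_deg_closed[OF cl] unfolding bilinear_op_def lin_on_def by simp_all
qed

lemma bilinear_sum:
  assumes g: "bilinear_op A \<Gamma> (Gamma_deg A F n) g"
    and C: "finite C" "\<And>c. c \<in> C \<Longrightarrow> u c \<in> Gamma_deg A F n"
    and E: "finite E" "\<And>d. d \<in> E \<Longrightarrow> v d \<in> Gamma_deg A F n"
  shows "g (finsum \<Gamma> u C) (finsum \<Gamma> v E) = (\<Oplus>\<^bsub>\<Gamma>\<^esub>p\<in>C \<times> E. g (u (fst p)) (v (snd p)))"
proof -
  have vE: "finsum \<Gamma> v E \<in> Gamma_deg A F n"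
    using lin_on_finsum(1)[OF bilinear_opD(2)[OF g Gamma_deg_closures(1)] E] .
  have cl: "g (u c) (v d) \<in> carrier \<Gamma>" if "c \<in> C" "d \<in> E" for c d
    by (rule Gamma_deg_closed[OF bilinear_opD(3)[OF g C(2)[OF that(1)] E(2)[OF that(2)]]])
  have "g (finsum \<Gamma> u C) (finsum \<Gamma> v E) = (\<Oplus>\<^bsub>\<Gamma>\<^esub>c\<in>C. g (u c) (finsum \<Gamma> v E))"
    by (rule lin_on_finsum(2)[OF bilinear_opD(1)[OF g vE] C])
  also have "\<dots> = (\<Oplus>\<^bsub>\<Gamma>\<^esub>c\<in>C. \<Oplus>\<^bsub>\<Gamma>\<^esub>d\<in>E. g (u c) (v d))"
    using cl by (intro GC.add.finprod_cong2 lin_on_finsum(2)[OF bilinear_opD(2)[OF g C(2)] E] GC.add.finprod_in)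
  also have "\<dots> = (\<Oplus>\<^bsub>\<Gamma>\<^esub>p\<in>C \<times> E. g (u (fst p)) (v (snd p)))"
    using C(1) E(1) cl by (subst GC.add.finprod_Sigma) simp_all
  finally show ?thesis .
qed

text \<open>An algebra only provides compatibility of scalars with the first factor; commutativity
  carries it over to the second.\<close>

lemma Gamma_deg_algebraD:
  assumes "algebra A (Gamma_deg_with_mult A F n f)"
  shows "bilinear_op A \<Gamma> (Gamma_deg A F n) f"
proof -
  let ?R = "Gamma_deg_with_mult A F n f"
  interpret R: algebra A ?R by fact
  have [simp]: "carrier ?R = Gamma_deg A F n" "monoid.mult ?R = f"
    "ring.add ?R = ring.add \<Gamma>" "module.smult ?R = module.smult \<Gamma>"
    by (simp_all add: Gamma_deg_with_mult_def)
  have comm: "f u v = f v u" if "u \<in> Gamma_deg A F n" "v \<in> Gamma_deg A F n" for u v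
    using R.m_comm[of u v] that by simp
  have sm: "f (a \<odot>\<^bsub>\<Gamma>\<^esub> u) v = a \<odot>\<^bsub>\<Gamma>\<^esub> f u v"
    if "a \<in> carrier A" "u \<in> Gamma_deg A F n" "v \<in> Gamma_deg A F n" for a u v
    using R.smult_assoc2[of a u v] that by simp
  have cl: "f u v \<in> Gamma_deg A F n" if "u \<in> Gamma_deg A F n" "v \<in> Gamma_deg A F n" for u v
    using R.m_closed[of u v] that by simp
  show ?thesis unfolding bilinear_op_def
  proof (intro conjI ballI)
    fix u v w assume 1: "u \<in> Gamma_deg A F n" "v \<in> Gamma_deg A F n" "w \<in> Gamma_deg A F n"
    show "f (u \<oplus>\<^bsub>\<Gamma>\<^esub> v) w = f u w \<oplus>\<^bsub>\<Gamma>\<^esub> f v w" using R.l_distr[of u v w] 1 by simp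
    show "f w (u \<oplus>\<^bsub>\<Gamma>\<^esub> v) = f w u \<oplus>\<^bsub>\<Gamma>\<^esub> f w v" using R.r_distr[of u v w] 1 by simp
  next
    fix a u v assume 1: "a \<in> carrier A" "u \<in> Gamma_deg A F n" "v \<in> Gamma_deg A F n"
    then show "f (a \<odot>\<^bsub>\<Gamma>\<^esub> u) v = a \<odot>\<^bsub>\<Gamma>\<^esub> f u v" by (rule sm)
    show "f u (a \<odot>\<^bsub>\<Gamma>\<^esub> v) = a \<odot>\<^bsub>\<Gamma>\<^esub> f u v"
      using 1 sm[OF 1(1,3,2)] comm[OF 1(2,3)] comm[OF 1(2) Gamma_deg_closures(4)[OF 1(1,3)]] by simp
  qed (rule cl)
qed

end

text \<open>Base change to the polynomial ring in one variable already determines the second product.\<close>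

locale dp_poly = dp_base_change A F "presented_algebra A {0::nat} {}"
  for A :: "('a, 'm) ring_scheme" and F :: "('a, 'f, 'k) module_scheme"
begin

abbreviation "B \<equiv> presented_algebra A {0::nat} {}"

sublocale b0: presentation A "{0::nat}" "{}"
  by (simp add: presentation.intro AC.is_cring)

definition T where "T = b0.gen 0"

lemma T_closed [simp]: "T \<in> carrier B"
  unfolding T_def by (rule b0.gen_closed) simp

lemma scal_con: "a \<in> carrier A \<Longrightarrow> scal a = b0.con a"
  unfolding scal_def using b0.smult_con[of a "\<one>\<^bsub>B\<^esub>"] b0.con_closed[of a]
    cring.cring_simprules(5)[OF b0.PA_cring] monoid.r_one[of B "b0.con a"]
  by (simp add: BC.one_closed BC.r_one)

definition toF where "toF = presented_lift UF (\<lambda>a. up_ring.monom UF (a \<odot>\<^bsub>F\<^esub> \<one>\<^bsub>F\<^esub>) 0) (\<lambda>_. up_ring.monom UF \<one>\<^bsub>F\<^esub> 1)"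

definition toG where "toG = presented_lift UG (\<lambda>a. mono (pres.con a) 0) (\<lambda>_. mono \<one>\<^bsub>\<Gamma>\<^esub> 1)"

lemma conF_hom: "(\<lambda>a. up_ring.monom UF (a \<odot>\<^bsub>F\<^esub> \<one>\<^bsub>F\<^esub>) 0) \<in> ring_hom A UF"
  by (intro ring_hom_memI)
    (simp_all add: alg.smult_l_distr alg.smult_assoc1 alg.smult_assoc2 flip: UF.monom_mult UF.monom_add)

lemma toF: "toF \<in> ring_hom B UF"
  "a \<in> carrier A \<Longrightarrow> toF (b0.con a) = up_ring.monom UF (a \<odot>\<^bsub>F\<^esub> \<one>\<^bsub>F\<^esub>) 0"
  "toF T = up_ring.monom UF \<one>\<^bsub>F\<^esub> 1"
proof -
  have v: "(\<lambda>_. up_ring.monom UF \<one>\<^bsub>F\<^esub> 1) \<in> {0::nat} \<rightarrow> carrier UF" by simp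
  note L = b0.presented_lift_hom[OF UF_cring conF_hom v] b0.presented_lift_con[OF UF_cring conF_hom v]
    b0.presented_lift_gen[OF UF_cring conF_hom v]
  show "toF \<in> ring_hom B UF" "a \<in> carrier A \<Longrightarrow> toF (b0.con a) = up_ring.monom UF (a \<odot>\<^bsub>F\<^esub> \<one>\<^bsub>F\<^esub>) 0"
    "toF T = up_ring.monom UF \<one>\<^bsub>F\<^esub> 1"
    unfolding toF_def T_def by (rule L; simp)+
qed

lemma toG: "toG \<in> ring_hom B UG"
  "a \<in> carrier A \<Longrightarrow> toG (b0.con a) = mono (pres.con a) 0"
  "toG T = mono \<one>\<^bsub>\<Gamma>\<^esub> 1"
proof -
  have v: "(\<lambda>_. mono \<one>\<^bsub>\<Gamma>\<^esub> 1) \<in> {0::nat} \<rightarrow> carrier UG" by simp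
  note L = b0.presented_lift_hom[OF UG_cring con_UG_hom v] b0.presented_lift_con[OF UG_cring con_UG_hom v]
    b0.presented_lift_gen[OF UG_cring con_UG_hom v]
  show "toG \<in> ring_hom B UG" "a \<in> carrier A \<Longrightarrow> toG (b0.con a) = mono (pres.con a) 0"
    "toG T = mono \<one>\<^bsub>\<Gamma>\<^esub> 1"
    unfolding toG_def T_def by (rule L; simp)+
qed

lemma toG_T_pow: "toG (T [^]\<^bsub>B\<^esub> (k::nat)) = mono \<one>\<^bsub>\<Gamma>\<^esub> k"
proof (induction k)
  case (Suc k)
  have "toG (T [^]\<^bsub>B\<^esub> Suc k) = toG (T [^]\<^bsub>B\<^esub> k) \<otimes>\<^bsub>UG\<^esub> toG T"
    by (simp add: ring_hom_mult[OF toG(1)])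
  then show ?case using Suc UG.monom_mult[of "\<one>\<^bsub>\<Gamma>\<^esub>" "\<one>\<^bsub>\<Gamma>\<^esub>" k 1] by (simp add: toG(3))
qed (simp add: ring_hom_one[OF toG(1)])

lemma toF_closed [simp]: "b \<in> carrier B \<Longrightarrow> toF b \<in> carrier UF"
  by (rule ring_hom_closed[OF toF(1)])

lemma toG_closed [simp]: "b \<in> carrier B \<Longrightarrow> toG b \<in> carrier UG"
  by (rule ring_hom_closed[OF toG(1)])

text \<open>Induction over the presentation of A[T]: \<open>dexp_scale\<close> handles constants,
  \<open>dexp_shift\<close> the variable, \<open>dp_seqs_binomial\<close> sums, and products iterate
  the claim.\<close>

lemma dexp_toF:
  assumes "b \<in> carrier B" "p \<in> carrier UF"
  shows "dexp (toF b \<otimes>\<^bsub>UF\<^esub> p) = (\<lambda>m. toG b [^]\<^bsub>UG\<^esub> m \<otimes>\<^bsub>UG\<^esub> dexp p m)"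
  using assms
proof (induction arbitrary: p rule: b0.PA_induct)
  case (con a)
  then show ?case by (simp only: toF(2) toG(2) dexp_scale)
next
  case (gen x)
  then show ?case using toF(3) toG(3) dexp_shift[of p] by (simp only: T_def singleton_iff)
next
  case (add b c)
  have "dexp (toF (b \<oplus>\<^bsub>B\<^esub> c) \<otimes>\<^bsub>UF\<^esub> p) = dexp ((toF b \<otimes>\<^bsub>UF\<^esub> p) \<oplus>\<^bsub>UF\<^esub> (toF c \<otimes>\<^bsub>UF\<^esub> p))"
    using add by (simp add: ring_hom_add[OF toF(1)] UF.P.l_distr)
  also have "\<dots> = dexp (toF b \<otimes>\<^bsub>UF\<^esub> p) \<otimes>\<^bsub>seqs UG\<^esub> dexp (toF c \<otimes>\<^bsub>UF\<^esub> p)"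
    using add by (intro dexp_add) simp_all
  also have "\<dots> = (\<lambda>m. (toG b \<oplus>\<^bsub>UG\<^esub> toG c) [^]\<^bsub>UG\<^esub> m \<otimes>\<^bsub>UG\<^esub> dexp p m)"
    using add by (simp add: UG.P.dp_seqs_binomial[OF dexp_dp])
  finally show ?case using add by (simp add: ring_hom_add[OF toG(1)])
next
  case (mult b c)
  have "dexp (toF (b \<otimes>\<^bsub>B\<^esub> c) \<otimes>\<^bsub>UF\<^esub> p) = dexp (toF b \<otimes>\<^bsub>UF\<^esub> (toF c \<otimes>\<^bsub>UF\<^esub> p))"
    using mult by (simp add: ring_hom_mult[OF toF(1)] UF.P.m_assoc)
  also have "\<dots> = (\<lambda>m. toG b [^]\<^bsub>UG\<^esub> m \<otimes>\<^bsub>UG\<^esub> (toG c [^]\<^bsub>UG\<^esub> m \<otimes>\<^bsub>UG\<^esub> dexp p m))"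
    using mult by simp
  finally show ?case using mult
    by (simp add: ring_hom_mult[OF toG(1)] UG.P.nat_pow_distrib UG.P.m_assoc)
qed

definition ext where "ext = presented_lift UF toF (\<lambda>x. up_ring.monom UF x 0)"

lemma ext: "ext \<in> ring_hom FB UF" "b \<in> carrier B \<Longrightarrow> ext (bc.con b) = toF b"
  "x \<in> carrier F \<Longrightarrow> ext (elt x) = up_ring.monom UF x 0"
proof -
  have v: "(\<lambda>x. up_ring.monom UF x 0) \<in> carrier F \<rightarrow> carrier UF" by simp
  have Q: "aterm_eval UF toF (\<lambda>x. up_ring.monom UF x 0) s = aterm_eval UF toF (\<lambda>x. up_ring.monom UF x 0) t"
    if "(s, t) \<in> base_change_rels A B F" for s t
    using that
  proof (induction rule: base_change_rels.induct[split_format (complete)])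
    case (1 x y)
    then show ?case by simp
  next
    case (2 x y)
    then show ?case using UF.monom_mult[of x y 0 0] by simp
  next
    case 3
    then show ?case by (simp add: ring_hom_one[OF toF(1)])
  next
    case (4 a x)
    then show ?case using toF(2)[of a] UF.monom_mult[of "a \<odot>\<^bsub>F\<^esub> \<one>\<^bsub>F\<^esub>" x 0 0] scal_con[of a]
      by (simp add: scal_def alg.smult_assoc2)
  qed
  note L = bc.presented_lift_hom[OF UF_cring toF(1) v Q] bc.presented_lift_con[OF UF_cring toF(1) v Q]
    bc.presented_lift_gen[OF UF_cring toF(1) v Q]
  show "ext \<in> ring_hom FB UF" "b \<in> carrier B \<Longrightarrow> ext (bc.con b) = toF b"
    "x \<in> carrier F \<Longrightarrow> ext (elt x) = up_ring.monom UF x 0"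
    unfolding ext_def FB_eq elt_eq by (rule L; assumption)+
qed

lemma ext_closed [simp]: "z \<in> carrier FB \<Longrightarrow> ext z \<in> carrier UF"
  by (rule ring_hom_closed[OF ext(1)])

lemma ext_smult: "\<lbrakk> b \<in> carrier B; z \<in> carrier FB \<rbrakk> \<Longrightarrow> ext (b \<odot>\<^bsub>FB\<^esub> z) = toF b \<otimes>\<^bsub>UF\<^esub> ext z"
  using bc.smult_con[of b z] ring_hom_mult[OF ext(1), of "bc.con b" z] bc.con_closed[of b]
  by (simp add: ext(2) flip: FB_eq)

text \<open>A map from the divided power algebra over A[T] to polynomials over
  \<open>\<Gamma>\<close>, well defined by \<open>dexp_toF\<close> and \<open>dexp_add\<close>. It
  sends T^k times the image of u to the monomial with coefficient u and exponent k, so coefficients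
  can be read off (\<open>spec_term\<close>).\<close>

definition spec where "spec = dB.Gamma_lift UG toG (\<lambda>z. dexp (ext z))"

lemma spec: "spec \<in> ring_hom \<Gamma>B UG" "b \<in> carrier B \<Longrightarrow> spec (dB.pres.con b) = toG b"
  "z \<in> carrier FB \<Longrightarrow> spec (dpow B FB m z) = dexp (ext z) m"
proof -
  have 1: "dexp (ext z) \<in> dp_seqs UG" if "z \<in> carrier FB" for z
    using that by (intro dexp_dp) simp
  have 2: "dexp (ext (b \<odot>\<^bsub>FB\<^esub> z)) m = toG b [^]\<^bsub>UG\<^esub> m \<otimes>\<^bsub>UG\<^esub> dexp (ext z) m"
    if "b \<in> carrier B" "z \<in> carrier FB" for b z m
    using that by (simp add: ext_smult dexp_toF)
  have 3: "dexp (ext (y \<oplus>\<^bsub>FB\<^esub> z)) = dexp (ext y) \<otimes>\<^bsub>seqs UG\<^esub> dexp (ext z)"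
    if "y \<in> carrier FB" "z \<in> carrier FB" for y z
    using that by (simp add: ring_hom_add[OF ext(1)] dexp_add)
  note L = dB.Gamma_lift[of UG toG "\<lambda>z. dexp (ext z)", OF UG_cring toG(1) 1 2 3]
  show "spec \<in> ring_hom \<Gamma>B UG" "b \<in> carrier B \<Longrightarrow> spec (dB.pres.con b) = toG b"
    "z \<in> carrier FB \<Longrightarrow> spec (dpow B FB m z) = dexp (ext z) m"
    unfolding spec_def by (rule L; assumption)+
qed

lemma spec_canon:
  assumes "u \<in> carrier \<Gamma>" shows "spec (canon u) = mono u 0"
proof -
  have "(spec \<circ> canon) u = (\<lambda>u. mono u 0) u"
  proof (rule Gamma_hom_ext[OF _ _ _ _ assms])
    show "spec \<circ> canon \<in> ring_hom \<Gamma> UG" by (rule ring_hom_trans[OF canon_hom spec(1)])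
    show "(\<lambda>u. mono u 0) \<in> ring_hom \<Gamma> UG"
      by (intro ring_hom_memI) (simp_all flip: UG.monom_mult)
  qed (simp_all add: canon_con spec scal_con b0.con_closed toG canon_dpow ext dexp_const)
  then show ?thesis by simp
qed

lemma spec_term:
  assumes "u \<in> carrier \<Gamma>"
  shows "spec ((T [^]\<^bsub>B\<^esub> (k::nat)) \<odot>\<^bsub>\<Gamma>B\<^esub> canon u) = mono u k"
  using assms UG.monom_mult[of "\<one>\<^bsub>\<Gamma>\<^esub>" u k 0]
  by (simp add: dB.Gamma_hom_smult[OF spec(1)] spec spec_canon toG_T_pow)

text \<open>The polynomial Y(T^b) as an element of the base change of F.\<close>

definition poly_elt where
  "poly_elt Y b = (\<Oplus>\<^bsub>FB\<^esub>k\<in>supp Y. (T [^]\<^bsub>B\<^esub> (b * k :: nat)) \<odot>\<^bsub>FB\<^esub> elt (cf Y k))"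

text \<open>The right-hand side does not mention f. By the norm law, gamma^n(Y(T^b)) times
  gamma^n(Z(T)) is gamma^n(Y(T^b) Z(T)), and by bilinearity it is the generating function of all
  products of coefficients. As b exceeds M and all weights of Z, the exponent bN + M comes from the
  pair (N, M) alone.\<close>

lemma law_determines:
  assumes n: "0 < n" and law: "norm_law_after A B F n f" and f: "bilinear_op A \<Gamma> (Gamma_deg A F n) f"
    and Y: "Y \<in> carrier UF" and Z: "Z \<in> carrier UF"
    and b: "M < b" "\<And>d. d \<in> comps (supp Z) n \<Longrightarrow> (\<Sum>k\<in>supp Z. k * d k) < b"
  shows "f (tcoeff n Y N) (tcoeff n Z M)
    = cg (spec (dpow B FB n (poly_elt Y b \<otimes>\<^bsub>FB\<^esub> poly_elt Z 1))) (b * N + M)"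
proof -
  let ?p = "\<lambda>Y c. finprod \<Gamma> (\<lambda>k. \<gamma> (c k) (cf Y k)) (supp Y)"
  let ?w = "\<lambda>Y c. \<Sum>k\<in>supp Y. k * c k"
  let ?C = "comps (supp Y) n" and ?E = "comps (supp Z) n"
  have p: "?p Y c \<in> Gamma_deg A F n" if "Y \<in> carrier UF" "c \<in> comps (supp Y) n" for Y c
    using that by (intro finprod_dpow_deg finite_supp) (simp_all add: comps_def)
  have t: "tcoeff n Y N = finsum \<Gamma> (?p Y) {c \<in> comps (supp Y) n. ?w Y c = N}" if "Y \<in> carrier UF" for Y N
    by (simp add: tcoeff_formula[OF that finite_supp[OF that] subset_refl] mat_sum_def)
  obtain c g where c: "c \<in> ring_hom \<Gamma> \<Gamma>B"
    and cx: "\<And>m x. x \<in> carrier F \<Longrightarrow> c (\<gamma> m x) = dpow B FB m (elt x)"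
    and ca: "\<And>a u. \<lbrakk> a \<in> carrier A; u \<in> carrier \<Gamma> \<rbrakk> \<Longrightarrow> c (a \<odot>\<^bsub>\<Gamma>\<^esub> u) = scal a \<odot>\<^bsub>\<Gamma>B\<^esub> c u"
    and g: "bilinear_op B \<Gamma>B (Gamma_deg B FB n) g"
    and gc: "\<And>u v. \<lbrakk> u \<in> Gamma_deg A F n; v \<in> Gamma_deg A F n \<rbrakk> \<Longrightarrow> g (c u) (c v) = c (f u v)"
    and gx: "\<And>x y. \<lbrakk> x \<in> carrier FB; y \<in> carrier FB \<rbrakk> \<Longrightarrow> g (dpow B FB n x) (dpow B FB n y) = dpow B FB n (x \<otimes>\<^bsub>FB\<^esub> y)"
    using law unfolding norm_law_after_def Let_def scal_def[symmetric] by metis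
  have cc: "c u = canon u" if "u \<in> carrier \<Gamma>" for u
    by (rule canon_unique[OF c cx ca that])
  have fU: "f u v \<in> Gamma_deg A F n" if "u \<in> Gamma_deg A F n" "v \<in> Gamma_deg A F n" for u v
    by (rule bilinear_opD(3)[OF f that])
  have gcanon: "g (canon u) (canon v) = canon (f u v)"
    if "u \<in> Gamma_deg A F n" "v \<in> Gamma_deg A F n" for u v
    using gc[OF that] cc[OF Gamma_deg_closed[OF that(1)]] cc[OF Gamma_deg_closed[OF that(2)]]
      cc[OF Gamma_deg_closed[OF fU[OF that]]] by simp
  have pe_closed: "poly_elt Y b \<in> carrier FB" if "Y \<in> carrier UF" for Y b
    unfolding poly_elt_def using that by (intro dB.FC.add.finprod_in) simp
  have pe: "dpow B FB n (poly_elt Y b)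
      = (\<Oplus>\<^bsub>\<Gamma>B\<^esub>c\<in>comps (supp Y) n. (T [^]\<^bsub>B\<^esub> (b * ?w Y c)) \<odot>\<^bsub>\<Gamma>B\<^esub> canon (?p Y c))"
    if "Y \<in> carrier UF" for Y b
    unfolding poly_elt_def using that finite_supp[OF that]
    by (simp add: dB.dpow_lincomb canon_finprod)
  have tU: "(T [^]\<^bsub>B\<^esub> (k::nat)) \<odot>\<^bsub>\<Gamma>B\<^esub> canon u \<in> Gamma_deg B FB n" if "u \<in> Gamma_deg A F n" for k u
    by (intro dB.Gamma_deg_closures(4) canon_deg n that BC.nat_pow_closed T_closed)
  have gl: "g ((T [^]\<^bsub>B\<^esub> (k::nat)) \<odot>\<^bsub>\<Gamma>B\<^esub> canon u) ((T [^]\<^bsub>B\<^esub> (l::nat)) \<odot>\<^bsub>\<Gamma>B\<^esub> canon v)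
      = (T [^]\<^bsub>B\<^esub> (k + l)) \<odot>\<^bsub>\<Gamma>B\<^esub> canon (f u v)"
    if uv: "u \<in> Gamma_deg A F n" "v \<in> Gamma_deg A F n" for k l u v
  proof -
    note cu = canon_deg[OF n uv(1)] and cv = canon_deg[OF n uv(2)]
    have "g ((T [^]\<^bsub>B\<^esub> k) \<odot>\<^bsub>\<Gamma>B\<^esub> canon u) ((T [^]\<^bsub>B\<^esub> l) \<odot>\<^bsub>\<Gamma>B\<^esub> canon v)
        = (T [^]\<^bsub>B\<^esub> k) \<odot>\<^bsub>\<Gamma>B\<^esub> g (canon u) ((T [^]\<^bsub>B\<^esub> l) \<odot>\<^bsub>\<Gamma>B\<^esub> canon v)"
      using dB.bilinear_opD(1)[OF g tU[OF uv(2), of l]] cu unfolding dB.lin_on_def by simp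
    also have "g (canon u) ((T [^]\<^bsub>B\<^esub> l) \<odot>\<^bsub>\<Gamma>B\<^esub> canon v) = (T [^]\<^bsub>B\<^esub> l) \<odot>\<^bsub>\<Gamma>B\<^esub> canon (f u v)"
      using dB.bilinear_opD(2)[OF g cu] cv gcanon[OF uv] unfolding dB.lin_on_def by simp
    finally show ?thesis using Gamma_deg_closed[OF fU[OF uv]]
      by (simp flip: dB.G.smult_assoc1 BC.nat_pow_mult)
  qed
  have "dpow B FB n (poly_elt Y b \<otimes>\<^bsub>FB\<^esub> poly_elt Z 1) = g (dpow B FB n (poly_elt Y b)) (dpow B FB n (poly_elt Z 1))"
    using gx pe_closed Y Z by simp
  also have "\<dots> = (\<Oplus>\<^bsub>\<Gamma>B\<^esub>q\<in>?C \<times> ?E. g ((T [^]\<^bsub>B\<^esub> (b * ?w Y (fst q))) \<odot>\<^bsub>\<Gamma>B\<^esub> canon (?p Y (fst q)))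
      ((T [^]\<^bsub>B\<^esub> (1 * ?w Z (snd q))) \<odot>\<^bsub>\<Gamma>B\<^esub> canon (?p Z (snd q))))"
    unfolding pe[OF Y] pe[OF Z] using Y Z finite_supp p
    by (intro dB.bilinear_sum[OF g] finite_comps tU) simp_all
  also have "\<dots> = (\<Oplus>\<^bsub>\<Gamma>B\<^esub>q\<in>?C \<times> ?E. (T [^]\<^bsub>B\<^esub> (b * ?w Y (fst q) + ?w Z (snd q))) \<odot>\<^bsub>\<Gamma>B\<^esub> canon (f (?p Y (fst q)) (?p Z (snd q))))"
  proof (rule dB.GC.add.finprod_cong2)
    fix q assume q: "q \<in> ?C \<times> ?E"
    then have pq: "?p Y (fst q) \<in> Gamma_deg A F n" "?p Z (snd q) \<in> Gamma_deg A F n"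
      using p Y Z by (simp_all add: mem_Times_iff)
    show "g ((T [^]\<^bsub>B\<^esub> (b * ?w Y (fst q))) \<odot>\<^bsub>\<Gamma>B\<^esub> canon (?p Y (fst q)))
      ((T [^]\<^bsub>B\<^esub> (1 * ?w Z (snd q))) \<odot>\<^bsub>\<Gamma>B\<^esub> canon (?p Z (snd q)))
      = (T [^]\<^bsub>B\<^esub> (b * ?w Y (fst q) + ?w Z (snd q))) \<odot>\<^bsub>\<Gamma>B\<^esub> canon (f (?p Y (fst q)) (?p Z (snd q)))"
      unfolding gl[OF pq] by simp
    show "(T [^]\<^bsub>B\<^esub> (b * ?w Y (fst q) + ?w Z (snd q))) \<odot>\<^bsub>\<Gamma>B\<^esub> canon (f (?p Y (fst q)) (?p Z (snd q))) \<in> carrier \<Gamma>B"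
      by (rule dB.Gamma_deg_closed[OF tU[OF fU[OF pq]]])
  qed
  finally have e: "dpow B FB n (poly_elt Y b \<otimes>\<^bsub>FB\<^esub> poly_elt Z 1) = \<dots>" .
  have fp: "f (?p Y (fst q)) (?p Z (snd q)) \<in> carrier \<Gamma>" if "q \<in> ?C \<times> ?E" for q
    using that p Y Z by (intro Gamma_deg_closed[OF fU]) (simp_all add: mem_Times_iff)
  have "spec (dpow B FB n (poly_elt Y b \<otimes>\<^bsub>FB\<^esub> poly_elt Z 1))
    = (\<Oplus>\<^bsub>UG\<^esub>q\<in>?C \<times> ?E. spec ((T [^]\<^bsub>B\<^esub> (b * ?w Y (fst q) + ?w Z (snd q))) \<odot>\<^bsub>\<Gamma>B\<^esub> canon (f (?p Y (fst q)) (?p Z (snd q)))))"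
    unfolding e using fp by (intro ring_hom_finsum[OF dB.Gamma_cring UG_cring spec(1)]) simp
  also have "\<dots> = (\<Oplus>\<^bsub>UG\<^esub>q\<in>?C \<times> ?E. mono (f (?p Y (fst q)) (?p Z (snd q))) (b * ?w Y (fst q) + ?w Z (snd q)))"
    using fp by (intro UG.P.add.finprod_cong2 spec_term UG.monom_closed)
  finally have "cg (spec (dpow B FB n (poly_elt Y b \<otimes>\<^bsub>FB\<^esub> poly_elt Z 1))) (b * N + M)
    = (\<Oplus>\<^bsub>\<Gamma>\<^esub>q\<in>{q \<in> ?C \<times> ?E. b * ?w Y (fst q) + ?w Z (snd q) = b * N + M}. f (?p Y (fst q)) (?p Z (snd q)))"
    using fp finite_supp Y Z by (simp only:) (intro coeff_mono_sum finite_cartesian_product finite_comps)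
  also have "{q \<in> ?C \<times> ?E. b * ?w Y (fst q) + ?w Z (snd q) = b * N + M} = {c \<in> ?C. ?w Y c = N} \<times> {d \<in> ?E. ?w Z d = M}"
  proof -
    have "b * x + y = b * N + M \<longleftrightarrow> x = N \<and> y = M" if "y < b" for x y
    proof
      assume e: "b * x + y = b * N + M"
      have "(b * x + y) div b = x" "(b * N + M) div b = N" using that b(1) by simp_all
      then show "x = N \<and> y = M" using e by simp
    qed simp
    then show ?thesis using b(2) by (auto simp: mem_Times_iff)
  qed
  also have "(\<Oplus>\<^bsub>\<Gamma>\<^esub>q\<in>{c \<in> ?C. ?w Y c = N} \<times> {d \<in> ?E. ?w Z d = M}. f (?p Y (fst q)) (?p Z (snd q)))
      = f (tcoeff n Y N) (tcoeff n Z M)"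
    unfolding t[OF Y] t[OF Z] using Y Z p finite_supp
    by (intro bilinear_sum[OF f, symmetric]) simp_all
  finally show ?thesis ..
qed

end

context dp_algebra
begin

lemma norm_mult_unique:
  assumes n: "0 < n" and f: "is_norm_mult A F n f"
    and u: "u \<in> Gamma_deg A F n" and v: "v \<in> Gamma_deg A F n"
  shows "f u v = norm_mult n u v"
proof -
  interpret b: presentation A "{0::nat}" "{}" by (simp add: presentation.intro AC.is_cring)
  have P: "dp_poly A F"
    by (intro dp_poly.intro dp_base_change.intro dp_algebra_axioms b.PA_cring b.PA_algebra)
  have bil: "bilinear_op A \<Gamma> (Gamma_deg A F n) h" if "is_norm_mult A F n h" for h
    using that Gamma_deg_algebraD unfolding is_norm_mult_def by blast
  have law: "norm_law_after A (presented_algebra A {0::nat} {}) F n h" if "is_norm_mult A F n h" for h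
    using that b.PA_algebra unfolding is_norm_mult_def by blast
  note g = norm_mult_is_norm_mult[OF n]
  note fl = bilinear_opD[OF bil[OF f]] and gl = bilinear_opD[OF bil[OF g]]
  have tt: "f (tcoeff n Y N) (tcoeff n Z M) = norm_mult n (tcoeff n Y N) (tcoeff n Z M)"
    if Y: "Y \<in> carrier UF" and Z: "Z \<in> carrier UF" for Y N Z M
  proof -
    let ?w = "\<lambda>d. \<Sum>k\<in>supp Z. k * d k"
    \<comment> \<open>One more than M plus the sum of all weights of Z, so that
      \<open>law_determines\<close> applies.\<close>
    define b where "b = Suc (M + (\<Sum>d\<in>comps (supp Z) n. ?w d))"
    have b: "M < b" "?w d < b" if "d \<in> comps (supp Z) n" for d
      using member_le_sum[OF that, of ?w] finite_comps[OF finite_supp[OF Z]] by (simp_all add: b_def)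
    have Mb: "M < b" by (simp add: b_def)
    show ?thesis
      using dp_poly.law_determines[OF P n law[OF f] bil[OF f] Y Z Mb b(2)]
        dp_poly.law_determines[OF P n law[OF g] bil[OF g] Y Z Mb b(2)] by metis
  qed
  have 1: "f u (tcoeff n Z M) = norm_mult n u (tcoeff n Z M)" if Z: "Z \<in> carrier UF" for Z M
    by (rule lin_on_ext[OF n fl(1) gl(1) tt u]) (simp_all add: Z tcoeff_deg)
  show ?thesis by (rule lin_on_ext[OF n fl(2)[OF u] gl(2)[OF u] 1 v])
qed

end

section \<open>Norm brackets and their determinants\<close>

text \<open>In the second product, \<open>br c\<close> is \<open>\<gamma>\<^sup>1(c\<^sub>0) * \<dots> * \<gamma>\<^sup>1(c\<^sub>n\<^sub>-\<^sub>1)\<close> and \<open>s i x\<close> is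
  \<open>\<gamma>\<^sup>i(x) * \<gamma>\<^sup>n\<^sup>-\<^sup>i(1)\<close>. The determinantal identities need nothing else.\<close>

locale norm_bracket = cring R + F: cring F for R (structure) and F (structure) +
  fixes n :: nat and br :: "(nat \<Rightarrow> 'c) \<Rightarrow> 'a" and s :: "nat \<Rightarrow> 'c \<Rightarrow> 'a"
  assumes n: "0 < n"
    and br_closed: "(\<And>i. i < n \<Longrightarrow> c i \<in> carrier F) \<Longrightarrow> br c \<in> carrier R"
    and br_cong: "(\<And>i. i < n \<Longrightarrow> c i = d i) \<Longrightarrow> br c = br d"
    and br_add: "\<lbrakk> \<And>i. i < n \<Longrightarrow> c i \<in> carrier F; k < n; x \<in> carrier F; y \<in> carrier F \<rbrakk>
      \<Longrightarrow> br (c(k := x \<oplus>\<^bsub>F\<^esub> y)) = br (c(k := x)) \<oplus> br (c(k := y))"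
    and br_perm: "\<lbrakk> \<And>i. i < n \<Longrightarrow> c i \<in> carrier F; p permutes {..<n} \<rbrakk> \<Longrightarrow> br (\<lambda>i. c (p i)) = br c"
    and br_mult: "\<lbrakk> \<And>i. i < n \<Longrightarrow> c i \<in> carrier F; \<And>i. i < n \<Longrightarrow> d i \<in> carrier F \<rbrakk>
      \<Longrightarrow> br c \<otimes> br d = (\<Oplus>\<tau>\<in>{\<tau>. \<tau> permutes {..<n}}. br (\<lambda>i. c i \<otimes>\<^bsub>F\<^esub> d (\<tau> i)))"
    and s_closed: "\<lbrakk> x \<in> carrier F; i \<le> n \<rbrakk> \<Longrightarrow> s i x \<in> carrier R"
    and s_mult: "\<lbrakk> x \<in> carrier F; i \<le> n; \<And>j. j < n \<Longrightarrow> c j \<in> carrier F \<rbrakk>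
      \<Longrightarrow> s i x \<otimes> br c = (\<Oplus>S\<in>{S. S \<subseteq> {..<n} \<and> card S = i}. br (\<lambda>j. if j \<in> S then x \<otimes>\<^bsub>F\<^esub> c j else c j))"
begin

abbreviation perms where "perms \<equiv> {\<theta>. \<theta> permutes {..<n}}"

definition sg where "sg \<theta> = (if evenperm \<theta> then \<one> else \<ominus> \<one>)"

definition delta where
  "delta x y = (\<Oplus>\<theta>\<in>perms. sg \<theta> \<otimes> br (\<lambda>i. x i \<otimes>\<^bsub>F\<^esub> y (\<theta> i)))"

abbreviation tuple where "tuple x \<equiv> (\<forall>i<n. x i \<in> carrier F)"

lemma finite_perms [simp]: "finite perms"
  by (simp add: finite_permutations)

lemma sg_closed [simp]: "sg \<theta> \<in> carrier R"
  by (simp add: sg_def)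

lemma perms_permutation: "\<theta> \<in> perms \<Longrightarrow> permutation \<theta>"
  using permutation_permutes by blast

lemma perms_lt: "\<lbrakk> \<theta> \<in> perms; i < n \<rbrakk> \<Longrightarrow> \<theta> i < n"
  using permutes_in_image[of \<theta> "{..<n}" i] by auto

lemma sg_comp: "\<lbrakk> \<theta> \<in> perms; \<tau> \<in> perms \<rbrakk> \<Longrightarrow> sg (\<theta> \<circ> \<tau>) = sg \<theta> \<otimes> sg \<tau>"
  unfolding sg_def using evenperm_comp[OF perms_permutation perms_permutation, of \<theta> \<tau>]
  by (simp add: l_minus)

lemma sg_inv: "\<theta> \<in> perms \<Longrightarrow> sg (inv_into UNIV \<theta>) = sg \<theta>"
  unfolding sg_def using evenperm_inv[OF perms_permutation] by simp

lemma sg_sq: "sg \<theta> \<otimes> sg \<theta> = \<one>"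
  unfolding sg_def by (simp add: l_minus)

lemma delta_term_closed [simp]:
  "\<lbrakk> tuple x; tuple y; \<theta> \<in> perms \<rbrakk> \<Longrightarrow> br (\<lambda>i. x i \<otimes>\<^bsub>F\<^esub> y (\<theta> i)) \<in> carrier R"
  using perms_lt by (intro br_closed) simp

lemma delta_closed [simp]: "\<lbrakk> tuple x; tuple y \<rbrakk> \<Longrightarrow> delta x y \<in> carrier R"
  unfolding delta_def by (intro add.finprod_in m_closed sg_closed delta_term_closed)

lemma delta_cong:
  assumes "\<And>i. i < n \<Longrightarrow> x i = x' i" "\<And>i. i < n \<Longrightarrow> y i = y' i" "tuple x" "tuple y"
  shows "delta x y = delta x' y'"
  unfolding delta_def
proof (rule add.finprod_cong2)
  fix \<theta> assume \<theta>: "\<theta> \<in> perms"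
  have "br (\<lambda>i. x i \<otimes>\<^bsub>F\<^esub> y (\<theta> i)) = br (\<lambda>i. x' i \<otimes>\<^bsub>F\<^esub> y' (\<theta> i))"
    using assms(1,2) perms_lt[OF \<theta>] by (intro br_cong) simp
  then show "sg \<theta> \<otimes> br (\<lambda>i. x i \<otimes>\<^bsub>F\<^esub> y (\<theta> i)) = sg \<theta> \<otimes> br (\<lambda>i. x' i \<otimes>\<^bsub>F\<^esub> y' (\<theta> i))" by simp
  show "sg \<theta> \<otimes> br (\<lambda>i. x' i \<otimes>\<^bsub>F\<^esub> y' (\<theta> i)) \<in> carrier R"
    using assms \<theta> by (intro m_closed sg_closed delta_term_closed) auto
qed

lemma delta_add:
  assumes "tuple x" "tuple y" and k: "k < n" and uv: "u \<in> carrier F" "v \<in> carrier F"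
  shows "delta (x(k := u \<oplus>\<^bsub>F\<^esub> v)) y = delta (x(k := u)) y \<oplus> delta (x(k := v)) y"
proof -
  have "delta (x(k := u \<oplus>\<^bsub>F\<^esub> v)) y
      = (\<Oplus>\<theta>\<in>perms. sg \<theta> \<otimes> br (\<lambda>i. (x(k := u)) i \<otimes>\<^bsub>F\<^esub> y (\<theta> i)) \<oplus> sg \<theta> \<otimes> br (\<lambda>i. (x(k := v)) i \<otimes>\<^bsub>F\<^esub> y (\<theta> i)))"
    unfolding delta_def
  proof (rule add.finprod_cong2)
    fix \<theta> assume \<theta>: "\<theta> \<in> perms"
    let ?c = "\<lambda>i. x i \<otimes>\<^bsub>F\<^esub> y (\<theta> i)"
    have e: "(\<lambda>i. (x(k := w)) i \<otimes>\<^bsub>F\<^esub> y (\<theta> i)) = ?c(k := w \<otimes>\<^bsub>F\<^esub> y (\<theta> k))" for w by auto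
    have "br (?c(k := (u \<oplus>\<^bsub>F\<^esub> v) \<otimes>\<^bsub>F\<^esub> y (\<theta> k))) = br (?c(k := u \<otimes>\<^bsub>F\<^esub> y (\<theta> k))) \<oplus> br (?c(k := v \<otimes>\<^bsub>F\<^esub> y (\<theta> k)))"
      using assms perms_lt[OF \<theta>] by (subst br_add[symmetric]) (simp_all add: F.l_distr)
    moreover have cl: "br (?c(k := w \<otimes>\<^bsub>F\<^esub> y (\<theta> k))) \<in> carrier R" if "w \<in> carrier F" for w
      using assms perms_lt[OF \<theta>] that by (intro br_closed) simp
    ultimately show "sg \<theta> \<otimes> br (\<lambda>i. (x(k := u \<oplus>\<^bsub>F\<^esub> v)) i \<otimes>\<^bsub>F\<^esub> y (\<theta> i))
      = sg \<theta> \<otimes> br (\<lambda>i. (x(k := u)) i \<otimes>\<^bsub>F\<^esub> y (\<theta> i)) \<oplus> sg \<theta> \<otimes> br (\<lambda>i. (x(k := v)) i \<otimes>\<^bsub>F\<^esub> y (\<theta> i))"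
      unfolding e using uv by (simp add: r_distr)
    show "sg \<theta> \<otimes> br (\<lambda>i. (x(k := u)) i \<otimes>\<^bsub>F\<^esub> y (\<theta> i)) \<oplus> sg \<theta> \<otimes> br (\<lambda>i. (x(k := v)) i \<otimes>\<^bsub>F\<^esub> y (\<theta> i)) \<in> carrier R"
      unfolding e using cl uv by simp
  qed
  also have "\<dots> = delta (x(k := u)) y \<oplus> delta (x(k := v)) y"
    unfolding delta_def using assms
    by (intro finsum_addf) (auto simp del: fun_upd_apply intro!: m_closed delta_term_closed, auto)
  finally show ?thesis .
qed

text \<open>The bracket locale has no base ring A. The scalar is thus an element of
  \<open>R\<close>, and its effect on brackets is a hypothesis.\<close>

lemma delta_smult:
  assumes "tuple x" "tuple y" and k: "k < n" and z: "z \<in> carrier F" "z' \<in> carrier F" and a: "a \<in> carrier R"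
    and br: "\<And>c y. \<lbrakk> tuple c; y \<in> carrier F \<rbrakk> \<Longrightarrow> br (c(k := z' \<otimes>\<^bsub>F\<^esub> y)) = a \<otimes> br (c(k := z \<otimes>\<^bsub>F\<^esub> y))"
  shows "delta (x(k := z')) y = a \<otimes> delta (x(k := z)) y"
proof -
  have t: "tuple (x(k := z))" using assms by simp
  have "delta (x(k := z')) y = (\<Oplus>\<theta>\<in>perms. a \<otimes> (sg \<theta> \<otimes> br (\<lambda>i. (x(k := z)) i \<otimes>\<^bsub>F\<^esub> y (\<theta> i))))"
    unfolding delta_def
  proof (rule add.finprod_cong2)
    fix \<theta> assume \<theta>: "\<theta> \<in> perms"
    let ?c = "\<lambda>i. x i \<otimes>\<^bsub>F\<^esub> y (\<theta> i)"
    have e: "(\<lambda>i. (x(k := w)) i \<otimes>\<^bsub>F\<^esub> y (\<theta> i)) = ?c(k := w \<otimes>\<^bsub>F\<^esub> y (\<theta> k))" for w by auto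
    have "br (?c(k := z' \<otimes>\<^bsub>F\<^esub> y (\<theta> k))) = a \<otimes> br (?c(k := z \<otimes>\<^bsub>F\<^esub> y (\<theta> k)))"
      using assms perms_lt[OF \<theta>] by (intro br) simp_all
    moreover have "br (?c(k := z \<otimes>\<^bsub>F\<^esub> y (\<theta> k))) \<in> carrier R"
      using assms perms_lt[OF \<theta>] by (intro br_closed) simp
    ultimately show "sg \<theta> \<otimes> br (\<lambda>i. (x(k := z')) i \<otimes>\<^bsub>F\<^esub> y (\<theta> i)) = a \<otimes> (sg \<theta> \<otimes> br (\<lambda>i. (x(k := z)) i \<otimes>\<^bsub>F\<^esub> y (\<theta> i)))"
      unfolding e using a by (simp add: m_lcomm)
    show "a \<otimes> (sg \<theta> \<otimes> br (\<lambda>i. (x(k := z)) i \<otimes>\<^bsub>F\<^esub> y (\<theta> i))) \<in> carrier R"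
      by (intro m_closed a sg_closed delta_term_closed t assms(2) \<theta>)
  qed
  also have "\<dots> = a \<otimes> delta (x(k := z)) y"
    unfolding delta_def using a t assms(2)
    by (intro finsum_rdistr[symmetric]) (auto simp del: fun_upd_apply)
  finally show ?thesis .
qed

lemma perms_inv_bij: "bij_betw (inv_into UNIV) perms perms"
  by (rule bij_betw_byWitness[of _ "inv_into UNIV"]) (auto simp: permutes_inv permutes_inv_inv)

text \<open>Reindexing by the inverse permutation, which has the same sign, moves the permutation
  from y to x; \<open>br_perm\<close> then reorders the slots.\<close>

lemma delta_sym:
  assumes "tuple x" "tuple y" shows "delta x y = delta y x"
proof -
  have "delta x y = (\<Oplus>\<theta>\<in>perms. sg (inv_into UNIV \<theta>) \<otimes> br (\<lambda>i. x i \<otimes>\<^bsub>F\<^esub> y (inv_into UNIV \<theta> i)))"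
    unfolding delta_def using assms
    by (subst add.finprod_bij[OF perms_inv_bij]) (simp_all add: permutes_inv)
  also have "\<dots> = delta y x"
    unfolding delta_def
  proof (rule add.finprod_cong2)
    fix \<theta> assume \<theta>: "\<theta> \<in> perms"
    have "br (\<lambda>i. x i \<otimes>\<^bsub>F\<^esub> y (inv_into UNIV \<theta> i)) = br (\<lambda>i. x (\<theta> i) \<otimes>\<^bsub>F\<^esub> y (inv_into UNIV \<theta> (\<theta> i)))"
      using assms \<theta> perms_lt[of "inv_into UNIV \<theta>"] by (subst br_perm[of _ \<theta>]) (simp_all add: permutes_inv)
    also have "\<dots> = br (\<lambda>i. y i \<otimes>\<^bsub>F\<^esub> x (\<theta> i))"
      using assms \<theta> perms_lt[OF \<theta>] by (intro br_cong) (simp add: permutes_inverses F.m_comm)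
    finally show "sg (inv_into UNIV \<theta>) \<otimes> br (\<lambda>i. x i \<otimes>\<^bsub>F\<^esub> y (inv_into UNIV \<theta> i)) = sg \<theta> \<otimes> br (\<lambda>i. y i \<otimes>\<^bsub>F\<^esub> x (\<theta> i))"
      using \<theta> by (simp add: sg_inv)
  qed (use assms in simp)
  finally show ?thesis .
qed

text \<open>Composition with the transposition matches even with odd permutations, and matched terms
  cancel. Splitting by parity instead of showing that the sum equals its own negative covers
  characteristic 2 as well.\<close>

lemma alternating_zero:
  assumes a: "a < n" "b < n" "a \<noteq> b"
    and h: "\<And>\<tau>. \<tau> \<in> perms \<Longrightarrow> h \<tau> \<in> carrier R" "\<And>\<tau>. \<tau> \<in> perms \<Longrightarrow> h (\<tau> \<circ> transpose a b) = h \<tau>"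
  shows "(\<Oplus>\<tau>\<in>perms. sg \<tau> \<otimes> h \<tau>) = \<zero>"
proof -
  let ?t = "transpose a b"
  have t: "?t \<in> perms" using a by (simp add: permutes_swap_id)
  have st: "sg ?t = \<ominus> \<one>" using a by (simp add: sg_def evenperm_swap)
  let ?E = "{\<tau> \<in> perms. evenperm \<tau>}" and ?O = "{\<tau> \<in> perms. \<not> evenperm \<tau>}"
  have tt: "\<tau> \<circ> ?t \<in> perms" if "\<tau> \<in> perms" for \<tau>
    using that t by (auto intro: permutes_compose)
  have ev: "evenperm (\<tau> \<circ> ?t) \<longleftrightarrow> \<not> evenperm \<tau>" if "\<tau> \<in> perms" for \<tau>
    using evenperm_comp[OF perms_permutation[OF that] perms_permutation[OF t]] a by (simp add: evenperm_swap)
  have bij: "bij_betw (\<lambda>\<tau>. \<tau> \<circ> ?t) ?E ?O"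
    by (rule bij_betw_byWitness[of _ "\<lambda>\<tau>. \<tau> \<circ> ?t"]) (use tt ev in \<open>auto simp: comp_assoc\<close>)
  have cl: "sg \<tau> \<otimes> h \<tau> \<in> carrier R" if "\<tau> \<in> perms" for \<tau> using h that by simp
  have "(\<Oplus>\<tau>\<in>?O. sg \<tau> \<otimes> h \<tau>) = (\<Oplus>\<tau>\<in>?E. sg (\<tau> \<circ> ?t) \<otimes> h (\<tau> \<circ> ?t))"
    using cl by (intro add.finprod_bij[OF bij]) simp
  also have "\<dots> = (\<Oplus>\<tau>\<in>?E. (\<ominus> \<one>) \<otimes> (sg \<tau> \<otimes> h \<tau>))"
    using h t cl by (intro add.finprod_cong2) (simp_all add: sg_comp st l_minus r_minus)
  also have "\<dots> = (\<ominus> \<one>) \<otimes> (\<Oplus>\<tau>\<in>?E. sg \<tau> \<otimes> h \<tau>)"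
    using cl by (intro finsum_rdistr[symmetric]) auto
  finally have o: "(\<Oplus>\<tau>\<in>?O. sg \<tau> \<otimes> h \<tau>) = (\<ominus> \<one>) \<otimes> (\<Oplus>\<tau>\<in>?E. sg \<tau> \<otimes> h \<tau>)" .
  have P: "perms = ?E \<union> ?O" by auto
  have Ecl: "(\<Oplus>\<tau>\<in>?E. sg \<tau> \<otimes> h \<tau>) \<in> carrier R" using cl by (intro add.finprod_in) simp
  have "(\<Oplus>\<tau>\<in>perms. sg \<tau> \<otimes> h \<tau>) = (\<Oplus>\<tau>\<in>?E \<union> ?O. sg \<tau> \<otimes> h \<tau>)"
    by (rule arg_cong[OF P])
  also have "\<dots> = (\<Oplus>\<tau>\<in>?E. sg \<tau> \<otimes> h \<tau>) \<oplus> (\<Oplus>\<tau>\<in>?O. sg \<tau> \<otimes> h \<tau>)"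
    using cl by (intro finsum_Un_disjoint) auto
  also have "\<dots> = \<zero>" unfolding o using Ecl by (simp add: l_minus r_neg)
  finally show ?thesis .
qed

text \<open>An alternating sum that pairs w_i with x_(tau i) and attaches a weight d_i to slot i. A
  product of two norms is a signed sum of such expressions in which y and y' enter only through the
  weights, so identities in w and x can be proved for fixed weights.\<close>

definition pairing where
  "pairing d w x = (\<Oplus>\<tau>\<in>perms. sg \<tau> \<otimes> br (\<lambda>i. w i \<otimes>\<^bsub>F\<^esub> x (\<tau> i) \<otimes>\<^bsub>F\<^esub> d i))"

lemma pairing_term_closed [simp]:
  "\<lbrakk> tuple d; tuple w; tuple x; \<tau> \<in> perms \<rbrakk> \<Longrightarrow> br (\<lambda>i. w i \<otimes>\<^bsub>F\<^esub> x (\<tau> i) \<otimes>\<^bsub>F\<^esub> d i) \<in> carrier R"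
  using perms_lt by (intro br_closed) simp

lemma pairing_closed [simp]: "\<lbrakk> tuple d; tuple w; tuple x \<rbrakk> \<Longrightarrow> pairing d w x \<in> carrier R"
  unfolding pairing_def by (intro add.finprod_in m_closed sg_closed pairing_term_closed)

lemma delta_mult:
  assumes "tuple w" "tuple y" "tuple x" "tuple y'"
  shows "delta w y \<otimes> delta x y' = (\<Oplus>\<theta>\<in>perms. \<Oplus>\<rho>\<in>perms. sg \<theta> \<otimes> sg \<rho> \<otimes>
    pairing (\<lambda>i. y (\<theta> i) \<otimes>\<^bsub>F\<^esub> y' (\<rho> i)) w x)"
proof -
  let ?b = "\<lambda>\<theta> \<rho> \<tau>. br (\<lambda>i. w i \<otimes>\<^bsub>F\<^esub> x (\<tau> i) \<otimes>\<^bsub>F\<^esub> (y (\<theta> i) \<otimes>\<^bsub>F\<^esub> y' (\<rho> i)))"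
  have td: "tuple (\<lambda>i. y (\<theta> i) \<otimes>\<^bsub>F\<^esub> y' (\<rho> i))" if "\<theta> \<in> perms" "\<rho> \<in> perms" for \<theta> \<rho>
    using assms perms_lt[OF that(1)] perms_lt[OF that(2)] by simp
  have cl [simp]: "?b \<theta> \<rho> \<tau> \<in> carrier R" if "\<theta> \<in> perms" "\<rho> \<in> perms" "\<tau> \<in> perms" for \<theta> \<rho> \<tau>
    using assms td[OF that(1,2)] that(3) by (intro pairing_term_closed)
  have comp: "\<theta>' \<circ> \<tau> \<in> perms" if "\<theta>' \<in> perms" "\<tau> \<in> perms" for \<theta>' \<tau>
    using that by (auto intro: permutes_compose)
  have step: "br (\<lambda>i. w i \<otimes>\<^bsub>F\<^esub> y (\<theta> i)) \<otimes> delta x y' = (\<Oplus>\<rho>\<in>perms. sg \<rho> \<otimes> (\<Oplus>\<tau>\<in>perms. sg \<tau> \<otimes> ?b \<theta> \<rho> \<tau>))"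
    if \<theta>: "\<theta> \<in> perms" for \<theta>
  proof -
    have "br (\<lambda>i. w i \<otimes>\<^bsub>F\<^esub> y (\<theta> i)) \<otimes> delta x y'
        = (\<Oplus>\<theta>'\<in>perms. br (\<lambda>i. w i \<otimes>\<^bsub>F\<^esub> y (\<theta> i)) \<otimes> (sg \<theta>' \<otimes> br (\<lambda>i. x i \<otimes>\<^bsub>F\<^esub> y' (\<theta>' i))))"
      unfolding delta_def using assms \<theta> by (intro finsum_rdistr) auto
    also have "\<dots> = (\<Oplus>\<theta>'\<in>perms. \<Oplus>\<tau>\<in>perms. sg \<theta>' \<otimes> ?b \<theta> (\<theta>' \<circ> \<tau>) \<tau>)"
    proof (rule add.finprod_cong2)
      fix \<theta>' assume \<theta>': "\<theta>' \<in> perms"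
      have "br (\<lambda>i. w i \<otimes>\<^bsub>F\<^esub> y (\<theta> i)) \<otimes> br (\<lambda>i. x i \<otimes>\<^bsub>F\<^esub> y' (\<theta>' i))
          = (\<Oplus>\<tau>\<in>perms. br (\<lambda>i. w i \<otimes>\<^bsub>F\<^esub> y (\<theta> i) \<otimes>\<^bsub>F\<^esub> (x (\<tau> i) \<otimes>\<^bsub>F\<^esub> y' (\<theta>' (\<tau> i)))))"
        using assms perms_lt[OF \<theta>] perms_lt[OF \<theta>'] by (intro br_mult) simp_all
      also have "\<dots> = (\<Oplus>\<tau>\<in>perms. ?b \<theta> (\<theta>' \<circ> \<tau>) \<tau>)"
      proof (rule add.finprod_cong2)
        fix \<tau> assume \<tau>: "\<tau> \<in> perms"
        show "br (\<lambda>i. w i \<otimes>\<^bsub>F\<^esub> y (\<theta> i) \<otimes>\<^bsub>F\<^esub> (x (\<tau> i) \<otimes>\<^bsub>F\<^esub> y' (\<theta>' (\<tau> i)))) = ?b \<theta> (\<theta>' \<circ> \<tau>) \<tau>"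
          using assms perms_lt[OF \<theta>] perms_lt[OF \<theta>'] perms_lt[OF \<tau>]
          by (intro br_cong) (simp add: F.m_ac)
        show "?b \<theta> (\<theta>' \<circ> \<tau>) \<tau> \<in> carrier R" by (rule cl[OF \<theta> comp[OF \<theta>' \<tau>] \<tau>])
      qed
      finally have e: "br (\<lambda>i. w i \<otimes>\<^bsub>F\<^esub> y (\<theta> i)) \<otimes> br (\<lambda>i. x i \<otimes>\<^bsub>F\<^esub> y' (\<theta>' i)) = (\<Oplus>\<tau>\<in>perms. ?b \<theta> (\<theta>' \<circ> \<tau>) \<tau>)" .
      have cl': "(\<lambda>\<tau>. ?b \<theta> (\<theta>' \<circ> \<tau>) \<tau>) \<in> perms \<rightarrow> carrier R" using cl[OF \<theta> comp[OF \<theta>']] by blast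
      have "br (\<lambda>i. w i \<otimes>\<^bsub>F\<^esub> y (\<theta> i)) \<otimes> (sg \<theta>' \<otimes> br (\<lambda>i. x i \<otimes>\<^bsub>F\<^esub> y' (\<theta>' i)))
          = sg \<theta>' \<otimes> (br (\<lambda>i. w i \<otimes>\<^bsub>F\<^esub> y (\<theta> i)) \<otimes> br (\<lambda>i. x i \<otimes>\<^bsub>F\<^esub> y' (\<theta>' i)))"
        using assms \<theta> \<theta>' by (intro m_lcomm delta_term_closed sg_closed)
      then show "br (\<lambda>i. w i \<otimes>\<^bsub>F\<^esub> y (\<theta> i)) \<otimes> (sg \<theta>' \<otimes> br (\<lambda>i. x i \<otimes>\<^bsub>F\<^esub> y' (\<theta>' i)))
          = (\<Oplus>\<tau>\<in>perms. sg \<theta>' \<otimes> ?b \<theta> (\<theta>' \<circ> \<tau>) \<tau>)"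
        using finsum_rdistr[OF finite_perms sg_closed cl'] e by simp
      show "(\<Oplus>\<tau>\<in>perms. sg \<theta>' \<otimes> ?b \<theta> (\<theta>' \<circ> \<tau>) \<tau>) \<in> carrier R"
        using cl' by (intro add.finprod_in m_closed sg_closed) blast
    qed
    also have "\<dots> = (\<Oplus>\<tau>\<in>perms. \<Oplus>\<theta>'\<in>perms. sg \<theta>' \<otimes> ?b \<theta> (\<theta>' \<circ> \<tau>) \<tau>)"
      using cl[OF \<theta> comp] by (intro add.finprod_swap m_closed sg_closed finite_perms)
    \<comment> \<open>Put rho = theta' o tau. Then the sign of theta' is the product of those of rho
      and tau, and the inner sum over tau becomes a pairing.\<close>
    also have "\<dots> = (\<Oplus>\<tau>\<in>perms. \<Oplus>\<rho>\<in>perms. sg \<rho> \<otimes> (sg \<tau> \<otimes> ?b \<theta> \<rho> \<tau>))"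
    proof (rule add.finprod_cong2)
      fix \<tau> assume \<tau>: "\<tau> \<in> perms"
      have \<tau>i: "inv_into UNIV \<tau> \<in> perms" using \<tau> by (simp add: permutes_inv)
      have o: "\<tau> \<circ> inv_into UNIV \<tau> = id" "inv_into UNIV \<tau> \<circ> \<tau> = id" using \<tau> permutes_inv_o by auto
      have bij: "bij_betw (\<lambda>\<theta>'. \<theta>' \<circ> \<tau>) perms perms"
        using comp[OF _ \<tau>] comp[OF _ \<tau>i]
        by (intro bij_betw_byWitness[where f' = "\<lambda>\<rho>. \<rho> \<circ> inv_into UNIV \<tau>"]) (auto simp: comp_assoc o)
      have "(\<Oplus>\<rho>\<in>perms. sg \<rho> \<otimes> (sg \<tau> \<otimes> ?b \<theta> \<rho> \<tau>)) = (\<Oplus>\<theta>'\<in>perms. sg (\<theta>' \<circ> \<tau>) \<otimes> (sg \<tau> \<otimes> ?b \<theta> (\<theta>' \<circ> \<tau>) \<tau>))"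
        using cl[OF \<theta> _ \<tau>] by (intro add.finprod_bij[OF bij] m_closed sg_closed)
      also have "\<dots> = (\<Oplus>\<theta>'\<in>perms. sg \<theta>' \<otimes> ?b \<theta> (\<theta>' \<circ> \<tau>) \<tau>)"
      proof (rule add.finprod_cong2)
        fix \<theta>' assume \<theta>': "\<theta>' \<in> perms"
        note c = cl[OF \<theta> comp[OF \<theta>' \<tau>] \<tau>]
        have "sg (\<theta>' \<circ> \<tau>) \<otimes> (sg \<tau> \<otimes> ?b \<theta> (\<theta>' \<circ> \<tau>) \<tau>) = sg \<theta>' \<otimes> ((sg \<tau> \<otimes> sg \<tau>) \<otimes> ?b \<theta> (\<theta>' \<circ> \<tau>) \<tau>)"
          unfolding sg_comp[OF \<theta>' \<tau>] using c by (simp only: m_assoc m_closed sg_closed)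
        then show "sg (\<theta>' \<circ> \<tau>) \<otimes> (sg \<tau> \<otimes> ?b \<theta> (\<theta>' \<circ> \<tau>) \<tau>) = sg \<theta>' \<otimes> ?b \<theta> (\<theta>' \<circ> \<tau>) \<tau>"
          using c by (simp only: sg_sq l_one)
        show "sg \<theta>' \<otimes> ?b \<theta> (\<theta>' \<circ> \<tau>) \<tau> \<in> carrier R" using c by (intro m_closed sg_closed)
      qed
      finally show "(\<Oplus>\<theta>'\<in>perms. sg \<theta>' \<otimes> ?b \<theta> (\<theta>' \<circ> \<tau>) \<tau>) = (\<Oplus>\<rho>\<in>perms. sg \<rho> \<otimes> (sg \<tau> \<otimes> ?b \<theta> \<rho> \<tau>))" ..
      show "(\<Oplus>\<rho>\<in>perms. sg \<rho> \<otimes> (sg \<tau> \<otimes> ?b \<theta> \<rho> \<tau>)) \<in> carrier R"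
        using cl[OF \<theta> _ \<tau>] by (intro add.finprod_in m_closed sg_closed)
    qed
    also have "\<dots> = (\<Oplus>\<rho>\<in>perms. \<Oplus>\<tau>\<in>perms. sg \<rho> \<otimes> (sg \<tau> \<otimes> ?b \<theta> \<rho> \<tau>))"
      using cl[OF \<theta>] by (intro add.finprod_swap m_closed sg_closed finite_perms)
    also have "\<dots> = (\<Oplus>\<rho>\<in>perms. sg \<rho> \<otimes> (\<Oplus>\<tau>\<in>perms. sg \<tau> \<otimes> ?b \<theta> \<rho> \<tau>))"
      using cl[OF \<theta>] by (intro add.finprod_cong2 finsum_rdistr[symmetric]) (auto intro!: add.finprod_in)
    finally show ?thesis .
  qed
  have dxy: "delta x y' \<in> carrier R" using assms by simp
  have "delta w y \<otimes> delta x y' = (\<Oplus>\<theta>\<in>perms. sg \<theta> \<otimes> br (\<lambda>i. w i \<otimes>\<^bsub>F\<^esub> y (\<theta> i)) \<otimes> delta x y')"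
    unfolding delta_def[of w y] using assms dxy by (intro finsum_ldistr) auto
  also have "\<dots> = (\<Oplus>\<theta>\<in>perms. \<Oplus>\<rho>\<in>perms. sg \<theta> \<otimes> sg \<rho> \<otimes> pairing (\<lambda>i. y (\<theta> i) \<otimes>\<^bsub>F\<^esub> y' (\<rho> i)) w x)"
  proof (rule add.finprod_cong2)
    fix \<theta> assume \<theta>: "\<theta> \<in> perms"
    have pc: "pairing (\<lambda>i. y (\<theta> i) \<otimes>\<^bsub>F\<^esub> y' (\<rho> i)) w x \<in> carrier R" if "\<rho> \<in> perms" for \<rho>
      using assms td[OF \<theta> that] by (intro pairing_closed)
    have "sg \<theta> \<otimes> br (\<lambda>i. w i \<otimes>\<^bsub>F\<^esub> y (\<theta> i)) \<otimes> delta x y' = sg \<theta> \<otimes> (br (\<lambda>i. w i \<otimes>\<^bsub>F\<^esub> y (\<theta> i)) \<otimes> delta x y')"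
      using assms \<theta> dxy by (intro m_assoc sg_closed delta_term_closed)
    also have "\<dots> = sg \<theta> \<otimes> (\<Oplus>\<rho>\<in>perms. sg \<rho> \<otimes> pairing (\<lambda>i. y (\<theta> i) \<otimes>\<^bsub>F\<^esub> y' (\<rho> i)) w x)"
      unfolding step[OF \<theta>] pairing_def ..
    also have "\<dots> = (\<Oplus>\<rho>\<in>perms. sg \<theta> \<otimes> (sg \<rho> \<otimes> pairing (\<lambda>i. y (\<theta> i) \<otimes>\<^bsub>F\<^esub> y' (\<rho> i)) w x))"
      using pc by (intro finsum_rdistr) auto
    also have "\<dots> = (\<Oplus>\<rho>\<in>perms. sg \<theta> \<otimes> sg \<rho> \<otimes> pairing (\<lambda>i. y (\<theta> i) \<otimes>\<^bsub>F\<^esub> y' (\<rho> i)) w x)"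
      using pc by (intro add.finprod_cong2) (simp_all only: m_assoc sg_closed m_closed)
    finally show "sg \<theta> \<otimes> br (\<lambda>i. w i \<otimes>\<^bsub>F\<^esub> y (\<theta> i)) \<otimes> delta x y'
        = (\<Oplus>\<rho>\<in>perms. sg \<theta> \<otimes> sg \<rho> \<otimes> pairing (\<lambda>i. y (\<theta> i) \<otimes>\<^bsub>F\<^esub> y' (\<rho> i)) w x)" .
    show "(\<Oplus>\<rho>\<in>perms. sg \<theta> \<otimes> sg \<rho> \<otimes> pairing (\<lambda>i. y (\<theta> i) \<otimes>\<^bsub>F\<^esub> y' (\<rho> i)) w x) \<in> carrier R"
      using pc by (intro add.finprod_in m_closed sg_closed)
  qed
  finally show ?thesis .
qed

text \<open>The terms in which \<open>z\<close> does not end up in the slot \<open>k\<close> cancel in pairs.\<close>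

lemma pairing_cramer:
  assumes d: "tuple d" and w: "tuple w" and x: "tuple x" and k: "k < n" and z: "z \<in> carrier F" and q: "q \<in> carrier F"
  shows "pairing d (w(k := q \<otimes>\<^bsub>F\<^esub> z)) x = (\<Oplus>i\<in>{..<n}. pairing d (w(k := q \<otimes>\<^bsub>F\<^esub> x i)) (x(i := z)))"
proof -
  \<comment> \<open>For fixed tau the replaced index is i = \<open>\<tau> j0\<close>, where
    \<open>j0\<close> is the slot that receives z; the sum over i becomes a sum over
    \<open>j0\<close>.\<close>
  define h where "h \<tau> j0 = br (\<lambda>j. (w(k := q \<otimes>\<^bsub>F\<^esub> x (\<tau> j0))) j \<otimes>\<^bsub>F\<^esub> (x(\<tau> j0 := z)) (\<tau> j) \<otimes>\<^bsub>F\<^esub> d j)" for \<tau> j0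
  have cl: "h \<tau> j0 \<in> carrier R" if "\<tau> \<in> perms" "j0 < n" for \<tau> j0
    unfolding h_def using assms that(1) perms_lt[OF that] by (intro pairing_term_closed) simp_all
  have inj: "\<tau> i = \<tau> j \<longleftrightarrow> i = j" if "\<tau> \<in> perms" for \<tau> i j
    using that permutes_inj by (auto dest: injD)
  \<comment> \<open>If \<open>j0\<close> differs from k, slot k contains both x(tau k) and x(tau
    j0), and slot \<open>j0\<close> contains z. Exchanging the two values of tau changes neither
    slot but reverses the sign.\<close>
  have zero: "(\<Oplus>\<tau>\<in>perms. sg \<tau> \<otimes> h \<tau> j0) = \<zero>" if j0: "j0 < n" "j0 \<noteq> k" for j0
  proof (rule alternating_zero[of k j0])
    show "h (\<tau> \<circ> transpose k j0) j0 = h \<tau> j0" if \<tau>: "\<tau> \<in> perms" for \<tau>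
      unfolding h_def
    proof (rule br_cong)
      fix j assume j: "j < n"
      have lt: "\<tau> k < n" "\<tau> j0 < n" using perms_lt[OF \<tau>] k j0 by auto
      show "(w(k := q \<otimes>\<^bsub>F\<^esub> x ((\<tau> \<circ> transpose k j0) j0))) j \<otimes>\<^bsub>F\<^esub> (x((\<tau> \<circ> transpose k j0) j0 := z)) ((\<tau> \<circ> transpose k j0) j) \<otimes>\<^bsub>F\<^esub> d j
        = (w(k := q \<otimes>\<^bsub>F\<^esub> x (\<tau> j0))) j \<otimes>\<^bsub>F\<^esub> (x(\<tau> j0 := z)) (\<tau> j) \<otimes>\<^bsub>F\<^esub> d j"
        using j0 lt x q d j k by (auto simp: transpose_def inj[OF \<tau>] F.m_ac)
    qed
  qed (use k j0 cl in auto)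
  have "(\<Oplus>i\<in>{..<n}. pairing d (w(k := q \<otimes>\<^bsub>F\<^esub> x i)) (x(i := z)))
      = (\<Oplus>\<tau>\<in>perms. \<Oplus>i\<in>{..<n}. sg \<tau> \<otimes> br (\<lambda>j. (w(k := q \<otimes>\<^bsub>F\<^esub> x i)) j \<otimes>\<^bsub>F\<^esub> (x(i := z)) (\<tau> j) \<otimes>\<^bsub>F\<^esub> d j))"
    unfolding pairing_def using assms
    by (intro add.finprod_swap m_closed sg_closed pairing_term_closed finite_perms) simp_all
  also have "\<dots> = (\<Oplus>\<tau>\<in>perms. \<Oplus>j0\<in>{..<n}. sg \<tau> \<otimes> h \<tau> j0)"
  proof (rule add.finprod_cong2)
    fix \<tau> assume \<tau>: "\<tau> \<in> perms"
    have bij: "bij_betw \<tau> {..<n} {..<n}" using \<tau> by (simp add: permutes_imp_bij)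
    have c: "br (\<lambda>j. (w(k := q \<otimes>\<^bsub>F\<^esub> x i)) j \<otimes>\<^bsub>F\<^esub> (x(i := z)) (\<tau> j) \<otimes>\<^bsub>F\<^esub> d j) \<in> carrier R" if "i < n" for i
      using assms that \<tau> by (intro pairing_term_closed) simp_all
    show "(\<Oplus>i\<in>{..<n}. sg \<tau> \<otimes> br (\<lambda>j. (w(k := q \<otimes>\<^bsub>F\<^esub> x i)) j \<otimes>\<^bsub>F\<^esub> (x(i := z)) (\<tau> j) \<otimes>\<^bsub>F\<^esub> d j))
        = (\<Oplus>j0\<in>{..<n}. sg \<tau> \<otimes> h \<tau> j0)"
      unfolding h_def using c by (intro add.finprod_bij[OF bij] m_closed sg_closed) simp
    show "(\<Oplus>j0\<in>{..<n}. sg \<tau> \<otimes> h \<tau> j0) \<in> carrier R"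
      using cl[OF \<tau>] by (intro add.finprod_in m_closed sg_closed) simp
  qed
  also have "\<dots> = (\<Oplus>j0\<in>{..<n}. \<Oplus>\<tau>\<in>perms. sg \<tau> \<otimes> h \<tau> j0)"
    using cl by (intro add.finprod_swap m_closed sg_closed finite_perms) simp_all
  also have "\<dots> = (\<Oplus>j0\<in>{..<n}. if k = j0 then (\<Oplus>\<tau>\<in>perms. sg \<tau> \<otimes> h \<tau> j0) else \<zero>)"
    using zero cl by (intro add.finprod_cong2) (auto intro!: add.finprod_in)
  also have "\<dots> = (\<Oplus>\<tau>\<in>perms. sg \<tau> \<otimes> h \<tau> k)"
    using k cl by (intro finsum_singleton) (auto intro!: add.finprod_in)
  also have "\<dots> = pairing d (w(k := q \<otimes>\<^bsub>F\<^esub> z)) x"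
    unfolding pairing_def
  proof (rule add.finprod_cong2)
    fix \<tau> assume \<tau>: "\<tau> \<in> perms"
    have "h \<tau> k = br (\<lambda>i. (w(k := q \<otimes>\<^bsub>F\<^esub> z)) i \<otimes>\<^bsub>F\<^esub> x (\<tau> i) \<otimes>\<^bsub>F\<^esub> d i)"
      unfolding h_def
    proof (rule br_cong)
      fix j assume j: "j < n"
      show "(w(k := q \<otimes>\<^bsub>F\<^esub> x (\<tau> k))) j \<otimes>\<^bsub>F\<^esub> (x(\<tau> k := z)) (\<tau> j) \<otimes>\<^bsub>F\<^esub> d j
        = (w(k := q \<otimes>\<^bsub>F\<^esub> z)) j \<otimes>\<^bsub>F\<^esub> x (\<tau> j) \<otimes>\<^bsub>F\<^esub> d j"
        using perms_lt[OF \<tau> k] x q d z j k by (auto simp: inj[OF \<tau>] F.m_ac)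
    qed
    then show "sg \<tau> \<otimes> h \<tau> k = sg \<tau> \<otimes> br (\<lambda>i. (w(k := q \<otimes>\<^bsub>F\<^esub> z)) i \<otimes>\<^bsub>F\<^esub> x (\<tau> i) \<otimes>\<^bsub>F\<^esub> d i)" by simp
    show "sg \<tau> \<otimes> br (\<lambda>i. (w(k := q \<otimes>\<^bsub>F\<^esub> z)) i \<otimes>\<^bsub>F\<^esub> x (\<tau> i) \<otimes>\<^bsub>F\<^esub> d i) \<in> carrier R"
      using assms \<tau> by (intro m_closed sg_closed pairing_term_closed) simp_all
  qed
  finally show ?thesis ..
qed

text \<open>By \<open>delta_mult\<close> the claim follows from \<open>pairing_cramer\<close> for
  every choice of weights. The factor q stays in slot k, which allows a monomial to be cut in two
  and only one part to be exchanged.\<close>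

theorem delta_cramer:
  assumes w: "tuple w" and y: "tuple y" and x: "tuple x" and y': "tuple y'"
    and k: "k < n" and z: "z \<in> carrier F" and q: "q \<in> carrier F"
  shows "delta (w(k := q \<otimes>\<^bsub>F\<^esub> z)) y \<otimes> delta x y'
    = (\<Oplus>i\<in>{..<n}. delta (w(k := q \<otimes>\<^bsub>F\<^esub> x i)) y \<otimes> delta (x(i := z)) y')"
proof -
  let ?d = "\<lambda>\<theta> \<rho> i. y (\<theta> i) \<otimes>\<^bsub>F\<^esub> y' (\<rho> i)"
  let ?P = "\<lambda>\<theta> \<rho> i. pairing (?d \<theta> \<rho>) (w(k := q \<otimes>\<^bsub>F\<^esub> x i)) (x(i := z))"
  have td: "tuple (?d \<theta> \<rho>)" if "\<theta> \<in> perms" "\<rho> \<in> perms" for \<theta> \<rho>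
    using y y' perms_lt[OF that(1)] perms_lt[OF that(2)] by simp
  have t: "tuple (w(k := q \<otimes>\<^bsub>F\<^esub> z))" "i < n \<Longrightarrow> tuple (w(k := q \<otimes>\<^bsub>F\<^esub> x i))" "tuple (x(i := z))" for i
    using assms by simp_all
  have P: "?P \<theta> \<rho> i \<in> carrier R" if "\<theta> \<in> perms" "\<rho> \<in> perms" "i < n" for \<theta> \<rho> i
    using td[OF that(1,2)] t(2)[OF that(3)] t(3) by (intro pairing_closed)
  have "delta (w(k := q \<otimes>\<^bsub>F\<^esub> z)) y \<otimes> delta x y'
      = (\<Oplus>\<theta>\<in>perms. \<Oplus>\<rho>\<in>perms. \<Oplus>i\<in>{..<n}. sg \<theta> \<otimes> sg \<rho> \<otimes> ?P \<theta> \<rho> i)"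
    unfolding delta_mult[OF t(1) y x y']
  proof (rule add.finprod_cong2, rule add.finprod_cong2)
    fix \<theta> \<rho> assume \<theta>\<rho>: "\<theta> \<in> perms" "\<rho> \<in> perms"
    show "sg \<theta> \<otimes> sg \<rho> \<otimes> pairing (?d \<theta> \<rho>) (w(k := q \<otimes>\<^bsub>F\<^esub> z)) x = (\<Oplus>i\<in>{..<n}. sg \<theta> \<otimes> sg \<rho> \<otimes> ?P \<theta> \<rho> i)"
      unfolding pairing_cramer[OF td[OF \<theta>\<rho>] w x k z q]
      using P[OF \<theta>\<rho>] by (intro finsum_rdistr) auto
  qed (use P in \<open>auto intro!: add.finprod_in\<close>)
  also have "\<dots> = (\<Oplus>\<theta>\<in>perms. \<Oplus>i\<in>{..<n}. \<Oplus>\<rho>\<in>perms. sg \<theta> \<otimes> sg \<rho> \<otimes> ?P \<theta> \<rho> i)"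
    using P by (intro add.finprod_cong2 add.finprod_swap m_closed sg_closed finite_perms)
      (auto intro!: add.finprod_in)
  also have "\<dots> = (\<Oplus>i\<in>{..<n}. \<Oplus>\<theta>\<in>perms. \<Oplus>\<rho>\<in>perms. sg \<theta> \<otimes> sg \<rho> \<otimes> ?P \<theta> \<rho> i)"
    using P by (intro add.finprod_swap finite_perms) (auto intro!: add.finprod_in)
  also have "\<dots> = (\<Oplus>i\<in>{..<n}. delta (w(k := q \<otimes>\<^bsub>F\<^esub> x i)) y \<otimes> delta (x(i := z)) y')"
  proof (rule add.finprod_cong2)
    fix i assume "i \<in> {..<n}"
    then have i: "i < n" by simp
    show "(\<Oplus>\<theta>\<in>perms. \<Oplus>\<rho>\<in>perms. sg \<theta> \<otimes> sg \<rho> \<otimes> ?P \<theta> \<rho> i)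
        = delta (w(k := q \<otimes>\<^bsub>F\<^esub> x i)) y \<otimes> delta (x(i := z)) y'"
      by (rule delta_mult[OF t(2)[OF i] y t(3) y', symmetric])
    show "delta (w(k := q \<otimes>\<^bsub>F\<^esub> x i)) y \<otimes> delta (x(i := z)) y' \<in> carrier R"
      by (intro m_closed delta_closed t(2)[OF i] y t(3) y')
  qed
  finally show ?thesis .
qed

text \<open>The Cayley-Hamilton theorem for \<open>t\<close>, in the slot \<open>k\<close>.\<close>

lemma delta_power_in_ideal:
  assumes I: "ideal I R" and x: "tuple x" and y: "tuple y" and k: "k < n"
    and t: "t \<in> carrier F" and c: "c \<in> carrier F"
    and lower: "\<And>m. m < n \<Longrightarrow> delta (x(k := t [^]\<^bsub>F\<^esub> m \<otimes>\<^bsub>F\<^esub> c)) y \<in> I"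
  shows "delta (x(k := t [^]\<^bsub>F\<^esub> n \<otimes>\<^bsub>F\<^esub> c)) y \<in> I"
proof -
  interpret I: ideal I R by fact
  define pw where "pw m = x(k := t [^]\<^bsub>F\<^esub> (m::nat) \<otimes>\<^bsub>F\<^esub> c)" for m
  \<comment> \<open>The power of t in slot k is n minus the size of S, and each slot in S receives
    one more factor t, so every such term carries t exactly n times.\<close>
  define b where "b \<theta> S = br (\<lambda>j. if j \<in> S then t \<otimes>\<^bsub>F\<^esub> (pw (n - card S) j \<otimes>\<^bsub>F\<^esub> y (\<theta> j)) else pw (n - card S) j \<otimes>\<^bsub>F\<^esub> y (\<theta> j))"
    for \<theta> S
  define e where "e S = (\<Oplus>\<theta>\<in>perms. sg \<theta> \<otimes> b \<theta> S)" for S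
  have pw: "tuple (pw m)" for m unfolding pw_def using x t c by simp
  have bcl: "b \<theta> S \<in> carrier R" if "\<theta> \<in> perms" for \<theta> S
    unfolding b_def using pw y t perms_lt[OF that] by (intro br_closed) simp
  have ecl: "e S \<in> carrier R" for S
    unfolding e_def using bcl by (intro add.finprod_in m_closed sg_closed)
  let ?sgn = "\<lambda>S. if even (card S) then \<one> else \<ominus> \<one>"
  \<comment> \<open>By \<open>s_mult\<close> the subsets of size i together give
    \<open>s i t\<close> times one norm, whose slot k has the power n - i of t. For i > 0 this norm
    lies in the ideal by assumption.\<close>
  have level: "(\<Oplus>S\<in>{S. S \<subseteq> {..<n} \<and> card S = i}. e S) = s i t \<otimes> delta (pw (n - i)) y" if i: "i \<le> n" for i
  proof -
    have "(\<Oplus>S\<in>{S. S \<subseteq> {..<n} \<and> card S = i}. e S)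
        = (\<Oplus>\<theta>\<in>perms. \<Oplus>S\<in>{S. S \<subseteq> {..<n} \<and> card S = i}. sg \<theta> \<otimes> b \<theta> S)"
      unfolding e_def using bcl by (intro add.finprod_swap m_closed sg_closed finite_perms) simp_all
    also have "\<dots> = (\<Oplus>\<theta>\<in>perms. s i t \<otimes> (sg \<theta> \<otimes> br (\<lambda>j. pw (n - i) j \<otimes>\<^bsub>F\<^esub> y (\<theta> j))))"
    proof (rule add.finprod_cong2)
      fix \<theta> assume \<theta>: "\<theta> \<in> perms"
      have "(\<Oplus>S\<in>{S. S \<subseteq> {..<n} \<and> card S = i}. sg \<theta> \<otimes> b \<theta> S)
          = sg \<theta> \<otimes> (\<Oplus>S\<in>{S. S \<subseteq> {..<n} \<and> card S = i}. b \<theta> S)"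
        using bcl[OF \<theta>] by (intro finsum_rdistr[symmetric]) auto
      also have "(\<Oplus>S\<in>{S. S \<subseteq> {..<n} \<and> card S = i}. b \<theta> S) = s i t \<otimes> br (\<lambda>j. pw (n - i) j \<otimes>\<^bsub>F\<^esub> y (\<theta> j))"
        using pw y perms_lt[OF \<theta>] bcl[OF \<theta>]
        by (subst s_mult[OF t i]) (auto intro!: add.finprod_cong2 simp: b_def)
      finally show "(\<Oplus>S\<in>{S. S \<subseteq> {..<n} \<and> card S = i}. sg \<theta> \<otimes> b \<theta> S)
          = s i t \<otimes> (sg \<theta> \<otimes> br (\<lambda>j. pw (n - i) j \<otimes>\<^bsub>F\<^esub> y (\<theta> j)))"
        using delta_term_closed[OF pw y \<theta>] s_closed[OF t i] by (simp add: m_lcomm)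
      show "s i t \<otimes> (sg \<theta> \<otimes> br (\<lambda>j. pw (n - i) j \<otimes>\<^bsub>F\<^esub> y (\<theta> j))) \<in> carrier R"
        by (intro m_closed sg_closed s_closed t i delta_term_closed pw y \<theta>)
    qed
    also have "\<dots> = s i t \<otimes> delta (pw (n - i)) y"
      unfolding delta_def using delta_term_closed[OF pw y] s_closed[OF t i]
      by (intro finsum_rdistr[symmetric]) auto
    finally show ?thesis .
  qed
  have zero: "(\<Oplus>S\<in>Pow {..<n}. ?sgn S \<otimes> e S) = \<zero>"
  proof -
    let ?P = "Pow ({..<n} - {k})"
    have fin: "finite ?P" by simp
    have P: "Pow {..<n} = ?P \<union> insert k ` ?P"
      using k Pow_insert[of k "{..<n} - {k}"] by (simp add: insert_absorb)
    have disj: "?P \<inter> insert k ` ?P = {}" by auto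
    have inj: "inj_on (insert k) ?P" by (auto simp: inj_on_def)
    \<comment> \<open>Adding k to S lowers the power in slot k by one and multiplies the same slot
      by t, so the term is unchanged while its sign flips. Hence the alternating sum over all S
      vanishes.\<close>
    have e_ins: "e (insert k S) = e S" if S: "S \<in> ?P" for S
    proof -
      have fS: "finite S" "k \<notin> S" using S finite_subset by auto
      have "card S \<le> card ({..<n} - {k})" using S by (intro card_mono) auto
      then have lt: "card S < n" using k by simp
      have "b \<theta> (insert k S) = b \<theta> S" if \<theta>: "\<theta> \<in> perms" for \<theta>
        unfolding b_def
      proof (rule br_cong)
        fix j assume j: "j < n"
        have "t \<otimes>\<^bsub>F\<^esub> (t [^]\<^bsub>F\<^esub> (n - Suc (card S)) \<otimes>\<^bsub>F\<^esub> c \<otimes>\<^bsub>F\<^esub> y (\<theta> k)) = t [^]\<^bsub>F\<^esub> Suc (n - Suc (card S)) \<otimes>\<^bsub>F\<^esub> c \<otimes>\<^bsub>F\<^esub> y (\<theta> k)"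
          using t c y perms_lt[OF \<theta> k] by (simp add: F.m_ac)
        then show "(if j \<in> insert k S then t \<otimes>\<^bsub>F\<^esub> (pw (n - card (insert k S)) j \<otimes>\<^bsub>F\<^esub> y (\<theta> j)) else pw (n - card (insert k S)) j \<otimes>\<^bsub>F\<^esub> y (\<theta> j))
            = (if j \<in> S then t \<otimes>\<^bsub>F\<^esub> (pw (n - card S) j \<otimes>\<^bsub>F\<^esub> y (\<theta> j)) else pw (n - card S) j \<otimes>\<^bsub>F\<^esub> y (\<theta> j))"
          using fS lt by (auto simp: pw_def Suc_diff_Suc)
      qed
      then show ?thesis unfolding e_def using bcl by (intro add.finprod_cong2) simp_all
    qed
    have "(\<Oplus>S\<in>Pow {..<n}. ?sgn S \<otimes> e S) = (\<Oplus>S\<in>?P. ?sgn S \<otimes> e S) \<oplus> (\<Oplus>S\<in>insert k ` ?P. ?sgn S \<otimes> e S)"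
      unfolding P using fin disj ecl by (intro finsum_Un_disjoint) auto
    also have "(\<Oplus>S\<in>insert k ` ?P. ?sgn S \<otimes> e S) = (\<Oplus>S\<in>?P. ?sgn (insert k S) \<otimes> e (insert k S))"
      using inj ecl by (intro finsum_reindex) auto
    also have "\<dots> = (\<Oplus>S\<in>?P. (\<ominus> \<one>) \<otimes> (?sgn S \<otimes> e S))"
    proof (rule add.finprod_cong2)
      fix S assume S: "S \<in> ?P"
      then have "finite S" "k \<notin> S" using finite_subset by auto
      then show "?sgn (insert k S) \<otimes> e (insert k S) = (\<ominus> \<one>) \<otimes> (?sgn S \<otimes> e S)"
        using ecl[of S] e_ins[OF S] by (simp add: l_minus r_minus)
    qed (use ecl in simp)
    also have "\<dots> = (\<ominus> \<one>) \<otimes> (\<Oplus>S\<in>?P. ?sgn S \<otimes> e S)"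
      using ecl by (intro finsum_rdistr[symmetric]) auto
    finally show ?thesis
      using ecl add.finprod_in[of ?P "\<lambda>S. ?sgn S \<otimes> e S"] by (simp add: l_minus r_neg)
  qed
  have e0: "e {} = delta (pw n) y" unfolding e_def b_def delta_def by simp
  have rest: "(\<Oplus>S\<in>Pow {..<n} - {{}}. ?sgn S \<otimes> e S) \<in> I"
  proof -
    have fin: "finite (Pow {..<n} - {{}})" by simp
    have "(\<Oplus>S\<in>Pow {..<n} - {{}}. ?sgn S \<otimes> e S)
        = (\<Oplus>i\<in>{1..n}. \<Oplus>S\<in>{S \<in> Pow {..<n} - {{}}. card S = i}. ?sgn S \<otimes> e S)"
    proof (rule add.finprod_fibres)
      fix S assume "S \<in> Pow {..<n} - {{}}"
      then have "S \<subseteq> {..<n}" "S \<noteq> {}" by auto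
      moreover have "finite S" using calculation finite_subset by blast
      ultimately show "card S \<in> {1..n}" using card_mono[of "{..<n}" S] by (auto simp: Suc_le_eq card_gt_0_iff)
    qed (use ecl in auto)
    also have "\<dots> \<in> I"
    proof -
      have "(\<Oplus>S\<in>{S \<in> Pow {..<n} - {{}}. card S = i}. ?sgn S \<otimes> e S) \<in> I" if i: "i \<in> {1..n}" for i
      proof -
        have S: "{S \<in> Pow {..<n} - {{}}. card S = i} = {S. S \<subseteq> {..<n} \<and> card S = i}" using i by auto
        let ?u = "if even i then \<one> else \<ominus> \<one>"
        have "(\<Oplus>S\<in>{S. S \<subseteq> {..<n} \<and> card S = i}. ?sgn S \<otimes> e S) = (\<Oplus>S\<in>{S. S \<subseteq> {..<n} \<and> card S = i}. ?u \<otimes> e S)"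
          using ecl by (intro add.finprod_cong2) auto
        also have "\<dots> = ?u \<otimes> (\<Oplus>S\<in>{S. S \<subseteq> {..<n} \<and> card S = i}. e S)"
          using ecl by (intro finsum_rdistr[symmetric]) auto
        also have "\<dots> = ?u \<otimes> (s i t \<otimes> delta (pw (n - i)) y)" using i level by simp
        also have "\<dots> \<in> I"
          using i lower[of "n - i"] s_closed[OF t, of i] I.I_l_closed unfolding pw_def by auto
        finally show ?thesis unfolding S .
      qed
      then show ?thesis by (intro finsum_ideal[OF I finite_atLeastAtMost])
    qed
    finally show ?thesis .
  qed
  have P: "Pow {..<n} = insert {} (Pow {..<n} - {{}})" by auto
  have "(\<Oplus>S\<in>Pow {..<n}. ?sgn S \<otimes> e S) = (\<Oplus>S\<in>insert {} (Pow {..<n} - {{}}). ?sgn S \<otimes> e S)"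
    by (rule arg_cong[OF P])
  also have "\<dots> = ?sgn ({} :: nat set) \<otimes> e {} \<oplus> (\<Oplus>S\<in>Pow {..<n} - {{}}. ?sgn S \<otimes> e S)"
    by (rule finsum_insert[of "Pow {..<n} - {{}}" "{}" "\<lambda>S. ?sgn S \<otimes> e S"]) (use ecl in auto)
  finally have "e {} \<oplus> (\<Oplus>S\<in>Pow {..<n} - {{}}. ?sgn S \<otimes> e S) = \<zero>" using zero ecl by simp
  then have "\<ominus> (\<Oplus>S\<in>Pow {..<n} - {{}}. ?sgn S \<otimes> e S) = e {}"
    by (intro minus_equality ecl I.Icarr[OF rest])
  then have "e {} \<in> I" using I.a_inv_closed[OF rest] by simp
  then show ?thesis unfolding e0 pw_def .
qed

end

section \<open>The matrix formula for the second product and its two special cases\<close>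

context dp_algebra
begin

text \<open>With exponents (n + 1)^j, the base n + 1 digits of the weight of a matrix are its column
  sums. Prescribing the weight in \<open>D_finprod\<close> is therefore the same as prescribing
  every column sum, which gives matrices with both margins fixed.\<close>

lemma norm_mult_finprod:
  fixes I :: "'i set" and l :: nat
  assumes n: "0 < n" and I: "finite I" "\<And>i. i \<in> I \<Longrightarrow> x i \<in> carrier F" "sum a I = n"
    and J: "\<And>j. j < l \<Longrightarrow> y j \<in> carrier F" "sum b {..<l} = n"
  shows "norm_mult n (finprod \<Gamma> (\<lambda>i. \<gamma> (a i) (x i)) I) (finprod \<Gamma> (\<lambda>j. \<gamma> (b j) (y j)) {..<l})
    = finsum \<Gamma> (\<lambda>d. finprod \<Gamma> (\<lambda>i. finprod \<Gamma> (\<lambda>j. \<gamma> (d i j) (x i \<otimes>\<^bsub>F\<^esub> y j)) {..<l}) I)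
      {d \<in> PiE I (\<lambda>i. comps {..<l} (a i)). \<forall>j<l. (\<Sum>i\<in>I. d i j) = b j}"
proof -
  define e where "e = (\<lambda>j :: nat. (n + 1) ^ j)"
  define N where "N = (\<Sum>j<l. e j * b j)"
  obtain Y where Y: "Y \<in> carrier UF" "supp Y \<subseteq> e ` {..<l}" "\<And>j. j < l \<Longrightarrow> cf Y (e j) = y j"
    "finprod \<Gamma> (\<lambda>j. \<gamma> (b j) (y j)) {..<l} = tcoeff n Y N"
  proof (rule finprod_dpow_kronecker[OF J n])
    fix Y
    assume *: "Y \<in> carrier UF" "supp Y \<subseteq> (\<lambda>i. (n + 1) ^ i) ` {..<l}" "\<And>i. i < l \<Longrightarrow> cf Y ((n + 1) ^ i) = y i"
      "finprod \<Gamma> (\<lambda>i. \<gamma> (b i) (y i)) {..<l} = tcoeff n Y (\<Sum>i<l. (n + 1) ^ i * b i)"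
    show thesis using * by (intro that[unfolded e_def N_def])
  qed
  let ?K = "e ` {..<l}"
  let ?T = "{d \<in> PiE I (\<lambda>i. comps {..<l} (a i)). \<forall>j<l. (\<Sum>i\<in>I. d i j) = b j}"
  let ?T' = "{d \<in> PiE I (\<lambda>i. comps ?K (a i)). (\<Sum>i\<in>I. \<Sum>k\<in>?K. k * d i k) = N}"
  let ?\<iota> = "inv_into {..<l} e"
  have inj: "inj_on e {..<l}" using n by (auto simp: e_def inj_on_def)
  have inv: "?\<iota> (e j) = j" if "j < l" for j using inj that by (simp add: inv_into_f_f)
  have sumK: "(\<Sum>k\<in>?K. f k) = (\<Sum>j<l. f (e j))" for f :: "nat \<Rightarrow> nat"
    using inj by (simp add: sum.reindex)
  let ?g = "\<lambda>d. \<lambda>i\<in>I. \<lambda>k\<in>?K. d i (?\<iota> k)" and ?h = "\<lambda>d. \<lambda>i\<in>I. \<lambda>j\<in>{..<l}. d i (e j)"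
  have wt: "(\<Sum>i\<in>I. \<Sum>j<l. e j * d i j) = (\<Sum>j<l. e j * (\<Sum>i\<in>I. d i j))" for d :: "'i \<Rightarrow> nat \<Rightarrow> nat"
    by (subst sum.swap) (simp add: sum_distrib_left)
  have bij: "bij_betw ?g ?T ?T'"
  proof (rule bij_betw_byWitness[where f' = ?h])
    show "\<forall>d\<in>?T. ?h (?g d) = d"
      by (auto simp: fun_eq_iff inv PiE_iff extensional_def comps_def)
    show "\<forall>d\<in>?T'. ?g (?h d) = d"
      by (auto simp: fun_eq_iff inv PiE_iff extensional_def comps_def)
    show "?g ` ?T \<subseteq> ?T'"
      by (auto simp: inv sumK wt N_def comps_def PiE_iff)
    show "?h ` ?T' \<subseteq> ?T"
    proof (rule image_subsetI)
      fix d assume "d \<in> ?T'"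
      then have d: "d \<in> PiE I (\<lambda>i. comps ?K (a i))" "(\<Sum>i\<in>I. \<Sum>k\<in>?K. k * d i k) = N" by simp_all
      have r: "(\<Sum>j<l. d i (e j)) = a i" if "i \<in> I" for i
        using d(1) that by (auto simp: PiE_iff comps_def sumK)
      have "(\<Sum>i\<in>I. d i (e j)) = b j" if j: "j < l" for j
      proof (rule digits_unique[of l "\<lambda>j. \<Sum>i\<in>I. d i (e j)" n b j])
        show "(\<Sum>i\<in>I. d i (e j)) \<le> n" if "j < l" for j
        proof -
          have "(\<Sum>i\<in>I. d i (e j)) \<le> (\<Sum>i\<in>I. a i)"
            using that r by (intro sum_mono) (metis finite_lessThan lessThan_iff member_le_sum zero_le)
          then show ?thesis by (simp add: I)
        qed
        show "b j \<le> n" if "j < l" for j using that J(2) member_le_sum[of j "{..<l}" b] by simp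
        show "(\<Sum>j<l. (n + 1) ^ j * (\<Sum>i\<in>I. d i (e j))) = (\<Sum>j<l. (n + 1) ^ j * b j)"
          using d(2)[unfolded sumK wt N_def] by (simp only: e_def)
      qed (rule j)
      then show "?h d \<in> ?T"
        using r by (simp add: comps_def PiE_iff)
    qed
  qed
  let ?F = "\<lambda>d. finprod \<Gamma> (\<lambda>i. finprod \<Gamma> (\<lambda>k. \<gamma> (d i k) (x i \<otimes>\<^bsub>F\<^esub> cf Y k)) ?K) I"
  have cl: "?F d \<in> carrier \<Gamma>" for d using I Y by (intro GC.finprod_in) simp
  have "norm_mult n (finprod \<Gamma> (\<lambda>i. \<gamma> (a i) (x i)) I) (finprod \<Gamma> (\<lambda>j. \<gamma> (b j) (y j)) {..<l})
      = finsum \<Gamma> ?F ?T'"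
    using I Y norm_mult_right[OF n Y(1) finprod_dpow_deg[OF I]] D_finprod[OF I(1,2) Y(1) _ Y(2)] by simp
  also have "\<dots> = finsum \<Gamma> (\<lambda>d. ?F (?g d)) ?T"
    using cl by (intro GC.add.finprod_bij[OF bij])
  also have "\<dots> = finsum \<Gamma> (\<lambda>d. finprod \<Gamma> (\<lambda>i. finprod \<Gamma> (\<lambda>j. \<gamma> (d i j) (x i \<otimes>\<^bsub>F\<^esub> y j)) {..<l}) I) ?T"
  proof (rule GC.add.finprod_cong2)
    fix d
    show "?F (?g d) = finprod \<Gamma> (\<lambda>i. finprod \<Gamma> (\<lambda>j. \<gamma> (d i j) (x i \<otimes>\<^bsub>F\<^esub> y j)) {..<l}) I"
    proof (rule GC.finprod_cong2)
      fix i assume i: "i \<in> I"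
      have "finprod \<Gamma> (\<lambda>k. \<gamma> (?g d i k) (x i \<otimes>\<^bsub>F\<^esub> cf Y k)) ?K
          = finprod \<Gamma> (\<lambda>j. \<gamma> (?g d i (e j)) (x i \<otimes>\<^bsub>F\<^esub> cf Y (e j))) {..<l}"
        using i I Y by (intro GC.finprod_bij[OF inj_on_imp_bij_betw[OF inj]]) simp
      also have "\<dots> = finprod \<Gamma> (\<lambda>j. \<gamma> (d i j) (x i \<otimes>\<^bsub>F\<^esub> y j)) {..<l}"
        using i I J Y by (intro GC.finprod_cong2) (simp_all add: inv)
      finally show "finprod \<Gamma> (\<lambda>k. \<gamma> (?g d i k) (x i \<otimes>\<^bsub>F\<^esub> cf Y k)) ?K
        = finprod \<Gamma> (\<lambda>j. \<gamma> (d i j) (x i \<otimes>\<^bsub>F\<^esub> y j)) {..<l}" .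
      show "finprod \<Gamma> (\<lambda>j. \<gamma> (d i j) (x i \<otimes>\<^bsub>F\<^esub> y j)) {..<l} \<in> carrier \<Gamma>"
        using i I J by (intro GC.finprod_in) simp
    qed
    show "finprod \<Gamma> (\<lambda>i. finprod \<Gamma> (\<lambda>j. \<gamma> (d i j) (x i \<otimes>\<^bsub>F\<^esub> y j)) {..<l}) I \<in> carrier \<Gamma>"
      using I J by (intro GC.finprod_in) simp
  qed
  finally show ?thesis .
qed

end

text \<open>Row sum 1 leaves a single 1 in each row, and column sum 1 makes the positions of these
  ones injective, hence a permutation. Outside the range the permutation is the identity.\<close>

lemma permutation_matrices_bij:
  fixes n :: nat
  shows "bij_betw (\<lambda>\<tau>. \<lambda>i\<in>{..<n}. \<lambda>j\<in>{..<n}. if j = \<tau> i then 1 else (0::nat)) {\<tau>. \<tau> permutes {..<n}}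
    {d \<in> PiE {..<n} (\<lambda>i. comps {..<n} 1). \<forall>j<n. (\<Sum>i<n. d i j) = 1}" (is "bij_betw ?m _ ?T")
  unfolding bij_betw_def
proof (intro conjI inj_onI equalityI subsetI)
  fix \<tau> \<rho> assume t: "\<tau> \<in> {\<tau>. \<tau> permutes {..<n}}" "\<rho> \<in> {\<tau>. \<tau> permutes {..<n}}" and e: "?m \<tau> = ?m \<rho>"
  show "\<tau> = \<rho>"
  proof
    fix i
    show "\<tau> i = \<rho> i"
    proof (cases "i < n")
      case True
      have lt: "\<tau> i < n" using t True permutes_in_image[of \<tau> "{..<n}" i] by simp
      have "?m \<tau> i (\<tau> i) = ?m \<rho> i (\<tau> i)" using e by simp
      then show ?thesis using True lt by (simp split: if_splits)
    next
      case False
      then show ?thesis using t permutes_not_in by (metis lessThan_iff mem_Collect_eq)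
    qed
  qed
next
  fix d assume "d \<in> ?m ` {\<tau>. \<tau> permutes {..<n}}"
  then obtain \<tau> where t: "\<tau> permutes {..<n}" and d: "d = ?m \<tau>" by blast
  have lt: "\<tau> i < n" if "i < n" for i using t that permutes_in_image[of \<tau> "{..<n}" i] by simp
  have "(\<Sum>i<n. if j = \<tau> i then 1 else (0::nat)) = 1" if "j < n" for j
  proof -
    have eq: "j = \<tau> i \<longleftrightarrow> inv_into UNIV \<tau> j = i" for i using permutes_inv_eq[OF t, of j i] by metis
    have "inv_into UNIV \<tau> j < n" using that permutes_in_image[OF permutes_inv[OF t], of j] by simp
    then show ?thesis unfolding eq by simp
  qed
  then show "d \<in> ?T" unfolding d using lt by (auto simp: comps_def PiE_iff)
next
  fix d assume d: "d \<in> ?T"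
  have rows: "\<exists>j<n. d i j = 1 \<and> (\<forall>k<n. k \<noteq> j \<longrightarrow> d i k = 0)" if "i < n" for i
  proof -
    have "(\<Sum>j<n. d i j) = 1" using d that by (auto simp: comps_def PiE_iff)
    then show ?thesis using sum_eq_1_iff[of "{..<n}" "d i"] by (metis finite_lessThan lessThan_iff)
  qed
  define \<tau> where "\<tau> i = (if i < n then SOME j. j < n \<and> d i j = 1 \<and> (\<forall>k<n. k \<noteq> j \<longrightarrow> d i k = 0) else i)" for i
  have \<tau>: "\<tau> i < n \<and> d i (\<tau> i) = 1 \<and> (\<forall>k<n. k \<noteq> \<tau> i \<longrightarrow> d i k = 0)" if "i < n" for i
    using someI_ex[OF rows[OF that]] that by (simp add: \<tau>_def)
  have "inj_on \<tau> {..<n}"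
  proof (rule inj_onI)
    fix i k assume ik: "i \<in> {..<n}" "k \<in> {..<n}" "\<tau> i = \<tau> k"
    have "(\<Sum>i<n. d i (\<tau> i')) = 1" if "i' < n" for i' using d \<tau>[OF that] by simp
    then have s: "(\<Sum>i'<n. d i' (\<tau> i)) = 1" using ik by simp
    show "i = k"
    proof (rule ccontr)
      assume "i \<noteq> k"
      then have "(\<Sum>i'\<in>{i, k}. d i' (\<tau> i)) = 2" using \<tau>[of i] \<tau>[of k] ik by simp
      moreover have "(\<Sum>i'\<in>{i, k}. d i' (\<tau> i)) \<le> (\<Sum>i'<n. d i' (\<tau> i))" using ik by (intro sum_mono2) simp_all
      ultimately show False using s by simp
    qed
  qed
  then have "bij_betw \<tau> {..<n} {..<n}"
    using \<tau> by (simp add: bij_betw_def endo_inj_surj image_subset_iff)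
  then have "\<tau> permutes {..<n}" by (rule bij_imp_permutes) (simp add: \<tau>_def)
  moreover have "d = ?m \<tau>"
    using \<tau> d by (auto simp: fun_eq_iff comps_def PiE_iff extensional_def)
  ultimately show "d \<in> ?m ` {\<tau>. \<tau> permutes {..<n}}" by blast
qed

text \<open>Column sums 1 make row 0 the indicator function of a subset and row 1 that of its
  complement.\<close>

lemma subset_matrices_bij:
  fixes n m :: nat
  assumes "m \<le> n"
  shows "bij_betw (\<lambda>S. \<lambda>i\<in>{0, 1}. \<lambda>j\<in>{..<n}. if (j \<in> S) = (i = 0) then 1 else (0::nat)) {S. S \<subseteq> {..<n} \<and> card S = m}
    {d \<in> PiE {0, 1::nat} (\<lambda>i. comps {..<n} (if i = 0 then m else n - m)). \<forall>j<n. (\<Sum>i\<in>{0, 1}. d i j) = 1}"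
    (is "bij_betw ?m ?S ?T")
proof (rule bij_betw_byWitness[where f' = "\<lambda>d. {j. j < n \<and> d 0 j = 1}"])
  show "\<forall>S\<in>?S. {j. j < n \<and> ?m S 0 j = 1} = S" by auto
  show "\<forall>d\<in>?T. ?m {j. j < n \<and> d 0 j = 1} = d"
  proof
    fix d assume d: "d \<in> ?T"
    then have s: "d 0 j + d 1 j = 1" if "j < n" for j using that by simp
    then have "d 0 j = (if d 0 j = 1 then 1 else 0)" "d 1 j = (if d 0 j = 1 then 0 else 1)" if "j < n" for j
      using s[OF that] by auto
    then show "?m {j. j < n \<and> d 0 j = 1} = d"
      using d by (auto simp: fun_eq_iff comps_def PiE_iff extensional_def)
  qed
  have c: "(\<Sum>j<n. if j \<in> S then 1 else 0) = card S" "(\<Sum>j<n. if j \<notin> S then 1 else 0) = n - card S"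
    if "S \<subseteq> {..<n}" for S
  proof -
    have 1: "{..<n} \<inter> S = S" "{..<n} \<inter> {j. j \<notin> S} = {..<n} - S" using that by auto
    show "(\<Sum>j<n. if j \<in> S then 1 else 0) = card S" "(\<Sum>j<n. if j \<notin> S then 1 else 0) = n - card S"
      using that finite_subset[OF that] 1 by (simp_all add: sum.If_cases card_Diff_subset Compl_eq)
  qed
  show "?m ` ?S \<subseteq> ?T" using c by (auto simp: comps_def PiE_iff)
  show "(\<lambda>d. {j. j < n \<and> d 0 j = 1}) ` ?T \<subseteq> ?S"
  proof clarify
    fix d assume d: "d \<in> PiE {0, 1::nat} (\<lambda>i. comps {..<n} (if i = 0 then m else n - m))" "\<forall>j<n. (\<Sum>i\<in>{0, 1}. d i j) = 1"
    let ?S = "{j. j < n \<and> d 0 j = 1}"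
    have "d 0 j = (if j \<in> ?S then 1 else 0)" if "j < n" for j
      using d(2) that by (auto dest!: spec[of _ j])
    then have "(\<Sum>j<n. d 0 j) = (\<Sum>j<n. if j \<in> ?S then 1 else 0)" by (intro sum.cong) auto
    moreover have "(\<Sum>j<n. d 0 j) = m" using d(1) by (simp add: comps_def PiE_iff)
    moreover have sub: "?S \<subseteq> {..<n}" by auto
    ultimately have "card ?S = m" using c(1)[OF sub] by (simp only:)
    then show "?S \<subseteq> {..<n} \<and> card ?S = m" using sub by blast
  qed
qed

lemma foldSetD_cong:
  assumes "(I, v) \<in> foldSetD D f e" "\<And>i. i \<in> I \<Longrightarrow> f i = g i"
  shows "(I, v) \<in> foldSetD D g e"
  using assms
proof (induction rule: foldSetD.induct)
  case emptyI
  then show ?case by (intro foldSetD.emptyI)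
next
  case (insertI i I v)
  then have "(insert i I, g i v) \<in> foldSetD D g e" by (intro foldSetD.insertI) simp_all
  then show ?case using insertI.prems[of i] by simp
qed

text \<open>The fold only sees the values on the index set, so no closure condition appears. The
  axiom \<open>br_cong\<close> speaks about arbitrary tuples and requires this form.\<close>

lemma finprod_eqI:
  assumes "\<And>i. i \<in> I \<Longrightarrow> f i = g i" shows "finprod G f I = finprod G g I"
proof -
  have "((I, v) \<in> foldSetD (carrier G) (monoid.mult G \<circ> f) e) \<longleftrightarrow> ((I, v) \<in> foldSetD (carrier G) (monoid.mult G \<circ> g) e)" for v e
    using foldSetD_cong[of I v "carrier G" "monoid.mult G \<circ> f" e "monoid.mult G \<circ> g"]
      foldSetD_cong[of I v "carrier G" "monoid.mult G \<circ> g" e "monoid.mult G \<circ> f"] assms by auto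
  then show ?thesis unfolding finprod_def foldD_def by simp
qed

section \<open>The component of degree n as a ring with norm brackets\<close>

locale norm_algebra = dp_algebra A F for A :: "('a, 'm) ring_scheme" and F :: "('a, 'f, 'k) module_scheme" +
  fixes n :: nat
  assumes n: "0 < n"
begin

abbreviation "R \<equiv> Gamma_ring A F n"

lemma R_simps [simp]: "carrier R = Gamma_deg A F n" "\<one>\<^bsub>R\<^esub> = \<gamma> n \<one>\<^bsub>F\<^esub>"
    "\<zero>\<^bsub>R\<^esub> = \<zero>\<^bsub>\<Gamma>\<^esub>" "u \<oplus>\<^bsub>R\<^esub> v = u \<oplus>\<^bsub>\<Gamma>\<^esub> v" "a \<odot>\<^bsub>R\<^esub> u = a \<odot>\<^bsub>\<Gamma>\<^esub> u"
  by (simp_all add: Gamma_ring_def Gamma_deg_with_mult_def)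

lemma norm_mult_choice: "is_norm_mult A F n (SOME f. is_norm_mult A F n f)"
  by (rule someI[of "is_norm_mult A F n", OF norm_mult_is_norm_mult[OF n]])

lemma R_algebra: "algebra A R"
  using norm_mult_choice unfolding Gamma_ring_def is_norm_mult_def by (rule conjunct1)

sublocale RC: cring R by (rule algebra.M_cring[OF R_algebra])
sublocale RA: algebra A R by (rule R_algebra)

text \<open>The product of \<open>R\<close> is an arbitrary admissible choice; uniqueness identifies
  it with the explicit product on elements of degree n.\<close>

lemma R_mult: "\<lbrakk> u \<in> Gamma_deg A F n; v \<in> Gamma_deg A F n \<rbrakk> \<Longrightarrow> u \<otimes>\<^bsub>R\<^esub> v = norm_mult n u v"
  using norm_mult_unique[OF n norm_mult_choice] by (simp add: Gamma_ring_def Gamma_deg_with_mult_def)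

lemma R_finsum:
  assumes "finite C" "\<And>c. c \<in> C \<Longrightarrow> f c \<in> Gamma_deg A F n"
  shows "finsum R f C = finsum \<Gamma> f C"
  using assms
proof (induction C rule: finite_induct)
  case (insert c C)
  have "finsum R f (insert c C) = f c \<oplus>\<^bsub>R\<^esub> finsum R f C"
    using insert by (intro RC.finsum_insert) simp_all
  moreover have "finsum \<Gamma> f (insert c C) = f c \<oplus>\<^bsub>\<Gamma>\<^esub> finsum \<Gamma> f C"
    using insert Gamma_deg_closed[OF insert.prems] by (intro GC.finsum_insert) simp_all
  ultimately show ?case using insert by simp
qed simp

lemma R_minus: "u \<in> Gamma_deg A F n \<Longrightarrow> \<ominus>\<^bsub>R\<^esub> u = \<ominus>\<^bsub>\<Gamma>\<^esub> u"
  using minus_smult[OF Gamma_deg_closed, of u n] RA.smult_l_minus[of "\<one>\<^bsub>A\<^esub>" u] RA.smult_one[of u]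
  by simp

definition br where "br c = finprod \<Gamma> (\<lambda>i. \<gamma> 1 (c i)) {..<n}"

text \<open>The coefficients of the characteristic polynomial of \<open>x\<close>, up to sign.\<close>

definition s where "s i x = \<gamma> i x \<otimes>\<^bsub>\<Gamma>\<^esub> \<gamma> (n - i) \<one>\<^bsub>F\<^esub>"

lemma br_deg: "(\<And>i. i < n \<Longrightarrow> c i \<in> carrier F) \<Longrightarrow> br c \<in> Gamma_deg A F n"
  unfolding br_def by (intro finprod_dpow_deg) simp_all

lemma br_upd:
  assumes "\<And>i. i < n \<Longrightarrow> c i \<in> carrier F" "k < n" "x \<in> carrier F"
  shows "br (c(k := x)) = \<gamma> 1 x \<otimes>\<^bsub>\<Gamma>\<^esub> finprod \<Gamma> (\<lambda>i. \<gamma> 1 (c i)) ({..<n} - {k})"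
proof -
  have I: "{..<n} = insert k ({..<n} - {k})" using assms by auto
  have "br (c(k := x)) = finprod \<Gamma> (\<lambda>i. \<gamma> 1 ((c(k := x)) i)) (insert k ({..<n} - {k}))"
    unfolding br_def by (rule arg_cong[OF I])
  also have "\<dots> = \<gamma> 1 x \<otimes>\<^bsub>\<Gamma>\<^esub> finprod \<Gamma> (\<lambda>i. \<gamma> 1 ((c(k := x)) i)) ({..<n} - {k})"
    using assms by (subst GC.finprod_insert) (simp_all add: Pi_iff)
  also have "finprod \<Gamma> (\<lambda>i. \<gamma> 1 ((c(k := x)) i)) ({..<n} - {k}) = finprod \<Gamma> (\<lambda>i. \<gamma> 1 (c i)) ({..<n} - {k})"
    using assms by (intro GC.finprod_cong2) simp_all
  finally show ?thesis .
qed

lemma br_rest: "(\<And>i. i < n \<Longrightarrow> c i \<in> carrier F) \<Longrightarrow> finprod \<Gamma> (\<lambda>i. \<gamma> 1 (c i)) ({..<n} - {k}) \<in> carrier \<Gamma>"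
  by (intro GC.finprod_in) simp

lemma dpow_1_add: "\<lbrakk> x \<in> carrier F; y \<in> carrier F \<rbrakk> \<Longrightarrow> \<gamma> 1 (x \<oplus>\<^bsub>F\<^esub> y) = \<gamma> 1 x \<oplus>\<^bsub>\<Gamma>\<^esub> \<gamma> 1 y"
  using fun_cong[OF dpow_add, of x y 1]
  by (simp add: seqs_def dpow_zero_deg GC.a_comm)

text \<open>All margins are 1, so the matrix formula runs over permutation matrices; a zero entry
  contributes gamma^0, which is 1.\<close>

lemma br_mult:
  assumes c: "\<And>i. i < n \<Longrightarrow> c i \<in> carrier F" and d: "\<And>i. i < n \<Longrightarrow> d i \<in> carrier F"
  shows "br c \<otimes>\<^bsub>R\<^esub> br d = (\<Oplus>\<^bsub>R\<^esub>\<tau>\<in>{\<tau>. \<tau> permutes {..<n}}. br (\<lambda>i. c i \<otimes>\<^bsub>F\<^esub> d (\<tau> i)))"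
proof -
  let ?m = "\<lambda>\<tau>. \<lambda>i\<in>{..<n}. \<lambda>j\<in>{..<n}. if j = \<tau> i then 1 else (0::nat)"
  let ?T = "{e \<in> PiE {..<n} (\<lambda>i. comps {..<n} 1). \<forall>j<n. (\<Sum>i<n. e i j) = 1}"
  let ?F = "\<lambda>e. finprod \<Gamma> (\<lambda>i. finprod \<Gamma> (\<lambda>j. \<gamma> (e i j) (c i \<otimes>\<^bsub>F\<^esub> d j)) {..<n}) {..<n}"
  have lt: "\<tau> i < n" if "\<tau> permutes {..<n}" "i < n" for \<tau> i
    using that permutes_in_image[of \<tau> "{..<n}" i] by simp
  have cl: "?F e \<in> carrier \<Gamma>" for e using c d by (intro GC.finprod_in) simp
  have "br c \<otimes>\<^bsub>R\<^esub> br d = norm_mult n (br c) (br d)"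
    using c d by (intro R_mult br_deg)
  also have "\<dots> = finsum \<Gamma> ?F ?T"
    unfolding br_def
    by (rule norm_mult_finprod[OF n, where a = "\<lambda>_. 1" and b = "\<lambda>_. 1"]) (use c d in simp_all)
  also have "\<dots> = finsum \<Gamma> (\<lambda>\<tau>. ?F (?m \<tau>)) {\<tau>. \<tau> permutes {..<n}}"
    using cl by (intro GC.add.finprod_bij[OF permutation_matrices_bij])
  also have "\<dots> = finsum \<Gamma> (\<lambda>\<tau>. br (\<lambda>i. c i \<otimes>\<^bsub>F\<^esub> d (\<tau> i))) {\<tau>. \<tau> permutes {..<n}}"
  proof (rule GC.add.finprod_cong2)
    fix \<tau> assume "\<tau> \<in> {\<tau>. \<tau> permutes {..<n}}"
    then have t: "\<tau> permutes {..<n}" by simp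
    show "?F (?m \<tau>) = br (\<lambda>i. c i \<otimes>\<^bsub>F\<^esub> d (\<tau> i))"
      unfolding br_def
    proof (rule GC.finprod_cong2)
      fix i assume "i \<in> {..<n}"
      then have i: "i < n" by simp
      have "finprod \<Gamma> (\<lambda>j. \<gamma> (?m \<tau> i j) (c i \<otimes>\<^bsub>F\<^esub> d j)) {..<n}
          = finprod \<Gamma> (\<lambda>j. if \<tau> i = j then \<gamma> 1 (c i \<otimes>\<^bsub>F\<^esub> d j) else \<one>\<^bsub>\<Gamma>\<^esub>) {..<n}"
        using i c d by (intro GC.finprod_cong2) (simp_all add: dpow_zero_deg)
      also have "\<dots> = \<gamma> 1 (c i \<otimes>\<^bsub>F\<^esub> d (\<tau> i))"
        using i c d lt[OF t i] by (intro GC.finprod_singleton) simp_all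
      finally show "finprod \<Gamma> (\<lambda>j. \<gamma> (?m \<tau> i j) (c i \<otimes>\<^bsub>F\<^esub> d j)) {..<n} = \<gamma> 1 (c i \<otimes>\<^bsub>F\<^esub> d (\<tau> i))" .
      show "\<gamma> 1 (c i \<otimes>\<^bsub>F\<^esub> d (\<tau> i)) \<in> carrier \<Gamma>" using c[OF i] d[OF lt[OF t i]] by simp
    qed
    show "br (\<lambda>i. c i \<otimes>\<^bsub>F\<^esub> d (\<tau> i)) \<in> carrier \<Gamma>"
      using c d lt[OF t] by (intro Gamma_deg_closed[OF br_deg]) simp
  qed
  also have "\<dots> = finsum R (\<lambda>\<tau>. br (\<lambda>i. c i \<otimes>\<^bsub>F\<^esub> d (\<tau> i))) {\<tau>. \<tau> permutes {..<n}}"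
    using c d lt by (intro R_finsum[symmetric] br_deg) (simp_all add: finite_permutations)
  finally show ?thesis .
qed

lemma finprod_01: "\<lbrakk> h 0 \<in> carrier \<Gamma>; h (1::nat) \<in> carrier \<Gamma> \<rbrakk> \<Longrightarrow> finprod \<Gamma> h {0, 1} = h 0 \<otimes>\<^bsub>\<Gamma>\<^esub> h 1"
  by (simp add: Pi_iff)

lemma s_finprod:
  assumes "x \<in> carrier F"
  shows "s i x = finprod \<Gamma> (\<lambda>k. \<gamma> (if k = 0 then i else n - i) (if k = 0 then x else \<one>\<^bsub>F\<^esub>)) {0, 1::nat}"
  unfolding s_def using assms by (simp add: Pi_iff)

lemma s_deg: "\<lbrakk> x \<in> carrier F; i \<le> n \<rbrakk> \<Longrightarrow> s i x \<in> Gamma_deg A F n"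
  unfolding s_finprod by (intro finprod_dpow_deg) simp_all

text \<open>The first factor consists of two divided powers, of degrees i and n - i, so the matrices
  have two rows and column sums 1. The entry \<open>c j\<close> is multiplied by x or by 1 according
  to the row in which column j has its 1.\<close>

lemma s_mult:
  assumes x: "x \<in> carrier F" and i: "i \<le> n" and c: "\<And>j. j < n \<Longrightarrow> c j \<in> carrier F"
  shows "s i x \<otimes>\<^bsub>R\<^esub> br c
    = (\<Oplus>\<^bsub>R\<^esub>S\<in>{S. S \<subseteq> {..<n} \<and> card S = i}. br (\<lambda>j. if j \<in> S then x \<otimes>\<^bsub>F\<^esub> c j else c j))"
proof -
  let ?m = "\<lambda>S. \<lambda>i\<in>{0, 1::nat}. \<lambda>j\<in>{..<n}. if (j \<in> S) = (i = 0) then 1 else (0::nat)"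
  let ?T = "{e \<in> PiE {0, 1::nat} (\<lambda>k. comps {..<n} (if k = 0 then i else n - i)). \<forall>j<n. (\<Sum>k\<in>{0, 1}. e k j) = 1}"
  let ?x = "\<lambda>k :: nat. if k = 0 then x else \<one>\<^bsub>F\<^esub>"
  let ?F = "\<lambda>e. finprod \<Gamma> (\<lambda>k. finprod \<Gamma> (\<lambda>j. \<gamma> (e k j) (?x k \<otimes>\<^bsub>F\<^esub> c j)) {..<n}) {0, 1}"
  let ?S = "{S. S \<subseteq> {..<n} \<and> card S = i}"
  let ?c = "\<lambda>S j. if j \<in> S then x \<otimes>\<^bsub>F\<^esub> c j else c j"
  have cS: "?c S j \<in> carrier F" if "j < n" for S j using x c[OF that] by simp
  have cl: "?F e \<in> carrier \<Gamma>" for e using c x by (intro GC.finprod_in) simp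
  have "s i x \<otimes>\<^bsub>R\<^esub> br c = norm_mult n (s i x) (br c)"
    using c x i by (intro R_mult br_deg s_deg)
  also have "\<dots> = finsum \<Gamma> ?F ?T"
    unfolding br_def s_finprod[OF x] using c x i
    by (intro norm_mult_finprod[OF n, where b = "\<lambda>_. 1"]) simp_all
  also have "\<dots> = finsum \<Gamma> (\<lambda>S. ?F (?m S)) ?S"
    using cl by (intro GC.add.finprod_bij[OF subset_matrices_bij[OF i]])
  also have "\<dots> = finsum \<Gamma> (\<lambda>S. br (?c S)) ?S"
  proof (rule GC.add.finprod_cong2)
    fix S
    have g: "\<gamma> m (?x k \<otimes>\<^bsub>F\<^esub> c j) \<in> carrier \<Gamma>" if "j < n" for m k j
      using x c[OF that] by simp
    have "?F (?m S) = finprod \<Gamma> (\<lambda>j. \<gamma> (?m S 0 j) (?x 0 \<otimes>\<^bsub>F\<^esub> c j)) {..<n}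
        \<otimes>\<^bsub>\<Gamma>\<^esub> finprod \<Gamma> (\<lambda>j. \<gamma> (?m S 1 j) (?x 1 \<otimes>\<^bsub>F\<^esub> c j)) {..<n}"
      by (rule finprod_01) (intro GC.finprod_in g; simp only: lessThan_iff)+
    also have "\<dots> = finprod \<Gamma> (\<lambda>j. \<gamma> (?m S 0 j) (?x 0 \<otimes>\<^bsub>F\<^esub> c j) \<otimes>\<^bsub>\<Gamma>\<^esub> \<gamma> (?m S 1 j) (?x 1 \<otimes>\<^bsub>F\<^esub> c j)) {..<n}"
      using g by (intro GC.finprod_multf[symmetric] Pi_I) (simp_all only: lessThan_iff)
    also have "\<dots> = br (?c S)"
      unfolding br_def using x c cS
      by (intro GC.finprod_cong2) (simp_all add: dpow_zero_deg)
    finally show "?F (?m S) = br (?c S)" .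
    show "br (?c S) \<in> carrier \<Gamma>" using cS by (rule Gamma_deg_closed[OF br_deg])
  qed
  also have "\<dots> = finsum R (\<lambda>S. br (?c S)) ?S"
    using cS by (intro R_finsum[symmetric] br_deg) simp_all
  finally show ?thesis .
qed

sublocale norm_bracket R F n br s
proof (intro norm_bracket.intro norm_bracket_axioms.intro RC.is_cring FC.is_cring n)
  fix c :: "nat \<Rightarrow> 'f" assume c: "\<And>i. i < n \<Longrightarrow> c i \<in> carrier F"
  show "br c \<in> carrier R" using br_deg[OF c] by simp
  show "br (c(k := x \<oplus>\<^bsub>F\<^esub> y)) = br (c(k := x)) \<oplus>\<^bsub>R\<^esub> br (c(k := y))"
    if "k < n" "x \<in> carrier F" "y \<in> carrier F" for k x y
  proof -
    have r: "finprod \<Gamma> (\<lambda>i. \<gamma> 1 (c i)) ({..<n} - {k}) \<in> carrier \<Gamma>" using c by (rule br_rest)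
    have u: "br (c(k := w)) = \<gamma> 1 w \<otimes>\<^bsub>\<Gamma>\<^esub> finprod \<Gamma> (\<lambda>i. \<gamma> 1 (c i)) ({..<n} - {k})"
      if "w \<in> carrier F" for w
      by (intro br_upd c \<open>k < n\<close> that)
    show ?thesis
      unfolding u[OF that(2)] u[OF that(3)] u[OF FC.a_closed[OF that(2,3)]] R_simps(4) dpow_1_add[OF that(2,3)]
      using that r by (intro GC.l_distr dpow_closed)
  qed
  show "br (\<lambda>i. c (p i)) = br c" if "p permutes {..<n}" for p
    unfolding br_def using c
    by (intro GC.finprod_bij[OF permutes_imp_bij[OF that], symmetric]) simp
  show "br c \<otimes>\<^bsub>R\<^esub> br d = (\<Oplus>\<^bsub>R\<^esub>\<tau>\<in>{\<tau>. \<tau> permutes {..<n}}. br (\<lambda>i. c i \<otimes>\<^bsub>F\<^esub> d (\<tau> i)))"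
    if "\<And>i. i < n \<Longrightarrow> d i \<in> carrier F" for d
    using c that by (rule br_mult)
  show "s i x \<otimes>\<^bsub>R\<^esub> br c
    = (\<Oplus>\<^bsub>R\<^esub>S\<in>{S. S \<subseteq> {..<n} \<and> card S = i}. br (\<lambda>j. if j \<in> S then x \<otimes>\<^bsub>F\<^esub> c j else c j))"
    if "x \<in> carrier F" "i \<le> n" for x i
    using that c by (rule s_mult)
next
  show "br c = br d" if "\<And>i. i < n \<Longrightarrow> c i = d i" for c d :: "nat \<Rightarrow> 'f"
    unfolding br_def using that by (intro finprod_eqI) simp
qed (simp add: s_deg)

lemma br_smult:
  assumes "\<And>i. i < n \<Longrightarrow> c i \<in> carrier F" "k < n" "x \<in> carrier F" "a \<in> carrier A"
  shows "br (c(k := a \<odot>\<^bsub>F\<^esub> x)) = (a \<odot>\<^bsub>R\<^esub> \<one>\<^bsub>R\<^esub>) \<otimes>\<^bsub>R\<^esub> br (c(k := x))"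
proof -
  have b: "br (c(k := x)) \<in> carrier R" using assms(1,3) by (intro br_closed) simp
  have "br (c(k := a \<odot>\<^bsub>F\<^esub> x)) = a \<odot>\<^bsub>\<Gamma>\<^esub> br (c(k := x))"
  proof -
    have u: "br (c(k := w)) = \<gamma> 1 w \<otimes>\<^bsub>\<Gamma>\<^esub> finprod \<Gamma> (\<lambda>i. \<gamma> 1 (c i)) ({..<n} - {k})"
      if "w \<in> carrier F" for w
      by (intro br_upd assms(1,2) that)
    have r: "finprod \<Gamma> (\<lambda>i. \<gamma> 1 (c i)) ({..<n} - {k}) \<in> carrier \<Gamma>" using assms(1) by (rule br_rest)
    show ?thesis
      unfolding u[OF assms(3)] u[OF alg.smult_closed[OF assms(4,3)]]
      using assms(3,4) r dpow_smult[OF assms(4,3), of 1] by (simp add: G.smult_assoc2)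
  qed
  also have "\<dots> = a \<odot>\<^bsub>R\<^esub> (\<one>\<^bsub>R\<^esub> \<otimes>\<^bsub>R\<^esub> br (c(k := x)))" using b RC.l_one[OF b] by (simp only: R_simps(5))
  also have "\<dots> = (a \<odot>\<^bsub>R\<^esub> \<one>\<^bsub>R\<^esub>) \<otimes>\<^bsub>R\<^esub> br (c(k := x))"
    using RA.smult_assoc2[OF assms(4) RC.one_closed b] by simp
  finally show ?thesis .
qed

lemma delta_scale:
  assumes "tuple x" "tuple y" "k < n" "z \<in> carrier F" "a \<in> carrier A"
  shows "delta (x(k := a \<odot>\<^bsub>F\<^esub> z)) y = (a \<odot>\<^bsub>R\<^esub> \<one>\<^bsub>R\<^esub>) \<otimes>\<^bsub>R\<^esub> delta (x(k := z)) y"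
proof (rule delta_smult[OF assms(1-4)])
  show "a \<odot>\<^bsub>R\<^esub> \<one>\<^bsub>R\<^esub> \<in> carrier R" using assms(5) RC.one_closed by (rule RA.smult_closed)
  show "br (c(k := a \<odot>\<^bsub>F\<^esub> z \<otimes>\<^bsub>F\<^esub> w)) = (a \<odot>\<^bsub>R\<^esub> \<one>\<^bsub>R\<^esub>) \<otimes>\<^bsub>R\<^esub> br (c(k := z \<otimes>\<^bsub>F\<^esub> w))"
    if "tuple c" "w \<in> carrier F" for c w
    using that assms alg.smult_assoc2[of a z w] br_smult[of c k "z \<otimes>\<^bsub>F\<^esub> w" a] by simp
qed (use assms in simp)

lemma norm_delta_eq:
  assumes "tuple x" "tuple y" shows "norm_delta A F n x y = delta x y"
proof -
  have "norm_delta A F n x y = finsum \<Gamma> (\<lambda>p. sg p \<otimes>\<^bsub>R\<^esub> br (\<lambda>i. x i \<otimes>\<^bsub>F\<^esub> y (p i))) perms"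
    unfolding norm_delta_def
  proof (rule GC.add.finprod_cong2)
    fix p assume p: "p \<in> perms"
    have b: "br (\<lambda>i. x i \<otimes>\<^bsub>F\<^esub> y (p i)) \<in> carrier R" by (rule delta_term_closed[OF assms p])
    have "sg p \<otimes>\<^bsub>R\<^esub> br (\<lambda>i. x i \<otimes>\<^bsub>F\<^esub> y (p i))
        = (if evenperm p then br (\<lambda>i. x i \<otimes>\<^bsub>F\<^esub> y (p i)) else \<ominus>\<^bsub>\<Gamma>\<^esub> br (\<lambda>i. x i \<otimes>\<^bsub>F\<^esub> y (p i)))"
      unfolding sg_def using b RC.l_one[OF b] RC.l_minus[OF RC.one_closed b] R_minus by simp
    then show "(let u = finprod \<Gamma> (\<lambda>i. \<gamma> 1 (x i \<otimes>\<^bsub>F\<^esub> y (p i))) {..<n} in if evenperm p then u else \<ominus>\<^bsub>\<Gamma>\<^esub> u)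
        = sg p \<otimes>\<^bsub>R\<^esub> br (\<lambda>i. x i \<otimes>\<^bsub>F\<^esub> y (p i))"
      by (simp only: br_def Let_def)
    show "sg p \<otimes>\<^bsub>R\<^esub> br (\<lambda>i. x i \<otimes>\<^bsub>F\<^esub> y (p i)) \<in> carrier \<Gamma>"
      by (rule Gamma_deg_closed[of _ n]) (use RC.m_closed[OF sg_closed b] in simp)
  qed
  also have "\<dots> = delta x y"
    unfolding delta_def using RC.m_closed[OF sg_closed delta_term_closed[OF assms]]
    by (intro R_finsum[symmetric] finite_perms) simp
  finally show ?thesis .
qed

end

section \<open>Reductions of ideals\<close>

text \<open>Products over lists record the number of factors and their repetitions. They serve for
  products of ideal generators as well as for monomials.\<close>

definition prl where "prl G f w = foldr (\<lambda>i z. f i \<otimes>\<^bsub>G\<^esub> z) w \<one>\<^bsub>G\<^esub>"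

lemma prl_simps [simp]: "prl G f [] = \<one>\<^bsub>G\<^esub>" "prl G f (i # w) = f i \<otimes>\<^bsub>G\<^esub> prl G f w"
  by (simp_all add: prl_def)

lemma count_list_pigeonhole:
  assumes "finite I" "set w \<subseteq> I" "card I * m < length w"
  shows "\<exists>i\<in>I. m \<le> count_list w i"
proof (rule ccontr)
  assume "\<not> ?thesis"
  then have "(\<Sum>i\<in>I. count_list w i) \<le> (\<Sum>i\<in>I. m)" by (intro sum_mono) (meson le_cases)
  then show False using assms sum_count_set[OF assms(2,1)] by simp
qed

context comm_monoid
begin

lemma prl_closed: "(\<And>i. i \<in> set w \<Longrightarrow> f i \<in> carrier G) \<Longrightarrow> prl G f w \<in> carrier G"
  by (induction w) auto

lemma prl_append:
  "\<lbrakk> \<And>i. i \<in> set u \<Longrightarrow> f i \<in> carrier G; \<And>i. i \<in> set w \<Longrightarrow> f i \<in> carrier G \<rbrakk>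
    \<Longrightarrow> prl G f (u @ w) = prl G f u \<otimes> prl G f w"
  by (induction u) (auto simp: prl_closed m_assoc)

lemma prl_remove1:
  "\<lbrakk> \<And>i. i \<in> set w \<Longrightarrow> f i \<in> carrier G; i \<in> set w \<rbrakk> \<Longrightarrow> prl G f w = f i \<otimes> prl G f (remove1 i w)"
proof (induction w)
  case (Cons k w)
  show ?case
  proof (cases "k = i")
    case False
    then have "prl G f w = f i \<otimes> prl G f (remove1 i w)" using Cons by simp
    moreover have "prl G f (remove1 i w) \<in> carrier G"
      using Cons.prems set_remove1_subset[of i w] by (intro prl_closed) auto
    ultimately show ?thesis using Cons.prems False by (simp add: m_lcomm)
  qed simp
qed simp

end

lemma count_list_split:
  "m \<le> count_list w i \<Longrightarrow> \<exists>c. mset w = replicate_mset m i + mset c"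
proof -
  assume "m \<le> count_list w i"
  then have "replicate_mset m i \<subseteq># mset w" by (simp add: subseteq_mset_def count_mset)
  then obtain M where "mset w = replicate_mset m i + M" using mset_subset_eq_exists_conv by metis
  then show ?thesis using ex_mset[of M] by metis
qed

context comm_monoid
begin

lemma prl_mset:
  assumes "mset u = mset w" "\<And>i. i \<in> set w \<Longrightarrow> f i \<in> carrier G"
  shows "prl G f u = prl G f w"
  using assms
proof (induction u arbitrary: w)
  case (Cons i u)
  have i: "i \<in> set w" using Cons.prems(1) by (metis list.set_intros(1) set_mset_mset)
  have "mset u = mset (remove1 i w)" using Cons.prems(1) by (simp flip: Cons.prems(1))
  then have "prl G f u = prl G f (remove1 i w)"
    using Cons.prems(2) set_remove1_subset[of i w] by (intro Cons.IH) auto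
  then show ?case using prl_remove1[OF Cons.prems(2) i] by simp
qed simp

lemma prl_power:
  assumes "\<And>i. i \<in> set w \<Longrightarrow> f i \<in> carrier G" "m \<le> count_list w i"
  shows "\<exists>c. set c \<subseteq> set w \<and> length c + m = length w \<and> prl G f w = prl G f (replicate m i) \<otimes> prl G f c"
proof -
  obtain c where c: "mset w = replicate_mset m i + mset c" using count_list_split[OF assms(2)] by blast
  then have e: "mset (replicate m i @ c) = mset w" by simp
  have s: "set (replicate m i @ c) = set w" using e by (metis set_mset_mset)
  have "length (replicate m i @ c) = length w" using e by (metis size_mset)
  moreover have "prl G f w = prl G f (replicate m i) \<otimes> prl G f c"
    using prl_mset[OF e assms(1)] s assms(1) by (subst prl_append[symmetric]) auto
  ultimately show ?thesis using s by (intro exI[of _ c]) auto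
qed

lemma prl_replicate: "f i \<in> carrier G \<Longrightarrow> prl G f (replicate m i) = f i [^] m"
  by (induction m) (simp_all add: m_comm)

end

text \<open>Linear combinations of the first k elements of u with coefficients in q, built so that
  an elimination can drop the last generator at each step.\<close>

primrec lincombs where
  "lincombs R q u 0 = {\<zero>\<^bsub>R\<^esub>}"
| "lincombs R q u (Suc k) = {a \<otimes>\<^bsub>R\<^esub> u k \<oplus>\<^bsub>R\<^esub> z |a z. a \<in> q \<and> z \<in> lincombs R q u k}"

context cring
begin

lemma idealI':
  assumes "I \<subseteq> carrier R" "\<zero> \<in> I" "\<And>a b. \<lbrakk> a \<in> I; b \<in> I \<rbrakk> \<Longrightarrow> a \<oplus> b \<in> I"
    "\<And>r a. \<lbrakk> r \<in> carrier R; a \<in> I \<rbrakk> \<Longrightarrow> r \<otimes> a \<in> I"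
  shows "ideal I R"
proof (rule idealI[OF ring_axioms])
  have neg: "\<ominus> a \<in> I" if "a \<in> I" for a
  proof -
    have "a \<in> carrier R" using assms(1) that by blast
    then have "(\<ominus> \<one>) \<otimes> a = \<ominus> a" by (simp add: l_minus)
    then show ?thesis using assms(4)[of "\<ominus> \<one>" a] that by simp
  qed
  show "subgroup I (add_monoid R)"
    using assms(1-3) neg by (intro add.subgroupI) (auto simp: a_inv_def)
  show "a \<otimes> x \<in> I" if "a \<in> I" "x \<in> carrier R" for a x
  proof -
    have "a \<in> carrier R" using assms(1) that by blast
    then show ?thesis using assms(4)[OF that(2,1)] m_comm that(2) by simp
  qed
qed (rule assms(4))

lemma idealD:
  assumes "ideal I R"
  shows "I \<subseteq> carrier R" "\<zero> \<in> I" "\<lbrakk> a \<in> I; b \<in> I \<rbrakk> \<Longrightarrow> a \<oplus> b \<in> I"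
    "\<lbrakk> r \<in> carrier R; a \<in> I \<rbrakk> \<Longrightarrow> r \<otimes> a \<in> I" "\<lbrakk> r \<in> carrier R; a \<in> I \<rbrakk> \<Longrightarrow> a \<otimes> r \<in> I" "a \<in> I \<Longrightarrow> a \<in> carrier R"
proof -
  interpret I: ideal I R by fact
  show "I \<subseteq> carrier R" "\<zero> \<in> I" "\<lbrakk> a \<in> I; b \<in> I \<rbrakk> \<Longrightarrow> a \<oplus> b \<in> I"
    "\<lbrakk> r \<in> carrier R; a \<in> I \<rbrakk> \<Longrightarrow> r \<otimes> a \<in> I" "\<lbrakk> r \<in> carrier R; a \<in> I \<rbrakk> \<Longrightarrow> a \<otimes> r \<in> I" "a \<in> I \<Longrightarrow> a \<in> carrier R"
    using I.a_subset by (simp_all add: I.zero_closed I.a_closed I.I_l_closed I.I_r_closed I.Icarr)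
qed

lemma colon_ideal:
  assumes L: "ideal L R" and a: "a \<in> carrier R" shows "ideal {x \<in> carrier R. a \<otimes> x \<in> L} R"
  by (rule idealI') (use a idealD[OF L] in \<open>auto simp: r_distr m_lcomm\<close>)

text \<open>The x with a x in L form an ideal by \<open>colon_ideal\<close>, so membership can be
  checked on generators, one factor at a time.\<close>

lemma genideal_mult:
  assumes L: "ideal L R" and A: "A \<subseteq> carrier R" and B: "B \<subseteq> carrier R"
    and AB: "\<And>a b. \<lbrakk> a \<in> A; b \<in> B \<rbrakk> \<Longrightarrow> a \<otimes> b \<in> L" and i: "i \<in> genideal R A" and j: "j \<in> genideal R B"
  shows "i \<otimes> j \<in> L"
proof -
  have jR: "j \<in> carrier R" using j idealD(1)[OF genideal_ideal[OF B]] by blast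
  have "j \<otimes> a \<in> L" if a: "a \<in> A" for a
  proof -
    have aR: "a \<in> carrier R" using a A by blast
    have "genideal R B \<subseteq> {x \<in> carrier R. a \<otimes> x \<in> L}"
      using AB[OF a] B by (intro genideal_minimal colon_ideal L aR) blast
    then have "a \<otimes> j \<in> L" using j by blast
    then show ?thesis using m_comm[OF aR jR] by simp
  qed
  then have "genideal R A \<subseteq> {x \<in> carrier R. j \<otimes> x \<in> L}"
    using A by (intro genideal_minimal colon_ideal L jR) blast
  then have "i \<in> carrier R" "j \<otimes> i \<in> L" using i by auto
  then show ?thesis using m_comm[OF _ jR] by simp
qed

lemma ideal_power_ideal: "ideal I R \<Longrightarrow> ideal (ideal_power R I m) R"
  by (induction m) (simp_all add: oneideal ideal_prod_is_ideal)

lemma ideal_prod_closed: "\<lbrakk> ideal L R; \<And>i j. \<lbrakk> i \<in> I; j \<in> J \<rbrakk> \<Longrightarrow> i \<otimes> j \<in> L; a \<in> ideal_prod R I J \<rbrakk> \<Longrightarrow> a \<in> L"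
proof -
  assume L: "ideal L R" and IJ: "\<And>i j. \<lbrakk> i \<in> I; j \<in> J \<rbrakk> \<Longrightarrow> i \<otimes> j \<in> L" and "a \<in> ideal_prod R I J"
  from this(3) show "a \<in> L"
    by (induction rule: ideal_prod.induct) (auto intro: IJ idealD(3)[OF L])
qed

lemma ideal_power_mult:
  assumes I: "ideal I R" and a: "a \<in> ideal_power R I d" and b: "b \<in> ideal_power R I e"
  shows "a \<otimes> b \<in> ideal_power R I (d + e)"
  using a
proof (induction d arbitrary: a)
  case 0
  then show ?case using idealD(4)[OF ideal_power_ideal[OF I]] b by simp
next
  case (Suc d)
  have bR: "b \<in> carrier R" by (rule idealD(6)[OF ideal_power_ideal[OF I] b])
  have "b \<otimes> a \<in> ideal_power R I (Suc d + e)"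
  proof -
    have "a \<in> {x \<in> carrier R. b \<otimes> x \<in> ideal_power R I (Suc d + e)}"
    proof (rule ideal_prod_closed[OF colon_ideal[OF ideal_power_ideal[OF I] bR]])
      show "a \<in> ideal_prod R I (ideal_power R I d)" using Suc.prems by simp
      fix i j assume ij: "i \<in> I" "j \<in> ideal_power R I d"
      note R = idealD(6)[OF I ij(1)] idealD(6)[OF ideal_power_ideal[OF I] ij(2)] bR
      have "b \<otimes> (i \<otimes> j) = i \<otimes> (j \<otimes> b)" using R by (simp add: m_ac)
      also have "\<dots> \<in> ideal_power R I (Suc d + e)" using Suc.IH[OF ij(2)] ij(1) by (auto intro: ideal_prod.prod)
      finally show "i \<otimes> j \<in> {x \<in> carrier R. b \<otimes> x \<in> ideal_power R I (Suc d + e)}" using R by simp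
    qed
    then show ?thesis by simp
  qed
  then show ?case using m_comm[OF bR idealD(6)[OF ideal_power_ideal[OF I] Suc.prems]] by simp
qed

lemma ideal_power_1: assumes "ideal I R" shows "ideal_power R I 1 = I"
proof (intro equalityI subsetI)
  show "a \<in> I" if "a \<in> ideal_power R I 1" for a
    by (rule ideal_prod_closed[OF assms, of I "carrier R"]) (use that idealD(5)[OF assms] in simp_all)
  show "a \<in> ideal_power R I 1" if "a \<in> I" for a
    using ideal_prod.prod[OF that one_closed, of R] idealD(6)[OF assms that] by simp
qed

lemma ideal_power_pow:
  assumes I: "ideal I R" and a: "a \<in> ideal_power R I d" shows "a [^] (m::nat) \<in> ideal_power R I (d * m)"
proof (induction m)
  case (Suc m)
  show ?case using ideal_power_mult[OF I Suc a] by (simp add: add.commute)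
qed simp

lemma ideal_power_mono: "I \<subseteq> K \<Longrightarrow> ideal_power R I m \<subseteq> ideal_power R K m"
proof (induction m)
  case (Suc m)
  have "a \<in> ideal_prod R K (ideal_power R K m)" if "a \<in> ideal_prod R I (ideal_power R I m)" for a
    using that by (induction rule: ideal_prod.induct) (use Suc in \<open>auto intro: ideal_prod.intros\<close>)
  then show ?case by auto
qed simp

lemma lincombs_closed:
  "\<lbrakk> q \<subseteq> carrier R; \<forall>i<k. u i \<in> carrier R; z \<in> lincombs R q u k \<rbrakk> \<Longrightarrow> z \<in> carrier R"
  by (induction k arbitrary: z) auto

lemma lincombs_zero: "\<lbrakk> \<forall>i<k. u i \<in> carrier R; \<zero> \<in> q \<rbrakk> \<Longrightarrow> \<zero> \<in> lincombs R q u k"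
proof (induction k)
  case (Suc k)
  then have "\<zero> = \<zero> \<otimes> u k \<oplus> \<zero>" "\<zero> \<in> lincombs R q u k" by simp_all
  then show ?case using Suc.prems(2) by (simp only: lincombs.simps) blast
qed simp

lemma lincombs_add:
  assumes q: "q \<subseteq> carrier R" "\<And>a b. \<lbrakk> a \<in> q; b \<in> q \<rbrakk> \<Longrightarrow> a \<oplus> b \<in> q"
    and u: "\<forall>i<k. u i \<in> carrier R"
  shows "\<lbrakk> y \<in> lincombs R q u k; z \<in> lincombs R q u k \<rbrakk> \<Longrightarrow> y \<oplus> z \<in> lincombs R q u k"
  using u
proof (induction k arbitrary: y z)
  case (Suc k)
  obtain a y' where y: "y = a \<otimes> u k \<oplus> y'" "a \<in> q" "y' \<in> lincombs R q u k" using Suc.prems(1) by auto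
  obtain b z' where z: "z = b \<otimes> u k \<oplus> z'" "b \<in> q" "z' \<in> lincombs R q u k" using Suc.prems(2) by auto
  have R: "a \<in> carrier R" "b \<in> carrier R" "y' \<in> carrier R" "z' \<in> carrier R" "u k \<in> carrier R"
    using y z q(1) Suc.prems(3) lincombs_closed[OF q(1), of k u] by auto
  have "y \<oplus> z = (a \<oplus> b) \<otimes> u k \<oplus> (y' \<oplus> z')" unfolding y z using R by (simp add: l_distr a_ac)
  moreover have "y' \<oplus> z' \<in> lincombs R q u k" using Suc.IH[OF y(3) z(3)] Suc.prems(3) by simp
  ultimately show ?case using q(2)[OF y(2) z(2)] by (simp only: lincombs.simps) blast
qed simp

lemma lincombs_scale:
  assumes q: "q \<subseteq> carrier R" "b \<in> carrier R" "\<And>a. a \<in> q \<Longrightarrow> b \<otimes> a \<in> q'"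
    and u: "\<forall>i<k. u i \<in> carrier R"
  shows "z \<in> lincombs R q u k \<Longrightarrow> b \<otimes> z \<in> lincombs R q' u k"
  using u
proof (induction k arbitrary: z)
  case 0
  then show ?case using q(2) by simp
next
  case (Suc k)
  obtain a z' where z: "z = a \<otimes> u k \<oplus> z'" "a \<in> q" "z' \<in> lincombs R q u k" using Suc.prems(1) by auto
  have R: "a \<in> carrier R" "z' \<in> carrier R" "u k \<in> carrier R"
    using z q(1) Suc.prems(2) lincombs_closed[OF q(1), of k u] by auto
  have "b \<otimes> z = (b \<otimes> a) \<otimes> u k \<oplus> b \<otimes> z'" unfolding z using R q(2) by (simp add: r_distr m_assoc)
  moreover have "b \<otimes> z' \<in> lincombs R q' u k" using Suc.IH[OF z(3)] Suc.prems(2) by simp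
  ultimately show ?case using q(3)[OF z(2)] by (simp only: lincombs.simps) blast
qed

lemma lincombs_mono:
  assumes "q \<subseteq> q'" "q \<subseteq> carrier R" "\<forall>i<k. u i \<in> carrier R" "z \<in> lincombs R q u k"
  shows "z \<in> lincombs R q' u k"
proof -
  have "\<one> \<otimes> a \<in> q'" if "a \<in> q" for a
  proof -
    have "a \<in> carrier R" "a \<in> q'" using that assms(1,2) by blast+
    then show ?thesis by simp
  qed
  then have "\<one> \<otimes> z \<in> lincombs R q' u k" using assms by (intro lincombs_scale[of q]) auto
  then show ?thesis using lincombs_closed[OF assms(2-4)] by simp
qed

lemma lincombs_mem:
  assumes "q \<subseteq> carrier R" "\<zero> \<in> q" "a \<in> q"
  shows "\<lbrakk> \<forall>i<k. u i \<in> carrier R; i < k \<rbrakk> \<Longrightarrow> a \<otimes> u i \<in> lincombs R q u k"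
proof (induction k)
  case (Suc k)
  have a: "a \<in> carrier R" using assms by blast
  show ?case
  proof (cases "i = k")
    case True
    have "a \<otimes> u k = a \<otimes> u k \<oplus> \<zero>" using a Suc.prems(1) by simp
    moreover have "\<zero> \<in> lincombs R q u k" using Suc.prems(1) assms(2) by (intro lincombs_zero) simp_all
    ultimately show ?thesis using assms(3) True by (simp only: lincombs.simps) blast
  next
    case False
    then have i: "i < k" using Suc.prems(2) by simp
    have "a \<otimes> u i = \<zero> \<otimes> u k \<oplus> a \<otimes> u i" using a Suc.prems i by simp
    moreover have "a \<otimes> u i \<in> lincombs R q u k" using Suc.IH Suc.prems(1) i by simp
    ultimately show ?thesis using assms(2) by (simp only: lincombs.simps) blast
  qed
qed simp

lemma lincombs_ideal:
  assumes J: "ideal J R" and u: "\<forall>i<k. u i \<in> carrier R"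
  shows "ideal (lincombs R J u k) R"
proof (rule idealI')
  show "lincombs R J u k \<subseteq> carrier R" by (intro subsetI lincombs_closed[OF idealD(1)[OF J] u])
  show "\<zero> \<in> lincombs R J u k" using u idealD(2)[OF J] by (rule lincombs_zero)
  show "a \<oplus> b \<in> lincombs R J u k" if "a \<in> lincombs R J u k" "b \<in> lincombs R J u k" for a b
    by (rule lincombs_add[OF _ _ u that]) (use idealD(1,3)[OF J] in auto)
  show "r \<otimes> a \<in> lincombs R J u k" if "r \<in> carrier R" "a \<in> lincombs R J u k" for r a
    using idealD(4)[OF J that(1)] that(2) by (intro lincombs_scale[OF idealD(1)[OF J] that(1)] u)
qed

lemma prl_ideal_power:
  assumes I: "ideal I R" shows "set gs \<subseteq> I \<Longrightarrow> prl R id gs \<in> ideal_power R I (length gs)"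
  by (induction gs) (auto intro: ideal_prod.prod)

lemma ideal_power_generated:
  assumes G: "G \<subseteq> carrier R" and K: "K \<subseteq> genideal R G"
  shows "ideal_power R K m \<subseteq> genideal R {prl R id gs |gs. set gs \<subseteq> G \<and> length gs = m}"
proof (induction m)
  case 0
  show ?case by (simp add: genideal_one)
next
  case (Suc m)
  let ?P = "\<lambda>m. {prl R id gs |gs. set gs \<subseteq> G \<and> length gs = m}"
  have P: "?P m \<subseteq> carrier R" for m using G by (auto intro!: prl_closed)
  have "i \<otimes> j \<in> genideal R (?P (Suc m))" if ij: "i \<in> K" "j \<in> ideal_power R K m" for i j
  proof (rule genideal_mult[OF genideal_ideal[OF P] G P])
    fix a b assume ab: "a \<in> G" "b \<in> ?P m"
    then obtain gs where gs: "b = prl R id gs" "set gs \<subseteq> G" "length gs = m" by blast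
    then have "a \<otimes> b = prl R id (a # gs)" "set (a # gs) \<subseteq> G" "length (a # gs) = Suc m" using ab by auto
    then have "a \<otimes> b \<in> ?P (Suc m)" by blast
    then show "a \<otimes> b \<in> genideal R (?P (Suc m))" using genideal_self[OF P] by blast
  qed (use ij K Suc in blast)+
  note closed = ideal_prod_closed[OF genideal_ideal[OF P, of "Suc m"], of K "ideal_power R K m", OF this]
  show ?case unfolding ideal_power.simps(2) by (intro subsetI closed)
qed

end

section \<open>Nilpotency modulo J in the Rees algebra of K\<close>

locale nested_ideals = cring R for R (structure) +
  fixes J K
  assumes J: "ideal J R" and K: "ideal K R" and JK: "J \<subseteq> K"
begin

abbreviation pw where "pw \<equiv> ideal_power R K"

text \<open>The component of degree m of the ideal that J, placed in degree 1, generates in the Rees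
  algebra of K. In degree 0 this component is zero.\<close>

definition NJ where "NJ m = (if m = 0 then {\<zero>} else ideal_prod R J (pw (m - 1)))"

lemmas pw_ideal = ideal_power_ideal[OF K]

lemma NJ_ideal: "ideal (NJ m) R"
  unfolding NJ_def using zeroideal ideal_prod_is_ideal[OF J pw_ideal] by simp

lemma NJ_mult:
  assumes a: "a \<in> pw e" and b: "b \<in> NJ m" shows "a \<otimes> b \<in> NJ (m + e)"
proof (cases m)
  case 0
  then show ?thesis using b idealD(6)[OF pw_ideal a] idealD(2)[OF NJ_ideal] by (simp add: NJ_def)
next
  case (Suc m')
  have aR: "a \<in> carrier R" by (rule idealD(6)[OF pw_ideal a])
  have "b \<in> {x \<in> carrier R. a \<otimes> x \<in> NJ (m + e)}"
  proof (rule ideal_prod_closed[OF colon_ideal[OF NJ_ideal aR]])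
    show "b \<in> ideal_prod R J (pw m')" using b Suc by (simp add: NJ_def)
    fix i j assume ij: "i \<in> J" "j \<in> pw m'"
    note R = idealD(6)[OF J ij(1)] idealD(6)[OF pw_ideal ij(2)] aR
    have "a \<otimes> (i \<otimes> j) = i \<otimes> (j \<otimes> a)" using R by (simp add: m_ac)
    also have "\<dots> \<in> NJ (m + e)"
      using ideal_power_mult[OF K ij(2) a] ij(1) Suc by (simp add: NJ_def) (rule ideal_prod.prod)
    finally show "i \<otimes> j \<in> {x \<in> carrier R. a \<otimes> x \<in> NJ (m + e)}" using R by simp
  qed
  then show ?thesis by simp
qed

text \<open>The element g, placed in degree d of the Rees algebra of K, is nilpotent modulo the
  ideal with components \<open>NJ\<close>. With the degree as a parameter, homogeneous elements can
  be handled inside \<open>R\<close>.\<close>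

definition Rad where "Rad d g \<longleftrightarrow> g \<in> pw d \<and> (\<exists>m>0. g [^] (m::nat) \<in> NJ (d * m))"

lemma Rad_pw: "Rad d g \<Longrightarrow> g \<in> pw d"
  by (simp add: Rad_def)

lemma NJ_pow_mono:
  assumes "g \<in> pw d" "g [^] (m::nat) \<in> NJ (d * m)" "m \<le> m'" shows "g [^] m' \<in> NJ (d * m')"
proof -
  have gR: "g \<in> carrier R" using idealD(6)[OF pw_ideal assms(1)] .
  have "g [^] (m' - m) \<otimes> g [^] m \<in> NJ (d * m + d * (m' - m))"
    by (intro NJ_mult assms ideal_power_pow K)
  also have "d * m + d * (m' - m) = d * m'" using assms(3) by (simp only: distrib_left[symmetric] le_add_diff_inverse)
  finally show ?thesis using assms(3) gR by (simp add: nat_pow_mult)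
qed

lemma Rad_mult:
  assumes a: "Rad d a" and b: "b \<in> pw e" shows "Rad (d + e) (a \<otimes> b)"
proof -
  obtain m :: nat where m: "m > 0" "a [^] m \<in> NJ (d * m)" using a by (auto simp: Rad_def)
  have R: "a \<in> carrier R" "b \<in> carrier R" using idealD(6)[OF pw_ideal] a b by (auto simp: Rad_def)
  have "b [^] m \<otimes> a [^] m \<in> NJ (d * m + e * m)" by (intro NJ_mult ideal_power_pow K m b)
  then have "(a \<otimes> b) [^] m \<in> NJ ((d + e) * m)"
    using R by (simp add: nat_pow_distrib m_comm distrib_right)
  then show ?thesis using m(1) ideal_power_mult[OF K Rad_pw[OF a] b] by (auto simp: Rad_def)
qed

lemma Rad_add:
  assumes a: "Rad d a" and b: "Rad d b" shows "Rad d (a \<oplus> b)"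
proof -
  obtain i0 :: nat where i0: "i0 > 0" "a [^] i0 \<in> NJ (d * i0)" using a by (auto simp: Rad_def)
  obtain j0 :: nat where j0: "j0 > 0" "b [^] j0 \<in> NJ (d * j0)" using b by (auto simp: Rad_def)
  note pa = Rad_pw[OF a] and pb = Rad_pw[OF b]
  have R: "a \<in> carrier R" "b \<in> carrier R" using idealD(6)[OF pw_ideal] pa pb by auto
  \<comment> \<open>The exponents i and j are kept general so that one factor a + b can be expanded
    at a time; this replaces the binomial theorem.\<close>
  have *: "a [^] i \<otimes> b [^] j \<otimes> (a \<oplus> b) [^] m \<in> NJ (d * (i + j + m))" if "i0 + j0 \<le> i + j + m" for i j m :: nat
    using that
  proof (induction m arbitrary: i j)
    case 0
    then consider "i0 \<le> i" | "j0 \<le> j" by linarith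
    then have "b [^] j \<otimes> a [^] i \<in> NJ (d * i + d * j) \<or> a [^] i \<otimes> b [^] j \<in> NJ (d * j + d * i)"
      using NJ_mult[OF ideal_power_pow[OF K pb, of j] NJ_pow_mono[OF pa i0(2)]]
        NJ_mult[OF ideal_power_pow[OF K pa, of i] NJ_pow_mono[OF pb j0(2)]] by metis
    then show ?case using R by (auto simp: m_comm distrib_left add.commute)
  next
    case (Suc m)
    let ?c = "(a \<oplus> b) [^] m"
    have c: "?c \<in> carrier R" using R by simp
    have "a [^] i \<otimes> b [^] j \<otimes> (a \<oplus> b) [^] Suc m
        = a [^] Suc i \<otimes> b [^] j \<otimes> ?c \<oplus> a [^] i \<otimes> b [^] Suc j \<otimes> ?c"
      using R c by (simp add: r_distr l_distr m_ac)
    moreover have "a [^] Suc i \<otimes> b [^] j \<otimes> ?c \<in> NJ (d * (i + j + Suc m))"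
      using Suc.IH[of "Suc i" j] Suc.prems by simp
    moreover have "a [^] i \<otimes> b [^] Suc j \<otimes> ?c \<in> NJ (d * (i + j + Suc m))"
      using Suc.IH[of i "Suc j"] Suc.prems by simp
    ultimately show ?case using idealD(3)[OF NJ_ideal] by simp
  qed
  have "(a \<oplus> b) [^] (i0 + j0) \<in> NJ (d * (i0 + j0))" using *[of 0 0 "i0 + j0"] R by simp
  then show ?thesis using i0(1) idealD(3)[OF pw_ideal pa pb] unfolding Rad_def by (metis add_gr_0)
qed

lemma Rad_zero: "Rad d \<zero>"
  unfolding Rad_def using idealD(2)[OF pw_ideal] idealD(2)[OF NJ_ideal] by (auto intro!: exI[of _ "1::nat"])

lemma Rad_finsum: "\<lbrakk> finite C; \<And>c. c \<in> C \<Longrightarrow> Rad d (h c) \<rbrakk> \<Longrightarrow> Rad d (finsum R h C)"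
proof (induction C rule: finite_induct)
  case (insert c C)
  then have "finsum R h (insert c C) = h c \<oplus> finsum R h C"
    using idealD(6)[OF pw_ideal Rad_pw] by (intro finsum_insert) auto
  then show ?case using insert Rad_add by simp
qed (simp add: Rad_zero)

text \<open>Cramer's rule gives information about the square of a norm only, and a nilpotent square
  comes from a nilpotent element.\<close>

lemma Rad_sqrt: assumes g: "g \<in> pw d" and "Rad (d + d) (g \<otimes> g)" shows "Rad d g"
proof -
  obtain m :: nat where m: "m > 0" "(g \<otimes> g) [^] m \<in> NJ ((d + d) * m)" using assms(2) by (auto simp: Rad_def)
  have gR: "g \<in> carrier R" using idealD(6)[OF pw_ideal g] .
  have "(g \<otimes> g) [^] m = g [^] (m + m)" using gR by (simp add: nat_pow_distrib nat_pow_mult)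
  then have "g [^] (m + m) \<in> NJ (d * (m + m))" using m(2) by (simp add: distrib_left distrib_right)
  then show ?thesis using g m(1) unfolding Rad_def by (metis add_gr_0)
qed

lemma Rad_J: "g \<in> J \<Longrightarrow> Rad 1 g"
  unfolding Rad_def using ideal_power_1[OF K] JK idealD(6)[OF J] ideal_prod.prod[of g J \<one> "carrier R" R]
  by (auto intro!: exI[of _ "1::nat"] simp: NJ_def)

text \<open>One exponent m, the sum of the individual ones, serves for all generators. A product of
  more than \<open>card G * m\<close> generators repeats one of them at least m times, so it lies in
  J K^N with N = \<open>card G * m\<close>.\<close>

lemma reduction:
  assumes G: "finite G" "G \<subseteq> K" "K \<subseteq> genideal R G" and rad: "\<And>g. g \<in> G \<Longrightarrow> Rad 1 g"
  shows "\<exists>N. pw (Suc N) \<subseteq> NJ (Suc N)"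
proof -
  have "\<forall>g\<in>G. \<exists>m::nat. g [^] m \<in> NJ (1 * m)" using rad by (auto simp: Rad_def)
  then obtain h :: "_ \<Rightarrow> nat" where h: "g [^] h g \<in> NJ (1 * h g)" if "g \<in> G" for g by metis
  define m where "m = sum h G"
  have m: "g [^] m \<in> NJ m" if g: "g \<in> G" for g
    using NJ_pow_mono[OF Rad_pw[OF rad[OF g]] h[OF g], of m] member_le_sum[OF g, of h] G(1) by (simp add: m_def)
  let ?N = "card G * m"
  have GR: "G \<subseteq> carrier R" using G(2) idealD(1)[OF K] by blast
  have "prl R id gs \<in> NJ (Suc ?N)" if gs: "set gs \<subseteq> G" "length gs = Suc ?N" for gs
  proof -
    obtain g where g: "g \<in> G" "m \<le> count_list gs g"
      using count_list_pigeonhole[OF G(1) gs(1), of m] gs(2) by auto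
    have "\<exists>c. set c \<subseteq> set gs \<and> length c + m = length gs \<and> prl R id gs = prl R id (replicate m g) \<otimes> prl R id c"
      by (rule prl_power[OF _ g(2)]) (use gs GR in auto)
    then obtain c where
      c: "set c \<subseteq> set gs" "length c + m = length gs" "prl R id gs = prl R id (replicate m g) \<otimes> prl R id c" by blast
    have gR: "g \<in> carrier R" using g GR by blast
    have pc: "prl R id c \<in> pw (length c)" using c gs G by (intro prl_ideal_power K) blast
    have "prl R id c \<otimes> g [^] m \<in> NJ (m + length c)" by (rule NJ_mult[OF pc m[OF g(1)]])
    moreover have "prl R id gs = prl R id c \<otimes> g [^] m"
      using c(3) prl_replicate[of id g m] gR idealD(6)[OF pw_ideal pc] by (simp add: m_comm)
    moreover have "m + length c = Suc ?N" using c(2) gs(2) by simp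
    ultimately show ?thesis by simp
  qed
  then have "genideal R {prl R id gs |gs. set gs \<subseteq> G \<and> length gs = Suc ?N} \<subseteq> NJ (Suc ?N)"
    by (intro genideal_minimal NJ_ideal) blast
  then show ?thesis using ideal_power_generated[OF GR G(3), of "Suc ?N"] by (intro exI[of _ ?N]) blast
qed

text \<open>The sets \<open>q d\<close> are the homogeneous components of a prime ideal of the Rees algebra of \<open>I\<close>.
  This is the determinant trick: multiplication by \<open>g\<close> on the finitely generated module
  \<open>K\<^sup>N\<close> has its matrix entries in \<open>J\<close>, and the matrix is triangulated modulo the prime.\<close>

lemma prime_contains:
  assumes G: "finite G" "G \<subseteq> K" "K \<subseteq> genideal R G" and rad: "\<And>g. g \<in> G \<Longrightarrow> Rad 1 g"
    and I: "ideal I R" "J \<subseteq> I" "I \<subseteq> K"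
    and q: "\<And>d. q d \<subseteq> ideal_power R I d" "\<And>d. \<zero> \<in> q d"
      "\<And>d a b. \<lbrakk> a \<in> q d; b \<in> q d \<rbrakk> \<Longrightarrow> a \<oplus> b \<in> q d"
      "\<And>d e a b. \<lbrakk> a \<in> ideal_power R I e; b \<in> q d \<rbrakk> \<Longrightarrow> a \<otimes> b \<in> q (e + d)"
      "\<And>d e a b. \<lbrakk> a \<in> ideal_power R I d; b \<in> ideal_power R I e; a \<otimes> b \<in> q (d + e) \<rbrakk> \<Longrightarrow> a \<in> q d \<or> b \<in> q e"
    and Jq: "J \<subseteq> q 1"
  shows "I \<subseteq> q 1"
proof
  fix g assume g: "g \<in> I"
  show "g \<in> q 1"
  proof (rule ccontr)
    assume gq: "g \<notin> q 1"
    let ?pI = "ideal_power R I"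
    note pI = ideal_power_ideal[OF I(1)]
    have gK: "g \<in> K" using g I(3) by blast
    have gR: "g \<in> carrier R" using idealD(6)[OF I(1) g] .
    have g1: "g \<in> ?pI 1" using g ideal_power_1[OF I(1)] by simp
    have GR: "G \<subseteq> carrier R" using G(2) idealD(1)[OF K] by blast
    have qR: "q d \<subseteq> carrier R" for d using q(1)[of d] idealD(1)[OF pI, of d] by blast
    obtain N where N: "pw (Suc N) \<subseteq> NJ (Suc N)" using reduction[OF G rad] by blast
    let ?P = "{prl R id gs |gs. set gs \<subseteq> G \<and> length gs = N}"
    have P: "?P \<subseteq> carrier R" using GR by (auto intro!: prl_closed)
    have Ppw: "?P \<subseteq> pw N" using G(2) prl_ideal_power[OF K] by blast
    have "?P = prl R id ` {gs. set gs \<subseteq> G \<and> length gs = N}" by auto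
    then have "finite ?P" using finite_lists_length_eq[OF G(1)] by simp
    from finite_list[OF this] obtain us where us: "set us = ?P" ..
    let ?u = "\<lambda>j. us ! j" and ?s = "length us"
    have uP: "?u j \<in> ?P" if "j < ?s" for j using us nth_mem[OF that] by blast
    have uR: "?u j \<in> carrier R" if "j < ?s" for j using uP[OF that] P by blast
    have uR': "\<forall>j<?s. ?u j \<in> carrier R" using uR by blast
    have span: "pw N \<subseteq> genideal R ?P" by (rule ideal_power_generated[OF GR G(3)])
    have inJ: "g \<otimes> ?u j \<in> lincombs R J ?u ?s" if j: "j < ?s" for j
    proof -
      have "?u j \<in> pw N" using uP[OF j] Ppw by blast
      then have "g \<otimes> ?u j \<in> ideal_prod R K (pw N)" using gK by (intro ideal_prod.prod)
      then have "g \<otimes> ?u j \<in> NJ (Suc N)" using N by auto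
      then have gu: "g \<otimes> ?u j \<in> ideal_prod R J (pw N)" by (simp add: NJ_def)
      show ?thesis
      proof (rule ideal_prod_closed[OF lincombs_ideal[OF J uR'] _ gu])
        fix a b assume ab: "a \<in> J" "b \<in> pw N"
        have aJ: "a \<in> genideal R J" by (rule subsetD[OF genideal_self[OF idealD(1)[OF J]] ab(1)])
        have bP: "b \<in> genideal R ?P" by (rule subsetD[OF span ab(2)])
        show "a \<otimes> b \<in> lincombs R J ?u ?s"
        proof (rule genideal_mult[OF lincombs_ideal[OF J uR'] idealD(1)[OF J] P _ aJ bP])
          fix a b assume a: "a \<in> J" and "b \<in> ?P"
          then have "b \<in> set us" unfolding us by blast
          then obtain i where "i < ?s" "b = ?u i" unfolding in_set_conv_nth by blast
          then show "a \<otimes> b \<in> lincombs R J ?u ?s"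
            using lincombs_mem[OF idealD(1,2)[OF J] a uR'] by simp
        qed
      qed
    qed
    \<comment> \<open>Invariant of the elimination: some b outside the prime sends every generator
      of K^N to a combination of the first k generators with coefficients in the prime. It starts
      with b = g and all generators, and at k = 0 it says that b annihilates K^N.\<close>
    let ?S = "\<lambda>k. \<exists>d. \<exists>b\<in>?pI d. b \<notin> q d \<and> (\<forall>j<?s. b \<otimes> ?u j \<in> lincombs R (q d) ?u k)"
    have "?S 0"
    proof (rule inc_induct[of 0 ?s ?S])
      have "g \<otimes> ?u j \<in> lincombs R (q 1) ?u ?s" if "j < ?s" for j
        by (rule lincombs_mono[OF Jq idealD(1)[OF J] uR' inJ[OF that]])
      then show "?S ?s" using g1 gq by blast
    next
      fix k assume k: "k < ?s" and "?S (Suc k)"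
      then obtain d b where b: "b \<in> ?pI d" "b \<notin> q d" "\<And>j. j < ?s \<Longrightarrow> b \<otimes> ?u j \<in> lincombs R (q d) ?u (Suc k)"
        by blast
      have uk: "\<forall>i<k. ?u i \<in> carrier R" using k uR by simp
      obtain a z where az: "b \<otimes> ?u k = a \<otimes> ?u k \<oplus> z" "a \<in> q d" "z \<in> lincombs R (q d) ?u k"
        using b(3)[OF k] by auto
      have R: "b \<in> carrier R" "a \<in> carrier R" "z \<in> carrier R" "?u k \<in> carrier R"
        using idealD(6)[OF pI b(1)] az(2) qR lincombs_closed[OF qR uk az(3)] uR[OF k] by auto
      have apI: "a \<in> ?pI d" using az(2) q(1) by blast
      \<comment> \<open>Moving the diagonal term to the other side gives (b - a) u_k = z. Since a
        lies in the prime and b does not, c stays outside.\<close>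
      define c where "c = b \<oplus> (\<ominus> \<one>) \<otimes> a"
      have cpI: "c \<in> ?pI d" unfolding c_def by (intro idealD(3)[OF pI] b(1) idealD(4)[OF pI] apI) simp
      have cR: "c \<in> carrier R" using idealD(6)[OF pI cpI] .
      have cq: "c \<notin> q d"
      proof
        assume "c \<in> q d"
        then have "c \<oplus> a \<in> q d" using q(3) az(2) by blast
        moreover have "c \<oplus> a = b" unfolding c_def using R by (simp add: l_minus a_assoc l_neg)
        ultimately show False using b(2) by simp
      qed
      have cu: "c \<otimes> ?u k = z"
      proof -
        have "c \<otimes> ?u k = b \<otimes> ?u k \<oplus> \<ominus> (a \<otimes> ?u k)" unfolding c_def using R by (simp add: l_distr l_minus)
        also have "\<dots> = (\<ominus> (a \<otimes> ?u k) \<oplus> a \<otimes> ?u k) \<oplus> z" unfolding az(1) using R by (simp add: a_ac)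
        also have "\<dots> = z" using R by (simp add: l_neg)
        finally show ?thesis .
      qed
      have sc: "e \<otimes> y \<in> lincombs R (q (d + d)) ?u k" if "e \<in> ?pI d" "y \<in> lincombs R (q d) ?u k" for e y
        using q(4)[OF that(1)] by (intro lincombs_scale[OF qR idealD(6)[OF pI that(1)] _ uk that(2)])
      \<comment> \<open>Multiplying the expression for b u_j by c replaces u_k by z, so bc no longer
        needs the generator u_k. By primality bc is outside the prime too.\<close>
      have "b \<otimes> c \<otimes> ?u j \<in> lincombs R (q (d + d)) ?u k" if j: "j < ?s" for j
      proof -
        obtain a' z' where az': "b \<otimes> ?u j = a' \<otimes> ?u k \<oplus> z'" "a' \<in> q d" "z' \<in> lincombs R (q d) ?u k"
          using b(3)[OF j] by auto
        have R': "a' \<in> carrier R" "z' \<in> carrier R" "?u j \<in> carrier R"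
          using az'(2) qR lincombs_closed[OF qR uk az'(3)] uR[OF j] by auto
        have "b \<otimes> c \<otimes> ?u j = c \<otimes> (b \<otimes> ?u j)" using R cR R' by (simp add: m_ac)
        also have "\<dots> = a' \<otimes> (c \<otimes> ?u k) \<oplus> c \<otimes> z'" unfolding az'(1) using R cR R' by (simp add: r_distr m_lcomm)
        also have "\<dots> \<in> lincombs R (q (d + d)) ?u k"
          unfolding cu using sc[OF _ az(3)] sc[OF cpI az'(3)] az'(2) q(1)
          by (intro lincombs_add[OF qR q(3) uk]) auto
        finally show ?thesis .
      qed
      moreover have "b \<otimes> c \<in> ?pI (d + d)" by (rule ideal_power_mult[OF I(1) b(1) cpI])
      moreover have "b \<otimes> c \<notin> q (d + d)" using q(5)[OF b(1) cpI] b(2) cq by blast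
      ultimately show "?S k" by blast
    qed simp
    then obtain d b where b: "b \<in> ?pI d" "b \<notin> q d" "\<And>j. j < ?s \<Longrightarrow> b \<otimes> ?u j = \<zero>" by auto
    have bR: "b \<in> carrier R" using idealD(6)[OF pI b(1)] .
    have "genideal R ?P \<subseteq> {x \<in> carrier R. b \<otimes> x \<in> {\<zero>}}"
    proof (intro genideal_minimal colon_ideal zeroideal bR subsetI)
      fix x assume "x \<in> ?P"
      then have "x \<in> set us" unfolding us by blast
      then obtain i where "i < ?s" "x = ?u i" unfolding in_set_conv_nth by blast
      then show "x \<in> {x \<in> carrier R. b \<otimes> x \<in> {\<zero>}}" using b(3) uR by simp
    qed
    moreover have "g [^] N \<in> pw N" using ideal_power_pow[OF K, of g 1 N] gK ideal_power_1[OF K] by simp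
    \<comment> \<open>As g^N lies in K^N it is annihilated by b. Zero is in the prime and b is not,
      so g^N is in the prime, which contradicts the choice of g.\<close>
    ultimately have "b \<otimes> g [^] N = \<zero>" using span by blast
    then have "b \<otimes> g [^] N \<in> q (d + N)" using q(2) by simp
    moreover have gp: "g [^] k \<in> ?pI k" for k :: nat using ideal_power_pow[OF I(1) g1, of k] by simp
    ultimately have gN: "g [^] N \<in> q N" using q(5)[OF b(1) gp] b(2) by blast
    have "g [^] k \<notin> q k" for k :: nat
    proof (induction k)
      case 0
      show ?case using q(4)[OF g1, of \<one> 0] gq gR by auto
    next
      case (Suc k)
      show ?case using q(5)[OF gp g1, of k] Suc gq by auto
    qed
    then show False using gN by blast
  qed
qed

end

section \<open>Norms of monomials\<close>

context norm_bracket
begin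

text \<open>Slots are moved into T one after the other, from the last to the first: in the inner
  induction all slots from m on already lie in T.\<close>

lemma tuple_induct [consumes 2, case_names base step]:
  assumes T: "T \<subseteq> carrier F" and x: "tuple x"
    and base: "\<And>x. \<forall>i<n. x i \<in> T \<Longrightarrow> Q x"
    and step: "\<And>x k. \<lbrakk> tuple x; k < n; \<And>z. z \<in> T \<Longrightarrow> Q (x(k := z)) \<rbrakk> \<Longrightarrow> Q x"
  shows "Q x"
proof -
  have "Q x" if "tuple x" "\<forall>i<n. m \<le> i \<longrightarrow> x i \<in> T" "m \<le> n" for m x
    using that
  proof (induction m arbitrary: x)
    case (Suc m)
    show ?case
    proof (rule step[OF Suc.prems(1)])
      show "m < n" using Suc.prems(3) by simp
      show "Q (x(m := z))" if z: "z \<in> T" for z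
        using Suc.prems z T by (intro Suc.IH) auto
    qed
  qed (simp add: base)
  from this[of x n] show ?thesis using x by simp
qed

end

locale norm_words = norm_algebra A F n
  for A :: "('a, 'm) ring_scheme" and F :: "('a, 'f, 'k) module_scheme" and n :: nat +
  fixes r :: nat and t :: "nat \<Rightarrow> 'f"
  assumes t: "t ` {..<r} \<subseteq> carrier F" and generated: "generated_subalgebra A F (t ` {..<r}) = carrier F"
begin

abbreviation wd where "wd \<equiv> prl F t"

text \<open>Monomials are represented by lists of generator indices, which makes prefixes,
  concatenation and length available. Reordered lists denote the same element of F.\<close>

definition words where "words = {w. set w \<subseteq> {..<r}}"

lemma t_closed: "w \<in> words \<Longrightarrow> i \<in> set w \<Longrightarrow> t i \<in> carrier F"
  using t by (auto simp: words_def)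

lemma wd_closed [simp]: "w \<in> words \<Longrightarrow> wd w \<in> carrier F"
  using t_closed by (intro FC.prl_closed)

lemma words_append [simp]: "u @ w \<in> words \<longleftrightarrow> u \<in> words \<and> w \<in> words"
  by (auto simp: words_def)

lemma wd_append: "\<lbrakk> u \<in> words; w \<in> words \<rbrakk> \<Longrightarrow> wd (u @ w) = wd u \<otimes>\<^bsub>F\<^esub> wd w"
  using t_closed by (intro FC.prl_append)

text \<open>Words are closed under concatenation, so their span is closed under products. As a
  subalgebra containing the generators it is all of F.\<close>

lemma span_words: "carrier F = lin_span A F (wd ` words)"
proof
  let ?L = "lin_span A F (wd ` words)"
  have sub: "wd ` words \<subseteq> carrier F" by auto
  have L: "submodule ?L A F" by (rule alg.lin_span_submodule[OF sub])
  note LD = alg.submoduleE[OF L]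
  have in_L: "wd w \<in> ?L" if "w \<in> words" for w
    by (rule subsetD[OF lin_span_superset imageI[OF that]])
  have mul: "submodule {z \<in> carrier F. u \<otimes>\<^bsub>F\<^esub> z \<in> ?L} A F" if "u \<in> carrier F" for u
  proof -
    have cm: "u \<otimes>\<^bsub>F\<^esub> (a \<odot>\<^bsub>F\<^esub> z) = a \<odot>\<^bsub>F\<^esub> (u \<otimes>\<^bsub>F\<^esub> z)" if "a \<in> carrier A" "z \<in> carrier F" for a z
      using alg.smult_assoc2[OF that \<open>u \<in> carrier F\<close>] that \<open>u \<in> carrier F\<close> by (simp add: FC.m_comm)
    have "\<zero>\<^bsub>F\<^esub> \<in> ?L" using subgroup.one_closed[OF submodule.axioms(1)[OF L]] by simp
    then show ?thesis
      using LD that by (intro alg.submoduleI) (simp_all add: FC.r_distr FC.r_minus cm subset_iff)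
  qed
  have "?L \<subseteq> {z \<in> carrier F. wd w \<otimes>\<^bsub>F\<^esub> z \<in> ?L}" if w: "w \<in> words" for w
  proof (intro lin_span_minimal mul wd_closed w subsetI)
    fix z assume "z \<in> wd ` words"
    then obtain u where u: "u \<in> words" "z = wd u" by blast
    then show "z \<in> {z \<in> carrier F. wd w \<otimes>\<^bsub>F\<^esub> z \<in> ?L}"
      using in_L[of "w @ u"] w by (simp add: wd_append)
  qed
  then have 1: "wd w \<otimes>\<^bsub>F\<^esub> z \<in> ?L" if "w \<in> words" "z \<in> ?L" for w z using that by blast
  have "?L \<subseteq> {z \<in> carrier F. u \<otimes>\<^bsub>F\<^esub> z \<in> ?L}" if u: "u \<in> ?L" for u
  proof (intro lin_span_minimal mul)
    show uF: "u \<in> carrier F" using LD(1) u by blast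
    show "wd ` words \<subseteq> {z \<in> carrier F. u \<otimes>\<^bsub>F\<^esub> z \<in> ?L}" using 1[OF _ u] uF by (auto simp: FC.m_comm)
  qed
  then have 2: "u \<otimes>\<^bsub>F\<^esub> z \<in> ?L" if "u \<in> ?L" "z \<in> ?L" for u z using that by blast
  have "subring ?L F"
  proof (rule FC.subringI)
    show "\<one>\<^bsub>F\<^esub> \<in> ?L" using in_L[of "[]"] by (simp add: words_def)
  qed (use LD 2 in auto)
  moreover have "t ` {..<r} \<subseteq> ?L"
  proof
    fix x assume "x \<in> t ` {..<r}"
    then obtain i where i: "i < r" "x = t i" by auto
    then have "wd [i] = x" using t by auto
    then show "x \<in> ?L" using in_L[of "[i]"] i by (simp add: words_def)
  qed
  ultimately show "carrier F \<subseteq> ?L"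
    using L unfolding generated[symmetric] generated_subalgebra_def by blast
  show "?L \<subseteq> carrier F" by (rule LD(1))
qed

text \<open>A norm is additive and homogeneous in each slot; hence membership in an ideal of
  \<open>R\<close> can be tested on a spanning set of F in that slot.\<close>

lemma slot_submodule:
  assumes I: "ideal I R" and x: "tuple x" and y: "tuple y" and k: "k < n"
  shows "submodule {z \<in> carrier F. delta (x(k := z)) y \<in> I} A F"
proof (rule alg.submoduleI)
  have sc: "delta (x(k := a \<odot>\<^bsub>F\<^esub> z)) y \<in> I" if "a \<in> carrier A" "z \<in> carrier F" "delta (x(k := z)) y \<in> I" for a z
    unfolding delta_scale[OF x y k that(2,1)]
    using that(1) RC.one_closed by (intro RC.idealD(4)[OF I _ that(3)] RA.smult_closed)
  have z0: "delta (x(k := \<zero>\<^bsub>F\<^esub>)) y \<in> I"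
  proof -
    have d: "delta (x(k := \<one>\<^bsub>F\<^esub>)) y \<in> carrier R" by (intro delta_closed y) (use x in simp)
    have "delta (x(k := \<zero>\<^bsub>A\<^esub> \<odot>\<^bsub>F\<^esub> \<one>\<^bsub>F\<^esub>)) y = (\<zero>\<^bsub>A\<^esub> \<odot>\<^bsub>R\<^esub> \<one>\<^bsub>R\<^esub>) \<otimes>\<^bsub>R\<^esub> delta (x(k := \<one>\<^bsub>F\<^esub>)) y"
      by (rule delta_scale[OF x y k]) simp_all
    also have "\<dots> = \<zero>\<^bsub>R\<^esub>" using RA.smult_l_null[OF RC.one_closed] RC.l_null[OF d] by (simp only:)
    finally show ?thesis using RC.idealD(2)[OF I] by (simp add: alg.smult_l_null)
  qed
  show "\<zero>\<^bsub>F\<^esub> \<in> {z \<in> carrier F. delta (x(k := z)) y \<in> I}" using z0 by simp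
  show "a \<odot>\<^bsub>F\<^esub> z \<in> {z \<in> carrier F. delta (x(k := z)) y \<in> I}"
    if "a \<in> carrier A" "z \<in> {z \<in> carrier F. delta (x(k := z)) y \<in> I}" for a z
    using that sc by simp
  then show "\<ominus>\<^bsub>F\<^esub> z \<in> {z \<in> carrier F. delta (x(k := z)) y \<in> I}"
    if "z \<in> {z \<in> carrier F. delta (x(k := z)) y \<in> I}" for z
    using that alg.smult_l_minus[of "\<one>\<^bsub>A\<^esub>" z] sc[of "\<ominus>\<^bsub>A\<^esub> \<one>\<^bsub>A\<^esub>" z] by simp
  show "u \<oplus>\<^bsub>F\<^esub> v \<in> {z \<in> carrier F. delta (x(k := z)) y \<in> I}"
    if "u \<in> {z \<in> carrier F. delta (x(k := z)) y \<in> I}" "v \<in> {z \<in> carrier F. delta (x(k := z)) y \<in> I}" for u v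
    using that delta_add[OF x y k, of u v] RC.idealD(3)[OF I] by simp
qed auto

lemma delta_span:
  assumes I: "ideal I R" and y: "tuple y"
    and T: "T \<subseteq> carrier F" "lin_span A F T = carrier F" "\<And>x. \<forall>i<n. x i \<in> T \<Longrightarrow> delta x y \<in> I"
    and x: "tuple x"
  shows "delta x y \<in> I"
proof (rule tuple_induct[where Q = "\<lambda>x. delta x y \<in> I", OF T(1) x T(3)])
  fix x k assume x: "tuple x" and k: "k < n" and IH: "\<And>z. z \<in> T \<Longrightarrow> delta (x(k := z)) y \<in> I"
  have "lin_span A F T \<subseteq> {z \<in> carrier F. delta (x(k := z)) y \<in> I}"
  proof (intro lin_span_minimal slot_submodule I y x k)
    show "T \<subseteq> {z \<in> carrier F. delta (x(k := z)) y \<in> I}" using IH T(1) by blast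
  qed
  then have "x k \<in> {z \<in> carrier F. delta (x(k := z)) y \<in> I}" unfolding T(2) using x k by blast
  then show "delta x y \<in> I" by simp
qed

text \<open>The two tuples are expanded separately, the second one through the symmetry
  \<open>delta_sym\<close>.\<close>

lemma delta_words:
  assumes I: "ideal I R"
    and W: "\<And>u v. \<lbrakk> \<forall>i<n. u i \<in> words; \<forall>i<n. v i \<in> words \<rbrakk> \<Longrightarrow> delta (wd \<circ> u) (wd \<circ> v) \<in> I"
    and x: "tuple x" and y: "tuple y"
  shows "delta x y \<in> I"
proof -
  have sub: "wd ` words \<subseteq> carrier F" by auto
  have lift: "\<exists>u. (\<forall>i<n. u i \<in> words) \<and> (\<forall>i<n. x i = (wd \<circ> u) i)" if "\<forall>i<n. x i \<in> wd ` words" for x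
  proof -
    have "\<forall>i. \<exists>w. i < n \<longrightarrow> w \<in> words \<and> x i = wd w" using that by blast
    then show ?thesis by (metis comp_apply)
  qed
  have "delta x y \<in> I" if xw: "\<forall>i<n. x i \<in> wd ` words" and y: "tuple y" for x y
  proof -
    have xt: "tuple x" using xw sub by blast
    have "delta y x \<in> I"
    proof (rule delta_span[OF I xt sub span_words[symmetric] _ y])
      fix y assume yw: "\<forall>i<n. y i \<in> wd ` words"
      obtain u v where uv: "\<forall>i<n. u i \<in> words" "\<forall>i<n. x i = (wd \<circ> u) i"
        "\<forall>i<n. v i \<in> words" "\<forall>i<n. y i = (wd \<circ> v) i" using lift[OF xw] lift[OF yw] by blast
      have "delta y x = delta (wd \<circ> v) (wd \<circ> u)"
        using uv yw xw by (intro delta_cong) auto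
      then show "delta y x \<in> I" using W uv by simp
    qed
    then show ?thesis using delta_sym[OF xt y] by simp
  qed
  from this[OF _ y] show ?thesis by (rule delta_span[OF I y sub span_words[symmetric] _ x])
qed

abbreviation short where "short \<equiv> {w \<in> words. length w < n}"

definition NI where "NI T = genideal R {delta x y |x y. (\<forall>i<n. x i \<in> T) \<and> (\<forall>i<n. y i \<in> T)}"

lemma NI_gens: "T \<subseteq> carrier F \<Longrightarrow> {delta x y |x y. (\<forall>i<n. x i \<in> T) \<and> (\<forall>i<n. y i \<in> T)} \<subseteq> carrier R"
  using delta_closed by blast

lemma NI_ideal: "T \<subseteq> carrier F \<Longrightarrow> ideal (NI T) R"
  unfolding NI_def by (intro RC.genideal_ideal NI_gens)

lemma NI_mem: "\<lbrakk> T \<subseteq> carrier F; \<forall>i<n. x i \<in> T; \<forall>i<n. y i \<in> T \<rbrakk> \<Longrightarrow> delta x y \<in> NI T"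
  unfolding NI_def by (rule subsetD[OF RC.genideal_self[OF NI_gens]]) auto

lemma NI_min:
  assumes "ideal I R" "\<And>x y. \<lbrakk> \<forall>i<n. x i \<in> T; \<forall>i<n. y i \<in> T \<rbrakk> \<Longrightarrow> delta x y \<in> I"
  shows "NI T \<subseteq> I"
  unfolding NI_def using assms by (intro RC.genideal_minimal) auto

lemma NI_mono: "\<lbrakk> T \<subseteq> T'; T' \<subseteq> carrier F \<rbrakk> \<Longrightarrow> NI T \<subseteq> NI T'"
  by (intro NI_min NI_ideal NI_mem) auto

lemma norm_ideal_eq: "T \<subseteq> carrier F \<Longrightarrow> norm_ideal A F n T = NI T"
proof -
  assume T: "T \<subseteq> carrier F"
  have "norm_delta A F n x y = delta x y" if "\<forall>i<n. x i \<in> T" "\<forall>i<n. y i \<in> T" for x y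
    using that T by (intro norm_delta_eq) auto
  then have "{norm_delta A F n x y |x y. (\<forall>i<n. x i \<in> T) \<and> (\<forall>i<n. y i \<in> T)}
      = {delta x y |x y. (\<forall>i<n. x i \<in> T) \<and> (\<forall>i<n. y i \<in> T)}" by (intro Collect_cong) metis
  then show ?thesis unfolding norm_ideal_def NI_def by (rule arg_cong)
qed

abbreviation IF where "IF \<equiv> NI (carrier F)"
abbreviation IS where "IS \<equiv> NI (wd ` short)"

lemma short_carrier: "wd ` short \<subseteq> carrier F" by auto

sublocale ni: nested_ideals R IS IF
  by (intro nested_ideals.intro nested_ideals_axioms.intro RC.is_cring NI_ideal NI_mono short_carrier subset_refl)

abbreviation dw where "dw u v \<equiv> delta (wd \<circ> u) (wd \<circ> v)"

lemma word_tuple [simp]: "\<forall>i<n. u i \<in> words \<Longrightarrow> tuple (wd \<circ> u)"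
  by simp

lemma dw_IF: "\<lbrakk> \<forall>i<n. u i \<in> words; \<forall>i<n. v i \<in> words \<rbrakk> \<Longrightarrow> dw u v \<in> IF"
  by (intro NI_mem) simp_all

lemma dw_pw: "\<lbrakk> \<forall>i<n. u i \<in> words; \<forall>i<n. v i \<in> words \<rbrakk> \<Longrightarrow> dw u v \<in> ni.pw 1"
  using dw_IF RC.ideal_power_1[OF ni.K] by simp

lemma dw_sym: "\<lbrakk> \<forall>i<n. u i \<in> words; \<forall>i<n. v i \<in> words \<rbrakk> \<Longrightarrow> dw u v = dw v u"
  by (intro delta_sym word_tuple)

text \<open>If some word is long, then one of the lengths \<open>0, \<dots>, n - 1\<close> is not attained. Splitting a prefix
  of that length off the long word writes the square of the norm as a sum of products in each of
  which one factor involves shorter words.\<close>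

lemma dw_Rad_left:
  assumes v: "\<forall>i<n. v i \<in> words"
    and sh: "\<And>u. \<forall>i<n. u i \<in> short \<Longrightarrow> ni.Rad 1 (dw u v)"
    and u: "\<forall>i<n. u i \<in> words"
  shows "ni.Rad 1 (dw u v)"
  using u
proof (induction "\<Sum>i<n. length (u i)" arbitrary: u rule: less_induct)
  case less
  note u = less.prems
  show ?case
  proof (cases "\<forall>i<n. u i \<in> short")
    case False
    then obtain k where k: "k < n" "n \<le> length (u k)" using u by force
    \<comment> \<open>Slot k has length at least n, so only n - 1 slots are left to attain the n
      values 0, ..., n - 1.\<close>
    have "\<exists>e<n. \<forall>i<n. length (u i) \<noteq> e"
    proof (rule ccontr)
      assume "\<not> ?thesis"
      then have "{..<n} \<subseteq> (length \<circ> u) ` ({..<n} - {k})" using k by (force simp: image_iff)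
      then have "card {..<n} \<le> card ((length \<circ> u) ` ({..<n} - {k}))" by (intro card_mono) simp_all
      also have "\<dots> \<le> card ({..<n} - {k})" by (intro card_image_le) simp
      finally show False using k by simp
    qed
    then obtain e where e: "e < n" "\<And>i. i < n \<Longrightarrow> length (u i) \<noteq> e" by blast
    define p q where "p = take e (u k)" and "q = drop e (u k)"
    have pq: "u k = p @ q" by (simp add: p_def q_def)
    have W: "p \<in> words" "q \<in> words" using u k(1) pq words_append by metis+
    have lp: "length p = e" "length p + length q = length (u k)" using e(1) k by (simp_all add: p_def q_def)
    have upd: "(wd \<circ> u)(i := wd w) = wd \<circ> u(i := w)" for i w by auto
    have sum_upd: "(\<Sum>j<n. length ((u(i := w)) j)) < (\<Sum>j<n. length (u j))" if "i < n" "length w < length (u i)" for i w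
      using that by (intro sum_strict_mono_ex1) auto
    have IH: "ni.Rad 1 (dw (u(i := w)) v)" if "i < n" "length w < length (u i)" "w \<in> words" for i w
      using that u by (intro less.hyps sum_upd) simp_all
    have "dw u v \<otimes>\<^bsub>R\<^esub> dw u v = delta ((wd \<circ> u)(k := wd q \<otimes>\<^bsub>F\<^esub> wd p)) (wd \<circ> v) \<otimes>\<^bsub>R\<^esub> dw u v"
    proof -
      have "wd q \<otimes>\<^bsub>F\<^esub> wd p = wd (u k)" using W by (simp add: pq wd_append FC.m_comm)
      then show ?thesis by (simp add: upd)
    qed
    also have "\<dots> = (\<Oplus>\<^bsub>R\<^esub>i\<in>{..<n}. delta ((wd \<circ> u)(k := wd q \<otimes>\<^bsub>F\<^esub> (wd \<circ> u) i)) (wd \<circ> v)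
        \<otimes>\<^bsub>R\<^esub> delta ((wd \<circ> u)(i := wd p)) (wd \<circ> v))"
      by (intro delta_cramer word_tuple u v k(1) wd_closed W)
    also have "ni.Rad (1 + 1) \<dots>"
    proof (rule ni.Rad_finsum)
      fix i assume "i \<in> {..<n}"
      then have i: "i < n" by simp
      have w: "q @ u i \<in> words" using W u i by simp
      have 1: "delta ((wd \<circ> u)(k := wd q \<otimes>\<^bsub>F\<^esub> (wd \<circ> u) i)) (wd \<circ> v) = dw (u(k := q @ u i)) v"
        using W u i by (simp add: wd_append flip: upd)
      have 2: "delta ((wd \<circ> u)(i := wd p)) (wd \<circ> v) = dw (u(i := p)) v" by (simp only: upd)
      have pw: "dw (u(k := q @ u i)) v \<in> ni.pw 1" "dw (u(i := p)) v \<in> ni.pw 1"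
        using w W u v by (intro dw_pw; simp)+
      \<comment> \<open>If \<open>u i\<close> is longer than e, replacing it by p shortens it. If it
        is shorter, \<open>q @ u i\<close> is shorter than \<open>u k\<close>, which is
        \<open>p @ q\<close>. Equality is excluded by the choice of e.\<close>
      consider "e < length (u i)" | "length (u i) < e" using e(2)[OF i] by linarith
      then show "ni.Rad (1 + 1) (delta ((wd \<circ> u)(k := wd q \<otimes>\<^bsub>F\<^esub> (wd \<circ> u) i)) (wd \<circ> v)
          \<otimes>\<^bsub>R\<^esub> delta ((wd \<circ> u)(i := wd p)) (wd \<circ> v))"
        unfolding 1 2
      proof cases
        assume "e < length (u i)"
        then have "ni.Rad 1 (dw (u(i := p)) v)" using i W lp by (intro IH) simp_all
        from ni.Rad_mult[OF this pw(1)]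
        show "ni.Rad (1 + 1) (dw (u(k := q @ u i)) v \<otimes>\<^bsub>R\<^esub> dw (u(i := p)) v)"
          using RC.m_comm[OF RC.idealD(6)[OF ni.pw_ideal pw(1)] RC.idealD(6)[OF ni.pw_ideal pw(2)]] by simp
      next
        assume "length (u i) < e"
        then have "ni.Rad 1 (dw (u(k := q @ u i)) v)" using k w lp by (intro IH) simp_all
        from ni.Rad_mult[OF this pw(2)]
        show "ni.Rad (1 + 1) (dw (u(k := q @ u i)) v \<otimes>\<^bsub>R\<^esub> dw (u(i := p)) v)" .
      qed
    qed simp
    finally show ?thesis by (rule ni.Rad_sqrt[OF dw_pw[OF u v]])
  qed (rule sh)
qed

text \<open>\<open>dw_Rad_left\<close> shortens one tuple while the other is kept. It is applied
  twice, with the symmetry of the norm in between, until both tuples are short and the norm lies in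
  \<open>IS\<close>.\<close>

lemma dw_Rad:
  assumes u: "\<forall>i<n. u i \<in> words" and v: "\<forall>i<n. v i \<in> words"
  shows "ni.Rad 1 (dw u v)"
proof (rule dw_Rad_left[OF v _ u])
  fix u assume u: "\<forall>i<n. u i \<in> short"
  then have uw: "\<forall>i<n. u i \<in> words" by simp
  have "ni.Rad 1 (dw v u)"
  proof (rule dw_Rad_left[OF uw _ v])
    fix v assume v: "\<forall>i<n. v i \<in> short"
    have "dw v u \<in> IS" using u v by (intro NI_mem short_carrier) auto
    then show "ni.Rad 1 (dw v u)" by (rule ni.Rad_J)
  qed
  then show "ni.Rad 1 (dw u v)" using dw_sym[OF uw v] by simp
qed

text \<open>A word longer than \<open>r * n\<close> repeats one of the r letters at least n times,
  which is what Cayley-Hamilton needs in order to shorten it.\<close>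

abbreviation bounded where "bounded \<equiv> {w \<in> words. length w \<le> r * n}"

definition gens where
  "gens = (\<lambda>(u, v). dw u v) ` (PiE {..<n} (\<lambda>_. bounded) \<times> PiE {..<n} (\<lambda>_. bounded))"

lemma finite_gens: "finite gens"
proof -
  have "finite bounded" using finite_lists_length_le[of "{..<r}" "r * n"] by (simp add: words_def)
  then show ?thesis unfolding gens_def by (intro finite_imageI finite_cartesian_product finite_PiE) simp_all
qed

lemma dw_gens:
  assumes "\<forall>i<n. u i \<in> bounded" "\<forall>i<n. v i \<in> bounded" shows "dw u v \<in> gens"
proof -
  have "dw u v = dw (restrict u {..<n}) (restrict v {..<n})"
    using assms by (intro delta_cong) simp_all
  moreover have "(restrict u {..<n}, restrict v {..<n}) \<in> PiE {..<n} (\<lambda>_. bounded) \<times> PiE {..<n} (\<lambda>_. bounded)"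
    using assms by (simp add: restrict_PiE_iff)
  ultimately show ?thesis unfolding gens_def by (metis (no_types, lifting) case_prod_conv image_eqI)
qed

lemma gensE:
  assumes "g \<in> gens"
  obtains u v where "\<forall>i<n. u i \<in> words" "\<forall>i<n. v i \<in> words" "g = dw u v"
  using assms unfolding gens_def by (auto simp: PiE_iff)

text \<open>Induction on the total length. Collecting n copies of the repeated letter writes the
  long word as t_i^n c; the same slot with a lower power of t_i has smaller total length, and
  \<open>delta_power_in_ideal\<close> concludes.\<close>

lemma dw_bounded_left:
  assumes I: "ideal I R" and y: "tuple y"
    and b: "\<And>u. \<forall>i<n. u i \<in> bounded \<Longrightarrow> delta (wd \<circ> u) y \<in> I"
    and u: "\<forall>i<n. u i \<in> words"
  shows "delta (wd \<circ> u) y \<in> I"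
  using u
proof (induction "\<Sum>i<n. length (u i)" arbitrary: u rule: less_induct)
  case less
  note u = less.prems
  show ?case
  proof (cases "\<forall>i<n. u i \<in> bounded")
    case False
    then obtain k where k: "k < n" "r * n < length (u k)" using u by force
    then have uk: "u k \<in> words" using u by blast
    obtain i where i: "i < r" "n \<le> count_list (u k) i"
      using count_list_pigeonhole[of "{..<r}" "u k" n] k uk by (auto simp: words_def)
    have "\<exists>c. set c \<subseteq> set (u k) \<and> length c + n = length (u k) \<and> wd (u k) = wd (replicate n i) \<otimes>\<^bsub>F\<^esub> wd c"
      by (rule FC.prl_power[OF _ i(2)]) (rule t_closed[OF uk])
    then obtain c where c: "set c \<subseteq> set (u k)" "length c + n = length (u k)"
      "wd (u k) = wd (replicate n i) \<otimes>\<^bsub>F\<^esub> wd c" by blast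
    have ti: "t i \<in> carrier F" using i t by auto
    have cw: "c \<in> words" using c(1) uk by (auto simp: words_def)
    have rw: "replicate m i \<in> words" for m using i by (auto simp: words_def)
    have upd: "(wd \<circ> u)(k := wd w) = wd \<circ> u(k := w)" for w by auto
    have pow: "t i [^]\<^bsub>F\<^esub> m \<otimes>\<^bsub>F\<^esub> wd c = wd (replicate m i @ c)" for m
      using wd_append[OF rw cw, of m] FC.prl_replicate[of t i m] ti by simp
    have "delta ((wd \<circ> u)(k := t i [^]\<^bsub>F\<^esub> n \<otimes>\<^bsub>F\<^esub> wd c)) y \<in> I"
    proof (rule delta_power_in_ideal[OF I word_tuple[OF u] y k(1) ti wd_closed[OF cw]])
      fix m assume m: "m < n"
      show "delta ((wd \<circ> u)(k := t i [^]\<^bsub>F\<^esub> m \<otimes>\<^bsub>F\<^esub> wd c)) y \<in> I"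
        unfolding pow upd
      proof (rule less.hyps)
        show "(\<Sum>j<n. length ((u(k := replicate m i @ c)) j)) < (\<Sum>j<n. length (u j))"
          using k m c(2) by (intro sum_strict_mono_ex1) auto
        show "\<forall>j<n. (u(k := replicate m i @ c)) j \<in> words" using u rw cw by simp
      qed
    qed
    moreover have "t i [^]\<^bsub>F\<^esub> n \<otimes>\<^bsub>F\<^esub> wd c = wd (u k)" using c(3) FC.prl_replicate[of t i n] ti by simp
    ultimately show ?thesis by (simp add: upd)
  qed (rule b)
qed

lemma gens_IF: "gens \<subseteq> IF"
  by (auto elim!: gensE intro: dw_IF)

lemma IF_generated: "IF \<subseteq> genideal R gens"
proof -
  have G: "gens \<subseteq> carrier R" using gens_IF RC.idealD(1)[OF ni.K] by (rule subset_trans)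
  note I = RC.genideal_ideal[OF G]
  have dwI: "dw u v \<in> genideal R gens" if u: "\<forall>i<n. u i \<in> words" and v: "\<forall>i<n. v i \<in> words" for u v
  proof (rule dw_bounded_left[OF I word_tuple[OF v] _ u])
    fix u assume u: "\<forall>i<n. u i \<in> bounded"
    then have uw: "\<forall>i<n. u i \<in> words" by simp
    have "dw v u \<in> genideal R gens"
      using RC.genideal_self[OF G] dw_gens[OF _ u] by (intro dw_bounded_left[OF I word_tuple[OF uw] _ v]) blast
    then show "dw u v \<in> genideal R gens" using dw_sym[OF uw v] by simp
  qed
  show ?thesis
  proof (rule NI_min[OF I])
    fix x y assume x: "tuple x" and y: "tuple y"
    show "delta x y \<in> genideal R gens" by (rule delta_words[OF I _ x y]) (rule dwI)
  qed
qed

lemma gens_Rad: "g \<in> gens \<Longrightarrow> ni.Rad 1 g"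
proof -
  assume "g \<in> gens"
  then obtain u v where "\<forall>i<n. u i \<in> words" "\<forall>i<n. v i \<in> words" "g = dw u v" by (rule gensE)
  then show ?thesis by (simp only: dw_Rad)
qed

lemmas prime_contains_norms = ni.prime_contains[OF finite_gens gens_IF IF_generated gens_Rad]

section \<open>Saturation\<close>

context
  fixes V v w
  assumes V: "V \<subseteq> carrier F" "\<And>u. \<lbrakk> u \<in> words; length u \<le> n \<rbrakk> \<Longrightarrow> wd u \<in> V"
    and v: "\<forall>i<n. v i \<in> short" and w: "\<forall>i<n. w i \<in> short"
begin

abbreviation pivot where "pivot \<equiv> dw v w"

text \<open>The g that become fractions of degree d over the Rees algebra of \<open>NI V\<close>
  when \<open>pivot\<close>, in degree 1, is inverted: g is the quotient of pivot^N g by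
  pivot^N.\<close>

definition Sat where "Sat d = {g \<in> carrier R. \<exists>N::nat. pivot [^]\<^bsub>R\<^esub> N \<otimes>\<^bsub>R\<^esub> g \<in> ideal_power R (NI V) (N + d)}"

lemma IV: "ideal (NI V) R" by (rule NI_ideal[OF V(1)])

lemmas pV_ideal = RC.ideal_power_ideal[OF IV]

lemma vw: "\<forall>i<n. v i \<in> words" "\<forall>i<n. w i \<in> words" "tuple (wd \<circ> v)" "tuple (wd \<circ> w)"
  using v w by auto

lemma pivot_closed: "pivot \<in> carrier R" by (intro delta_closed vw)

lemma pivot_IV: "pivot \<in> ideal_power R (NI V) 1"
  unfolding RC.ideal_power_1[OF IV] using v w by (intro NI_mem V) (auto intro!: V(2))

lemma pivot_pow: "pivot [^]\<^bsub>R\<^esub> N \<in> ideal_power R (NI V) N" for N :: nat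
  using RC.ideal_power_pow[OF IV pivot_IV, of N] by simp

lemma Sat_more:
  fixes N N' :: nat
  assumes g: "g \<in> carrier R" and "pivot [^]\<^bsub>R\<^esub> N \<otimes>\<^bsub>R\<^esub> g \<in> ideal_power R (NI V) (N + d)" "N \<le> N'"
  shows "pivot [^]\<^bsub>R\<^esub> N' \<otimes>\<^bsub>R\<^esub> g \<in> ideal_power R (NI V) (N' + d)"
proof -
  have "pivot [^]\<^bsub>R\<^esub> (N' - N) \<otimes>\<^bsub>R\<^esub> (pivot [^]\<^bsub>R\<^esub> N \<otimes>\<^bsub>R\<^esub> g) \<in> ideal_power R (NI V) (N' - N + (N + d))"
    by (intro RC.ideal_power_mult IV pivot_pow assms)
  moreover have "pivot [^]\<^bsub>R\<^esub> (N' - N) \<otimes>\<^bsub>R\<^esub> (pivot [^]\<^bsub>R\<^esub> N \<otimes>\<^bsub>R\<^esub> g) = pivot [^]\<^bsub>R\<^esub> N' \<otimes>\<^bsub>R\<^esub> g"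
    using assms(3) by (simp only: RC.m_assoc[symmetric] RC.nat_pow_closed pivot_closed g RC.nat_pow_mult le_add_diff_inverse2)
  ultimately show ?thesis using assms(3) by simp
qed

lemma Sat_power: "g \<in> ideal_power R (NI V) d \<Longrightarrow> g \<in> Sat d"
proof -
  assume g: "g \<in> ideal_power R (NI V) d"
  have gR: "g \<in> carrier R" by (rule RC.idealD(6)[OF pV_ideal g])
  have "pivot [^]\<^bsub>R\<^esub> (0::nat) \<otimes>\<^bsub>R\<^esub> g = g" by (simp only: RC.nat_pow_0 RC.l_one[OF gR])
  then show ?thesis unfolding Sat_def using g gR by (metis (mono_tags, lifting) add_0 mem_Collect_eq)
qed

lemma Sat_ideal: "ideal (Sat d) R"
proof (rule RC.idealI')
  show "Sat d \<subseteq> carrier R" by (auto simp: Sat_def)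
  show "\<zero>\<^bsub>R\<^esub> \<in> Sat d" by (rule Sat_power[OF RC.idealD(2)[OF pV_ideal]])
  fix a assume a: "a \<in> Sat d"
  then obtain N :: nat where aR: "a \<in> carrier R" and N: "pivot [^]\<^bsub>R\<^esub> N \<otimes>\<^bsub>R\<^esub> a \<in> ideal_power R (NI V) (N + d)"
    by (auto simp: Sat_def)
  show "x \<otimes>\<^bsub>R\<^esub> a \<in> Sat d" if x: "x \<in> carrier R" for x
  proof -
    have "pivot [^]\<^bsub>R\<^esub> N \<otimes>\<^bsub>R\<^esub> (x \<otimes>\<^bsub>R\<^esub> a) = x \<otimes>\<^bsub>R\<^esub> (pivot [^]\<^bsub>R\<^esub> N \<otimes>\<^bsub>R\<^esub> a)"
      by (intro RC.m_lcomm RC.nat_pow_closed pivot_closed x aR)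
    then have "pivot [^]\<^bsub>R\<^esub> N \<otimes>\<^bsub>R\<^esub> (x \<otimes>\<^bsub>R\<^esub> a) \<in> ideal_power R (NI V) (N + d)"
      using RC.idealD(4)[OF pV_ideal x N] by (simp only:)
    then show ?thesis unfolding Sat_def using RC.m_closed[OF x aR] by blast
  qed
  show "a \<oplus>\<^bsub>R\<^esub> b \<in> Sat d" if b: "b \<in> Sat d" for b
  proof -
    obtain M :: nat where bR: "b \<in> carrier R" and M: "pivot [^]\<^bsub>R\<^esub> M \<otimes>\<^bsub>R\<^esub> b \<in> ideal_power R (NI V) (M + d)"
      using b by (auto simp: Sat_def)
    have "pivot [^]\<^bsub>R\<^esub> (N + M) \<otimes>\<^bsub>R\<^esub> (a \<oplus>\<^bsub>R\<^esub> b) = pivot [^]\<^bsub>R\<^esub> (N + M) \<otimes>\<^bsub>R\<^esub> a \<oplus>\<^bsub>R\<^esub> pivot [^]\<^bsub>R\<^esub> (N + M) \<otimes>\<^bsub>R\<^esub> b"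
      by (intro RC.r_distr RC.nat_pow_closed pivot_closed aR bR)
    also have "\<dots> \<in> ideal_power R (NI V) (N + M + d)"
      by (intro RC.idealD(3)[OF pV_ideal] Sat_more[OF aR N] Sat_more[OF bR M]) simp_all
    finally show ?thesis unfolding Sat_def using RC.a_closed[OF aR bR] by blast
  qed
qed

lemma Sat_mult: "\<lbrakk> a \<in> Sat d; b \<in> Sat e \<rbrakk> \<Longrightarrow> a \<otimes>\<^bsub>R\<^esub> b \<in> Sat (d + e)"
proof -
  assume a: "a \<in> Sat d" and b: "b \<in> Sat e"
  then obtain N M :: nat where R: "a \<in> carrier R" "b \<in> carrier R"
    and NM: "pivot [^]\<^bsub>R\<^esub> N \<otimes>\<^bsub>R\<^esub> a \<in> ideal_power R (NI V) (N + d)" "pivot [^]\<^bsub>R\<^esub> M \<otimes>\<^bsub>R\<^esub> b \<in> ideal_power R (NI V) (M + e)"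
    by (auto simp: Sat_def)
  have p: "pivot [^]\<^bsub>R\<^esub> k \<in> carrier R" for k :: nat by (rule RC.nat_pow_closed[OF pivot_closed])
  have "pivot [^]\<^bsub>R\<^esub> (N + M) \<otimes>\<^bsub>R\<^esub> (a \<otimes>\<^bsub>R\<^esub> b) = (pivot [^]\<^bsub>R\<^esub> N \<otimes>\<^bsub>R\<^esub> a) \<otimes>\<^bsub>R\<^esub> (pivot [^]\<^bsub>R\<^esub> M \<otimes>\<^bsub>R\<^esub> b)"
    unfolding RC.nat_pow_mult[OF pivot_closed, symmetric] using p[of N] p[of M] R
    by (simp only: RC.m_ac RC.m_closed)
  also have "\<dots> \<in> ideal_power R (NI V) (N + d + (M + e))" by (rule RC.ideal_power_mult[OF IV NM])
  also have "N + d + (M + e) = N + M + (d + e)" by simp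
  finally show ?thesis unfolding Sat_def using RC.m_closed[OF R] by blast
qed

text \<open>The extra factor \<open>pivot\<close> joins the power, which raises N by one and
  accounts for the drop in degree from 2 to 1.\<close>

lemma Sat_cancel: "\<lbrakk> g \<in> carrier R; pivot \<otimes>\<^bsub>R\<^esub> g \<in> Sat (1 + 1) \<rbrakk> \<Longrightarrow> g \<in> Sat 1"
proof -
  assume g: "g \<in> carrier R" and "pivot \<otimes>\<^bsub>R\<^esub> g \<in> Sat (1 + 1)"
  then obtain N :: nat where N: "pivot [^]\<^bsub>R\<^esub> N \<otimes>\<^bsub>R\<^esub> (pivot \<otimes>\<^bsub>R\<^esub> g) \<in> ideal_power R (NI V) (N + (1 + 1))"
    by (auto simp: Sat_def)
  have "pivot [^]\<^bsub>R\<^esub> N \<otimes>\<^bsub>R\<^esub> (pivot \<otimes>\<^bsub>R\<^esub> g) = pivot [^]\<^bsub>R\<^esub> Suc N \<otimes>\<^bsub>R\<^esub> g"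
    unfolding RC.nat_pow_Suc by (intro RC.m_assoc[symmetric] RC.nat_pow_closed pivot_closed g)
  then have "pivot [^]\<^bsub>R\<^esub> Suc N \<otimes>\<^bsub>R\<^esub> g \<in> ideal_power R (NI V) (Suc N + 1)" using N by simp
  then show ?thesis unfolding Sat_def using g by blast
qed

lemma Sat_V: "\<lbrakk> \<forall>i<n. x i \<in> V; \<forall>i<n. y i \<in> V \<rbrakk> \<Longrightarrow> delta x y \<in> Sat 1"
  by (intro Sat_power) (simp only: RC.ideal_power_1[OF IV] NI_mem[OF V(1)])

lemma short_V: "\<forall>i<n. (wd \<circ> v) i \<in> V" "\<forall>i<n. (wd \<circ> w) i \<in> V"
  using v w V(2) by auto

text \<open>Induction on the word, splitting off its first letter t_j. Cramer's rule produces
  factors with t_j v_l in slot i; the word v_l is short, so t_j v_l has degree at most n and the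
  factor lies in \<open>NI V\<close>. The other factor is covered by induction, and
  \<open>Sat_cancel\<close> removes the pivot.\<close>

lemma Sat_slot_word: "u \<in> words \<Longrightarrow> \<forall>i<n. delta ((wd \<circ> v)(i := wd u)) (wd \<circ> w) \<in> Sat 1"
proof (induction u)
  case Nil
  have "wd [] \<in> V" by (rule V(2)) (simp_all add: words_def)
  then show ?case using short_V by (intro allI impI Sat_V) simp_all
next
  case (Cons j u)
  have uw: "u \<in> words" and j: "j < r" using Cons.prems by (auto simp: words_def)
  have tj: "t j \<in> carrier F" using t j by auto
  show ?case
  proof (intro allI impI Sat_cancel)
    fix i assume i: "i < n"
    show d: "delta ((wd \<circ> v)(i := wd (j # u))) (wd \<circ> w) \<in> carrier R"
      using vw Cons.prems wd_closed[OF Cons.prems] by (intro delta_closed) (simp_all del: prl_simps)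
    have "pivot \<otimes>\<^bsub>R\<^esub> delta ((wd \<circ> v)(i := wd (j # u))) (wd \<circ> w) = delta ((wd \<circ> v)(i := t j \<otimes>\<^bsub>F\<^esub> wd u)) (wd \<circ> w) \<otimes>\<^bsub>R\<^esub> pivot"
      using RC.m_comm[OF pivot_closed d] by simp
    also have "\<dots> = (\<Oplus>\<^bsub>R\<^esub>l\<in>{..<n}. delta ((wd \<circ> v)(i := t j \<otimes>\<^bsub>F\<^esub> (wd \<circ> v) l)) (wd \<circ> w)
        \<otimes>\<^bsub>R\<^esub> delta ((wd \<circ> v)(l := wd u)) (wd \<circ> w))"
      by (intro delta_cramer vw i tj wd_closed uw)
    also have "\<dots> \<in> Sat (1 + 1)"
    proof (rule RC.finsum_ideal[OF Sat_ideal])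
      fix l assume "l \<in> {..<n}"
      then have l: "l < n" by simp
      have "wd (j # v l) \<in> V" using v l j by (intro V(2)) (auto simp: words_def Suc_le_eq)
      then have "delta ((wd \<circ> v)(i := t j \<otimes>\<^bsub>F\<^esub> (wd \<circ> v) l)) (wd \<circ> w) \<in> Sat 1"
        using short_V by (intro Sat_V) simp_all
      then show "delta ((wd \<circ> v)(i := t j \<otimes>\<^bsub>F\<^esub> (wd \<circ> v) l)) (wd \<circ> w)
        \<otimes>\<^bsub>R\<^esub> delta ((wd \<circ> v)(l := wd u)) (wd \<circ> w) \<in> Sat (1 + 1)"
        using Cons.IH[OF uw, THEN spec[of _ l]] l by (intro Sat_mult) (simp_all only:)
    qed simp
    finally show "pivot \<otimes>\<^bsub>R\<^esub> delta ((wd \<circ> v)(i := wd (j # u))) (wd \<circ> w) \<in> Sat (1 + 1)" .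
  qed
qed

lemma Sat_slot: "\<lbrakk> i < n; z \<in> carrier F \<rbrakk> \<Longrightarrow> delta ((wd \<circ> v)(i := z)) (wd \<circ> w) \<in> Sat 1"
proof -
  assume i: "i < n" and z: "z \<in> carrier F"
  have "carrier F \<subseteq> {z \<in> carrier F. delta ((wd \<circ> v)(i := z)) (wd \<circ> w) \<in> Sat 1}"
    using Sat_slot_word i unfolding span_words
    by (intro lin_span_minimal slot_submodule[unfolded span_words] Sat_ideal) (auto simp flip: span_words simp: vw)
  then show ?thesis using z by blast
qed

text \<open>Cramer's rule against \<open>pivot\<close> with q = 1 exchanges an arbitrary entry of x
  for the short monomials of v. The other factors have a single arbitrary slot and are covered by
  \<open>Sat_slot\<close>.\<close>

lemma Sat_delta_left:
  assumes y: "tuple y" and b: "\<And>x. \<forall>i<n. x i \<in> wd ` short \<Longrightarrow> delta x y \<in> Sat 1" and x: "tuple x"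
  shows "delta x y \<in> Sat 1"
proof (rule tuple_induct[where Q = "\<lambda>x. delta x y \<in> Sat 1", OF short_carrier x b])
  fix x k assume x: "tuple x" and k: "k < n" and IH: "\<And>z. z \<in> wd ` short \<Longrightarrow> delta (x(k := z)) y \<in> Sat 1"
  have xk: "x k \<in> carrier F" using x k by blast
  show "delta x y \<in> Sat 1"
  proof (rule Sat_cancel)
    show d: "delta x y \<in> carrier R" by (intro delta_closed x y)
    have "pivot \<otimes>\<^bsub>R\<^esub> delta x y = delta (x(k := \<one>\<^bsub>F\<^esub> \<otimes>\<^bsub>F\<^esub> x k)) y \<otimes>\<^bsub>R\<^esub> pivot"
      using RC.m_comm[OF pivot_closed d] xk by simp
    also have "\<dots> = (\<Oplus>\<^bsub>R\<^esub>i\<in>{..<n}. delta (x(k := \<one>\<^bsub>F\<^esub> \<otimes>\<^bsub>F\<^esub> (wd \<circ> v) i)) y \<otimes>\<^bsub>R\<^esub> delta ((wd \<circ> v)(i := x k)) (wd \<circ> w))"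
      by (intro delta_cramer x k y vw xk FC.one_closed)
    also have "\<dots> \<in> Sat (1 + 1)"
    proof (rule RC.finsum_ideal[OF Sat_ideal])
      fix i assume "i \<in> {..<n}"
      then have i: "i < n" by simp
      have "delta (x(k := (wd \<circ> v) i)) y \<in> Sat 1" using v i by (intro IH) auto
      moreover have "\<one>\<^bsub>F\<^esub> \<otimes>\<^bsub>F\<^esub> (wd \<circ> v) i = (wd \<circ> v) i" using vw(3) i by (intro FC.l_one) blast
      ultimately show "delta (x(k := \<one>\<^bsub>F\<^esub> \<otimes>\<^bsub>F\<^esub> (wd \<circ> v) i)) y \<otimes>\<^bsub>R\<^esub> delta ((wd \<circ> v)(i := x k)) (wd \<circ> w) \<in> Sat (1 + 1)"
        using Sat_slot[OF i xk] by (intro Sat_mult) (simp only:)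
    qed simp
    finally show "pivot \<otimes>\<^bsub>R\<^esub> delta x y \<in> Sat (1 + 1)" .
  qed
qed

lemma IF_Sat: "IF \<subseteq> Sat 1"
proof (rule NI_min[OF Sat_ideal])
  have sV: "wd ` short \<subseteq> V" using V(2) by auto
  fix x y assume x: "tuple x" and y: "tuple y"
  show "delta x y \<in> Sat 1"
  proof (rule Sat_delta_left[OF y _ x])
    fix x assume x: "\<forall>i<n. x i \<in> wd ` short"
    then have xt: "tuple x" using short_carrier by blast
    have "delta y x \<in> Sat 1"
      using x sV by (intro Sat_delta_left[OF xt _ y] Sat_V) blast+
    then show "delta x y \<in> Sat 1" using delta_sym[OF xt y] by simp
  qed
qed

lemma pw_Sat: "ni.pw m \<subseteq> Sat m"
proof (induction m)
  case 0
  show ?case using Sat_power[of _ 0] by auto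
next
  case (Suc m)
  have "i \<otimes>\<^bsub>R\<^esub> j \<in> Sat (Suc m)" if "i \<in> IF" "j \<in> ni.pw m" for i j
    using Sat_mult[of i 1 j m] that IF_Sat Suc by auto
  from RC.ideal_prod_closed[OF Sat_ideal this] show ?case unfolding ideal_power.simps(2) by blast
qed

text \<open>The exponent can always be enlarged, so finitely many elements can later share
  one.\<close>

theorem saturated_power:
  assumes "g \<in> ni.pw d"
  shows "\<exists>N::nat. \<forall>M\<ge>N. pivot [^]\<^bsub>R\<^esub> M \<otimes>\<^bsub>R\<^esub> g \<in> ideal_power R (NI V) (M + d)"
proof -
  have "g \<in> Sat d" using pw_Sat assms by blast
  then show ?thesis unfolding Sat_def using Sat_more by blast
qed

end

section \<open>The span of the monomials of bounded degree\<close>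

lemma wd_finprod: "w \<in> words \<Longrightarrow> wd w = finprod F (\<lambda>i. t i [^]\<^bsub>F\<^esub> count_list w i) {..<r}"
proof (induction w)
  case Nil
  then show ?case using t by (simp add: FC.finprod_one_eqI)
next
  case (Cons j w)
  have j: "j < r" and w: "w \<in> words" using Cons.prems by (auto simp: words_def)
  have ti: "t i \<in> carrier F" if "i < r" for i using that t by auto
  have "finprod F (\<lambda>i. t i [^]\<^bsub>F\<^esub> count_list (j # w) i) {..<r}
      = finprod F (\<lambda>i. (if j = i then t i else \<one>\<^bsub>F\<^esub>) \<otimes>\<^bsub>F\<^esub> t i [^]\<^bsub>F\<^esub> count_list w i) {..<r}"
    using ti by (intro FC.finprod_cong2) (simp_all add: FC.m_comm)
  also have "\<dots> = finprod F (\<lambda>i. if j = i then t i else \<one>\<^bsub>F\<^esub>) {..<r} \<otimes>\<^bsub>F\<^esub> finprod F (\<lambda>i. t i [^]\<^bsub>F\<^esub> count_list w i) {..<r}"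
    using ti by (intro FC.finprod_multf) auto
  also have "finprod F (\<lambda>i. if j = i then t i else \<one>\<^bsub>F\<^esub>) {..<r} = t j"
    using ti j by (intro FC.finprod_singleton) auto
  finally show ?case using Cons.IH[OF w] by simp
qed

lemma monomial_span_props:
  "monomial_span A F r t d \<subseteq> carrier F" "\<lbrakk> u \<in> words; length u \<le> d \<rbrakk> \<Longrightarrow> wd u \<in> monomial_span A F r t d"
proof -
  let ?M = "{finprod F (\<lambda>i. t i [^]\<^bsub>F\<^esub> e i) {..<r} |e::nat \<Rightarrow> nat. sum e {..<r} \<le> d}"
  have ti: "t i \<in> carrier F" if "i < r" for i using that t by auto
  have "finprod F (\<lambda>i. t i [^]\<^bsub>F\<^esub> e i) {..<r} \<in> carrier F" for e :: "nat \<Rightarrow> nat"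
    using ti by (intro FC.finprod_in) simp
  then have "?M \<subseteq> carrier F" by blast
  then show "monomial_span A F r t d \<subseteq> carrier F"
    unfolding monomial_span_def using alg.submoduleE(1)[OF alg.lin_span_submodule] by blast
  show "wd u \<in> monomial_span A F r t d" if u: "u \<in> words" "length u \<le> d"
  proof -
    \<comment> \<open>The exponent vector of the monomial is given by the letter counts of the word,
      whose sum is the length.\<close>
    have "sum (count_list u) {..<r} = length u" using u by (intro sum_count_set) (simp_all add: words_def)
    then have "wd u \<in> ?M"
      unfolding wd_finprod[OF u(1)] using u(2) by (intro CollectI exI[of _ "count_list u"] conjI) simp_all
    then show ?thesis unfolding monomial_span_def by (rule subsetD[OF lin_span_superset])
  qed
qed

end

section \<open>Graded rings and Proj\<close>

lemma UN_pairs_const: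
  assumes "\<And>a f b g. \<lbrakk> (a, f) \<in> U; (b, g) \<in> V \<rbrakk> \<Longrightarrow> F a f b g = Z" "p \<in> U" "q \<in> V"
  shows "(\<Union>(a, f)\<in>U. \<Union>(b, g)\<in>V. F a f b g) = Z"
proof -
  have "(\<Union>(a, f)\<in>U. \<Union>(b, g)\<in>V. F a f b g) = (\<Union>r\<in>U. \<Union>r'\<in>V. Z)"
    by (intro SUP_cong refl) (auto simp: assms(1))
  then show ?thesis using assms(2,3) by auto
qed

text \<open>The projections \<open>cmp\<close> onto the components are part of the data. They turn
  homogeneity of an ideal into a condition on components and can be shared with a graded
  subring.\<close>

locale graded_cring = cring S for S (structure) +
  fixes G :: "nat \<Rightarrow> 'a set" and cmp :: "nat \<Rightarrow> 'a \<Rightarrow> 'a"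
  assumes comp_carrier: "G m \<subseteq> carrier S"
    and comp_one: "\<one> \<in> G 0"
    and comp_zero: "\<zero> \<in> G m"
    and comp_add: "\<lbrakk> a \<in> G m; b \<in> G m \<rbrakk> \<Longrightarrow> a \<oplus> b \<in> G m"
    and comp_mult: "\<lbrakk> a \<in> G m; b \<in> G k \<rbrakk> \<Longrightarrow> a \<otimes> b \<in> G (m + k)"
    and cmp_in: "a \<in> carrier S \<Longrightarrow> cmp m a \<in> G m"
    and cmp_id: "a \<in> G m \<Longrightarrow> cmp k a = (if k = m then a else \<zero>)"
    and cmp_add: "\<lbrakk> a \<in> carrier S; b \<in> carrier S \<rbrakk> \<Longrightarrow> cmp m (a \<oplus> b) = cmp m a \<oplus> cmp m b"
    and cmp_mult: "\<lbrakk> a \<in> carrier S; b \<in> carrier S \<rbrakk>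
      \<Longrightarrow> cmp m (a \<otimes> b) = (\<Oplus>i\<in>{..m}. cmp i a \<otimes> cmp (m - i) b)"
    and cmp_sum: "a \<in> carrier S \<Longrightarrow> \<exists>N. a = (\<Oplus>m\<in>{..N}. cmp m a)"
begin

lemma cmp_closed [simp]: "a \<in> carrier S \<Longrightarrow> cmp m a \<in> carrier S"
  using cmp_in comp_carrier by blast

lemma comp_closed: "a \<in> G m \<Longrightarrow> a \<in> carrier S"
  using comp_carrier by blast

lemma ideal_finsum:
  assumes "ideal P S" "finite I" "\<And>i. i \<in> I \<Longrightarrow> f i \<in> P"
  shows "finsum S f I \<in> P"
  using assms(2,3)
proof (induction I rule: finite_induct)
  case empty
  then show ?case by (simp add: additive_subgroup.zero_closed assms(1) ideal.axioms(1))
next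
  case (insert x F)
  interpret P: ideal P S by fact
  have "f \<in> F \<rightarrow> carrier S" "f x \<in> carrier S" using insert P.Icarr by auto
  then show ?case using insert by (simp add: P.a_closed)
qed

text \<open>The elements with all components in P form an ideal that contains the homogeneous
  elements of P; conversely every element is the sum of its components.\<close>

lemma homogeneous_ideal_iff:
  assumes P: "ideal P S"
  shows "P = genideal S (P \<inter> (\<Union>m. G m)) \<longleftrightarrow> (\<forall>a\<in>P. \<forall>m. cmp m a \<in> P)"
proof
  interpret P: ideal P S by fact
  let ?H = "{a \<in> carrier S. \<forall>m. cmp m a \<in> P}"
  have c0: "cmp m \<zero> = \<zero>" for m using cmp_id[OF comp_zero, of m m] by simp
  have "ideal ?H S"
  proof (rule idealI[OF ring_axioms])
    show "subgroup ?H (add_monoid S)"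
    proof
      fix x assume x: "x \<in> ?H"
      have "cmp m (\<ominus> x) = \<ominus> cmp m x" for m
      proof -
        have "cmp m x \<oplus> cmp m (\<ominus> x) = \<zero>"
          using x cmp_add[of x "\<ominus> x" m] by (simp add: r_neg c0)
        then show ?thesis using x by (metis (no_types, lifting) a_inv_closed cmp_closed mem_Collect_eq minus_equality minus_minus a_comm)
      qed
      then show "inv\<^bsub>add_monoid S\<^esub> x \<in> ?H" using x by (simp flip: a_inv_def)
    qed (auto simp: cmp_add c0)
    fix a x assume a: "a \<in> ?H" "x \<in> carrier S"
    then have "cmp m (x \<otimes> a) \<in> P" for m
      by (subst cmp_mult) (auto intro!: ideal_finsum[OF P] P.I_l_closed)
    then show "x \<otimes> a \<in> ?H" using a by auto
    then show "a \<otimes> x \<in> ?H" using a by (simp add: m_comm)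
  qed
  moreover have "P \<inter> (\<Union>m. G m) \<subseteq> ?H"
    using cmp_id by (auto simp: P.zero_closed dest: comp_closed)
  ultimately have "genideal S (P \<inter> (\<Union>m. G m)) \<subseteq> ?H"
    by (simp add: genideal_minimal)
  then show "P = genideal S (P \<inter> (\<Union>m. G m)) \<Longrightarrow> \<forall>a\<in>P. \<forall>m. cmp m a \<in> P" by blast
next
  interpret P: ideal P S by fact
  assume *: "\<forall>a\<in>P. \<forall>m. cmp m a \<in> P"
  have sub: "P \<inter> (\<Union>m. G m) \<subseteq> carrier S" using P.Icarr by auto
  have "P \<subseteq> genideal S (P \<inter> (\<Union>m. G m))"
  proof
    fix a assume a: "a \<in> P"
    then obtain N where N: "a = (\<Oplus>m\<in>{..N}. cmp m a)" using cmp_sum P.Icarr by blast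
    have "(\<Oplus>m\<in>{..N}. cmp m a) \<in> genideal S (P \<inter> (\<Union>m. G m))"
      using a * genideal_self[OF sub] cmp_in[OF P.Icarr[OF a]]
      by (intro ideal_finsum genideal_ideal sub) blast+
    then show "a \<in> genideal S (P \<inter> (\<Union>m. G m))" using N by simp
  qed
  moreover have "genideal S (P \<inter> (\<Union>m. G m)) \<subseteq> P"
    by (simp add: genideal_minimal P)
  ultimately show "P = genideal S (P \<inter> (\<Union>m. G m))" by blast
qed

lemma Proj_points_iff:
  "P \<in> Proj_points S G \<longleftrightarrow>
    primeideal P S \<and> (\<forall>a\<in>P. \<forall>m. cmp m a \<in> P) \<and> (\<exists>m>0. \<not> G m \<subseteq> P)"
  unfolding Proj_points_def
  using homogeneous_ideal_iff primeideal.axioms(1) by blast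

lemma topspace_Proj_top [simp]: "topspace (Proj_top S G) = Proj_points S G"
proof -
  have "\<exists>f m. 0 < m \<and> f \<in> G m \<and> f \<notin> P" if "P \<in> Proj_points S G" for P
    using that by (auto simp: Proj_points_def)
  then show ?thesis
    unfolding Proj_top_def topology_generated_by_topspace by blast
qed

lemma openin_basic: "\<lbrakk> 0 < m; f \<in> G m \<rbrakk> \<Longrightarrow> openin (Proj_top S G) {P \<in> Proj_points S G. f \<notin> P}"
  unfolding Proj_top_def by (rule topology_generated_by_Basis) blast

definition hfrac_ok where
  "hfrac_ok P a f \<longleftrightarrow> (\<exists>m. a \<in> G m \<and> f \<in> G m) \<and> f \<notin> P"

lemma prime_mult_notin:
  assumes "primeideal P S" "a \<in> carrier S" "b \<in> carrier S" "a \<notin> P" "b \<notin> P"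
  shows "a \<otimes> b \<notin> P"
  using primeideal.I_prime[OF assms(1-3)] assms(4,5) by blast

lemma prime_pow_notin:
  assumes "primeideal P S" "a \<in> carrier S" "a \<notin> P"
  shows "a [^] (n::nat) \<notin> P"
proof (induction n)
  case 0
  interpret primeideal P S by fact
  have "\<one> \<notin> P" using I_notcarr one_imp_carrier by blast
  then show ?case by simp
next
  case (Suc n)
  then show ?case using assms prime_mult_notin by simp
qed

lemma mem_hfrac:
  "(b, g) \<in> hfrac S G P a f \<longleftrightarrow> hfrac_ok P b g \<and>
    (\<exists>m. \<exists>h\<in>G m. h \<notin> P \<and> h \<otimes> (a \<otimes> g) = h \<otimes> (b \<otimes> f))"
  unfolding hfrac_def hfrac_ok_def by blast

lemma hfrac_ok_closed:
  assumes "hfrac_ok P a f" shows "a \<in> carrier S" "f \<in> carrier S" "f \<notin> P"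
  using assms comp_closed by (auto simp: hfrac_ok_def)

lemma hfrac_refl:
  assumes "primeideal P S" "hfrac_ok P a f"
  shows "(a, f) \<in> hfrac S G P a f"
  using assms(2) comp_one prime_pow_notin[OF assms(1) hfrac_ok_closed(2,3)[OF assms(2)], of 0]
  unfolding mem_hfrac by auto

lemma hfrac_sym:
  assumes "hfrac_ok P a f" "(b, g) \<in> hfrac S G P a f"
  shows "(a, f) \<in> hfrac S G P b g"
proof -
  obtain m h where "h \<in> G m" "h \<notin> P" "h \<otimes> (a \<otimes> g) = h \<otimes> (b \<otimes> f)"
    using assms(2) unfolding mem_hfrac by blast
  then show ?thesis unfolding mem_hfrac using assms(1) by (metis (no_types))
qed

lemma hfrac_trans:
  assumes P: "primeideal P S" and "hfrac_ok P a f" "(b, g) \<in> hfrac S G P a f" "(c, e) \<in> hfrac S G P b g"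
  shows "(c, e) \<in> hfrac S G P a f"
proof -
  obtain m h k j where h: "h \<in> G m" "h \<notin> P" "h \<otimes> (a \<otimes> g) = h \<otimes> (b \<otimes> f)"
    and k: "k \<in> G j" "k \<notin> P" "k \<otimes> (b \<otimes> e) = k \<otimes> (c \<otimes> g)"
    and ok: "hfrac_ok P b g" "hfrac_ok P c e"
    using assms unfolding mem_hfrac by blast
  note cl [simp] = hfrac_ok_closed(1,2)[OF assms(2)] hfrac_ok_closed(1,2)[OF ok(1)]
    hfrac_ok_closed(1,2)[OF ok(2)] comp_closed[OF h(1)] comp_closed[OF k(1)]
  obtain i where i: "g \<in> G i" using ok(1) hfrac_ok_def by auto
  \<comment> \<open>The denominator g of the middle fraction becomes part of the multiplier, because
    it cannot be cancelled in a ring with zero divisors. It lies outside P, as h and k do.\<close>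
  have "h \<otimes> k \<otimes> g \<otimes> (a \<otimes> e) = k \<otimes> e \<otimes> (h \<otimes> (a \<otimes> g))" by (simp add: m_ac)
  also have "\<dots> = h \<otimes> f \<otimes> (k \<otimes> (b \<otimes> e))" unfolding h(3) by (simp add: m_ac)
  also have "\<dots> = h \<otimes> k \<otimes> g \<otimes> (c \<otimes> f)" unfolding k(3) by (simp add: m_ac)
  finally have e: "h \<otimes> k \<otimes> g \<otimes> (a \<otimes> e) = h \<otimes> k \<otimes> g \<otimes> (c \<otimes> f)" .
  have "h \<otimes> k \<otimes> g \<in> G (m + j + i)" using h k i comp_mult by blast
  moreover have "h \<otimes> k \<otimes> g \<notin> P"
    using h k hfrac_ok_closed(3)[OF ok(1)] by (intro prime_mult_notin[OF P]) auto
  ultimately show ?thesis unfolding mem_hfrac using e ok(2) by (intro conjI exI bexI)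
qed

lemma hfrac_eqI:
  assumes P: "primeideal P S" and "hfrac_ok P a f" "(b, g) \<in> hfrac S G P a f"
  shows "hfrac S G P a f = hfrac S G P b g"
proof -
  have bg: "hfrac_ok P b g" using assms(3) mem_hfrac by blast
  have "(c, e) \<in> hfrac S G P a f \<longleftrightarrow> (c, e) \<in> hfrac S G P b g" for c e
    using hfrac_trans[OF P assms(2,3), of c e]
      hfrac_trans[OF P bg hfrac_sym[OF assms(2,3)], of c e] by blast
  then show ?thesis by (simp add: set_eq_iff split_paired_all)
qed

lemma hfrac_eq_iff:
  assumes P: "primeideal P S" and "hfrac_ok P a f" "hfrac_ok P b g"
  shows "hfrac S G P a f = hfrac S G P b g \<longleftrightarrow>
    (\<exists>m. \<exists>h\<in>G m. h \<notin> P \<and> h \<otimes> (a \<otimes> g) = h \<otimes> (b \<otimes> f))"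
proof -
  have "hfrac S G P a f = hfrac S G P b g \<longleftrightarrow> (b, g) \<in> hfrac S G P a f"
    using hfrac_eqI[OF P assms(2)] hfrac_refl[OF P assms(3)] by blast
  then show ?thesis using mem_hfrac assms(3) by blast
qed

lemma hfrac_ok_mult:
  assumes P: "primeideal P S" and "hfrac_ok P a f" "hfrac_ok P b g"
  shows "hfrac_ok P (a \<otimes> b) (f \<otimes> g)"
proof -
  obtain m k where "a \<in> G m" "f \<in> G m" "b \<in> G k" "g \<in> G k"
    using assms hfrac_ok_def by auto
  then have "a \<otimes> b \<in> G (m + k)" "f \<otimes> g \<in> G (m + k)" by (simp_all add: comp_mult)
  moreover have "f \<otimes> g \<notin> P"
    using assms(2,3) by (intro prime_mult_notin[OF P] hfrac_ok_closed)
  ultimately show ?thesis unfolding hfrac_ok_def by auto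
qed

lemma hfrac_ok_add:
  assumes P: "primeideal P S" and "hfrac_ok P a f" "hfrac_ok P b g"
  shows "hfrac_ok P (a \<otimes> g \<oplus> b \<otimes> f) (f \<otimes> g)"
proof -
  obtain m k where mk: "a \<in> G m" "f \<in> G m" "b \<in> G k" "g \<in> G k"
    using assms hfrac_ok_def by auto
  then have "a \<otimes> g \<oplus> b \<otimes> f \<in> G (m + k)" "f \<otimes> g \<in> G (m + k)"
    using comp_mult[of b k f m] comp_mult[of a m g k] comp_mult[of f m g k] comp_add
    by (simp_all add: add.commute)
  moreover have "f \<otimes> g \<notin> P"
    using assms(2,3) by (intro prime_mult_notin[OF P] hfrac_ok_closed)
  ultimately show ?thesis unfolding hfrac_ok_def by auto
qed

lemma hloc_carrier: "carrier (hloc S G P) = {hfrac S G P a f |a f. hfrac_ok P a f}"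
  unfolding hloc_def hfrac_ok_def by simp

lemma hloc_mult_hfrac:
  assumes P: "primeideal P S" and af: "hfrac_ok P a f" and bg: "hfrac_ok P b g"
  shows "hfrac S G P a f \<otimes>\<^bsub>hloc S G P\<^esub> hfrac S G P b g = hfrac S G P (a \<otimes> b) (f \<otimes> g)"
proof -
  have "hfrac S G P (a' \<otimes> b') (f' \<otimes> g') = hfrac S G P (a \<otimes> b) (f \<otimes> g)"
    if 1: "(a', f') \<in> hfrac S G P a f" and 2: "(b', g') \<in> hfrac S G P b g" for a' f' b' g'
  proof -
    have ok: "hfrac_ok P a' f'" "hfrac_ok P b' g'" using 1 2 mem_hfrac by blast+
    obtain m h k j where h: "h \<in> G m" "h \<notin> P" "h \<otimes> (a \<otimes> f') = h \<otimes> (a' \<otimes> f)"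
      and k: "k \<in> G j" "k \<notin> P" "k \<otimes> (b \<otimes> g') = k \<otimes> (b' \<otimes> g)"
      using 1 2 unfolding mem_hfrac by blast
    note cl [simp] = hfrac_ok_closed(1,2)[OF ok(1)] hfrac_ok_closed(1,2)[OF ok(2)]
       hfrac_ok_closed(1,2)[OF af] hfrac_ok_closed(1,2)[OF bg]
       comp_closed[OF h(1)] comp_closed[OF k(1)]
    have "h \<otimes> k \<otimes> (a' \<otimes> b' \<otimes> (f \<otimes> g)) = (h \<otimes> (a' \<otimes> f)) \<otimes> (k \<otimes> (b' \<otimes> g))" by (simp add: m_ac)
    also have "\<dots> = h \<otimes> k \<otimes> (a \<otimes> b \<otimes> (f' \<otimes> g'))"
      unfolding h(3)[symmetric] k(3)[symmetric] by (simp add: m_ac)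
    finally show ?thesis
      using prime_mult_notin[OF P cl(9,10) h(2) k(2)] comp_mult[OF h(1) k(1)]
      by (subst hfrac_eq_iff[OF P hfrac_ok_mult[OF P ok] hfrac_ok_mult[OF P af bg]]) blast
  qed
  moreover have "(a, f) \<in> hfrac S G P a f" "(b, g) \<in> hfrac S G P b g"
    using hfrac_refl P af bg by blast+
  ultimately show ?thesis unfolding hloc_def monoid.simps ring.simps
    by (intro UN_pairs_const)
qed

lemma hloc_add_hfrac:
  assumes P: "primeideal P S" and af: "hfrac_ok P a f" and bg: "hfrac_ok P b g"
  shows "hfrac S G P a f \<oplus>\<^bsub>hloc S G P\<^esub> hfrac S G P b g
    = hfrac S G P (a \<otimes> g \<oplus> b \<otimes> f) (f \<otimes> g)"
proof -
  have "hfrac S G P (a' \<otimes> g' \<oplus> b' \<otimes> f') (f' \<otimes> g') = hfrac S G P (a \<otimes> g \<oplus> b \<otimes> f) (f \<otimes> g)"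
    if 1: "(a', f') \<in> hfrac S G P a f" and 2: "(b', g') \<in> hfrac S G P b g" for a' f' b' g'
  proof -
    have ok: "hfrac_ok P a' f'" "hfrac_ok P b' g'" using 1 2 mem_hfrac by blast+
    obtain m h k j where h: "h \<in> G m" "h \<notin> P" "h \<otimes> (a \<otimes> f') = h \<otimes> (a' \<otimes> f)"
      and k: "k \<in> G j" "k \<notin> P" "k \<otimes> (b \<otimes> g') = k \<otimes> (b' \<otimes> g)"
      using 1 2 unfolding mem_hfrac by blast
    note cl [simp] = hfrac_ok_closed(1,2)[OF ok(1)] hfrac_ok_closed(1,2)[OF ok(2)]
       hfrac_ok_closed(1,2)[OF af] hfrac_ok_closed(1,2)[OF bg]
       comp_closed[OF h(1)] comp_closed[OF k(1)]
    have "h \<otimes> k \<otimes> ((a' \<otimes> g' \<oplus> b' \<otimes> f') \<otimes> (f \<otimes> g))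
        = k \<otimes> g' \<otimes> g \<otimes> (h \<otimes> (a' \<otimes> f)) \<oplus> h \<otimes> f' \<otimes> f \<otimes> (k \<otimes> (b' \<otimes> g))"
      by (simp add: l_distr r_distr m_ac)
    also have "\<dots> = h \<otimes> k \<otimes> ((a \<otimes> g \<oplus> b \<otimes> f) \<otimes> (f' \<otimes> g'))"
      unfolding h(3)[symmetric] k(3)[symmetric] by (simp add: l_distr r_distr m_ac)
    finally show ?thesis
      using prime_mult_notin[OF P cl(9,10) h(2) k(2)] comp_mult[OF h(1) k(1)]
      by (subst hfrac_eq_iff[OF P hfrac_ok_add[OF P ok] hfrac_ok_add[OF P af bg]]) blast
  qed
  moreover have "(a, f) \<in> hfrac S G P a f" "(b, g) \<in> hfrac S G P b g"
    using hfrac_refl P af bg by blast+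
  ultimately show ?thesis unfolding hloc_def monoid.simps ring.simps
    by (intro UN_pairs_const)
qed

lemma hfrac_ok_one: "primeideal P S \<Longrightarrow> hfrac_ok P \<one> \<one>"
  using comp_one primeideal.I_notcarr[of P S] ideal.one_imp_carrier[of P S] primeideal.axioms(1)[of P S]
  unfolding hfrac_ok_def by auto

end

text \<open>The situation of two blow-ups in abstract form: C is a graded subring, and the charts of
  B, in degree 1, cover both Proj. By \<open>saturated\<close>, C and the whole ring have the same
  localization at every f in B, so the affine charts coincide.\<close>

locale graded_pair = S: graded_cring S G cmp + T: graded_cring "S\<lparr>carrier := C\<rparr>" G' cmp
  for S (structure) and G cmp C G' +
  fixes B
  assumes sub: "C \<subseteq> carrier S"
    and sub_comp: "G' m \<subseteq> G m"
    and B_deg: "B \<subseteq> G' 1"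
    and saturated: "\<lbrakk> f \<in> B; a \<in> carrier S \<rbrakk> \<Longrightarrow> \<exists>N. f [^] (N::nat) \<otimes> a \<in> C"
    and cover_S: "P \<in> Proj_points S G \<Longrightarrow> \<exists>f\<in>B. f \<notin> P"
    and cover_T: "Q \<in> Proj_points (S\<lparr>carrier := C\<rparr>) G' \<Longrightarrow> \<exists>f\<in>B. f \<notin> Q"
begin

abbreviation (input) T where "T \<equiv> S\<lparr>carrier := C\<rparr>"

abbreviation (input) contr where "contr \<equiv> Proj_map_point T (\<lambda>p. p)"

abbreviation (input) stalk_map where
  "stalk_map P u \<equiv> (\<Union>(a, f)\<in>u. hfrac S G P a f)"

lemma T_pow: "f [^]\<^bsub>T\<^esub> (N::nat) = f [^] N"
  by (simp add: nat_pow_def)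

lemma T_neg: assumes "a \<in> C" shows "\<ominus>\<^bsub>T\<^esub> a = \<ominus> a"
proof -
  have "\<ominus>\<^bsub>T\<^esub> a \<in> C" "\<ominus>\<^bsub>T\<^esub> a \<oplus> a = \<zero>"
    using T.a_inv_closed[of a] T.l_neg[of a] assms by simp_all
  then show ?thesis
    using S.minus_equality[of "\<ominus>\<^bsub>T\<^esub> a" a] subsetD[OF sub assms] subsetD[OF sub] by metis
qed

lemma B_S: "f \<in> B \<Longrightarrow> f \<in> G 1" and B_T: "f \<in> B \<Longrightarrow> f \<in> G' 1"
  and B_closed: "f \<in> B \<Longrightarrow> f \<in> carrier S"
  using B_deg sub_comp S.comp_closed by blast+

lemma pow_deg: "f \<in> B \<Longrightarrow> f [^] (N::nat) \<in> G' N"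
proof (induction N)
  case (Suc N)
  then show ?case using T.comp_mult[OF Suc.IH B_T] by simp
qed (use T.comp_one in simp)

lemma comp_T_closed: "a \<in> G' m \<Longrightarrow> a \<in> C"
  using T.comp_closed by fastforce

lemma comp_T_iff: "a \<in> G' m \<longleftrightarrow> a \<in> G m \<and> a \<in> C"
proof
  assume "a \<in> G m \<and> a \<in> C"
  then show "a \<in> G' m" using S.cmp_id[of a m m] T.cmp_in[of a m] by simp
qed (use sub_comp comp_T_closed in blast)

lemma saturated_comp:
  assumes "f \<in> B" "a \<in> G m"
  obtains N where "f [^] (N::nat) \<otimes> a \<in> G' (N + m)"
proof -
  obtain N where "f [^] (N::nat) \<otimes> a \<in> C" using saturated[of f a] assms S.comp_closed by blast
  moreover have "f [^] N \<otimes> a \<in> G (N + m)"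
    using pow_deg[OF assms(1)] sub_comp assms(2) S.comp_mult by blast
  ultimately show ?thesis using that comp_T_iff by blast
qed

lemma saturated2:
  assumes "f \<in> B" "a \<in> carrier S" "b \<in> carrier S"
  obtains N where "f [^] (N::nat) \<otimes> a \<in> C" "f [^] (N::nat) \<otimes> b \<in> C"
proof -
  obtain N M where NM: "f [^] (N::nat) \<otimes> a \<in> C" "f [^] (M::nat) \<otimes> b \<in> C"
    using saturated assms by metis
  have p: "f [^] (k::nat) \<in> C" for k using pow_deg[OF assms(1)] comp_T_closed by blast
  note [simp] = B_closed[OF assms(1)] assms(2,3)
  have "f [^] (N + M) \<otimes> a = f [^] M \<otimes> (f [^] N \<otimes> a)" "f [^] (N + M) \<otimes> b = f [^] N \<otimes> (f [^] M \<otimes> b)"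
    by (simp_all flip: S.nat_pow_mult add: S.m_ac)
  then show ?thesis using that[of "N + M"] T.m_closed[of "f [^] M"] T.m_closed[of "f [^] N"] NM p by auto
qed

lemma contr_eq: "contr P = P \<inter> C"
  unfolding Proj_map_point_def by auto

lemma contr_point:
  assumes P: "P \<in> Proj_points S G"
  shows "P \<inter> C \<in> Proj_points T G'"
proof -
  have P': "primeideal P S" "\<forall>a\<in>P. \<forall>m. cmp m a \<in> P" using P S.Proj_points_iff by auto
  interpret P: primeideal P S by fact
  have "ideal (P \<inter> C) T"
  proof (rule idealI[OF T.ring_axioms])
    show "subgroup (P \<inter> C) (add_monoid T)"
    proof
      fix x assume x: "x \<in> P \<inter> C"
      then have "\<ominus>\<^bsub>T\<^esub> x \<in> C" using T.a_inv_closed[of x] by simp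
      then show "inv\<^bsub>add_monoid T\<^esub> x \<in> P \<inter> C"
        using x T_neg P.a_inv_closed[of x] unfolding a_inv_def[symmetric] by simp
    qed (use T.zero_closed T.a_closed in auto)
  qed (use sub T.m_closed P.I_l_closed P.I_r_closed in auto)
  moreover obtain f where f: "f \<in> B" "f \<notin> P" using cover_S P by blast
  have "primeideal (P \<inter> C) T"
  proof (rule primeidealI)
    show "carrier T \<noteq> P \<inter> C" using f B_T comp_T_closed by auto
    show "a \<in> P \<inter> C \<or> b \<in> P \<inter> C"
      if "a \<in> carrier T" "b \<in> carrier T" "a \<otimes>\<^bsub>T\<^esub> b \<in> P \<inter> C" for a b
      using that P.I_prime[of a b] sub by auto
  qed (use calculation T.is_cring in auto)
  ultimately show ?thesis unfolding T.Proj_points_iff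
    using P' f B_T T.cmp_in comp_T_closed by fastforce
qed

text \<open>The inverse of contraction on points: in the chart of f it pulls back the prime that Q
  generates after inverting f.\<close>

definition ext where "ext Q = {a \<in> carrier S. \<exists>f\<in>B. f \<notin> Q \<and> (\<exists>N::nat. f [^] N \<otimes> a \<in> Q)}"

text \<open>A single chart function outside Q decides membership: a power of f brings a into C, and
  there a power of any other g outside Q can be cancelled because Q is prime.\<close>

lemma ext_iff:
  assumes Q: "Q \<in> Proj_points T G'" and f: "f \<in> B" "f \<notin> Q" and a: "a \<in> carrier S"
  shows "a \<in> ext Q \<longleftrightarrow> (\<exists>N::nat. f [^] N \<otimes> a \<in> Q)"
proof
  have Q': "primeideal Q T" using Q T.Proj_points_iff by auto
  interpret Q: primeideal Q T by fact
  assume "a \<in> ext Q"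
  then obtain g N where g: "g \<in> B" "g \<notin> Q" "g [^] (N::nat) \<otimes> a \<in> Q" unfolding ext_def by blast
  obtain M where M: "f [^] (M::nat) \<otimes> a \<in> C" using saturated f a by blast
  note [simp] = B_closed[OF f(1)] B_closed[OF g(1)] a
  have "g [^] N \<otimes> (f [^] M \<otimes> a) = f [^] M \<otimes> (g [^] N \<otimes> a)" by (simp add: S.m_ac)
  also have "\<dots> \<in> Q" using Q.I_l_closed[OF g(3), of "f [^] M"] pow_deg[OF f(1)] comp_T_closed by auto
  finally have "f [^] M \<otimes> a \<in> Q"
    using Q.I_prime[of "g [^] N" "f [^] M \<otimes> a"] M pow_deg[OF g(1)] comp_T_closed
      T.prime_pow_notin[OF Q' _ g(2), of N] B_T[OF g(1)] by (auto simp: T_pow)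
  then show "\<exists>N::nat. f [^] N \<otimes> a \<in> Q" by blast
qed (use assms ext_def in blast)

lemma Q_sub: "Q \<in> Proj_points T G' \<Longrightarrow> Q \<subseteq> C"
  unfolding T.Proj_points_iff using ideal.Icarr primeideal.axioms(1) by fastforce

lemma ext_contr:
  assumes Q: "Q \<in> Proj_points T G'"
  shows "ext Q \<inter> C = Q"
proof -
  obtain f where f: "f \<in> B" "f \<notin> Q" using cover_T Q by blast
  have Q': "primeideal Q T" using Q T.Proj_points_iff by auto
  interpret Q: primeideal Q T by fact
  have "a \<in> ext Q \<longleftrightarrow> a \<in> Q" if a: "a \<in> C" for a
  proof -
    have "a \<in> Q" if "f [^] (N::nat) \<otimes> a \<in> Q" for N
      using Q.I_prime[of "f [^] N" a] a pow_deg[OF f(1)] comp_T_closed that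
        T.prime_pow_notin[OF Q' _ f(2), of N] B_T[OF f(1)] by (auto simp: T_pow)
    moreover have "f [^] (0::nat) \<otimes> a \<in> Q" if "a \<in> Q"
      using that a sub by (simp add: subset_iff)
    ultimately show ?thesis using ext_iff[OF Q f] a sub by blast
  qed
  then show ?thesis using Q_sub[OF Q] by blast
qed

lemma contr_ext:
  assumes P: "P \<in> Proj_points S G"
  shows "ext (P \<inter> C) = P"
proof -
  have P': "primeideal P S" using P S.Proj_points_iff by auto
  interpret P: primeideal P S by fact
  obtain f where f: "f \<in> B" "f \<notin> P" using cover_S P by blast
  have "a \<in> ext (P \<inter> C) \<longleftrightarrow> a \<in> P" if a: "a \<in> carrier S" for a
  proof
    assume "a \<in> ext (P \<inter> C)"
    then obtain N where "f [^] (N::nat) \<otimes> a \<in> P"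
      using ext_iff[OF contr_point[OF P] f(1)] a f by blast
    then show "a \<in> P"
      using P.I_prime[of "f [^] N" a] S.prime_pow_notin[OF P' B_closed[OF f(1)] f(2), of N] a B_closed[OF f(1)] by auto
  next
    assume "a \<in> P"
    moreover obtain N where "f [^] (N::nat) \<otimes> a \<in> C" using saturated f a by blast
    ultimately show "a \<in> ext (P \<inter> C)"
      using P.I_l_closed[of a "f [^] N"] B_closed[OF f(1)] f
      by (subst ext_iff[OF contr_point[OF P] f(1)]) (auto simp: a)
  qed
  then show ?thesis using P.Icarr unfolding ext_def by blast
qed

lemma ext_point:
  assumes Q: "Q \<in> Proj_points T G'"
  shows "ext Q \<in> Proj_points S G"
proof -
  obtain f where f: "f \<in> B" "f \<notin> Q" using cover_T Q by blast
  have Q': "primeideal Q T" "\<forall>a\<in>Q. \<forall>m. cmp m a \<in> Q" using Q T.Proj_points_iff by auto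
  interpret Q: primeideal Q T by fact
  have fC: "f [^] (N::nat) \<in> C" for N using pow_deg[OF f(1)] comp_T_closed by blast
  note fc [simp] = B_closed[OF f(1)]
  note iff = ext_iff[OF Q f]
  have extE: thesis if "a \<in> ext Q" "\<And>N. \<lbrakk> a \<in> carrier S; f [^] (N::nat) \<otimes> a \<in> Q \<rbrakk> \<Longrightarrow> thesis" for a thesis
  proof -
    have "a \<in> carrier S" using that(1) unfolding ext_def by blast
    then show thesis using that iff by blast
  qed
  have up: "f [^] (N + M) \<otimes> a \<in> Q" if "f [^] N \<otimes> a \<in> Q" "a \<in> carrier S" for N M :: nat and a
  proof -
    have "f [^] (N + M) \<otimes> a = f [^] M \<otimes> (f [^] N \<otimes> a)"
      using that by (simp flip: S.nat_pow_mult add: S.m_ac)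
    then show ?thesis using Q.I_l_closed[OF that(1), of "f [^] M"] fC by simp
  qed
  have "ideal (ext Q) S"
  proof (rule idealI[OF S.ring_axioms])
    show "subgroup (ext Q) (add_monoid S)"
    proof
      show "ext Q \<subseteq> carrier (add_monoid S)" unfolding ext_def by auto
      have "f [^] (0::nat) \<otimes> \<zero> \<in> Q" using Q.zero_closed by simp
      then show "\<one>\<^bsub>add_monoid S\<^esub> \<in> ext Q" using iff by auto
    next
      fix x y assume xy: "x \<in> ext Q" "y \<in> ext Q"
      obtain N where x: "x \<in> carrier S" "f [^] (N::nat) \<otimes> x \<in> Q" using extE[OF xy(1)] by blast
      obtain M where y: "y \<in> carrier S" "f [^] (M::nat) \<otimes> y \<in> Q" using extE[OF xy(2)] by blast
      have "f [^] (N + M) \<otimes> (x \<oplus> y) \<in> Q"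
        using up[OF x(2,1), of M] up[OF y(2,1), of N] x y Q.a_closed
        by (simp add: S.r_distr add.commute)
      then show "x \<otimes>\<^bsub>add_monoid S\<^esub> y \<in> ext Q" using iff x y by auto
    next
      fix x assume "x \<in> ext Q"
      from extE[OF this] obtain N where x: "x \<in> carrier S" "f [^] (N::nat) \<otimes> x \<in> Q" by blast
      have "f [^] N \<otimes> (\<ominus> x) = \<ominus>\<^bsub>T\<^esub> (f [^] N \<otimes> x)"
        using x Q_sub[OF Q] by (subst T_neg) (auto simp: S.r_minus)
      then have "f [^] N \<otimes> (\<ominus> x) \<in> Q" using x Q.a_inv_closed by simp
      then show "inv\<^bsub>add_monoid S\<^esub> x \<in> ext Q" using iff x unfolding a_inv_def[symmetric] by auto
    qed
    fix a x assume a: "a \<in> ext Q" "x \<in> carrier S"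
    from extE[OF a(1)] obtain N where N: "a \<in> carrier S" "f [^] (N::nat) \<otimes> a \<in> Q" by blast
    obtain M where M: "f [^] (M::nat) \<otimes> x \<in> C" using saturated f a by blast
    have "f [^] (N + M) \<otimes> (x \<otimes> a) = (f [^] M \<otimes> x) \<otimes> (f [^] N \<otimes> a)"
      using a N by (simp flip: S.nat_pow_mult add: S.m_ac)
    then have "f [^] (N + M) \<otimes> (x \<otimes> a) \<in> Q" using Q.I_l_closed[OF N(2), of "f [^] M \<otimes> x"] M by simp
    then show "x \<otimes> a \<in> ext Q" using iff a N by blast
    then show "a \<otimes> x \<in> ext Q" using a N by (simp add: S.m_comm)
  qed
  moreover have fe: "f \<notin> ext Q" using ext_contr[OF Q] f B_T comp_T_closed by blast
  have "primeideal (ext Q) S"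
  proof (rule primeidealI)
    show "carrier S \<noteq> ext Q" using fe fc by blast
    fix a b assume ab: "a \<in> carrier S" "b \<in> carrier S" "a \<otimes> b \<in> ext Q"
    then obtain N where N: "f [^] (N::nat) \<otimes> (a \<otimes> b) \<in> Q" using iff by blast
    \<comment> \<open>A common exponent brings both factors into C, where primality of Q can be
      applied.\<close>
    obtain M where M: "f [^] (M::nat) \<otimes> a \<in> C" "f [^] M \<otimes> b \<in> C" using saturated2 f ab by metis
    have "f [^] N \<otimes> ((f [^] M \<otimes> a) \<otimes> (f [^] M \<otimes> b)) = f [^] (N + (M + M)) \<otimes> (a \<otimes> b)"
      using ab by (simp flip: S.nat_pow_mult add: S.m_ac)
    also have "\<dots> \<in> Q" using up[OF N, of "M + M"] ab by simp
    finally have "(f [^] M \<otimes> a) \<otimes> (f [^] M \<otimes> b) \<in> Q"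
      using Q.I_prime[of "f [^] N"] fC M T.m_closed[of "f [^] M \<otimes> a" "f [^] M \<otimes> b"]
        T.prime_pow_notin[OF Q'(1) _ f(2), of N] fC[of 1] by (auto simp: T_pow)
    then have "f [^] M \<otimes> a \<in> Q \<or> f [^] M \<otimes> b \<in> Q" using Q.I_prime M by simp
    then show "a \<in> ext Q \<or> b \<in> ext Q" using iff ab by blast
  qed (use calculation S.is_cring in auto)
  moreover have "cmp m a \<in> ext Q" if "a \<in> ext Q" for a m
  proof -
    from extE[OF that] obtain N where N: "a \<in> carrier S" "f [^] (N::nat) \<otimes> a \<in> Q" by blast
    have fN: "f [^] N \<in> G N" using pow_deg[OF f(1)] sub_comp by blast
    \<comment> \<open>The power f^N is homogeneous of degree N, so multiplication by it shifts
      components by N and homogeneity of Q carries over.\<close>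
    have "cmp (N + m) (f [^] N \<otimes> a) = (\<Oplus>i\<in>{..N + m}. cmp i (f [^] N) \<otimes> cmp (N + m - i) a)"
      using N by (simp add: S.cmp_mult)
    also have "\<dots> = (\<Oplus>i\<in>{..N + m}. if N = i then f [^] N \<otimes> cmp (N + m - i) a else \<zero>)"
      using N by (intro S.finsum_cong') (auto simp: S.cmp_id[OF fN])
    also have "\<dots> = f [^] N \<otimes> cmp m a"
      using N by (subst S.finsum_singleton) auto
    finally have "f [^] N \<otimes> cmp m a \<in> Q" using Q'(2) N(2) by metis
    then show ?thesis using iff[OF S.cmp_closed[OF N(1)]] by blast
  qed
  moreover have "\<not> G 1 \<subseteq> ext Q" using fe B_S[OF f(1)] by blast
  ultimately show ?thesis unfolding S.Proj_points_iff
    by (intro conjI ballI allI exI[of _ 1] zero_less_one)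
qed

lemma domain_eq: "Proj_map_domain G' S G (\<lambda>p. p) = Proj_points S G"
proof -
  have "\<not> (\<lambda>p. p) ` G' 1 \<subseteq> P" if "P \<in> Proj_points S G" for P
    using cover_S[OF that] B_T by auto
  then show ?thesis unfolding Proj_map_domain_def using zero_less_one by blast
qed

lemma contr_homeo: "homeomorphic_map (Proj_top S G) (Proj_top T G') contr"
proof (rule homeomorphic_maps_imp_map)
  show "homeomorphic_maps (Proj_top S G) (Proj_top T G') contr ext"
    unfolding homeomorphic_maps_def
  proof (intro conjI ballI)
    show "continuous_map (Proj_top S G) (Proj_top T G') contr"
      unfolding Proj_top_def[of T]
    proof (rule continuous_on_generated_topo)
      fix U assume "U \<in> {{P \<in> Proj_points T G'. f \<notin> P} |f m. 0 < m \<and> f \<in> G' m}"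
      then obtain f m where U: "U = {P \<in> Proj_points T G'. f \<notin> P}" "0 < m" "f \<in> G' m" by blast
      have "contr -` U \<inter> topspace (Proj_top S G) = {P \<in> Proj_points S G. f \<notin> P}"
        using contr_point comp_T_closed[OF U(3)] U(1) by (auto simp: contr_eq)
      moreover have "f \<in> G m" using U(3) sub_comp by blast
      ultimately show "openin (Proj_top S G) (contr -` U \<inter> topspace (Proj_top S G))"
        using S.openin_basic[OF U(2)] by metis
    next
      show "contr ` topspace (Proj_top S G) \<subseteq>
        \<Union> {{P \<in> Proj_points T G'. f \<notin> P} |f m. 0 < m \<and> f \<in> G' m}"
        using contr_point T.topspace_Proj_top
        unfolding Proj_top_def topology_generated_by_topspace by (auto simp: contr_eq)
    qed
    show "continuous_map (Proj_top T G') (Proj_top S G) ext"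
      unfolding Proj_top_def[of S]
    proof (rule continuous_on_generated_topo)
      fix U assume "U \<in> {{P \<in> Proj_points S G. a \<notin> P} |a m. 0 < m \<and> a \<in> G m}"
      then obtain a m where U: "U = {P \<in> Proj_points S G. a \<notin> P}" "0 < m" "a \<in> G m" by blast
      define N where "N f = (SOME N. f [^] (N::nat) \<otimes> a \<in> G' (N + m))" for f
      have N: "f [^] N f \<otimes> a \<in> G' (N f + m)" if "f \<in> B" for f
        unfolding N_def using saturated_comp[OF that U(3)] by (metis (no_types, lifting) someI_ex)
      \<comment> \<open>The preimage is assembled from its parts in the charts. The additional
        factor f ensures that a point of such a part really lies in the chart of f, even if the
        chosen exponent is 0.\<close>
      have "ext -` U \<inter> topspace (Proj_top T G') =
        (\<Union>f\<in>B. {Q \<in> Proj_points T G'. f \<otimes> (f [^] N f \<otimes> a) \<notin> Q})"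
      proof (intro equalityI subsetI)
        fix Q assume "Q \<in> ext -` U \<inter> topspace (Proj_top T G')"
        then have Q: "Q \<in> Proj_points T G'" "a \<notin> ext Q" using U by auto
        have Q': "primeideal Q T" using Q T.Proj_points_iff by auto
        obtain f where f: "f \<in> B" "f \<notin> Q" using cover_T Q by blast
        have "f [^] N f \<otimes> a \<notin> Q" using Q(2) ext_iff[OF Q(1) f] S.comp_closed[OF U(3)] by blast
        then have "f \<otimes> (f [^] N f \<otimes> a) \<notin> Q"
          using T.prime_mult_notin[OF Q', of f "f [^] N f \<otimes> a"] f comp_T_closed[OF N] comp_T_closed[OF B_T] by simp
        then show "Q \<in> (\<Union>f\<in>B. {Q \<in> Proj_points T G'. f \<otimes> (f [^] N f \<otimes> a) \<notin> Q})"
          using f Q by blast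
      next
        fix Q assume "Q \<in> (\<Union>f\<in>B. {Q \<in> Proj_points T G'. f \<otimes> (f [^] N f \<otimes> a) \<notin> Q})"
        then obtain f where f: "f \<in> B" "f \<otimes> (f [^] N f \<otimes> a) \<notin> Q" and Q: "Q \<in> Proj_points T G'" by blast
        have "ideal Q T" using Q T.Proj_points_iff primeideal.axioms(1) by auto
        then interpret Q: ideal Q T .
        have "f \<notin> Q" using f(2) Q.I_r_closed[of f "f [^] N f \<otimes> a"] comp_T_closed[OF N[OF f(1)]] by auto
        moreover have "a \<notin> ext Q"
        proof
          assume "a \<in> ext Q"
          then have "a \<in> ext Q \<inter> carrier S" using S.comp_closed[OF U(3)] by blast
          have "ideal (ext Q) S" using ext_point[OF Q] S.Proj_points_iff primeideal.axioms(1) by auto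
          then interpret E: ideal "ext Q" S .
          have "f [^] N f \<otimes> a \<in> ext Q \<inter> C"
            using E.I_l_closed[OF \<open>a \<in> ext Q\<close>, of "f [^] N f"] B_closed[OF f(1)] comp_T_closed[OF N[OF f(1)]] by auto
          then show False using ext_contr[OF Q] f(2) Q.I_l_closed[of "f [^] N f \<otimes> a" f]
              comp_T_closed[OF B_T[OF f(1)]] by auto
        qed
        ultimately show "Q \<in> ext -` U \<inter> topspace (Proj_top T G')"
          using Q U(1) ext_point[OF Q] by auto
      qed
      moreover have "openin (Proj_top T G') {Q \<in> Proj_points T G'. f \<otimes> (f [^] N f \<otimes> a) \<notin> Q}"
        if "f \<in> B" for f
        using T.openin_basic[of "1 + (N f + m)" "f \<otimes> (f [^] N f \<otimes> a)"]
          T.comp_mult[OF B_T[OF that] N[OF that]] by simp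
      ultimately show "openin (Proj_top T G') (ext -` U \<inter> topspace (Proj_top T G'))" by auto
    next
      show "ext ` topspace (Proj_top T G') \<subseteq>
        \<Union> {{P \<in> Proj_points S G. f \<notin> P} |f m. 0 < m \<and> f \<in> G m}"
        using ext_point S.topspace_Proj_top
        unfolding Proj_top_def topology_generated_by_topspace by auto
    qed
  qed (auto simp: contr_eq contr_ext ext_contr)
qed

end

section \<open>Comparison of stalks and sections\<close>

context graded_pair
begin

context
  fixes P assumes P: "P \<in> Proj_points S G"
begin

private lemma primeP: "primeideal P S" using P S.Proj_points_iff by auto

private lemma primeQ: "primeideal (P \<inter> C) T"
  using contr_point[OF P] T.Proj_points_iff by auto

lemma hfrac_ok_sub: "T.hfrac_ok (P \<inter> C) a f \<Longrightarrow> S.hfrac_ok P a f"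
  unfolding S.hfrac_ok_def T.hfrac_ok_def using comp_T_iff by blast

lemma stalk_map_hfrac:
  assumes af: "T.hfrac_ok (P \<inter> C) a f"
  shows "stalk_map P (hfrac T G' (P \<inter> C) a f) = hfrac S G P a f"
proof -
  have "hfrac S G P b g = hfrac S G P a f" if "(b, g) \<in> hfrac T G' (P \<inter> C) a f" for b g
  proof -
    from that obtain m h where bg: "T.hfrac_ok (P \<inter> C) b g"
      and h: "h \<in> G' m" "h \<notin> P \<inter> C" "h \<otimes> (a \<otimes> g) = h \<otimes> (b \<otimes> f)"
      unfolding T.mem_hfrac by auto
    have "(b, g) \<in> hfrac S G P a f"
      unfolding S.mem_hfrac using h comp_T_iff hfrac_ok_sub[OF bg] by blast
    then show ?thesis using S.hfrac_eqI[OF primeP hfrac_ok_sub[OF af]] by metis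
  qed
  then have "\<And>p. p \<in> hfrac T G' (P \<inter> C) a f \<Longrightarrow> (case p of (b, g) \<Rightarrow> hfrac S G P b g) = hfrac S G P a f"
    by auto
  moreover have "hfrac T G' (P \<inter> C) a f \<noteq> {}"
    using T.hfrac_refl[OF primeQ af] by blast
  ultimately show ?thesis by simp
qed

lemma stalk_map_hom: "stalk_map P \<in> ring_hom (hloc T G' (P \<inter> C)) (hloc S G P)"
proof (rule ring_hom_memI)
  fix u v
  assume "u \<in> carrier (hloc T G' (P \<inter> C))" "v \<in> carrier (hloc T G' (P \<inter> C))"
  then obtain a f b g where u: "u = hfrac T G' (P \<inter> C) a f" "T.hfrac_ok (P \<inter> C) a f"
    and v: "v = hfrac T G' (P \<inter> C) b g" "T.hfrac_ok (P \<inter> C) b g"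
    unfolding T.hloc_carrier by blast
  note T = T.hloc_mult_hfrac[OF primeQ u(2) v(2)] T.hloc_add_hfrac[OF primeQ u(2) v(2)]
  note S = S.hloc_mult_hfrac[OF primeP hfrac_ok_sub[OF u(2)] hfrac_ok_sub[OF v(2)]]
    S.hloc_add_hfrac[OF primeP hfrac_ok_sub[OF u(2)] hfrac_ok_sub[OF v(2)]]
  show "stalk_map P (u \<otimes>\<^bsub>hloc T G' (P \<inter> C)\<^esub> v) = stalk_map P u \<otimes>\<^bsub>hloc S G P\<^esub> stalk_map P v"
    unfolding u(1) v(1) T stalk_map_hfrac[OF T.hfrac_ok_mult[OF primeQ u(2) v(2)]]
      stalk_map_hfrac[OF u(2)] stalk_map_hfrac[OF v(2)] S by simp
  show "stalk_map P (u \<oplus>\<^bsub>hloc T G' (P \<inter> C)\<^esub> v) = stalk_map P u \<oplus>\<^bsub>hloc S G P\<^esub> stalk_map P v"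
    unfolding u(1) v(1) T stalk_map_hfrac[OF T.hfrac_ok_add[OF primeQ u(2) v(2)]]
      stalk_map_hfrac[OF u(2)] stalk_map_hfrac[OF v(2)] S by simp
next
  show "stalk_map P u \<in> carrier (hloc S G P)" if "u \<in> carrier (hloc T G' (P \<inter> C))" for u
    using that hfrac_ok_sub unfolding T.hloc_carrier S.hloc_carrier
    by (auto simp: stalk_map_hfrac) blast
next
  show "stalk_map P \<one>\<^bsub>hloc T G' (P \<inter> C)\<^esub> = \<one>\<^bsub>hloc S G P\<^esub>"
  proof -
    have "\<one>\<^bsub>hloc T G' (P \<inter> C)\<^esub> = hfrac T G' (P \<inter> C) \<one>\<^bsub>T\<^esub> \<one>\<^bsub>T\<^esub>" "\<one>\<^bsub>hloc S G P\<^esub> = hfrac S G P \<one> \<one>"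
      by (simp_all only: hloc_def monoid.simps)
    then show ?thesis using stalk_map_hfrac[OF T.hfrac_ok_one[OF primeQ]] by simp
  qed
qed

text \<open>A power of g brings numerator and denominator into C at once, and the fraction stays the
  same because g is outside P.\<close>

lemma stalk_map_lift:
  assumes af: "S.hfrac_ok P a f" and g: "g \<in> B" "g \<notin> P"
    and N: "g [^] (N::nat) \<otimes> a \<in> C" "g [^] N \<otimes> f \<in> C"
  shows "T.hfrac_ok (P \<inter> C) (g [^] N \<otimes> a) (g [^] N \<otimes> f)"
    and "stalk_map P (hfrac T G' (P \<inter> C) (g [^] N \<otimes> a) (g [^] N \<otimes> f)) = hfrac S G P a f"
proof -
  obtain m where m: "a \<in> G m" "f \<in> G m" "f \<notin> P" using af unfolding S.hfrac_ok_def by blast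
  note [simp] = B_closed[OF g(1)] S.comp_closed[OF m(1)] S.comp_closed[OF m(2)]
  have gN: "g [^] N \<in> G N" using pow_deg[OF g(1)] sub_comp by blast
  have "g [^] N \<otimes> f \<notin> P"
    using m g by (intro S.prime_mult_notin[OF primeP] S.prime_pow_notin[OF primeP]) auto
  then show ok: "T.hfrac_ok (P \<inter> C) (g [^] N \<otimes> a) (g [^] N \<otimes> f)"
    unfolding T.hfrac_ok_def comp_T_iff using S.comp_mult[OF gN] m N by blast
  have "hfrac S G P (g [^] N \<otimes> a) (g [^] N \<otimes> f) = hfrac S G P a f"
  proof (subst S.hfrac_eq_iff[OF primeP hfrac_ok_sub[OF ok] af], intro exI bexI conjI)
    show "\<one> \<in> G 0" by (rule S.comp_one)
    show "\<one> \<notin> P" using S.hfrac_ok_one[OF primeP] unfolding S.hfrac_ok_def by blast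
  qed (simp add: S.m_ac)
  then show "stalk_map P (hfrac T G' (P \<inter> C) (g [^] N \<otimes> a) (g [^] N \<otimes> f)) = hfrac S G P a f"
    using stalk_map_hfrac[OF ok] by simp
qed

text \<open>Surjectivity is \<open>stalk_map_lift\<close>. For injectivity, the multiplier h that
  witnesses an equality of fractions is itself brought into C by a power of g.\<close>

lemma stalk_map_bij:
  "bij_betw (stalk_map P) (carrier (hloc T G' (P \<inter> C))) (carrier (hloc S G P))"
proof (rule bij_betw_imageI)
  obtain g where g: "g \<in> B" "g \<notin> P" using cover_S P by blast
  show "inj_on (stalk_map P) (carrier (hloc T G' (P \<inter> C)))"
  proof (rule inj_onI)
    fix u v
    assume "u \<in> carrier (hloc T G' (P \<inter> C))" "v \<in> carrier (hloc T G' (P \<inter> C))"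
      and eq: "stalk_map P u = stalk_map P v"
    then obtain a f b e where u: "u = hfrac T G' (P \<inter> C) a f" "T.hfrac_ok (P \<inter> C) a f"
      and v: "v = hfrac T G' (P \<inter> C) b e" "T.hfrac_ok (P \<inter> C) b e"
      unfolding T.hloc_carrier by blast
    then have "hfrac S G P a f = hfrac S G P b e"
      using eq stalk_map_hfrac by simp
    then obtain m h where h: "h \<in> G m" "h \<notin> P" "h \<otimes> (a \<otimes> e) = h \<otimes> (b \<otimes> f)"
      unfolding S.hfrac_eq_iff[OF primeP hfrac_ok_sub[OF u(2)] hfrac_ok_sub[OF v(2)]] by blast
    obtain N where N: "g [^] (N::nat) \<otimes> h \<in> G' (N + m)" using saturated_comp[OF g(1) h(1)] .
    note [simp] = B_closed[OF g(1)] S.comp_closed[OF h(1)]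
      S.hfrac_ok_closed(1,2)[OF hfrac_ok_sub[OF u(2)]] S.hfrac_ok_closed(1,2)[OF hfrac_ok_sub[OF v(2)]]
    have "g [^] N \<otimes> h \<notin> P"
      using h g by (intro S.prime_mult_notin[OF primeP] S.prime_pow_notin[OF primeP]) auto
    moreover have "g [^] N \<otimes> h \<otimes> (a \<otimes> e) = g [^] N \<otimes> h \<otimes> (b \<otimes> f)"
      using h(3) by (simp add: S.m_assoc)
    ultimately show "u = v" unfolding u(1) v(1)
      by (subst T.hfrac_eq_iff[OF primeQ u(2) v(2)]) (use N in auto)
  qed
  show "stalk_map P ` carrier (hloc T G' (P \<inter> C)) = carrier (hloc S G P)"
  proof
    show "stalk_map P ` carrier (hloc T G' (P \<inter> C)) \<subseteq> carrier (hloc S G P)"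
      using ring_hom_closed[OF stalk_map_hom] by auto
    show "carrier (hloc S G P) \<subseteq> stalk_map P ` carrier (hloc T G' (P \<inter> C))"
    proof
      fix u assume "u \<in> carrier (hloc S G P)"
      then obtain a f where u: "u = hfrac S G P a f" "S.hfrac_ok P a f"
        unfolding S.hloc_carrier by blast
      obtain N where N: "g [^] (N::nat) \<otimes> a \<in> C" "g [^] N \<otimes> f \<in> C"
        using saturated2[OF g(1) S.hfrac_ok_closed(1,2)[OF u(2)]] .
      then show "u \<in> stalk_map P ` carrier (hloc T G' (P \<inter> C))"
        using stalk_map_lift[OF u(2) g N] unfolding u(1) T.hloc_carrier
        by (intro image_eqI[where x = "hfrac T G' (P \<inter> C) (g [^] N \<otimes> a) (g [^] N \<otimes> f)"]) auto
    qed
  qed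
qed

end

abbreviation (input) pull where "pull W \<equiv> {P \<in> Proj_points S G. contr P \<in> W}"

lemma Proj_map_sections_apply:
  "Proj_map_sections T G' S G (\<lambda>p. p) W s = (\<lambda>P\<in>pull W. stalk_map P (s (P \<inter> C)))"
  unfolding Proj_map_sections_def domain_eq by (simp add: contr_eq)

lemma openin_pull:
  assumes "openin (Proj_top T G') W" shows "openin (Proj_top S G) (pull W)"
  using openin_continuous_map_preimage[OF homeomorphic_imp_continuous_map[OF contr_homeo] assms] by simp

lemma openin_push:
  assumes "openin (Proj_top S G) W" shows "openin (Proj_top T G') {Q \<in> Proj_points T G'. ext Q \<in> W}"
proof -
  have W: "W \<subseteq> Proj_points S G" using openin_subset[OF assms] by simp
  have "contr ` W = {Q \<in> Proj_points T G'. ext Q \<in> W}"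
  proof (intro equalityI subsetI)
    fix Q assume "Q \<in> contr ` W"
    then show "Q \<in> {Q \<in> Proj_points T G'. ext Q \<in> W}"
      using W contr_point contr_ext by (auto simp: contr_eq)
  next
    fix Q assume "Q \<in> {Q \<in> Proj_points T G'. ext Q \<in> W}"
    then show "Q \<in> contr ` W" using ext_contr[of Q] contr_eq[of "ext Q"] by (auto intro!: rev_image_eqI)
  qed
  then show ?thesis
    using homeomorphic_imp_open_map[OF contr_homeo] assms unfolding open_map_def by metis
qed

text \<open>Sections are functions into the stalks that are locally fractions. Stalk maps are
  bijective, so injectivity and the candidate for a preimage are stalkwise matters; what remains is
  that the preimage is again locally a fraction.\<close>

lemma Proj_map_sections_iso:
  assumes W: "openin (Proj_top T G') W"
  shows "Proj_map_sections T G' S G (\<lambda>p. p) W \<in> ring_iso (Proj_sections T G' W) (Proj_sections S G (pull W))"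
proof -
  let ?h = "Proj_map_sections T G' S G (\<lambda>p. p) W"
  have WT: "W \<subseteq> Proj_points T G'" using openin_subset[OF W] by simp
  have pullI: "P \<in> Proj_points S G \<and> P \<inter> C \<in> W" if "P \<in> pull W" for P
    using that by (simp add: contr_eq)
  have closed: "?h s \<in> carrier (Proj_sections S G (pull W))"
    if s: "s \<in> carrier (Proj_sections T G' W)" for s
  proof -
    have sP: "s \<in> (\<Pi>\<^sub>E Q\<in>W. carrier (hloc T G' Q))" using s unfolding Proj_sections_def by simp
    have "\<exists>W'. openin (Proj_top S G) W' \<and> P \<in> W' \<and> W' \<subseteq> pull W \<and>
         (\<exists>m. \<exists>a\<in>G m. \<exists>f\<in>G m. \<forall>Q\<in>W'. f \<notin> Q \<and> ?h s Q = hfrac S G Q a f)" if P: "P \<in> pull W" for P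
    proof -
      have "P \<inter> C \<in> W" using pullI P by blast
      then obtain W' m a f where W': "openin (Proj_top T G') W'" "P \<inter> C \<in> W'" "W' \<subseteq> W"
        and af: "a \<in> G' m" "f \<in> G' m" "\<And>Q. Q \<in> W' \<Longrightarrow> f \<notin> Q \<and> s Q = hfrac T G' Q a f"
        using s unfolding Proj_sections_def by simp (metis (no_types, lifting))
      have eq: "f \<notin> P' \<and> ?h s P' = hfrac S G P' a f" if P': "P' \<in> pull W'" for P'
      proof -
        have 1: "P' \<in> Proj_points S G" "P' \<inter> C \<in> W'" using P' by (simp_all add: contr_eq)
        then have "T.hfrac_ok (P' \<inter> C) a f" unfolding T.hfrac_ok_def using af by blast
        moreover have "P' \<in> pull W" using P' W' by blast
        moreover have "f \<notin> P'" using af(3)[OF 1(2)] comp_T_closed[OF af(2)] by blast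
        ultimately show ?thesis
          using af(3)[OF 1(2)] stalk_map_hfrac[OF 1(1)] by (simp add: Proj_map_sections_apply)
      qed
      have P': "P \<in> pull W'" "pull W' \<subseteq> pull W" using P W' by (auto simp: contr_eq)
      have af': "a \<in> G m" "f \<in> G m" using af(1,2) sub_comp by blast+
      show ?thesis
        by (intro exI[of _ "pull W'"] exI[of _ m] bexI[OF _ af'(1)] bexI[OF _ af'(2)] conjI[OF openin_pull[OF W'(1)]]
            conjI[OF P'(1)] conjI[OF P'(2)] ballI) (rule eq)
    qed
    moreover have "?h s \<in> (\<Pi>\<^sub>E P\<in>pull W. carrier (hloc S G P))"
    proof (rule PiE_I)
      fix P assume P: "P \<in> pull W"
      then have "stalk_map P (s (P \<inter> C)) \<in> carrier (hloc S G P)"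
        using pullI[OF P] sP by (intro ring_hom_closed[OF stalk_map_hom]) auto
      then show "?h s P \<in> carrier (hloc S G P)" using P by (simp add: Proj_map_sections_apply)
    qed (simp only: Proj_map_sections_apply restrict_def if_False)
    ultimately show ?thesis unfolding Proj_sections_def by simp
  qed
  have hom: "?h \<in> ring_hom (Proj_sections T G' W) (Proj_sections S G (pull W))"
  proof (rule ring_hom_memI[OF closed])
    fix s t assume st: "s \<in> carrier (Proj_sections T G' W)" "t \<in> carrier (Proj_sections T G' W)"
    have st': "s Q \<in> carrier (hloc T G' Q)" "t Q \<in> carrier (hloc T G' Q)" if "Q \<in> W" for Q
      using st that unfolding Proj_sections_def by auto
    note 1 = ring_hom_mult[OF stalk_map_hom st'] ring_hom_add[OF stalk_map_hom st']
    show "?h (s \<otimes>\<^bsub>Proj_sections T G' W\<^esub> t) = ?h s \<otimes>\<^bsub>Proj_sections S G (pull W)\<^esub> ?h t"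
      "?h (s \<oplus>\<^bsub>Proj_sections T G' W\<^esub> t) = ?h s \<oplus>\<^bsub>Proj_sections S G (pull W)\<^esub> ?h t"
      unfolding Proj_map_sections_apply using pullI
      by (auto simp: Proj_sections_def 1 fun_eq_iff restrict_def)
  next
    show "?h \<one>\<^bsub>Proj_sections T G' W\<^esub> = \<one>\<^bsub>Proj_sections S G (pull W)\<^esub>"
      unfolding Proj_map_sections_apply using pullI ring_hom_one[OF stalk_map_hom]
      by (auto simp: Proj_sections_def fun_eq_iff restrict_def)
  qed
  have "bij_betw ?h (carrier (Proj_sections T G' W)) (carrier (Proj_sections S G (pull W)))"
  proof (rule bij_betw_imageI)
    show "inj_on ?h (carrier (Proj_sections T G' W))"
    proof (rule inj_onI)
      fix s t assume st: "s \<in> carrier (Proj_sections T G' W)" "t \<in> carrier (Proj_sections T G' W)"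
        and eq: "?h s = ?h t"
      have sP: "s \<in> (\<Pi>\<^sub>E Q\<in>W. carrier (hloc T G' Q))" "t \<in> (\<Pi>\<^sub>E Q\<in>W. carrier (hloc T G' Q))"
        using st unfolding Proj_sections_def by auto
      show "s = t"
      proof (rule PiE_ext[OF sP])
        fix Q assume Q: "Q \<in> W"
        then have QT: "Q \<in> Proj_points T G'" using WT by blast
        have e: "ext Q \<inter> C = Q" using ext_contr QT by blast
        have "ext Q \<in> pull W" using ext_point[OF QT] Q e by (simp add: contr_eq)
        then have st_eq: "stalk_map (ext Q) (s Q) = stalk_map (ext Q) (t Q)"
          using fun_cong[OF eq, of "ext Q"] e by (simp add: Proj_map_sections_apply)
        have "inj_on (stalk_map (ext Q)) (carrier (hloc T G' Q))"
          using bij_betw_imp_inj_on[OF stalk_map_bij[OF ext_point[OF QT]]] e by simp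
        from inj_onD[OF this st_eq] show "s Q = t Q" using sP Q by blast
      qed
    qed
    show "?h ` carrier (Proj_sections T G' W) = carrier (Proj_sections S G (pull W))"
    proof
      show "?h ` carrier (Proj_sections T G' W) \<subseteq> carrier (Proj_sections S G (pull W))"
        using closed by blast
      show "carrier (Proj_sections S G (pull W)) \<subseteq> ?h ` carrier (Proj_sections T G' W)"
      proof
        fix z assume z: "z \<in> carrier (Proj_sections S G (pull W))"
        then have zP: "z \<in> (\<Pi>\<^sub>E P\<in>pull W. carrier (hloc S G P))" unfolding Proj_sections_def by simp
        define s where "s = (\<lambda>Q\<in>W. inv_into (carrier (hloc T G' Q)) (stalk_map (ext Q)) (z (ext Q)))"
        have QW: "ext Q \<in> pull W \<and> ext Q \<in> Proj_points S G \<and> ext Q \<inter> C = Q" if "Q \<in> W" for Q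
        proof -
          have "Q \<in> Proj_points T G'" using WT that by blast
          then show ?thesis using ext_point ext_contr that by (simp add: contr_eq)
        qed
        have bij: "bij_betw (stalk_map (ext Q)) (carrier (hloc T G' Q)) (carrier (hloc S G (ext Q)))"
          if "Q \<in> W" for Q
          using stalk_map_bij[of "ext Q"] QW[OF that] by simp
        have zc: "z (ext Q) \<in> carrier (hloc S G (ext Q))" if "Q \<in> W" for Q
          using zP QW[OF that] by blast
        have s_in: "s Q \<in> carrier (hloc T G' Q)" "stalk_map (ext Q) (s Q) = z (ext Q)" if "Q \<in> W" for Q
        proof -
          have 1: "z (ext Q) \<in> stalk_map (ext Q) ` carrier (hloc T G' Q)"
            using zc[OF that] bij_betw_imp_surj_on[OF bij[OF that]] by blast
          have 2: "s Q = inv_into (carrier (hloc T G' Q)) (stalk_map (ext Q)) (z (ext Q))"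
            unfolding s_def using that by (rule restrict_apply')
          show "s Q \<in> carrier (hloc T G' Q)" unfolding 2 using 1 by (rule inv_into_into)
          show "stalk_map (ext Q) (s Q) = z (ext Q)" unfolding 2 using 1 by (rule f_inv_into_f)
        qed
        have "\<exists>W'. openin (Proj_top T G') W' \<and> Q \<in> W' \<and> W' \<subseteq> W \<and>
         (\<exists>m. \<exists>a\<in>G' m. \<exists>f\<in>G' m. \<forall>Q\<in>W'. f \<notin> Q \<and> s Q = hfrac T G' Q a f)" if Q: "Q \<in> W" for Q
        proof -
          have "\<forall>P\<in>pull W. \<exists>W'. openin (Proj_top S G) W' \<and> P \<in> W' \<and> W' \<subseteq> pull W \<and>
         (\<exists>m. \<exists>a\<in>G m. \<exists>f\<in>G m. \<forall>Q\<in>W'. f \<notin> Q \<and> z Q = hfrac S G Q a f)"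
            using z unfolding Proj_sections_def by simp
          then obtain V m a f where V: "openin (Proj_top S G) V" "ext Q \<in> V" "V \<subseteq> pull W"
            and af: "a \<in> G m" "f \<in> G m" "\<And>P. P \<in> V \<Longrightarrow> f \<notin> P \<and> z P = hfrac S G P a f"
            using QW[OF Q] by (metis (no_types, lifting))
          obtain g where g: "g \<in> B" "g \<notin> ext Q" using cover_S QW[OF Q] by blast
          obtain N where N: "g [^] (N::nat) \<otimes> a \<in> C" "g [^] N \<otimes> f \<in> C"
            using saturated2[OF g(1)] S.comp_closed af(1,2) by metis
          have gN: "g [^] N \<in> G N" using pow_deg[OF g(1)] sub_comp by blast
          have N': "g [^] N \<otimes> a \<in> G' (N + m)" "g [^] N \<otimes> f \<in> G' (N + m)"
            using S.comp_mult[OF gN] af N comp_T_iff by blast+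
          \<comment> \<open>On the part where g does not vanish, multiplying numerator and
            denominator by g^N works at all points simultaneously, with the N found for the given
            fraction.\<close>
          define V' where "V' = V \<inter> {P \<in> Proj_points S G. g \<notin> P}"
          have "openin (Proj_top S G) V'"
            unfolding V'_def using S.openin_basic[OF zero_less_one B_S[OF g(1)]] V by blast
          then have o: "openin (Proj_top T G') {Q \<in> Proj_points T G'. ext Q \<in> V'}"
            by (rule openin_push)
          have eq: "g [^] N \<otimes> f \<notin> Q' \<and> s Q' = hfrac T G' Q' (g [^] N \<otimes> a) (g [^] N \<otimes> f)"
            if "Q' \<in> Proj_points T G'" "ext Q' \<in> V'" for Q'
          proof -
            have e: "ext Q' \<inter> C = Q'" "ext Q' \<in> Proj_points S G" "g \<notin> ext Q'" "ext Q' \<in> V"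
              using ext_contr that unfolding V'_def by auto
            then have Q': "Q' \<in> W" using V(3) by (auto simp: contr_eq)
            have ok: "S.hfrac_ok (ext Q') a f" unfolding S.hfrac_ok_def using af e by blast
            note l = stalk_map_lift[OF e(2) ok g(1) e(3) N, unfolded e(1)]
            have st_eq: "stalk_map (ext Q') (s Q') = stalk_map (ext Q') (hfrac T G' Q' (g [^] N \<otimes> a) (g [^] N \<otimes> f))"
              using l(2) s_in(2)[OF Q'] af(3)[OF e(4)] by simp
            have "hfrac T G' Q' (g [^] N \<otimes> a) (g [^] N \<otimes> f) \<in> carrier (hloc T G' Q')"
              using l(1) unfolding T.hloc_carrier by blast
            then have "s Q' = hfrac T G' Q' (g [^] N \<otimes> a) (g [^] N \<otimes> f)"
              using inj_onD[OF bij_betw_imp_inj_on[OF bij[OF Q']] st_eq s_in(1)[OF Q']] by blast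
            then show ?thesis using l(1) unfolding T.hfrac_ok_def by blast
          qed
          have 1: "Q \<in> {Q \<in> Proj_points T G'. ext Q \<in> V'}"
            using Q WT V g QW[OF Q] unfolding V'_def by blast
          have 2: "{Q \<in> Proj_points T G'. ext Q \<in> V'} \<subseteq> W"
            using V(3) ext_contr unfolding V'_def by (auto simp: contr_eq)
          show ?thesis
            by (rule exI[of _ "{Q \<in> Proj_points T G'. ext Q \<in> V'}"], rule conjI[OF o], rule conjI[OF 1],
                rule conjI[OF 2], rule exI[of _ "N + m"], rule bexI[OF _ N'(1)], rule bexI[OF _ N'(2)])
              (use eq in blast)
        qed
        then have "s \<in> carrier (Proj_sections T G' W)"
          unfolding Proj_sections_def using s_in(1) by (auto simp: s_def)
        moreover have "?h s = z"
        proof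
          fix P show "?h s P = z P"
          proof (cases "P \<in> pull W")
            case True
            then have "ext (P \<inter> C) = P" "P \<inter> C \<in> W" using pullI contr_ext by blast+
            then show ?thesis using True s_in(2)[of "P \<inter> C"] by (simp add: Proj_map_sections_apply)
          next
            case False
            then show ?thesis using zP by (auto simp: Proj_map_sections_apply PiE_def extensional_def)
          qed
        qed
        ultimately show "z \<in> ?h ` carrier (Proj_sections T G' W)" by blast
      qed
    qed
  qed
  then show ?thesis unfolding ring_iso_def using hom by blast
qed

theorem Proj_iso:
  "Proj_map_domain G' S G (\<lambda>p. p) = topspace (sp (Proj S G)) \<and>
   ringed_space_iso (Proj S G) (Proj T G') contr (Proj_map_sections T G' S G (\<lambda>p. p))"
proof -
  have "Proj_map_sections T G' S G (\<lambda>p. p) W' (restrict s W')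
      = restrict (Proj_map_sections T G' S G (\<lambda>p. p) W s) (pull W')" if "W' \<subseteq> W" for W W' s
    using that unfolding Proj_map_sections_apply by (auto simp: fun_eq_iff restrict_def contr_eq)
  then show ?thesis
    unfolding ringed_space_iso_def Proj_def
    using contr_homeo Proj_map_sections_iso domain_eq by simp
qed

end

section \<open>Rees algebras\<close>

lemma finsum_subring:
  assumes "cring U" "cring (U\<lparr>carrier := H\<rparr>)" "H \<subseteq> carrier U" "finite C" "\<And>c. c \<in> C \<Longrightarrow> h c \<in> H"
  shows "finsum (U\<lparr>carrier := H\<rparr>) h C = finsum U h C \<and> finsum U h C \<in> H"
proof -
  interpret U: cring U by fact
  interpret H: cring "U\<lparr>carrier := H\<rparr>" by fact
  show ?thesis using assms(4,5)
  proof (induction C rule: finite_induct)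
    case empty
    then show ?case using H.zero_closed by simp
  next
    case (insert c C)
    have "finsum (U\<lparr>carrier := H\<rparr>) h (insert c C) = h c \<oplus>\<^bsub>U\<^esub> finsum U h C"
      using insert by (subst H.finsum_insert) auto
    moreover have "finsum U h (insert c C) = h c \<oplus>\<^bsub>U\<^esub> finsum U h C"
      using insert assms(3) by (intro U.finsum_insert) auto
    moreover have "h c \<oplus>\<^bsub>U\<^esub> finsum U h C \<in> H"
      using insert H.a_closed[of "h c" "finsum U h C"] by simp
    ultimately show ?case by simp
  qed
qed

locale rees = cring R for R (structure) + fixes I assumes I: "ideal I R"
begin

abbreviation "UR \<equiv> UP R"
abbreviation mon where "mon \<equiv> up_ring.monom UR"
abbreviation cf where "cf \<equiv> up_ring.coeff UR"
abbreviation pw where "pw \<equiv> ideal_power R I"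
abbreviation S where "S \<equiv> Rees R I"

sublocale U: UP_cring R UR by (simp add: UP_cring.intro is_cring)

lemmas pw_ideal = ideal_power_ideal[OF I]

lemma pw_closed: "a \<in> pw m \<Longrightarrow> a \<in> carrier R"
  by (rule idealD(6)[OF pw_ideal])

definition H where "H = {p \<in> carrier UR. \<forall>m. cf p m \<in> pw m}"

text \<open>Only the carrier differs from that of the polynomial ring, so the Rees algebras of two
  ideals share all operations, as \<open>graded_pair\<close> requires.\<close>

lemma S_eq: "S = UR\<lparr>carrier := H\<rparr>"
  by (simp add: Rees_def H_def)

lemma S_simps [simp]: "carrier S = H" "x \<otimes>\<^bsub>S\<^esub> y = x \<otimes>\<^bsub>UR\<^esub> y" "x \<oplus>\<^bsub>S\<^esub> y = x \<oplus>\<^bsub>UR\<^esub> y"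
    "\<one>\<^bsub>S\<^esub> = \<one>\<^bsub>UR\<^esub>" "\<zero>\<^bsub>S\<^esub> = \<zero>\<^bsub>UR\<^esub>"
  by (simp_all add: S_eq)

lemma H_UR: "H \<subseteq> carrier UR" by (auto simp: H_def)

lemma S_cring: "cring S"
proof -
  have "subring H UR"
  proof (rule U.P.subringI)
    show "H \<subseteq> carrier UR" by (rule H_UR)
    show "\<one>\<^bsub>UR\<^esub> \<in> H" unfolding H_def using idealD(2)[OF pw_ideal] by simp
    show "\<ominus>\<^bsub>UR\<^esub> p \<in> H" if "p \<in> H" for p
    proof -
      have p: "p \<in> carrier UR" "\<And>m. cf p m \<in> pw m" using that by (simp_all add: H_def)
      have "\<ominus> cf p m \<in> pw m" for m
        using additive_subgroup.a_inv_closed[OF ideal.axioms(1)[OF pw_ideal] p(2)] .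
      then show ?thesis unfolding H_def using p(1) by simp
    qed
    fix p q assume "p \<in> H" "q \<in> H"
    then have pq: "p \<in> carrier UR" "\<And>m. cf p m \<in> pw m" "q \<in> carrier UR" "\<And>m. cf q m \<in> pw m"
      by (simp_all add: H_def)
    show "p \<oplus>\<^bsub>UR\<^esub> q \<in> H" unfolding H_def using pq idealD(3)[OF pw_ideal] by simp
    have "cf p i \<otimes> cf q (m - i) \<in> pw m" if "i \<le> m" for i m
      using ideal_power_mult[OF I pq(2)[of i] pq(4)[of "m - i"]] that by simp
    then have "(\<Oplus>i\<in>{..m}. cf p i \<otimes> cf q (m - i)) \<in> pw m" for m by (intro finsum_ideal[OF pw_ideal]) simp_all
    then show "p \<otimes>\<^bsub>UR\<^esub> q \<in> H" unfolding H_def using pq by simp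
  qed
  then have "subcring H UR" by (rule U.P.subcringI')
  then show ?thesis unfolding S_eq using U.P.subcring_iff[OF H_UR] by simp
qed

lemma S_finsum:
  assumes "finite C" "\<And>c. c \<in> C \<Longrightarrow> h c \<in> H" shows "finsum S h C = finsum UR h C" "finsum UR h C \<in> H"
  using finsum_subring[OF U.P.is_cring S_cring[unfolded S_eq] H_UR assms] by (simp_all add: S_eq)

lemma mon_H: "a \<in> pw m \<Longrightarrow> mon a m \<in> H"
  unfolding H_def using pw_closed[of a m] idealD(2)[OF pw_ideal] by simp

lemma Rees_deg_eq: "Rees_deg R I m = {mon a m |a. a \<in> pw m}"
proof (intro equalityI subsetI)
  fix p assume "p \<in> Rees_deg R I m"
  then have p: "p \<in> carrier UR" "\<And>i. cf p i \<in> pw i" "\<And>i. i \<noteq> m \<Longrightarrow> cf p i = \<zero>"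
    by (simp_all add: Rees_deg_def H_def)
  have "p = mon (cf p m) m"
    using p by (intro U.up_eqI) simp_all
  then show "p \<in> {mon a m |a. a \<in> pw m}" using p(2) by blast
next
  fix p assume "p \<in> {mon a m |a. a \<in> pw m}"
  then obtain a where "a \<in> pw m" "p = mon a m" by blast
  then show "p \<in> Rees_deg R I m" using mon_H[of a m] pw_closed[of a m] by (simp add: Rees_deg_def)
qed

text \<open>Extraction of the coefficient of degree m does not depend on the ideal, so the same
  projections serve for both Rees algebras.\<close>

definition cmp where "cmp m p = mon (cf p m) m"

lemma S_graded: "graded_cring S (Rees_deg R I) cmp"
proof (intro graded_cring.intro graded_cring_axioms.intro S_cring)
  show "Rees_deg R I m \<subseteq> carrier S" for m by (auto simp: Rees_deg_def)
  show "\<one>\<^bsub>S\<^esub> \<in> Rees_deg R I 0"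
    unfolding Rees_deg_eq S_simps using one_closed U.monom_one by force
  show "\<zero>\<^bsub>S\<^esub> \<in> Rees_deg R I m" for m
    unfolding Rees_deg_eq S_simps using idealD(2)[OF pw_ideal] U.monom_zero by force
  show "p \<oplus>\<^bsub>S\<^esub> q \<in> Rees_deg R I m" if pq: "p \<in> Rees_deg R I m" "q \<in> Rees_deg R I m" for p q m
  proof -
    obtain a b where ab: "a \<in> pw m" "b \<in> pw m" "p = mon a m" "q = mon b m" using pq unfolding Rees_deg_eq by blast
    then have "p \<oplus>\<^bsub>S\<^esub> q = mon (a \<oplus> b) m" by (simp add: pw_closed)
    then show ?thesis unfolding Rees_deg_eq using idealD(3)[OF pw_ideal ab(1,2)] by blast
  qed
  show "p \<otimes>\<^bsub>S\<^esub> q \<in> Rees_deg R I (m + k)" if pq: "p \<in> Rees_deg R I m" "q \<in> Rees_deg R I k" for p q m k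
  proof -
    obtain a b where ab: "a \<in> pw m" "b \<in> pw k" "p = mon a m" "q = mon b k" using pq unfolding Rees_deg_eq by blast
    then have "p \<otimes>\<^bsub>S\<^esub> q = mon (a \<otimes> b) (m + k)" by (simp add: pw_closed U.monom_mult)
    then show ?thesis unfolding Rees_deg_eq using ideal_power_mult[OF I ab(1,2)] by blast
  qed
  show "cmp m p \<in> Rees_deg R I m" if "p \<in> carrier S" for p m
    unfolding Rees_deg_eq cmp_def using that by (auto simp: H_def)
  show "cmp k p = (if k = m then p else \<zero>\<^bsub>S\<^esub>)" if p: "p \<in> Rees_deg R I m" for p m k
  proof -
    obtain a where "a \<in> pw m" "p = mon a m" using p unfolding Rees_deg_eq by blast
    then show ?thesis by (simp add: cmp_def pw_closed U.monom_zero)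
  qed
  fix p assume "p \<in> carrier S"
  then have p: "p \<in> carrier UR" "\<And>i. cf p i \<in> pw i" by (simp_all add: H_def)
  have "p = (\<Oplus>\<^bsub>UR\<^esub>m\<in>{..deg R p}. cmp m p)"
    unfolding cmp_def using U.up_repr[OF p(1)] by simp
  then show "\<exists>N. p = (\<Oplus>\<^bsub>S\<^esub>m\<in>{..N}. cmp m p)"
    using S_finsum(1)[of "{..deg R p}" "\<lambda>m. cmp m p"] mon_H[OF p(2)] unfolding cmp_def
    by (intro exI[of _ "deg R p"]) simp
  fix q assume "q \<in> carrier S"
  then have q: "q \<in> carrier UR" "\<And>i. cf q i \<in> pw i" by (simp_all add: H_def)
  show "cmp m (p \<oplus>\<^bsub>S\<^esub> q) = cmp m p \<oplus>\<^bsub>S\<^esub> cmp m q" for m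
    unfolding cmp_def using p q by simp
  show "cmp m (p \<otimes>\<^bsub>S\<^esub> q) = (\<Oplus>\<^bsub>S\<^esub>i\<in>{..m}. cmp i p \<otimes>\<^bsub>S\<^esub> cmp (m - i) q)" for m
  proof -
    have t: "cmp i p \<otimes>\<^bsub>S\<^esub> cmp (m - i) q = mon (cf p i \<otimes> cf q (m - i)) m" if "i \<in> {..m}" for i
      using that p q U.monom_mult[of "cf p i" "cf q (m - i)" i "m - i"] by (simp add: cmp_def)
    have c: "cf p i \<otimes> cf q (m - i) \<in> pw m" if "i \<in> {..m}" for i
      using ideal_power_mult[OF I p(2)[of i] q(2)[of "m - i"]] that by simp
    have "(\<Oplus>\<^bsub>S\<^esub>i\<in>{..m}. cmp i p \<otimes>\<^bsub>S\<^esub> cmp (m - i) q) = (\<Oplus>\<^bsub>UR\<^esub>i\<in>{..m}. cmp i p \<otimes>\<^bsub>S\<^esub> cmp (m - i) q)"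
      using mon_H[OF c] t by (intro S_finsum) simp_all
    also have "\<dots> = (\<Oplus>\<^bsub>UR\<^esub>i\<in>{..m}. mon (cf p i \<otimes> cf q (m - i)) m)"
      using t p q by (intro U.P.add.finprod_cong2) simp_all
    also have "\<dots> = mon (\<Oplus>i\<in>{..m}. cf p i \<otimes> cf q (m - i)) m"
      using p q by (intro finsum_monom) simp_all
    finally show ?thesis unfolding cmp_def using p q by simp
  qed
qed

lemma mon_pow: "c \<in> carrier R \<Longrightarrow> mon c 1 [^]\<^bsub>S\<^esub> (N::nat) = mon (c [^] N) N"
proof (induction N)
  case (Suc N)
  then show ?case using U.monom_mult[of "c [^] N" c N 1] by simp
qed simp

text \<open>The components of a homogeneous prime as subsets of R, which is the form in which
  \<open>prime_contains\<close> takes a prime of the Rees algebra.\<close>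

definition prime_comp where "prime_comp P d = {a \<in> pw d. mon a d \<in> P}"

context
  fixes P assumes P: "P \<in> Proj_points S (Rees_deg R I)"
begin

lemma P_prime: "primeideal P S"
  using P by (simp add: Proj_points_def)

lemma P_ideal: "ideal P S"
  by (rule primeideal.axioms(1)[OF P_prime])

lemma prime_comp_zero: "\<zero> \<in> prime_comp P d"
  using cring.idealD(2)[OF S_cring P_ideal] idealD(2)[OF pw_ideal] by (simp add: prime_comp_def U.monom_zero)

lemma prime_comp_add: "\<lbrakk> a \<in> prime_comp P d; b \<in> prime_comp P d \<rbrakk> \<Longrightarrow> a \<oplus> b \<in> prime_comp P d"
  using cring.idealD(3)[OF S_cring P_ideal, of "mon a d" "mon b d"] idealD(3)[OF pw_ideal, of a d b]
    pw_closed[of a d] pw_closed[of b d]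
  by (simp add: prime_comp_def)

lemma prime_comp_mult: "\<lbrakk> a \<in> pw e; b \<in> prime_comp P d \<rbrakk> \<Longrightarrow> a \<otimes> b \<in> prime_comp P (e + d)"
  using cring.idealD(4)[OF S_cring P_ideal, of "mon a e" "mon b d"] ideal_power_mult[OF I, of a e b d]
    pw_closed[of a e] pw_closed[of b d] mon_H[of a e]
  by (simp add: prime_comp_def U.monom_mult)

lemma prime_comp_prime:
  assumes a: "a \<in> pw d" and b: "b \<in> pw e" and ab: "a \<otimes> b \<in> prime_comp P (d + e)"
  shows "a \<in> prime_comp P d \<or> b \<in> prime_comp P e"
proof -
  have "mon a d \<otimes>\<^bsub>S\<^esub> mon b e \<in> P"
    using ab U.monom_mult[OF pw_closed[OF a] pw_closed[OF b], of d e] by (simp add: prime_comp_def)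
  then have "mon a d \<in> P \<or> mon b e \<in> P"
    using primeideal.I_prime[OF P_prime, of "mon a d" "mon b e"] mon_H[OF a] mon_H[OF b] by simp
  then show ?thesis using a b by (auto simp: prime_comp_def)
qed

text \<open>The Rees algebra is generated in degree 1 over degree 0, so a prime containing all of
  degree 1 would contain the irrelevant ideal.\<close>

lemma prime_comp_proper: "\<not> I \<subseteq> prime_comp P 1"
proof
  assume sub: "I \<subseteq> prime_comp P 1"
  have "a \<in> prime_comp P (Suc m)" if "a \<in> pw (Suc m)" for a m
  proof -
    have "a \<in> ideal_prod R I (pw m)" using that by simp
    then show ?thesis
    proof (induction rule: ideal_prod.induct)
      case (prod i j)
      then have "j \<otimes> i \<in> prime_comp P (m + 1)" using sub by (intro prime_comp_mult) blast+
      then show ?case using m_comm[OF pw_closed[OF prod(2)] idealD(6)[OF I prod(1)]] by simp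
    qed (rule prime_comp_add)
  qed
  then have "Rees_deg R I (Suc m) \<subseteq> P" for m
    unfolding Rees_deg_eq prime_comp_def by blast
  then have "Rees_deg R I m \<subseteq> P" if "m > 0" for m using that by (cases m) simp_all
  then show False using P by (auto simp: Proj_points_def)
qed

end

end

section \<open>The charts of the two blow-ups and the conclusion\<close>

context norm_words
begin

lemma short_words:
  assumes "\<forall>i<n. x i \<in> wd ` short"
  obtains v where "\<forall>i<n. v i \<in> short" "\<forall>i<n. x i = (wd \<circ> v) i"
proof -
  have "\<forall>i. \<exists>w. i < n \<longrightarrow> w \<in> short \<and> x i = wd w" using assms by blast
  then obtain v where "\<forall>i. i < n \<longrightarrow> v i \<in> short \<and> x i = wd (v i)" by metis
  then show thesis by (intro that[of v]) simp_all
qed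

text \<open>The norms of short monomials, which generate \<open>IS\<close>, placed in degree 1. They
  belong to the Rees algebra of every ideal that contains \<open>IS\<close>.\<close>

definition charts where
  "charts = {up_ring.monom (UP R) (dw v w) 1 |v w. (\<forall>i<n. v i \<in> short) \<and> (\<forall>i<n. w i \<in> short)}"

text \<open>A point outside all charts contains \<open>IS\<close> in degree 1, hence all of
  \<open>I\<close> by \<open>prime_contains_norms\<close>, which \<open>prime_comp_proper\<close>
  excludes. The ideal \<open>I\<close> is left general so that one argument covers both
  \<open>IF\<close> and \<open>NI V\<close>.\<close>

lemma charts_cover:
  assumes I: "ideal I R" "IS \<subseteq> I" "I \<subseteq> IF" and P: "P \<in> Proj_points (Rees R I) (Rees_deg R I)"
  shows "\<exists>f\<in>charts. f \<notin> P"
proof (rule ccontr)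
  assume no: "\<not> ?thesis"
  interpret I: rees R I by (intro rees.intro rees_axioms.intro RC.is_cring I)
  let ?q = "I.prime_comp P"
  have q1: "?q 1 \<subseteq> carrier R" using RC.idealD(1)[OF I.pw_ideal] unfolding I.prime_comp_def by blast
  have qI: "ideal (?q 1) R"
  proof (rule RC.idealI'[OF q1 I.prime_comp_zero[OF P] I.prime_comp_add[OF P]])
    show "x \<otimes>\<^bsub>R\<^esub> a \<in> ?q 1" if "x \<in> carrier R" "a \<in> ?q 1" for x a
      using I.prime_comp_mult[OF P, of x 0 a 1] that by simp
  qed
  have Jq: "IS \<subseteq> ?q 1"
  proof (rule NI_min[OF qI])
    fix x y assume xy: "\<forall>i<n. x i \<in> wd ` short" "\<forall>i<n. y i \<in> wd ` short"
    obtain v where v: "\<forall>i<n. v i \<in> short" "\<forall>i<n. x i = (wd \<circ> v) i" using short_words[OF xy(1)] .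
    obtain w where w: "\<forall>i<n. w i \<in> short" "\<forall>i<n. y i = (wd \<circ> w) i" using short_words[OF xy(2)] .
    have xyt: "tuple x" "tuple y" using xy short_carrier by blast+
    have e: "delta x y = dw v w" using v(2) w(2) by (intro delta_cong xyt) simp_all
    have "dw v w \<in> I.pw 1"
      unfolding RC.ideal_power_1[OF I(1)] e[symmetric] using NI_mem[OF short_carrier xy] I(2) by blast
    moreover have "I.mon (dw v w) 1 \<in> P" using no v(1) w(1) unfolding charts_def by blast
    ultimately show "delta x y \<in> ?q 1" unfolding e I.prime_comp_def by blast
  qed
  have "I \<subseteq> ?q 1"
  proof (rule prime_contains_norms[OF _ I, where q = ?q])
    show "?q d \<subseteq> I.pw d" for d unfolding I.prime_comp_def by blast
    show "\<zero>\<^bsub>R\<^esub> \<in> ?q d" for d by (rule I.prime_comp_zero[OF P])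
    show "a \<oplus>\<^bsub>R\<^esub> b \<in> ?q d" if "a \<in> ?q d" "b \<in> ?q d" for d a b
      using that by (rule I.prime_comp_add[OF P])
    show "a \<otimes>\<^bsub>R\<^esub> b \<in> ?q (e + d)" if "a \<in> I.pw e" "b \<in> ?q d" for d e a b
      using that by (rule I.prime_comp_mult[OF P])
    show "a \<in> ?q d \<or> b \<in> ?q e" if "a \<in> I.pw d" "b \<in> I.pw e" "a \<otimes>\<^bsub>R\<^esub> b \<in> ?q (d + e)" for d e a b
      using that by (rule I.prime_comp_prime[OF P])
    show "IS \<subseteq> ?q 1" by (rule Jq)
  qed
  then show False using I.prime_comp_proper[OF P] by blast
qed

text \<open>Each coefficient of the polynomial has an exponent by \<open>saturated_power\<close>.
  There are finitely many coefficients, and the sum of their exponents works for all of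
  them.\<close>

lemma charts_saturated:
  assumes V: "V \<subseteq> carrier F" "\<And>u. \<lbrakk> u \<in> words; length u \<le> n \<rbrakk> \<Longrightarrow> wd u \<in> V"
    and f: "f \<in> charts" and p: "p \<in> carrier (Rees R IF)"
  shows "\<exists>N::nat. f [^]\<^bsub>Rees R IF\<^esub> N \<otimes>\<^bsub>Rees R IF\<^esub> p \<in> carrier (Rees R (NI V))"
proof -
  interpret K: rees R IF by (intro rees.intro rees_axioms.intro RC.is_cring ni.K)
  interpret I: rees R "NI V" by (intro rees.intro rees_axioms.intro RC.is_cring NI_ideal V(1))
  obtain v w where vw: "\<forall>i<n. v i \<in> short" "\<forall>i<n. w i \<in> short" and f: "f = K.mon (dw v w) 1"
    using f unfolding charts_def by blast
  have c: "dw v w \<in> carrier R" using vw by (intro delta_closed word_tuple) simp_all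
  have p: "p \<in> carrier K.UR" "\<And>m. K.cf p m \<in> K.pw m" using p by (simp_all add: K.H_def)
  let ?D = "deg R p"
  have "\<exists>N::nat. \<forall>M\<ge>N. dw v w [^]\<^bsub>R\<^esub> M \<otimes>\<^bsub>R\<^esub> K.cf p m \<in> I.pw (M + m)" for m
    by (rule saturated_power[OF V vw p(2)])
  then obtain h :: "nat \<Rightarrow> nat" where h: "dw v w [^]\<^bsub>R\<^esub> M \<otimes>\<^bsub>R\<^esub> K.cf p m \<in> I.pw (M + m)" if "h m \<le> M" for m M
    by metis
  define N where "N = sum h {..?D}"
  have hN: "h m \<le> N" if "m \<le> ?D" for m unfolding N_def using that by (intro member_le_sum) simp_all
  let ?c = "dw v w [^]\<^bsub>R\<^esub> N"
  have cN: "?c \<in> carrier R" by (rule RC.nat_pow_closed[OF c])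
  have pR: "K.cf p m \<in> carrier R" for m by (rule K.pw_closed[OF p(2)])
  have "K.mon ?c N \<otimes>\<^bsub>K.UR\<^esub> p = K.mon ?c N \<otimes>\<^bsub>K.UR\<^esub> (\<Oplus>\<^bsub>K.UR\<^esub>m\<in>{..?D}. K.mon (K.cf p m) m)"
    using K.U.up_repr[OF p(1)] by simp
  also have "\<dots> = (\<Oplus>\<^bsub>K.UR\<^esub>m\<in>{..?D}. K.mon ?c N \<otimes>\<^bsub>K.UR\<^esub> K.mon (K.cf p m) m)"
    using cN pR by (intro K.U.P.finsum_rdistr Pi_I K.U.monom_closed) simp_all
  also have "\<dots> = (\<Oplus>\<^bsub>K.UR\<^esub>m\<in>{..?D}. K.mon (?c \<otimes>\<^bsub>R\<^esub> K.cf p m) (N + m))"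
    using K.U.monom_mult[OF cN pR] cN pR
    by (intro K.U.P.add.finprod_cong2 K.U.monom_closed RC.m_closed) simp_all
  also have "\<dots> \<in> I.H"
    using h hN by (intro I.S_finsum(2) I.mon_H) simp_all
  finally have "K.mon ?c N \<otimes>\<^bsub>K.UR\<^esub> p \<in> I.H" .
  then show ?thesis unfolding f using K.mon_pow[OF c, of N] by (intro exI[of _ N]) simp
qed

theorem blowup_iso:
  assumes V: "V \<subseteq> carrier F" "\<And>u. \<lbrakk> u \<in> words; length u \<le> n \<rbrakk> \<Longrightarrow> wd u \<in> V"
  shows "Proj_map_domain (Rees_deg R (NI V)) (Rees R IF) (Rees_deg R IF) (\<lambda>p. p) = topspace (sp (Blowup R IF)) \<and>
    ringed_space_iso (Blowup R IF) (Blowup R (NI V))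
      (Proj_map_point (Rees R (NI V)) (\<lambda>p. p))
      (Proj_map_sections (Rees R (NI V)) (Rees_deg R (NI V)) (Rees R IF) (Rees_deg R IF) (\<lambda>p. p))"
proof -
  interpret K: rees R IF by (intro rees.intro rees_axioms.intro RC.is_cring ni.K)
  interpret I: rees R "NI V" by (intro rees.intro rees_axioms.intro RC.is_cring NI_ideal V(1))
  have sV: "wd ` short \<subseteq> V" using V(2) by auto
  have IV: "NI V \<subseteq> IF" by (intro NI_mono V subset_refl)
  have SI: "IS \<subseteq> NI V" by (intro NI_mono V sV)
  have T: "(Rees R IF)\<lparr>carrier := carrier (Rees R (NI V))\<rparr> = Rees R (NI V)"
    by (simp add: Rees_def)
  have pw: "I.pw m \<subseteq> K.pw m" for m by (rule RC.ideal_power_mono[OF IV])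
  have "graded_pair (Rees R IF) (Rees_deg R IF) K.cmp (carrier (Rees R (NI V))) (Rees_deg R (NI V)) charts"
  proof (intro graded_pair.intro graded_pair_axioms.intro K.S_graded)
    show "graded_cring ((Rees R IF)\<lparr>carrier := carrier (Rees R (NI V))\<rparr>) (Rees_deg R (NI V)) K.cmp"
      unfolding T by (rule I.S_graded)
    show "carrier (Rees R (NI V)) \<subseteq> carrier (Rees R IF)"
      unfolding K.S_simps(1) I.S_simps(1) K.H_def I.H_def using pw by blast
    show "Rees_deg R (NI V) m \<subseteq> Rees_deg R IF m" for m
      unfolding K.Rees_deg_eq I.Rees_deg_eq using pw by blast
    show "charts \<subseteq> Rees_deg R (NI V) 1"
    proof
      fix f assume "f \<in> charts"
      then obtain v w where vw: "\<forall>i<n. v i \<in> short" "\<forall>i<n. w i \<in> short" and f: "f = I.mon (dw v w) 1"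
        unfolding charts_def by blast
      have "dw v w \<in> IS" by (intro NI_mem short_carrier) (use vw in auto)
      then have "dw v w \<in> NI V" using SI by blast
      then show "f \<in> Rees_deg R (NI V) 1"
        unfolding I.Rees_deg_eq RC.ideal_power_1[OF I.I] f by blast
    qed
    show "\<exists>N. f [^]\<^bsub>Rees R IF\<^esub> (N::nat) \<otimes>\<^bsub>Rees R IF\<^esub> a \<in> carrier (Rees R (NI V))"
      if "f \<in> charts" "a \<in> carrier (Rees R IF)" for f a
      using V that by (rule charts_saturated)
    show "\<exists>f\<in>charts. f \<notin> P" if "P \<in> Proj_points (Rees R IF) (Rees_deg R IF)" for P
      using ni.K ni.JK subset_refl that by (rule charts_cover)
    show "\<exists>f\<in>charts. f \<notin> Q"
      if "Q \<in> Proj_points ((Rees R IF)\<lparr>carrier := carrier (Rees R (NI V))\<rparr>) (Rees_deg R (NI V))" for Q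
      using I.I SI IV that[unfolded T] by (rule charts_cover)
  qed
  from graded_pair.Proj_iso[OF this] show ?thesis
    unfolding T Blowup_def .
qed

end

theorem proposition8p4:
  fixes A :: "('a, 'm) ring_scheme"
    and F :: "('a, 'f, 'k) module_scheme"
    and n r :: nat
    and t :: "nat \<Rightarrow> 'f"
  assumes "cring A"
    and "noetherian_ring A"
    and "algebra A F"
    and "0 < n"
    and "t ` {..<r} \<subseteq> carrier F"
    and "generated_subalgebra A F (t ` {..<r}) = carrier F"
  defines "V \<equiv> monomial_span A F r t n"
    and "R \<equiv> Gamma_ring A F n"
  defines "I\<^sub>V \<equiv> norm_ideal A F n V"
    and "I\<^sub>F \<equiv> norm_ideal A F n (carrier F)"
  shows
    "Proj_map_domain (Rees_deg R I\<^sub>V) (Rees R I\<^sub>F) (Rees_deg R I\<^sub>F) (\<lambda>p. p)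
      = topspace (sp (Blowup R I\<^sub>F)) \<and>
    ringed_space_iso (Blowup R I\<^sub>F) (Blowup R I\<^sub>V)
      (Proj_map_point (Rees R I\<^sub>V) (\<lambda>p. p))
      (Proj_map_sections (Rees R I\<^sub>V) (Rees_deg R I\<^sub>V) (Rees R I\<^sub>F) (Rees_deg R I\<^sub>F) (\<lambda>p. p))"
proof -
  interpret W: norm_words A F n r t
    using assms(1,3-6)
    by (intro norm_words.intro norm_words_axioms.intro norm_algebra.intro norm_algebra_axioms.intro
      dp_algebra.intro algebra.M_cring)
  \<comment> \<open>Two facts about the monomial span are passed on: it lies in F, and it contains
    every product of at most n generators.\<close>
  note V = W.monomial_span_props[where d = n]
  show ?thesis
    unfolding I\<^sub>V_def I\<^sub>F_def V_def R_def W.norm_ideal_eq[OF V(1)] W.norm_ideal_eq[OF subset_refl]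
    by (rule W.blowup_iso[OF V])
qed

end
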